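(* Let $\varphi:\mathbb{C}^n\to\mathbb{R}$ be an admissible weight with maximal eigenvalue radius function $\rho$, and suppose $\kappa:\mathbb{C}^n\to(0,+\infty)$ satisfies: (1) $\kappa$ is a bounded radius function; (2) $\kappa(z)\ge\rho(z)$ for all $z$; (3) $\Box_\varphi$ is $\kappa^{-1}$-coercive. Then there are constants $\varepsilon,r_0,R_0>0$ and $C<\infty$, depending only on $\varphi$, $\kappa$ and $n$, such that the following holds. Let $z\in\mathbb{C}^n$ and let $u\in\mathcal{D}_1(\bar\partial)\subseteq L^2_{(0,1)}(\mathbb{C}^n,\varphi)$ satisfy $\bar\partial u=0$ and $u=0$ outside $B_\kappa(z,r_0)$. Then the canonical solution $f$ of $\bar\partial f=u$ exists, and $$|f(w)|\le C\,e^{\varphi(w)}\kappa(z)e^{-\varepsilon d_\kappa(z,w)}\rho(w)^{-n}\|u\|_\varphi$$ for every $w\in\mathbb{C}^n$ with $d_\kappa(z,w)\ge R_0$ (where $f$ is holomorphic near such $w$).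
   Context: Weighted spaces: for a $C^2$ function $\varphi:\mathbb{C}^n\to\mathbb{R}$, $L^2(\mathbb{C}^n,\varphi)$ is the Hilbert space of measurable $f$ with $\|f\|_\varphi^2=\int|f|^2e^{-2\varphi}\,d\mathcal{L}<\infty$, and $A^2(\mathbb{C}^n,\varphi)$ its closed subspace of holomorphic functions. $L^2_{(0,q)}(\mathbb{C}^n,\varphi)$ ($q=1,2$) denotes $(0,q)$-forms with coefficients in $L^2(\mathbb{C}^n,\varphi)$, normed by the sum of squared coefficient norms; $(0,1)$-forms $u=\sum u_jd\bar z_j$ are identified with vectors, $|u|^2=\sum|u_j|^2$. $\bar\partial f=\sum_j\partial_{\bar z_j}f\,d\bar z_j$ on $\mathcal{D}_0(\bar\partial)=\{f\in L^2(\mathbb{C}^n,\varphi):\partial_{\bar z_j}f\in L^2(\mathbb{C}^n,\varphi)\ \forall j\}$; on $(0,1)$-forms $\bar\partial u=\sum_{j<k}(\partial_{\bar z_j}u_k-\partial_{\bar z_k}u_j)d\bar z_j\wedge d\bar z_k$ on the domain $\mathcal{D}_1(\bar\partial)$ where these coefficients are in $L^2(\mathbb{C}^n,\varphi)$ (distributional derivatives). $\bar\partial^*_\varphi$ are the Hilbert-space adjoints, with domains $\mathcal{D}_1(\bar\partial^*_\varphi)$ (on $(0,1)$-forms) and $\mathcal{D}_2(\bar\partial^*_\varphi)$ (on $(0,2)$-forms). $\Box_\varphi=\bar\partial^*_\varphi\bar\partial+\bar\partial\bar\partial^*_\varphi$ on $\{u\in\mathcal{D}_1(\bar\partial)\cap\mathcal{D}_1(\bar\partial^*_\varphi):\bar\partial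 u\in\mathcal{D}_2(\bar\partial^*_\varphi),\bar\partial^*_\varphi u\in\mathcal{D}_0(\bar\partial)\}$; $\mathcal{E}_\varphi(u)=\|\bar\partial u\|_\varphi^2+\|\bar\partial^*_\varphi u\|_\varphi^2$ on $\mathcal{D}(\mathcal{E}_\varphi)=\mathcal{D}_1(\bar\partial)\cap\mathcal{D}_1(\bar\partial^*_\varphi)$. $\Box_\varphi$ is $\mu$-coercive ($\mu\ge0$ measurable) if $\mathcal{E}_\varphi(u)\ge\int\mu^2|u|^2e^{-2\varphi}$ for all $u\in\mathcal{D}(\mathcal{E}_\varphi)$. For $\bar\partial$-closed $u\in L^2_{(0,1)}(\mathbb{C}^n,\varphi)$, the canonical solution of $\bar\partial f=u$ is the unique $f\in\mathcal{D}_0(\bar\partial)$ with $\bar\partial f=u$ and $f\perp A^2(\mathbb{C}^n,\varphi)$. Radius functions (on $\mathbb{R}^d$, with $\mathbb{C}^n\cong\mathbb{R}^{2n}$): Borel $\rho:\mathbb{R}^d\to(0,\infty)$ with a constant $C$ such that $C^{-1}\rho(x)\le\rho(y)\le C\rho(x)$ whenever $|y-x|<\rho(x)$. $d_\rho(x,y)=\inf_\gamma\int_I|\gamma'(t)|/\rho(\gamma(t))dt$ over piecewise $C^1$ curves $\gamma$ on compact intervals $I$ joining $x$ and $y$; $B_\rho(x,r)=\{y:d_\rho(x,y)<r\}$. Admissible weights: a $C^2$ function $\varphi$ whose complex Hessian $H_\varphi=(\partial^2\varphi/\partial z_j\partial\bar z_k)$ is positive semidefinite everywhere and such that (a) $\sup_{B(z,2r)}\Delta\varphi\le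 D\sup_{B(z,r)}\Delta\varphi$ for all $z$, $r>0$, with $D$ fixed, and (b) $\inf_z\sup_{B(z,c)}\Delta\varphi>0$ for some $c>0$. Its maximal eigenvalue radius function is $\rho(z)=\sup\{r>0:\sup_{B(z,r)}\Delta\varphi\le r^{-2}\}$. *)

theory Defs
  imports "HOL-Analysis.Analysis"
begin

fun Ck :: "nat \<Rightarrow> ('a::real_normed_vector \<Rightarrow> 'b::real_normed_vector) \<Rightarrow> bool" where
  "Ck 0 f = continuous_on UNIV f"
| "Ck (Suc k) f = ((\<forall>x. f differentiable (at x)) \<and>
       (\<forall>v. Ck k (\<lambda>x. frechet_derivative f (at x) v)))"

definition smooth_fun :: "('a::real_normed_vector \<Rightarrow> 'b::real_normed_vector) \<Rightarrow> bool" where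
  "smooth_fun f \<longleftrightarrow> (\<forall>k. Ck k f)"

definition test_fun :: "(complex^'n \<Rightarrow> complex) \<Rightarrow> bool" where
  "test_fun \<psi> \<longleftrightarrow> smooth_fun \<psi> \<and> bounded {z. \<psi> z \<noteq> 0}"

definition wzbar :: "'n \<Rightarrow> (complex^'n \<Rightarrow> complex) \<Rightarrow> complex^'n \<Rightarrow> complex" where
  "wzbar j g z = (frechet_derivative g (at z) (axis j 1)
                   + \<i> * frechet_derivative g (at z) (axis j \<i>)) / 2"

definition wz :: "'n \<Rightarrow> (complex^'n \<Rightarrow> complex) \<Rightarrow> complex^'n \<Rightarrow> complex" where
  "wz j g z = (frechet_derivative g (at z) (axis j 1)
                   - \<i> * frechet_derivative g (at z) (axis j \<i>)) / 2"

definition holo_on :: "(complex^'n) set \<Rightarrow> (complex^'n \<Rightarrow> complex) \<Rightarrow> bool" where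
  "holo_on U f \<longleftrightarrow> (\<forall>x\<in>U. \<exists>L. (f has_derivative L) (at x) \<and> (\<forall>c v. L (c *s v) = c * L v))"

definition wnorm2 :: "(complex^'n \<Rightarrow> real) \<Rightarrow> (complex^'n \<Rightarrow> 'b::real_normed_vector) \<Rightarrow> ennreal" where
  "wnorm2 \<phi> f = (\<integral>\<^sup>+ z. ennreal ((norm (f z))\<^sup>2 * exp (-2 * \<phi> z)) \<partial>lebesgue)"

definition L2w :: "(complex^'n \<Rightarrow> real) \<Rightarrow> (complex^'n \<Rightarrow> complex) \<Rightarrow> bool" where
  "L2w \<phi> f \<longleftrightarrow> f \<in> borel_measurable lebesgue \<and> wnorm2 \<phi> f < \<infinity>"

text \<open>(0,1)-forms are identified with vector-valued functions, |u|^2 = sum |u_j|^2.\<close>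
definition L2form1 :: "(complex^'n \<Rightarrow> real) \<Rightarrow> (complex^'n \<Rightarrow> complex^'n) \<Rightarrow> bool" where
  "L2form1 \<phi> u \<longleftrightarrow> (\<forall>j. L2w \<phi> (\<lambda>z. u z $ j))"

definition form1_norm :: "(complex^'n \<Rightarrow> real) \<Rightarrow> (complex^'n \<Rightarrow> complex^'n) \<Rightarrow> real" where
  "form1_norm \<phi> u = sqrt (enn2real (wnorm2 \<phi> u))"

definition winner :: "(complex^'n \<Rightarrow> real) \<Rightarrow> (complex^'n \<Rightarrow> complex) \<Rightarrow> (complex^'n \<Rightarrow> complex) \<Rightarrow> complex" where
  "winner \<phi> f g = (\<integral> z. f z * cnj (g z) * complex_of_real (exp (-2 * \<phi> z)) \<partial>lebesgue)"

definition winner1 :: "(complex^'n \<Rightarrow> real) \<Rightarrow> (complex^'n \<Rightarrow> complex^'n) \<Rightarrow> (complex^'n \<Rightarrow> complex^'n) \<Rightarrow> complex" where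
  "winner1 \<phi> u v = (\<Sum>j\<in>UNIV. winner \<phi> (\<lambda>z. u z $ j) (\<lambda>z. v z $ j))"

definition A2 :: "(complex^'n \<Rightarrow> real) \<Rightarrow> (complex^'n \<Rightarrow> complex) \<Rightarrow> bool" where
  "A2 \<phi> h \<longleftrightarrow> L2w \<phi> h \<and> holo_on UNIV h"

definition weak_dbar0 :: "'n \<Rightarrow> (complex^'n \<Rightarrow> complex) \<Rightarrow> (complex^'n \<Rightarrow> complex) \<Rightarrow> bool" where
  "weak_dbar0 j f g \<longleftrightarrow> (\<forall>\<psi>. test_fun \<psi> \<longrightarrow>
      (\<integral> z. f z * wzbar j \<psi> z \<partial>lebesgue) = - (\<integral> z. g z * \<psi> z \<partial>lebesgue))"

text \<open>g is the distribution d/d(zbar_j) u_k - d/d(zbar_k) u_j, i.e. the (j,k) coefficient of dbar u.\<close>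
definition weak_dbar1 :: "'n \<Rightarrow> 'n \<Rightarrow> (complex^'n \<Rightarrow> complex^'n) \<Rightarrow> (complex^'n \<Rightarrow> complex) \<Rightarrow> bool" where
  "weak_dbar1 j k u g \<longleftrightarrow> (\<forall>\<psi>. test_fun \<psi> \<longrightarrow>
      (\<integral> z. u z $ k * wzbar j \<psi> z - u z $ j * wzbar k \<psi> z \<partial>lebesgue)
        = - (\<integral> z. g z * \<psi> z \<partial>lebesgue))"

definition has_dbar0 :: "(complex^'n \<Rightarrow> complex) \<Rightarrow> (complex^'n \<Rightarrow> complex^'n) \<Rightarrow> bool" where
  "has_dbar0 f v \<longleftrightarrow> (\<forall>j. weak_dbar0 j f (\<lambda>z. v z $ j))"

definition dom_dbar0 :: "(complex^'n \<Rightarrow> real) \<Rightarrow> (complex^'n \<Rightarrow> complex) \<Rightarrow> bool" where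
  "dom_dbar0 \<phi> f \<longleftrightarrow> L2w \<phi> f \<and> (\<forall>j. \<exists>g. L2w \<phi> g \<and> weak_dbar0 j f g)"

definition dom_dbar1 :: "(complex^'n \<Rightarrow> real) \<Rightarrow> (complex^'n \<Rightarrow> complex^'n) \<Rightarrow> bool" where
  "dom_dbar1 \<phi> u \<longleftrightarrow> L2form1 \<phi> u \<and> (\<forall>j k. \<exists>g. L2w \<phi> g \<and> weak_dbar1 j k u g)"

definition adj_dbar :: "(complex^'n \<Rightarrow> real) \<Rightarrow> (complex^'n \<Rightarrow> complex^'n) \<Rightarrow> (complex^'n \<Rightarrow> complex) \<Rightarrow> bool" where
  "adj_dbar \<phi> u g \<longleftrightarrow> L2form1 \<phi> u \<and> L2w \<phi> g \<and>
     (\<forall>f v. dom_dbar0 \<phi> f \<and> has_dbar0 f v \<and> L2form1 \<phi> v \<longrightarrow> winner1 \<phi> v u = winner \<phi> f g)"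

text \<open>Box_phi is mu-coercive: E_phi(u) >= int mu^2 |u|^2 e^{-2 phi} on D_1(dbar) \<inter> D_1(dbar*).
  ||dbar u||^2 = sum_{j<k} ||W j k||^2 = (1/2) sum_{j,k} ||W j k||^2 (W antisymmetric a.e.).\<close>
definition coercive :: "(complex^'n \<Rightarrow> real) \<Rightarrow> (complex^'n \<Rightarrow> real) \<Rightarrow> bool" where
  "coercive \<phi> \<mu> \<longleftrightarrow> (\<forall>u W g.
      L2form1 \<phi> u \<and> (\<forall>j k. L2w \<phi> (W j k) \<and> weak_dbar1 j k u (W j k)) \<and> adj_dbar \<phi> u g \<longrightarrow>
      (\<integral>\<^sup>+ z. ennreal ((\<mu> z)\<^sup>2 * (norm (u z))\<^sup>2 * exp (-2 * \<phi> z)) \<partial>lebesgue)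
        \<le> (\<Sum>j\<in>UNIV. \<Sum>k\<in>UNIV. wnorm2 \<phi> (W j k)) / 2 + wnorm2 \<phi> g)"

definition canonical_solution :: "(complex^'n \<Rightarrow> real) \<Rightarrow> (complex^'n \<Rightarrow> complex^'n) \<Rightarrow> (complex^'n \<Rightarrow> complex) \<Rightarrow> bool" where
  "canonical_solution \<phi> u f \<longleftrightarrow> dom_dbar0 \<phi> f \<and> has_dbar0 f u \<and> (\<forall>h. A2 \<phi> h \<longrightarrow> winner \<phi> f h = 0)"

definition radius_fun :: "('a::euclidean_space \<Rightarrow> real) \<Rightarrow> bool" where
  "radius_fun \<rho> \<longleftrightarrow> \<rho> \<in> borel_measurable borel \<and> (\<forall>x. 0 < \<rho> x) \<and>
     (\<exists>C. \<forall>x y. dist y x < \<rho> x \<longrightarrow> \<rho> x / C \<le> \<rho> y \<and> \<rho> y \<le> C * \<rho> x)"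

definition curve_len :: "('a::euclidean_space \<Rightarrow> real) \<Rightarrow> (real \<Rightarrow> 'a) \<Rightarrow> real \<Rightarrow> real \<Rightarrow> ennreal" where
  "curve_len \<rho> \<gamma> a b = (\<integral>\<^sup>+ t\<in>{a..b}. ennreal (norm (vector_derivative \<gamma> (at t)) / \<rho> (\<gamma> t)) \<partial>lborel)"

definition d_rho :: "('a::euclidean_space \<Rightarrow> real) \<Rightarrow> 'a \<Rightarrow> 'a \<Rightarrow> real" where
  "d_rho \<rho> x y = enn2real (INF (\<gamma>, a, b) \<in> {(\<gamma>, a, b). a \<le> b \<and> \<gamma> piecewise_C1_differentiable_on {a..b}
        \<and> \<gamma> a = x \<and> \<gamma> b = y}. curve_len \<rho> \<gamma> a b)"

definition ball_rho :: "('a::euclidean_space \<Rightarrow> real) \<Rightarrow> 'a \<Rightarrow> real \<Rightarrow> 'a set" where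
  "ball_rho \<rho> x r = {y. d_rho \<rho> x y < r}"

definition dd :: "(complex^'n \<Rightarrow> real) \<Rightarrow> complex^'n \<Rightarrow> complex^'n \<Rightarrow> real" where
  "dd \<phi> v z = frechet_derivative (\<lambda>x. frechet_derivative \<phi> (at x) v) (at z) v"

definition lap :: "(complex^'n \<Rightarrow> real) \<Rightarrow> complex^'n \<Rightarrow> real" where
  "lap \<phi> z = (\<Sum>j\<in>UNIV. dd \<phi> (axis j 1) z + dd \<phi> (axis j \<i>) z)"

definition cHess :: "(complex^'n \<Rightarrow> real) \<Rightarrow> complex^'n \<Rightarrow> 'n \<Rightarrow> 'n \<Rightarrow> complex" where
  "cHess \<phi> z j k = wz j (wzbar k (\<lambda>x. complex_of_real (\<phi> x))) z"

definition admissible :: "(complex^'n \<Rightarrow> real) \<Rightarrow> bool" where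
  "admissible \<phi> \<longleftrightarrow> Ck 2 \<phi> \<and>
     (\<forall>z \<xi>. 0 \<le> Re (\<Sum>j\<in>UNIV. \<Sum>k\<in>UNIV. cnj (\<xi> $ j) * cHess \<phi> z j k * \<xi> $ k)) \<and>
     (\<exists>D. \<forall>z r. 0 < r \<longrightarrow> Sup (lap \<phi> ` ball z (2 * r)) \<le> D * Sup (lap \<phi> ` ball z r)) \<and>
     (\<exists>c>0. Inf (range (\<lambda>z. Sup (lap \<phi> ` ball z c))) > 0)"

definition max_eig_radius :: "(complex^'n \<Rightarrow> real) \<Rightarrow> complex^'n \<Rightarrow> real" where
  "max_eig_radius \<phi> z = Sup {r. 0 < r \<and> Sup (lap \<phi> ` ball z r) \<le> 1 / r\<^sup>2}"

end

theory Submission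
  imports Defs "HOL-Complex_Analysis.Complex_Analysis"
begin

text \<open>Coercivity and the Riesz representation theorem on the domain of the quadratic form give a weak solution \<open>g\<close> of
  \<open>\<box> g = u\<close>, with \<open>\<integral> |g|\<^sup>2/\<kappa>\<^sup>2 e\<^bsup>-2\<phi>\<^esup>\<close> controlled by \<open>\<integral> |\<kappa> u|\<^sup>2 e\<^bsup>-2\<phi>\<^esup>\<close>; the canonical solution is \<open>f = dbar* g\<close>.
  Let \<open>\<eta>\<close> be a smooth version of \<open>max 0 (exp (\<epsilon> d\<^sub>\<kappa>(z,\<cdot>)) - const)\<close> that vanishes on the support of \<open>u\<close>. Its gradient is
  at most a small multiple of \<open>(\<eta> + const)/\<kappa>\<close>, so testing the equation with \<open>\<eta>\<^sup>2 g\<close> and absorbing the commutators by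
  coercivity bounds \<open>\<eta> f\<close> in the weighted space by \<open>\<kappa>(z)\<close> times the norm of \<open>u\<close>. Away from the support of \<open>u\<close>, \<open>f\<close> is
  holomorphic by Weyl's lemma. On a ball about \<open>w\<close> of radius comparable to \<open>\<rho>(w) \<le> \<kappa>(w)\<close> the Laplacian of \<open>\<phi>\<close> is at
  most \<open>\<rho>(w)\<^bsup>-2\<^esup>\<close> up to a constant, so \<open>|f|\<^sup>2 exp (-2\<phi> + c |x - w|\<^sup>2/\<rho>(w)\<^sup>2)\<close> is subharmonic there, and its mean value
  inequality turns the weighted bound into the pointwise one.\<close>

text \<open>No density of compactly supported forms in the form domain is established. Instead a
  form is carried together with its weak \<open>dbar\<close> and its adjoint image, and the domain
  is the orthogonal complement of explicit square-integrable functions; closedness, hence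
  completeness, is then a limit of inner products. Multiplication by a cut-off stays inside the
  domain by duality: the cut-off is moved onto the test function. The weight is truncated at height
  \<open>d_rho \<kappa> z w\<close>, so it is bounded and no exponential integrability of the
  solution is presupposed, while the final constants do not depend on the truncation. Boundedness of
  \<kappa> enters twice: it makes the form dominate the norm of the weighted space, and it makes the
  truncated distance constant off a bounded set. With C the comparison constant of \<kappa>, the
  radius r0 = 1/(2C) places the support of u in the Euclidean ball of radius \<kappa>(z)/2, where
  \<kappa> is at most C \<kappa>(z). The rate \<epsilon> = 1/(11 n C^3) gives the gradient bound p =
  3/(11 n), so 6 n^2 p^2 = 54/121 stays below the 1/2 that absorption requires.\<close>

definition sq_int :: "'a measure \<Rightarrow> ('a \<Rightarrow> 'b::euclidean_space) \<Rightarrow> bool" where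
  "sq_int M F \<longleftrightarrow> F \<in> borel_measurable M \<and> integrable M (\<lambda>x. (norm (F x))\<^sup>2)"

section \<open>Square-integrable functions: Cauchy-Schwarz, completeness, Riesz
  representation\<close>

lemma discriminant_bound:
  fixes a b c :: real
  assumes "\<And>t. 0 \<le> a + 2 * t * b + t\<^sup>2 * c" and c: "0 \<le> c"
  shows "b\<^sup>2 \<le> a * c"
proof (cases "c = 0")
  case True
  have "b = 0"
  proof (rule ccontr)
    assume "b \<noteq> 0"
    then have "a + 2 * (- (a + 1) / (2 * b)) * b = -1" by (simp add: field_simps)
    then show False using assms(1)[of "- (a + 1) / (2 * b)"] True by simp
  qed
  then show ?thesis using True by simp
next
  case False
  with c have c0: "c > 0" by simp
  have "a + 2 * (- b / c) * b + (- b / c)\<^sup>2 * c = a - b\<^sup>2 / c"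
    using c0 by (simp add: field_simps power2_eq_square)
  then have "0 \<le> a - b\<^sup>2 / c" using assms(1)[of "- b / c"] by simp
  then show ?thesis using c0 by (simp add: field_simps)
qed

lemma sq_intD:
  assumes "sq_int M F"
  shows "F \<in> borel_measurable M" "integrable M (\<lambda>x. (norm (F x))\<^sup>2)"
  using assms by (auto simp: sq_int_def)

lemma sq_int_bound:
  fixes F :: "'a \<Rightarrow> 'b::euclidean_space" and G :: "'a \<Rightarrow> 'c::euclidean_space"
  assumes "sq_int M F" "G \<in> borel_measurable M" "\<And>x. norm (G x) \<le> C * norm (F x)"
  shows "sq_int M G"
  unfolding sq_int_def
proof
  note [measurable] = sq_intD(1)[OF assms(1)] assms(2)
  show "G \<in> borel_measurable M" by fact
  show "integrable M (\<lambda>x. (norm (G x))\<^sup>2)"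
  proof (rule Bochner_Integration.integrable_bound[where f = "\<lambda>x. C\<^sup>2 * (norm (F x))\<^sup>2"])
    show "integrable M (\<lambda>x. C\<^sup>2 * (norm (F x))\<^sup>2)" using sq_intD(2)[OF assms(1)] by simp
    show "AE x in M. norm ((norm (G x))\<^sup>2) \<le> norm (C\<^sup>2 * (norm (F x))\<^sup>2)"
      using power_mono[OF assms(3) norm_ge_zero, of _ 2] by (simp add: power_mult_distrib)
  qed measurable
qed

lemma sq_int_add:
  assumes "sq_int M F" "sq_int M G"
  shows "sq_int M (\<lambda>x. F x + G x)"
  unfolding sq_int_def
proof
  note [measurable] = sq_intD(1)[OF assms(1)] sq_intD(1)[OF assms(2)]
  show "(\<lambda>x. F x + G x) \<in> borel_measurable M" by measurable
  show "integrable M (\<lambda>x. (norm (F x + G x))\<^sup>2)"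
  proof (rule Bochner_Integration.integrable_bound[where f = "\<lambda>x. 2 * (norm (F x))\<^sup>2 + 2 * (norm (G x))\<^sup>2"])
    show "integrable M (\<lambda>x. 2 * (norm (F x))\<^sup>2 + 2 * (norm (G x))\<^sup>2)"
      using sq_intD(2)[OF assms(1)] sq_intD(2)[OF assms(2)] by simp
    have "(norm (F x + G x))\<^sup>2 \<le> 2 * (norm (F x))\<^sup>2 + 2 * (norm (G x))\<^sup>2" for x
    proof -
      have "(norm (F x + G x))\<^sup>2 \<le> (norm (F x) + norm (G x))\<^sup>2"
        by (intro power_mono norm_triangle_ineq) simp
      also have "\<dots> \<le> 2 * (norm (F x))\<^sup>2 + 2 * (norm (G x))\<^sup>2"
        using sum_squares_bound[of "norm (F x)" "norm (G x)"] by (simp add: power2_sum)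
      finally show ?thesis .
    qed
    then show "AE x in M. norm ((norm (F x + G x))\<^sup>2) \<le> norm (2 * (norm (F x))\<^sup>2 + 2 * (norm (G x))\<^sup>2)"
      by simp
  qed measurable
qed

lemma sq_int_scaleR:
  assumes "sq_int M F" shows "sq_int M (\<lambda>x. a *\<^sub>R F x)"
  using sq_intD[OF assms] by (intro sq_int_bound[OF assms, of _ "\<bar>a\<bar>"]) auto

lemma sq_int_lin:
  assumes "sq_int M F" "sq_int M G"
  shows "sq_int M (\<lambda>x. a *\<^sub>R F x + b *\<^sub>R G x)"
  by (intro sq_int_add sq_int_scaleR assms)

lemma sq_int_diff:
  assumes "sq_int M F" "sq_int M G"
  shows "sq_int M (\<lambda>x. F x - G x)"
  using sq_int_lin[OF assms, of 1 "-1"] by simp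

lemma sq_int_norm_mult:
  fixes F :: "'a \<Rightarrow> 'b::euclidean_space" and G :: "'a \<Rightarrow> 'c::euclidean_space"
  assumes "sq_int M F" "sq_int M G"
  shows "integrable M (\<lambda>x. norm (F x) * norm (G x))"
proof (rule Bochner_Integration.integrable_bound[where f = "\<lambda>x. (norm (F x))\<^sup>2 + (norm (G x))\<^sup>2"])
  note [measurable] = sq_intD(1)[OF assms(1)] sq_intD(1)[OF assms(2)]
  show "(\<lambda>x. norm (F x) * norm (G x)) \<in> borel_measurable M" by measurable
  show "integrable M (\<lambda>x. (norm (F x))\<^sup>2 + (norm (G x))\<^sup>2)"
    using sq_intD(2)[OF assms(1)] sq_intD(2)[OF assms(2)] by simp
  have "norm (F x) * norm (G x) \<le> (norm (F x))\<^sup>2 + (norm (G x))\<^sup>2" for x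
    using sum_squares_bound[of "norm (F x)" "norm (G x)"] mult_nonneg_nonneg[OF norm_ge_zero[of "F x"] norm_ge_zero[of "G x"]]
    by linarith
  then show "AE x in M. norm (norm (F x) * norm (G x)) \<le> norm ((norm (F x))\<^sup>2 + (norm (G x))\<^sup>2)"
    by simp
qed

lemma sq_int_Cauchy_Schwarz:
  fixes F :: "'a \<Rightarrow> 'b::euclidean_space" and G :: "'a \<Rightarrow> 'c::euclidean_space"
  assumes "sq_int M F" "sq_int M G"
  shows "(\<integral>x. norm (F x) * norm (G x) \<partial>M)\<^sup>2 \<le> (\<integral>x. (norm (F x))\<^sup>2 \<partial>M) * (\<integral>x. (norm (G x))\<^sup>2 \<partial>M)"
proof (rule discriminant_bound)
  note I = sq_intD(2)[OF assms(1)] sq_intD(2)[OF assms(2)] sq_int_norm_mult[OF assms]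
  fix t :: real
  have "0 \<le> (\<integral>x. (norm (F x) + t * norm (G x))\<^sup>2 \<partial>M)" by simp
  also have "(\<lambda>x. (norm (F x) + t * norm (G x))\<^sup>2)
     = (\<lambda>x. (norm (F x))\<^sup>2 + 2 * t * (norm (F x) * norm (G x)) + t\<^sup>2 * (norm (G x))\<^sup>2)"
    by (simp add: power2_sum power_mult_distrib algebra_simps)
  also have "integral\<^sup>L M \<dots> = (\<integral>x. (norm (F x))\<^sup>2 \<partial>M) + 2 * t * (\<integral>x. norm (F x) * norm (G x) \<partial>M)
      + t\<^sup>2 * (\<integral>x. (norm (G x))\<^sup>2 \<partial>M)"
    using I by simp
  finally show "0 \<le> (\<integral>x. (norm (F x))\<^sup>2 \<partial>M) + 2 * t * (\<integral>x. norm (F x) * norm (G x) \<partial>M)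
      + t\<^sup>2 * (\<integral>x. (norm (G x))\<^sup>2 \<partial>M)" .
qed simp

lemma sq_int_inner:
  assumes "sq_int M F" "sq_int M G"
  shows "integrable M (\<lambda>x. F x \<bullet> G x)"
proof (rule Bochner_Integration.integrable_bound[OF sq_int_norm_mult[OF assms]])
  note [measurable] = sq_intD(1)[OF assms(1)] sq_intD(1)[OF assms(2)]
  show "(\<lambda>x. F x \<bullet> G x) \<in> borel_measurable M" by measurable
  show "AE x in M. norm (F x \<bullet> G x) \<le> norm (norm (F x) * norm (G x))"
    by (simp add: Cauchy_Schwarz_ineq2)
qed

text \<open>Riesz-Fischer. Along a subsequence the squared increments have integrals below 4^(-i),
  so the sum of 2^i times the squared increments is integrable. Where it is finite the increments
  decay like 2^(-i/2), and the subsequence converges pointwise; Fatou's lemma returns to the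
  norm.\<close>

lemma sq_int_complete:
  fixes F :: "nat \<Rightarrow> 'a \<Rightarrow> 'b::euclidean_space"
  assumes sq: "\<And>n. sq_int M (F n)"
    and Cau: "\<And>e. e > 0 \<Longrightarrow> \<exists>N. \<forall>m\<ge>N. \<forall>n\<ge>N. (\<integral>x. (norm (F m x - F n x))\<^sup>2 \<partial>M) < e"
  obtains G where "sq_int M G" "(\<lambda>n. \<integral>x. (norm (F n x - G x))\<^sup>2 \<partial>M) \<longlonglongrightarrow> 0"
proof -
  have sqd: "sq_int M (\<lambda>x. F m x - F n x)" for m n using sq_int_diff sq by blast
  note [measurable] = sq_intD(1)[OF sq]
  have nn: "(\<integral>\<^sup>+x. ennreal ((norm (F m x - F n x))\<^sup>2) \<partial>M) = ennreal (\<integral>x. (norm (F m x - F n x))\<^sup>2 \<partial>M)" for m n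
    using sq_intD(2)[OF sqd] by (intro nn_integral_eq_integral) auto
  have "\<forall>i::nat. \<exists>N. \<forall>m\<ge>N. \<forall>n\<ge>N. (\<integral>x. (norm (F m x - F n x))\<^sup>2 \<partial>M) < (1/4)^i"
    using Cau by simp
  then obtain N where N: "\<And>i m n. m \<ge> N i \<Longrightarrow> n \<ge> N i \<Longrightarrow> (\<integral>x. (norm (F m x - F n x))\<^sup>2 \<partial>M) < (1/4)^i"
    by metis
  \<comment> \<open>Partial sums make both \<open>r i\<close> and \<open>r (Suc i)\<close> at least
    \<open>N i\<close>, so that the tolerance (1/4)^i applies to consecutive terms; the summand i
    forces \<open>r\<close> to infinity.\<close>
  define r where "r i = (\<Sum>j\<le>i. N j) + i" for i
  have rN: "r i \<ge> N i" for i
    unfolding r_def using member_le_sum[of i "{..i}" N] by simp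
  have rS: "r (Suc i) \<ge> N i" for i
    using rN[of i] unfolding r_def by simp
  have rmono: "r i \<ge> i" for i unfolding r_def by simp
  define a where "a i x = norm (F (r (Suc i)) x - F (r i) x)" for i x
  have am[measurable]: "a i \<in> borel_measurable M" for i unfolding a_def by measurable
  have "(\<integral>\<^sup>+x. (\<Sum>i. ennreal (2^i * (a i x)\<^sup>2)) \<partial>M) = (\<Sum>i. \<integral>\<^sup>+x. ennreal (2^i * (a i x)\<^sup>2) \<partial>M)"
    by (intro nn_integral_suminf) measurable
  also have "\<dots> \<le> (\<Sum>i. ennreal ((1/2)^i))"
  proof (intro suminf_le allI)
    fix i
    have "(\<integral>\<^sup>+x. ennreal (2^i * (a i x)\<^sup>2) \<partial>M) = ennreal (2^i) * (\<integral>\<^sup>+x. ennreal ((a i x)\<^sup>2) \<partial>M)"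
      by (simp add: ennreal_mult nn_integral_cmult)
    also have "\<dots> \<le> ennreal (2^i) * ennreal ((1/4)^i)"
      unfolding a_def nn using N[OF rS[of i] rN[of i]] by (intro mult_left_mono ennreal_leI) auto
    also have "\<dots> = ennreal ((1/2)^i)"
      by (simp add: ennreal_mult[symmetric] power_mult_distrib[symmetric])
    finally show "(\<integral>\<^sup>+x. ennreal (2^i * (a i x)\<^sup>2) \<partial>M) \<le> ennreal ((1/2)^i)" .
  qed auto
  also have "\<dots> = ennreal 2"
    using suminf_geometric[of "1/2::real"] by (subst suminf_ennreal2) auto
  finally have "(\<integral>\<^sup>+x. (\<Sum>i. ennreal (2^i * (a i x)\<^sup>2)) \<partial>M) \<noteq> \<infinity>"
    by (auto simp: top_unique)
  then have "AE x in M. (\<Sum>i. ennreal (2^i * (a i x)\<^sup>2)) \<noteq> \<infinity>"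
    by (intro nn_integral_PInf_AE) auto
  then have conv: "AE x in M. convergent (\<lambda>i. F (r i) x)"
  proof eventually_elim
    case (elim x)
    define s where "s = enn2real (\<Sum>i. ennreal (2^i * (a i x)\<^sup>2))"
    have s: "s \<ge> 0" "(\<Sum>i. ennreal (2^i * (a i x)\<^sup>2)) = ennreal s"
      unfolding s_def using elim by (simp_all add: less_top)
    have "a i x \<le> sqrt s * (sqrt (1/2))^i" for i
    proof -
      have "ennreal (2^i * (a i x)\<^sup>2) \<le> ennreal s"
      proof -
        have "(\<Sum>j\<in>{i}. ennreal (2^j * (a j x)\<^sup>2)) \<le> (\<Sum>j. ennreal (2^j * (a j x)\<^sup>2))"
          by (rule sum_le_suminf) auto
        then show ?thesis unfolding s(2) by (subst (asm) sum.insert) simp_all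
      qed
      then have "2^i * (a i x)\<^sup>2 \<le> s" using s(1) by (simp only: ennreal_le_iff)
      then have "(a i x)\<^sup>2 \<le> s * (1/2)^i" by (simp add: field_simps power_one_over)
      then have "sqrt ((a i x)\<^sup>2) \<le> sqrt (s * (1/2)^i)" by (rule real_sqrt_le_mono)
      then show ?thesis by (simp add: a_def real_sqrt_mult real_sqrt_power)
    qed
    moreover have "summable (\<lambda>i. sqrt s * (sqrt (1/2))^i)"
      by (intro summable_mult summable_geometric) (simp add: real_sqrt_divide)
    ultimately have "summable (\<lambda>i. a i x)"
      by (intro summable_comparison_test'[of "\<lambda>i. sqrt s * (sqrt (1/2))^i" 0 "\<lambda>i. a i x"]) (auto simp: a_def)
    then have "summable (\<lambda>i. F (r (Suc i)) x - F (r i) x)"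
      unfolding a_def by (rule summable_norm_cancel)
    then have "convergent (\<lambda>n. \<Sum>i<n. F (r (Suc i)) x - F (r i) x)"
      by (simp add: summable_iff_convergent)
    then have "convergent (\<lambda>n. F (r n) x - F (r 0) x)"
      by (simp only: sum_lessThan_telescope[of "\<lambda>i. F (r i) x"])
    then have "convergent (\<lambda>n. (F (r n) x - F (r 0) x) + F (r 0) x)"
      by (intro convergent_add convergent_const)
    then show ?case by simp
  qed
  define G where "G x = lim (\<lambda>i. F (r i) x)" for x
  have Gm[measurable]: "G \<in> borel_measurable M" unfolding G_def by measurable
  have lim: "AE x in M. (\<lambda>i. F (r i) x) \<longlonglongrightarrow> G x"
    using conv unfolding G_def by eventually_elim (simp add: convergent_LIMSEQ_iff)
  \<comment> \<open>Fatou along the subsequence: a Cauchy bound between \<open>F m\<close> and all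
    late terms passes to the pointwise limit.\<close>
  have key: "(\<integral>\<^sup>+x. ennreal ((norm (F m x - G x))\<^sup>2) \<partial>M) \<le> ennreal e"
    if e: "\<And>n. n \<ge> N0 \<Longrightarrow> (\<integral>x. (norm (F m x - F n x))\<^sup>2 \<partial>M) < e" for m N0 e
  proof -
    have "(\<integral>\<^sup>+x. ennreal ((norm (F m x - G x))\<^sup>2) \<partial>M)
        = (\<integral>\<^sup>+x. liminf (\<lambda>k. ennreal ((norm (F m x - F (r k) x))\<^sup>2)) \<partial>M)"
      using lim
    proof (intro nn_integral_cong_AE, eventually_elim)
      case (elim x)
      then have "(\<lambda>k. ennreal ((norm (F m x - F (r k) x))\<^sup>2)) \<longlonglongrightarrow> ennreal ((norm (F m x - G x))\<^sup>2)"
        by (intro tendsto_ennrealI tendsto_intros)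
      then show ?case by (rule lim_imp_Liminf[OF trivial_limit_sequentially, symmetric])
    qed
    also have "\<dots> \<le> liminf (\<lambda>k. \<integral>\<^sup>+x. ennreal ((norm (F m x - F (r k) x))\<^sup>2) \<partial>M)"
      by (intro nn_integral_liminf) measurable
    also have "\<dots> \<le> limsup (\<lambda>k. \<integral>\<^sup>+x. ennreal ((norm (F m x - F (r k) x))\<^sup>2) \<partial>M)"
      by (intro Liminf_le_Limsup) simp
    also have "\<dots> \<le> ennreal e"
    proof (intro Limsup_bounded)
      show "\<forall>\<^sub>F k in sequentially. (\<integral>\<^sup>+x. ennreal ((norm (F m x - F (r k) x))\<^sup>2) \<partial>M) \<le> ennreal e"
      proof (rule eventually_sequentiallyI[of N0])
        fix k assume "N0 \<le> k"
        then have "r k \<ge> N0" using rmono[of k] by linarith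
        then show "(\<integral>\<^sup>+x. ennreal ((norm (F m x - F (r k) x))\<^sup>2) \<partial>M) \<le> ennreal e"
          using e[of "r k"] unfolding nn by (intro ennreal_leI) simp
      qed
    qed
    finally show ?thesis .
  qed
  have sqG': "sq_int M (\<lambda>x. F (N 0) x - G x)"
  proof -
    have "(\<integral>\<^sup>+x. ennreal ((norm (F (N 0) x - G x))\<^sup>2) \<partial>M) \<le> ennreal 1"
      using N[of 0 "N 0"] by (intro key[of "N 0"]) auto
    then show ?thesis unfolding sq_int_def
      by (auto intro!: integrableI_nonneg simp: le_less_trans)
  qed
  have sqG: "sq_int M G"
    using sq_int_diff[OF sq[of "N 0"] sqG'] by simp
  have "(\<lambda>n. \<integral>x. (norm (F n x - G x))\<^sup>2 \<partial>M) \<longlonglongrightarrow> 0"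
  proof (rule LIMSEQ_I)
    fix e :: real assume e: "e > 0"
    obtain N0 where N0: "\<And>m n. m \<ge> N0 \<Longrightarrow> n \<ge> N0 \<Longrightarrow> (\<integral>x. (norm (F m x - F n x))\<^sup>2 \<partial>M) < e / 2"
      using Cau[of "e/2"] e by auto
    have "(\<integral>x. (norm (F m x - G x))\<^sup>2 \<partial>M) \<le> e / 2" if "m \<ge> N0" for m
    proof -
      have "ennreal (\<integral>x. (norm (F m x - G x))\<^sup>2 \<partial>M) = (\<integral>\<^sup>+x. ennreal ((norm (F m x - G x))\<^sup>2) \<partial>M)"
        using sq_intD(2)[OF sq_int_diff[OF sq[of m] sqG]] by (intro nn_integral_eq_integral[symmetric]) auto
      also have "\<dots> \<le> ennreal (e / 2)" using N0[OF that] by (intro key[of N0]) auto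
      finally show ?thesis using e by simp
    qed
    then show "\<exists>no. \<forall>n\<ge>no. norm ((\<integral>x. (norm (F n x - G x))\<^sup>2 \<partial>M) - 0) < e"
      using e by (intro exI[of _ N0]) force
  qed
  then show ?thesis using that sqG by blast
qed

text \<open>The representer minimises \<open>B v v - 2 l v\<close>; completeness is only needed for sequences that are
  Cauchy for the seminorm of \<open>B\<close>.\<close>
lemma Riesz_on:
  fixes V :: "('x \<Rightarrow> 'b::real_vector) set" and B :: "('x \<Rightarrow> 'b) \<Rightarrow> ('x \<Rightarrow> 'b) \<Rightarrow> real"
  assumes ne: "V \<noteq> {}"
    and lin: "\<And>f g a b. f \<in> V \<Longrightarrow> g \<in> V \<Longrightarrow> (\<lambda>x. a *\<^sub>R f x + b *\<^sub>R g x) \<in> V"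
    and Blin: "\<And>f g h a b. f \<in> V \<Longrightarrow> g \<in> V \<Longrightarrow> h \<in> V \<Longrightarrow>
          B (\<lambda>x. a *\<^sub>R f x + b *\<^sub>R g x) h = a * B f h + b * B g h"
    and Bsym: "\<And>f g. f \<in> V \<Longrightarrow> g \<in> V \<Longrightarrow> B f g = B g f"
    and Bpos: "\<And>f. f \<in> V \<Longrightarrow> 0 \<le> B f f"
    and complete: "\<And>F. (\<And>n::nat. F n \<in> V) \<Longrightarrow>
          (\<And>e. e > 0 \<Longrightarrow> \<exists>N. \<forall>m\<ge>N. \<forall>n\<ge>N. B (\<lambda>x. F m x - F n x) (\<lambda>x. F m x - F n x) < e) \<Longrightarrow>
          \<exists>G\<in>V. (\<lambda>n. B (\<lambda>x. F n x - G x) (\<lambda>x. F n x - G x)) \<longlonglongrightarrow> 0"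
    and llin: "\<And>f g a b. f \<in> V \<Longrightarrow> g \<in> V \<Longrightarrow> l (\<lambda>x. a *\<^sub>R f x + b *\<^sub>R g x) = a * l f + b * l g"
    and lbd: "\<And>f. f \<in> V \<Longrightarrow> (l f)\<^sup>2 \<le> K * B f f" and K: "0 \<le> K"
  shows "\<exists>g\<in>V. \<forall>v\<in>V. B g v = l v"
proof -
  have Bsum: "B (\<lambda>x. a *\<^sub>R f x + b *\<^sub>R g x) (\<lambda>x. a *\<^sub>R f x + b *\<^sub>R g x)
      = a\<^sup>2 * B f f + 2 * a * b * B f g + b\<^sup>2 * B g g" if "f \<in> V" "g \<in> V" for f g a b
  proof -
    have "B (\<lambda>x. a *\<^sub>R f x + b *\<^sub>R g x) f = a * B f f + b * B f g"
         "B (\<lambda>x. a *\<^sub>R f x + b *\<^sub>R g x) g = a * B f g + b * B g g"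
      using Blin[OF that] Bsym that by auto
    then show ?thesis
      using that lin[OF that]
      by (simp add: Blin Bsym[of "\<lambda>x. a *\<^sub>R f x + b *\<^sub>R g x"] Bsym[of _ "\<lambda>x. a *\<^sub>R f x + b *\<^sub>R g x"] 
           power2_eq_square algebra_simps)
  qed
  have dV: "(\<lambda>x. f x - g x) \<in> V" if "f \<in> V" "g \<in> V" for f g
    using lin[OF that, of 1 "-1"] by simp
  have CS: "(B f g)\<^sup>2 \<le> B f f * B g g" if "f \<in> V" "g \<in> V" for f g
  proof (rule discriminant_bound)
    show "0 \<le> B f f + 2 * t * B f g + t\<^sup>2 * B g g" for t
      using Bpos[OF lin[OF that, of 1 t]] Bsum[OF that, of 1 t] by simp
  qed (rule Bpos[OF that(2)])
  define J where "J f = B f f - 2 * l f" for f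
  have Jbelow: "- K \<le> J f" if "f \<in> V" for f
  proof -
    have "(2 * l f)\<^sup>2 \<le> (K + B f f)\<^sup>2"
      using lbd[OF that] zero_le_power2[of "K - B f f"] by (simp add: power2_eq_square algebra_simps)
    then have "2 * l f \<le> K + B f f"
      by (rule power2_le_imp_le) (use K Bpos[OF that] in linarith)
    then show ?thesis unfolding J_def by simp
  qed
  define I where "I = Inf (J ` V)"
  have bdd: "bdd_below (J ` V)" using Jbelow by (intro bdd_belowI[of _ "-K"]) auto
  have IJ: "I \<le> J f" if "f \<in> V" for f
    unfolding I_def using bdd that by (simp add: cInf_lower)
  have "\<exists>f\<in>V. J f < I + 1 / (real n + 1)" for n :: nat
    using cInf_lessD[of "J ` V" "I + 1 / (real n + 1)"] ne unfolding I_def by auto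
  then obtain F where F: "\<And>n::nat. F n \<in> V" "\<And>n. J (F n) < I + 1 / (real n + 1)"
    by metis
  have Jlin: "J (\<lambda>x. a *\<^sub>R f x + b *\<^sub>R g x)
      = a\<^sup>2 * B f f + 2 * a * b * B f g + b\<^sup>2 * B g g - 2 * (a * l f + b * l g)" if "f \<in> V" "g \<in> V" for f g a b
    unfolding J_def using Bsum[OF that] llin[OF that] by simp
  \<comment> \<open>Parallelogram identity: the midpoint of two near-minimisers has value at least
    \<open>I\<close>, so their difference is small for \<open>B\<close>. Minimising sequences are
    therefore Cauchy.\<close>
  have par: "B (\<lambda>x. F m x - F n x) (\<lambda>x. F m x - F n x) < 2 / (real m + 1) + 2 / (real n + 1)" for m n
  proof -
    have "I \<le> J (\<lambda>x. (1/2) *\<^sub>R F m x + (1/2) *\<^sub>R F n x)" by (intro IJ lin F)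
    also have "\<dots> = J (F m) / 2 + J (F n) / 2 - B (\<lambda>x. F m x - F n x) (\<lambda>x. F m x - F n x) / 4"
      using Bsum[OF F(1) F(1), of 1 m "-1" n]
      by (subst Jlin[OF F(1) F(1)]) (simp add: J_def field_simps power2_eq_square)
    finally show ?thesis using F(2)[of m] F(2)[of n] by simp
  qed
  have "\<exists>N. \<forall>m\<ge>N. \<forall>n\<ge>N. B (\<lambda>x. F m x - F n x) (\<lambda>x. F m x - F n x) < e" if "e > 0" for e
  proof -
    obtain N :: nat where N: "real N > 4 / e" using reals_Archimedean2 by blast
    have "2 / (real m + 1) < e / 2" if "m \<ge> N" for m
    proof -
      have "4 / e < real m + 1" using N that by linarith
      then show ?thesis using \<open>e > 0\<close> by (simp add: field_simps)
    qed
    then show ?thesis using par by (intro exI[of _ N]) (smt (verit) field_sum_of_halves)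
  qed
  from complete[OF F(1) this] obtain G where
    G: "G \<in> V" "(\<lambda>n. B (\<lambda>x. F n x - G x) (\<lambda>x. F n x - G x)) \<longlonglongrightarrow> 0" by blast
  have "B G v = l v" if v: "v \<in> V" for v
  proof -
    have "(\<lambda>n. (B (F n) v - B G v)\<^sup>2) \<longlonglongrightarrow> 0"
    proof (rule tendsto_sandwich[OF _ _ tendsto_const])
      show "\<forall>\<^sub>F n in sequentially. (B (F n) v - B G v)\<^sup>2 \<le> B (\<lambda>x. F n x - G x) (\<lambda>x. F n x - G x) * B v v"
      proof (intro always_eventually allI)
        fix n
        have "B (F n) v - B G v = B (\<lambda>x. F n x - G x) v"
          using Blin[OF F(1)[of n] G(1) v, of 1 "-1"] by simp
        then show "(B (F n) v - B G v)\<^sup>2 \<le> B (\<lambda>x. F n x - G x) (\<lambda>x. F n x - G x) * B v v"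
          using CS[OF dV[OF F(1)[of n] G(1)] v] by simp
      qed
      show "(\<lambda>n. B (\<lambda>x. F n x - G x) (\<lambda>x. F n x - G x) * B v v) \<longlonglongrightarrow> 0"
        using tendsto_mult_left_zero[OF G(2)] by simp
    qed simp
    then have "(\<lambda>n. B (F n) v - B G v) \<longlonglongrightarrow> 0"
      using tendsto_real_sqrt[of "\<lambda>n. (B (F n) v - B G v)\<^sup>2" 0 sequentially] by (simp add: tendsto_rabs_zero_iff)
    then have lim: "(\<lambda>n. B (F n) v) \<longlonglongrightarrow> B G v" by (simp add: LIM_zero_iff)
    \<comment> \<open>First variation at the minimiser, obtained as a limit along the sequence. The
      leading 0 is the constant coefficient handed to \<open>discriminant_bound\<close>, which
      forces the linear coefficient to vanish.\<close>
    have "0 \<le> 0 + 2 * t * (B G v - l v) + t\<^sup>2 * B v v" for t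
    proof (rule LIMSEQ_le_const)
      have "(\<lambda>n. 1 / (real n + 1)) \<longlonglongrightarrow> 0" by (rule LIMSEQ_inverse_real_of_nat[unfolded inverse_eq_divide of_nat_Suc add.commute[of 1]])
      then show "(\<lambda>n. 1 / (real n + 1) + 2 * t * (B (F n) v - l v) + t\<^sup>2 * B v v)
          \<longlonglongrightarrow> 0 + 2 * t * (B G v - l v) + t\<^sup>2 * B v v"
        by (intro tendsto_intros lim)
      have "0 \<le> 1 / (real n + 1) + 2 * t * (B (F n) v - l v) + t\<^sup>2 * B v v" for n
      proof -
        have "I \<le> J (\<lambda>x. 1 *\<^sub>R F n x + t *\<^sub>R v x)" by (intro IJ lin F v)
        also have "\<dots> = J (F n) + 2 * t * (B (F n) v - l v) + t\<^sup>2 * B v v"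
          by (subst Jlin[OF F(1) v]) (simp add: J_def algebra_simps)
        finally show ?thesis using F(2)[of n] by linarith
      qed
      then show "\<exists>N. \<forall>n\<ge>N. 0 \<le> 1 / (real n + 1) + 2 * t * (B (F n) v - l v) + t\<^sup>2 * B v v" by blast
    qed
    then have "(B G v - l v)\<^sup>2 \<le> 0 * B v v" by (rule discriminant_bound) (rule Bpos[OF v])
    then show ?thesis by simp
  qed
  then show ?thesis using G(1) by blast
qed

section \<open>Calculus of the classes \<open>Ck\<close> and \<open>smooth_fun\<close>\<close>

lemma Ck_SucI:
  assumes "\<And>x. (f has_derivative f' x) (at x)" "\<And>v. Ck k (\<lambda>x. f' x v)"
  shows "Ck (Suc k) f"
  using assms frechet_derivative_at[OF assms(1)] by (auto simp: differentiable_def)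

lemma Ck_has_derivative:
  assumes "Ck (Suc k) f"
  shows "(f has_derivative frechet_derivative f (at x)) (at x)"
  using assms by (simp add: frechet_derivative_works)

lemma Ck_SucD: "Ck (Suc k) f \<Longrightarrow> Ck k (\<lambda>x. frechet_derivative f (at x) v)"
  by simp

lemma Ck_pred: "Ck (Suc k) f \<Longrightarrow> Ck k f"
proof (induction k arbitrary: f)
  case 0
  then show ?case
    by (auto intro!: continuous_at_imp_continuous_on differentiable_imp_continuous_within)
next
  case (Suc k)
  then show ?case using Suc.IH[of "\<lambda>x. frechet_derivative f (at x) _"] by (metis Ck.simps(2))
qed

lemma Ck_continuous: "Ck k f \<Longrightarrow> continuous_on UNIV f"
  by (induction k) (auto dest: Ck_pred simp del: Ck.simps(2))

lemma Ck_const: "Ck k (\<lambda>x. c)"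
proof (induction k arbitrary: c)
  case (Suc k) then show ?case by (intro Ck_SucI[of _ "\<lambda>x v. 0"]) auto
qed simp

lemma Ck_linear: "bounded_linear f \<Longrightarrow> Ck k f"
proof (cases k)
  case (Suc n)
  assume "bounded_linear f"
  then show ?thesis unfolding Suc
    by (intro Ck_SucI[of _ "\<lambda>x. f"] Ck_const bounded_linear_imp_has_derivative)
qed (simp add: linear_continuous_on)

lemma Ck_add: "Ck k f \<Longrightarrow> Ck k g \<Longrightarrow> Ck k (\<lambda>x. f x + g x)"
proof (induction k arbitrary: f g)
  case 0 then show ?case by (simp add: continuous_on_add)
next
  case (Suc k)
  show ?case
    by (rule Ck_SucI, rule has_derivative_add[OF Ck_has_derivative[OF Suc.prems(1)] Ck_has_derivative[OF Suc.prems(2)]])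
       (intro Suc.IH Ck_SucD[OF Suc.prems(1)] Ck_SucD[OF Suc.prems(2)])
qed

lemma Ck_bilinear:
  assumes "bounded_bilinear B"
  shows "Ck k f \<Longrightarrow> Ck k g \<Longrightarrow> Ck k (\<lambda>x. B (f x) (g x))"
proof (induction k arbitrary: f g)
  case 0 then show ?case using bounded_bilinear.continuous_on[OF assms, of UNIV f g] by simp
next
  case (Suc k)
  show ?case
    by (rule Ck_SucI, rule bounded_bilinear.FDERIV[OF assms Ck_has_derivative[OF Suc.prems(1)] Ck_has_derivative[OF Suc.prems(2)]])
       (intro Ck_add Suc.IH Ck_SucD[OF Suc.prems(1)] Ck_SucD[OF Suc.prems(2)] Ck_pred[OF Suc.prems(1)] Ck_pred[OF Suc.prems(2)])
qed

lemma Ck_mult: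
  fixes f g :: "'a::real_normed_vector \<Rightarrow> 'b::real_normed_algebra"
  shows "Ck k f \<Longrightarrow> Ck k g \<Longrightarrow> Ck k (\<lambda>x. f x * g x)"
  by (rule Ck_bilinear[OF bounded_bilinear_mult])

lemma Ck_comp_linear: "bounded_linear L \<Longrightarrow> Ck k f \<Longrightarrow> Ck k (\<lambda>x. L (f x))"
proof (induction k arbitrary: f)
  case 0 then show ?case by (simp add: bounded_linear.continuous_on)
next
  case (Suc k)
  show ?case
    by (rule Ck_SucI, rule bounded_linear.has_derivative[OF Suc.prems(1) Ck_has_derivative[OF Suc.prems(2)]])
       (intro Suc.IH Ck_SucD[OF Suc.prems(2)] Suc.prems)
qed

lemma Ck_affine: "bounded_linear A \<Longrightarrow> Ck k f \<Longrightarrow> Ck k (\<lambda>x. f (A x + t))"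
proof (induction k arbitrary: f)
  case 0
  have f: "continuous_on UNIV f" using 0 by simp
  have "continuous_on UNIV (\<lambda>x. f (A x + t))"
    by (rule continuous_on_compose2[OF f continuous_on_add[OF linear_continuous_on[OF 0(1)] continuous_on_const]]) simp
  then show ?case by simp
next
  case (Suc k)
  have "((\<lambda>x. A x + t) has_derivative A) (at x)" for x
    by (rule has_derivative_add_const) (rule bounded_linear_imp_has_derivative[OF Suc.prems(1)])
  then have "((\<lambda>x. f (A x + t)) has_derivative (\<lambda>v. frechet_derivative f (at (A x + t)) (A v))) (at x)" for x
    by (rule has_derivative_compose[OF _ Ck_has_derivative[OF Suc.prems(2)]])
  then show ?case
    by (rule Ck_SucI) (intro Suc.IH[of "\<lambda>x. frechet_derivative f (at x) _"] Suc.prems Ck_SucD[OF Suc.prems(2)])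
qed

lemma smooth_funD: "smooth_fun f \<Longrightarrow> Ck k f"
  by (simp add: smooth_fun_def)

lemma smooth_fun_derivative: "smooth_fun f \<Longrightarrow> smooth_fun (\<lambda>x. frechet_derivative f (at x) v)"
  unfolding smooth_fun_def by (metis Ck.simps(2))

lemma smooth_has_derivative: "smooth_fun f \<Longrightarrow> (f has_derivative frechet_derivative f (at x)) (at x)"
  using Ck_has_derivative smooth_funD by blast

lemma smooth_continuous: "smooth_fun f \<Longrightarrow> continuous_on UNIV f"
  using Ck_continuous smooth_funD by blast

lemma smooth_mult:
  fixes f g :: "'a::real_normed_vector \<Rightarrow> 'b::real_normed_algebra"
  shows "smooth_fun f \<Longrightarrow> smooth_fun g \<Longrightarrow> smooth_fun (\<lambda>x. f x * g x)"
  unfolding smooth_fun_def by (blast intro: Ck_mult)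

lemma smooth_add: "smooth_fun f \<Longrightarrow> smooth_fun g \<Longrightarrow> smooth_fun (\<lambda>x. f x + g x)"
  unfolding smooth_fun_def by (blast intro: Ck_add)

lemma smooth_comp_linear: "bounded_linear L \<Longrightarrow> smooth_fun f \<Longrightarrow> smooth_fun (\<lambda>x. L (f x))"
  unfolding smooth_fun_def by (blast intro: Ck_comp_linear)

lemma smooth_affine: "bounded_linear A \<Longrightarrow> smooth_fun f \<Longrightarrow> smooth_fun (\<lambda>x. f (A x + t))"
  unfolding smooth_fun_def by (blast intro: Ck_affine)

lemma dirderiv_has_vector_derivative:
  assumes "\<And>x. (f has_derivative f' x) (at x)"
  shows "((\<lambda>t. f (x + t *\<^sub>R v)) has_vector_derivative f' (x + t *\<^sub>R v) v) (at t)"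
proof -
  have "((\<lambda>t. x + t *\<^sub>R v) has_vector_derivative v) (at t)"
    by (auto intro!: derivative_eq_intros)
  from vector_derivative_diff_chain_within[of _ v t UNIV f "f' (x + t *\<^sub>R v)"] this assms[of "x + t *\<^sub>R v"]
  show ?thesis by (auto simp: o_def intro: has_derivative_at_withinI)
qed

subsection \<open>Bump functions\<close>

text \<open>All powers m are needed at once: the derivative of member m is a combination of members
  m + 1 and m + 2, so an induction over the order of differentiability closes within the
  family.\<close>

definition expinv :: "nat \<Rightarrow> real \<Rightarrow> real" where
  "expinv m t = (if t \<le> 0 then 0 else (1 / t) ^ m * exp (- (1 / t)))"

lemma expinv_nonneg: "0 \<le> expinv m t"
  by (simp add: expinv_def)

lemma expinv_tendsto_0: "(expinv m \<longlongrightarrow> 0) (at_right 0)"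
proof -
  have "((\<lambda>x::real. x ^ m / exp x) \<longlongrightarrow> 0) at_top" by (rule tendsto_power_div_exp_0)
  then have "((\<lambda>t. inverse t ^ m / exp (inverse t)) \<longlongrightarrow> 0) (at_right (0::real))"
    by (rule filterlim_compose[OF _ filterlim_inverse_at_top_right])
  then show ?thesis
    by (rule tendsto_cong[THEN iffD1, rotated])
       (auto simp: eventually_at_right_field expinv_def exp_minus field_simps intro!: exI[of _ 1])
qed

lemma expinv_deriv:
  "(expinv m has_real_derivative expinv (m + 2) t - real m * expinv (m + 1) t) (at t)"
proof -
  consider "t < 0" | "t = 0" | "t > 0" by linarith
  then show ?thesis
  proof cases
    case 1
    have "((\<lambda>_. 0) has_real_derivative 0) (at t)" by simp
    then have "(expinv m has_real_derivative 0) (at t)"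
      by (rule has_field_derivative_transform_within_open[of _ _ _ "{..<0}"]) (use 1 in \<open>auto simp: expinv_def\<close>)
    then show ?thesis using 1 by (simp add: expinv_def)
  next
    case 2
    have "((\<lambda>h. (expinv m (0 + h) - expinv m 0) / h) \<longlongrightarrow> 0) (at 0)"
    proof (rule filterlim_split_at)
      show "((\<lambda>h. (expinv m (0 + h) - expinv m 0) / h) \<longlongrightarrow> 0) (at_left 0)"
        by (rule tendsto_cong[THEN iffD1, rotated, OF tendsto_const])
           (auto simp: eventually_at_left_field expinv_def intro!: exI[of _ "-1"])
      \<comment> \<open>For positive h the difference quotient at 0 is
        \<open>expinv (Suc m) h\<close>.\<close>
      show "((\<lambda>h. (expinv m (0 + h) - expinv m 0) / h) \<longlongrightarrow> 0) (at_right 0)"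
        by (rule tendsto_cong[THEN iffD1, rotated, OF expinv_tendsto_0[of "Suc m"]])
           (auto simp: eventually_at_right_field expinv_def intro!: exI[of _ 1])
    qed
    then have "(expinv m has_real_derivative 0) (at 0)" by (simp add: DERIV_def)
    then show ?thesis using 2 by (simp add: expinv_def)
  next
    case 3
    have "((\<lambda>t. (1 / t) ^ m * exp (- (1 / t))) has_real_derivative
        (1/t) ^ m * (exp (- (1/t)) * (1/t) ^ 2) + (real m * (1/t) ^ (m - 1) * (- ((1/t) ^ 2))) * exp (- (1/t))) (at t)"
      using 3 by (cases m; (auto intro!: derivative_eq_intros simp: power2_eq_square field_simps)?;
          (metis power_minus_mult mult.commute neq0_conv One_nat_def)?)
    also have "(1/t) ^ m * (exp (- (1/t)) * (1/t) ^ 2) + (real m * (1/t) ^ (m - 1) * (- ((1/t) ^ 2))) * exp (- (1/t))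
       = expinv (m + 2) t - real m * expinv (m + 1) t"
      using 3 by (cases m) (auto simp: expinv_def power_add power2_eq_square algebra_simps add_divide_distrib)
    finally show ?thesis
      by (rule has_field_derivative_transform_within_open[of _ _ _ "{0<..}"]) (use 3 in \<open>auto simp: expinv_def\<close>)
  qed
qed

lemma expinv_radial_derivative:
  fixes x :: "'a::euclidean_space"
  shows "((\<lambda>x. expinv m (1 - x \<bullet> x)) has_derivative
     (\<lambda>v. (expinv (m + 2) (1 - x \<bullet> x) - real m * expinv (m + 1) (1 - x \<bullet> x)) * (- 2 * (x \<bullet> v)))) (at x)"
proof -
  have "((\<lambda>x. 1 - x \<bullet> x) has_derivative (\<lambda>v. - 2 * (x \<bullet> v))) (at x)"
    by (auto intro!: derivative_eq_intros simp: inner_commute)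
  from has_derivative_compose[OF this expinv_deriv[of m "1 - x \<bullet> x", unfolded has_field_derivative_def]]
  show ?thesis .
qed

lemma Ck_expinv_radial: "Ck k (\<lambda>x::'a::euclidean_space. expinv m (1 - x \<bullet> x))"
proof (induction k arbitrary: m)
  case 0
  have "continuous_on UNIV (expinv m)"
    by (intro continuous_at_imp_continuous_on ballI DERIV_isCont[OF expinv_deriv])
  then have "continuous_on UNIV (\<lambda>x::'a. expinv m (1 - x \<bullet> x))"
    by (rule continuous_on_compose2) (auto intro!: continuous_intros)
  then show ?case by simp
next
  case (Suc k)
  have b: "Ck k (\<lambda>x::'a. - 2 * (x \<bullet> v))" for v
    by (intro Ck_linear bounded_linear_const_mult bounded_linear_inner_left)
  have "Ck k (\<lambda>x::'a. (expinv (m + 2) (1 - x \<bullet> x) + (- real m) * expinv (m + 1) (1 - x \<bullet> x)) * (- 2 * (x \<bullet> v)))" for v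
    by (intro Ck_mult Ck_add b Suc.IH Ck_const)
  then show ?case
    by (intro Ck_SucI[OF expinv_radial_derivative]) simp
qed

text \<open>The profile 2 \<open>expinv 2\<close> is dictated by \<open>bump_pot\<close>:
  \<open>expinv 0\<close> has derivative \<open>expinv 2\<close>, and the inner function 1 - x
  \<bullet> x contributes -2 x. One constant normalises both functions, giving \<open>bump\<close>
  mass 1 and keeping the gradient relation between them exact.\<close>

definition bump_const :: "'a::euclidean_space itself \<Rightarrow> real" where
  "bump_const _ = 1 / (\<integral>(x::'a). 2 * expinv 2 (1 - x \<bullet> x) \<partial>lborel)"

definition bump :: "'a::euclidean_space \<Rightarrow> real" where
  "bump x = bump_const TYPE('a) * (2 * expinv 2 (1 - x \<bullet> x))"

definition bump_pot :: "'a::euclidean_space \<Rightarrow> real" where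
  "bump_pot x = bump_const TYPE('a) * expinv 0 (1 - x \<bullet> x)"

lemma smooth_bump: "smooth_fun (bump :: 'a::euclidean_space \<Rightarrow> real)"
  unfolding smooth_fun_def bump_def by (intro allI Ck_mult Ck_const Ck_expinv_radial)

lemma smooth_bump_pot: "smooth_fun (bump_pot :: 'a::euclidean_space \<Rightarrow> real)"
  unfolding smooth_fun_def bump_pot_def by (intro allI Ck_mult Ck_const Ck_expinv_radial)

lemma norm_ge_1_inner: "norm x \<ge> 1 \<Longrightarrow> 1 - x \<bullet> x \<le> 0"
  using power_mono[of 1 "norm x" 2] by (simp add: power2_norm_eq_inner)

lemma bump_support: "norm x \<ge> 1 \<Longrightarrow> bump x = 0"
  using norm_ge_1_inner[of x] by (simp add: bump_def expinv_def)

lemma bump_pot_support: "norm x \<ge> 1 \<Longrightarrow> bump_pot x = 0"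
  using norm_ge_1_inner[of x] by (simp add: bump_pot_def expinv_def)

lemma bump_minus [simp]: "bump (- x) = bump x"
  by (simp add: bump_def)

lemma continuous_integrable_support:
  fixes f :: "'a::euclidean_space \<Rightarrow> 'b::{banach, second_countable_topology}"
  assumes "continuous_on UNIV f" "\<And>x. norm x > R \<Longrightarrow> f x = 0"
  shows "integrable lborel f"
proof -
  have "integrable lborel (\<lambda>x. indicator (cball 0 R) x *\<^sub>R f x)"
    using assms(1) by (intro borel_integrable_compact continuous_on_subset[OF assms(1)]) auto
  also have "(\<lambda>x. indicator (cball 0 R) x *\<^sub>R f x) = f"
    using assms(2) by (auto simp: fun_eq_iff indicator_def)
  finally show ?thesis .
qed

lemma bump_mass_pos: "0 < (\<integral>(x::'a::euclidean_space). 2 * expinv 2 (1 - x \<bullet> x) \<partial>lborel)"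
proof -
  let ?f = "\<lambda>x::'a. 2 * expinv 2 (1 - x \<bullet> x)"
  have c: "continuous_on UNIV ?f"
    using Ck_continuous[OF Ck_expinv_radial[of 0 2]] by (intro continuous_intros)
  have s: "?f x = 0" if "norm x > 1" for x
    using norm_ge_1_inner[of x] that by (simp add: expinv_def)
  have int: "integrable lborel ?f" by (rule continuous_integrable_support[OF c s])
  define e where "e = ?f 0"
  have e: "e > 0" by (simp add: e_def expinv_def)
  have "open (?f -` {e/2<..})"
    using c by (intro open_vimage) auto
  moreover have "0 \<in> ?f -` {e/2<..}" using e by (simp add: e_def)
  ultimately obtain d where d: "d > 0" "ball 0 d \<subseteq> ?f -` {e/2<..}"
    by (meson openE)
  have fin: "emeasure lborel (ball (0::'a) d) < \<infinity>" by (rule emeasure_lborel_ball_finite)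
  have "0 < e/2 * measure lborel (ball (0::'a) d)"
    using e d(1) content_ball_pos[of d "0::'a"] by (simp add: measure_def)
  also have "\<dots> = (\<integral>x. e/2 * indicator (ball (0::'a) d) x \<partial>lborel)"
    by simp
  also have "\<dots> \<le> integral\<^sup>L lborel ?f"
  proof (rule integral_mono[OF _ int])
    show "integrable lborel (\<lambda>x. e/2 * indicator (ball (0::'a) d) x)" using fin by simp
    show "e/2 * indicator (ball 0 d) x \<le> ?f x" for x
      using d(2) e expinv_nonneg[of 2 "1 - x \<bullet> x"] by (auto simp: indicator_def subset_eq intro: less_imp_le)
  qed
  finally show ?thesis .
qed

lemma bump_const_pos: "bump_const TYPE('a::euclidean_space) > 0"
  using bump_mass_pos[where 'a='a] by (simp add: bump_const_def)

lemma bump_nonneg: "0 \<le> bump x" 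
  using bump_const_pos[where 'a='a] by (simp add: bump_def expinv_nonneg less_imp_le)

lemma bump_pot_nonneg: "0 \<le> bump_pot x" 
  using bump_const_pos[where 'a='a] by (simp add: bump_pot_def expinv_nonneg less_imp_le)

lemma bump_integral: "(\<integral>(x::'a::euclidean_space). bump x \<partial>lborel) = 1"
  using bump_mass_pos[where 'a='a] unfolding bump_def by (simp add: bump_const_def)

lemma bump_integrable: "integrable lborel (bump :: 'a::euclidean_space \<Rightarrow> real)"
  by (rule continuous_integrable_support[of _ 1]) (simp_all add: smooth_continuous smooth_bump bump_support)

lemma bump_pot_derivative:
  "frechet_derivative bump_pot (at (x::'a::euclidean_space)) v = - (x \<bullet> v) * bump x"
proof -
  have "(bump_pot has_derivative (\<lambda>v. - (x \<bullet> v) * bump x)) (at x)"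
    unfolding bump_pot_def bump_def
    by (rule has_derivative_eq_rhs[OF has_derivative_mult_right[OF expinv_radial_derivative]])
       (simp add: fun_eq_iff numeral_2_eq_2)
  then show ?thesis by (metis frechet_derivative_at)
qed

lemma bump_tangential_derivative:
  assumes "x \<bullet> v = 0"
  shows "frechet_derivative bump (at (x::'a::euclidean_space)) v = 0"
proof -
  have "(bump has_derivative (\<lambda>v. bump_const TYPE('a) * (2 * ((expinv (2 + 2) (1 - x \<bullet> x) - real 2 * expinv (2 + 1) (1 - x \<bullet> x)) * (- 2 * (x \<bullet> v)))))) (at x)"
    unfolding bump_def
    by (intro has_derivative_mult_right expinv_radial_derivative)
  from frechet_derivative_at[OF this, symmetric] assms show ?thesis by simp
qed

subsection \<open>Convolution\<close>

lemma lborel_integral_affine: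
  fixes f :: "'a::euclidean_space \<Rightarrow> 'b::{banach, second_countable_topology}"
  assumes f: "f \<in> borel_measurable borel" and c: "c \<noteq> 0"
  shows "(\<integral>x. f (t + c *\<^sub>R x) \<partial>lborel) = (\<integral>x. f x \<partial>lborel) /\<^sub>R \<bar>c\<bar> ^ DIM('a)"
proof -
  note [measurable] = f
  have "(\<integral>x. f x \<partial>lborel) = (\<integral>x. f x \<partial>(density (distr lborel borel (\<lambda>x. t + c *\<^sub>R x)) (\<lambda>_. \<bar>c\<bar> ^ DIM('a))))"
    using lborel_affine[OF c, of t] by simp
  also have "\<dots> = (\<integral>x. \<bar>c\<bar> ^ DIM('a) *\<^sub>R f (t + c *\<^sub>R x) \<partial>lborel)"
    by (subst integral_density) (auto simp: integral_distr)
  also have "\<dots> = \<bar>c\<bar> ^ DIM('a) *\<^sub>R (\<integral>x. f (t + c *\<^sub>R x) \<partial>lborel)" by simp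
  finally show ?thesis using c by simp
qed

lemma lborel_integral_reflect:
  fixes f :: "'a::euclidean_space \<Rightarrow> 'b::{banach, second_countable_topology}"
  assumes f: "f \<in> borel_measurable borel"
  shows "(\<integral>y. f (x - y) \<partial>lborel) = (\<integral>y. f y \<partial>lborel)"
  using lborel_integral_affine[OF f, of "-1" x] by simp

lemma lborel_integral_translate:
  fixes f :: "'a::euclidean_space \<Rightarrow> 'b::{banach, second_countable_topology}"
  assumes f: "f \<in> borel_measurable borel"
  shows "(\<integral>y. f (x + y) \<partial>lborel) = (\<integral>y. f y \<partial>lborel)"
  using lborel_integral_affine[OF f, of "1" x] by simp

text \<open>Borel rather than Lebesgue measurability is required, so that Fubini and affine
  substitutions on \<open>lborel\<close> apply directly; Lebesgue measurable solutions are first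
  replaced by Borel representatives.\<close>

definition loc_int :: "('a::euclidean_space \<Rightarrow> 'b::euclidean_space) \<Rightarrow> bool" where
  "loc_int f \<longleftrightarrow> f \<in> borel_measurable borel \<and>
     (\<forall>R. integrable lborel (\<lambda>x. indicator (cball 0 R) x *\<^sub>R f x))"

definition conv :: "('a::euclidean_space \<Rightarrow> 'b::euclidean_space) \<Rightarrow> ('a \<Rightarrow> real) \<Rightarrow> 'a \<Rightarrow> 'b" where
  "conv f \<xi> x = (\<integral>y. \<xi> (x - y) *\<^sub>R f y \<partial>lborel)"

lemma borel_continuous: 
  fixes f :: "'a::euclidean_space \<Rightarrow> 'b::real_normed_vector"
  shows "continuous_on UNIV f \<Longrightarrow> f \<in> borel_measurable borel"
  by (rule borel_measurable_continuous_onI)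

lemma loc_intD:
  assumes "loc_int f"
  shows "f \<in> borel_measurable borel" "integrable lborel (\<lambda>x. indicator (cball 0 R) x *\<^sub>R f x)"
  using assms by (auto simp: loc_int_def)

lemma continuous_loc_int: "continuous_on UNIV f \<Longrightarrow> loc_int f"
  unfolding loc_int_def
  by (auto intro!: borel_continuous borel_integrable_compact continuous_on_subset[of UNIV f])

lemma continuous_support_bounded:
  fixes f :: "'a::euclidean_space \<Rightarrow> 'b::real_normed_vector"
  assumes "continuous_on UNIV f" "\<And>x. norm x > R \<Longrightarrow> f x = 0"
  obtains B where "B \<ge> 0" "\<And>x. norm (f x) \<le> B"
proof -
  have "compact (f ` cball 0 R)"
    using assms(1) by (intro compact_continuous_image) (auto intro: continuous_on_subset)
  then have "bounded (f ` cball 0 R)" by (rule compact_imp_bounded)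
  then obtain B where B: "\<forall>y\<in>f ` cball 0 R. norm y \<le> B"
    unfolding bounded_iff by (elim exE)
  have "norm (f x) \<le> max B 0" for x
    using B assms(2)[of x] by (cases "norm x > R") (auto simp: max.coboundedI1)
  then show ?thesis using that[of "max B 0"] by auto
qed

lemma loc_int_mult_support:
  assumes f: "loc_int f" and g: "g \<in> borel_measurable borel" and b: "\<And>x. \<bar>g x\<bar> \<le> B"
    and s: "\<And>x. norm x > R \<Longrightarrow> g x = 0"
  shows "integrable lborel (\<lambda>x. g x *\<^sub>R f x)"
proof (rule Bochner_Integration.integrable_bound)
  note [measurable] = g loc_intD(1)[OF f]
  show "integrable lborel (\<lambda>x. B *\<^sub>R (indicator (cball 0 R) x *\<^sub>R f x))"
    by (intro integrable_scaleR_right loc_intD(2)[OF f])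
  show "(\<lambda>x. g x *\<^sub>R f x) \<in> borel_measurable lborel" by measurable
  have "norm (g x *\<^sub>R f x) \<le> norm (B *\<^sub>R (indicator (cball 0 R) x *\<^sub>R f x))" for x
  proof (cases "norm x > R")
    case False
    then show ?thesis using b[of x] by (simp add: mult_right_mono)
  qed (simp add: s)
  then show "AE x in lborel. norm (g x *\<^sub>R f x) \<le> norm (B *\<^sub>R (indicator (cball 0 R) x *\<^sub>R f x))" by simp
qed

lemma conv_integrable:
  assumes f: "loc_int f" and g: "continuous_on UNIV \<xi>" and s: "\<And>x. norm x > R \<Longrightarrow> \<xi> x = 0"
  shows "integrable lborel (\<lambda>y. \<xi> (x - y) *\<^sub>R f y)"
proof -
  obtain B where B: "\<And>x. norm (\<xi> x) \<le> B" using continuous_support_bounded[OF g s] by blast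
  have "continuous_on UNIV (\<lambda>y. \<xi> (x - y))"
    by (rule continuous_on_compose2[OF g]) (auto intro!: continuous_intros)
  then have m: "(\<lambda>y. \<xi> (x - y)) \<in> borel_measurable borel" by (rule borel_continuous)
  show ?thesis
  proof (rule loc_int_mult_support[OF f m])
    show "\<bar>\<xi> (x - y)\<bar> \<le> B" for y using B[of "x - y"] by simp
    show "\<xi> (x - y) = 0" if "norm y > R + norm x" for y
      using norm_triangle_ineq2[of y x] that by (intro s) (simp add: norm_minus_commute)
  qed
qed

lemma derivative_support:
  fixes f :: "'a::euclidean_space \<Rightarrow> 'b::real_normed_vector"
  assumes "\<And>x. norm x > R \<Longrightarrow> f x = 0" "norm x > R"
  shows "frechet_derivative f (at x) v = 0"
proof -
  have o: "open {x::'a. norm x > R}" by (intro open_Collect_less continuous_intros)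
  have "((\<lambda>_. 0) has_derivative (\<lambda>_. 0)) (at x)" by simp
  then have "(f has_derivative (\<lambda>_. 0)) (at x)"
    by (rule has_derivative_transform_within_open[OF _ o]) (use assms in auto)
  from frechet_derivative_at[OF this, symmetric] show ?thesis by simp
qed

lemma onorm_le_Basis:
  fixes L :: "'a::euclidean_space \<Rightarrow> 'b::real_normed_vector"
  assumes "linear L" "\<And>b. b \<in> Basis \<Longrightarrow> norm (L b) \<le> B"
  shows "norm (L h) \<le> B * DIM('a) * norm h" "onorm L \<le> B * DIM('a)"
proof -
  show *: "norm (L h) \<le> B * DIM('a) * norm h" for h
  proof -
    have "L h = L (\<Sum>b\<in>Basis. (h \<bullet> b) *\<^sub>R b)" by (simp add: euclidean_representation)
    also have "\<dots> = (\<Sum>b\<in>Basis. (h \<bullet> b) *\<^sub>R L b)" 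
      using assms(1) by (simp add: linear_sum linear_cmul)
    finally have "norm (L h) \<le> (\<Sum>b\<in>Basis. norm ((h \<bullet> b) *\<^sub>R L b))" by (metis norm_sum)
    also have "\<dots> \<le> (\<Sum>b\<in>(Basis::'a set). norm h * B)"
      using assms(2) by (intro sum_mono) (auto intro!: mult_mono Basis_le_norm)
    finally show ?thesis by (simp add: mult_ac)
  qed
  then show "onorm L \<le> B * DIM('a)" by (intro onorm_le) (simp add: mult_ac)
qed

text \<open>Second derivatives of a compactly supported C^2 function are bounded, so the Taylor
  remainder is quadratic with one constant for all base points. This uniformity allows
  differentiation under a convolution integral.\<close>

lemma Ck2_uniform_first_order:
  fixes \<xi> :: "'a::euclidean_space \<Rightarrow> real"
  assumes C: "Ck 2 \<xi>" and s: "\<And>x. norm x > R \<Longrightarrow> \<xi> x = 0"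
  obtains K where "K \<ge> 0" "\<And>x h. \<bar>\<xi> (x + h) - \<xi> x - frechet_derivative \<xi> (at x) h\<bar> \<le> K * (norm h)\<^sup>2"
proof -
  have C': "Ck (Suc (Suc 0)) \<xi>" using C by (simp add: numeral_2_eq_2)
  let ?D = "\<lambda>v x. frechet_derivative \<xi> (at x) v"
  let ?DD = "\<lambda>w v x. frechet_derivative (?D v) (at x) w"
  have s1: "?D v x = 0" if "norm x > R" for v x using derivative_support[OF s that] .
  have s2: "?DD w v x = 0" if "norm x > R" for w v x using derivative_support[OF s1 that] .
  have "\<exists>B\<ge>0. \<forall>x. norm (?DD w v x) \<le> B" for w v
  proof -
    have "continuous_on UNIV (?DD w v)"
      using Ck_SucD[OF Ck_SucD[OF C', of v], of w] by simp
    from continuous_support_bounded[OF this s2] show ?thesis by metis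
  qed
  then have "\<forall>w v. \<exists>B\<ge>0. \<forall>x. norm (?DD w v x) \<le> B" by blast
  then obtain B where B: "\<And>w v. B w v \<ge> 0" "\<And>w v x. norm (?DD w v x) \<le> B w v" by metis
  define L where "L = (\<Sum>w\<in>(Basis::'a set). \<Sum>v\<in>(Basis::'a set). B w v)"
  have L: "norm (?DD w v x) \<le> L" if "w \<in> Basis" "v \<in> Basis" for w v x
  proof -
    have "B w v \<le> (\<Sum>v\<in>(Basis::'a set). B w v)" using that B(1) by (intro member_le_sum) auto
    also have "\<dots> \<le> L" unfolding L_def using that B(1)
      by (intro member_le_sum[of w Basis "\<lambda>w. \<Sum>v\<in>Basis. B w v"] sum_nonneg) auto
    finally show ?thesis using B(2)[where w=w and v=v and x=x] by simp
  qed
  have L0: "L \<ge> 0" unfolding L_def by (intro sum_nonneg B(1))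
  have Dd: "(?D v has_derivative (\<lambda>w. ?DD w v x)) (at x)" for v x
    using Ck_has_derivative[OF Ck_SucD[OF C', of v], of x] by simp
  have Lip: "norm (?D v x - ?D v y) \<le> L * DIM('a) * norm (x - y)" if "v \<in> Basis" for v x y
  proof (rule differentiable_bound[where S = UNIV])
    show "onorm (\<lambda>w. ?DD w v x) \<le> L * DIM('a)" for x
      using L that by (intro onorm_le_Basis(2) has_derivative_linear[OF Dd])
  qed (use Dd in auto)
  define K where "K = L * DIM('a) * DIM('a)"
  show ?thesis
  proof
    show "K \<ge> 0" using L0 by (simp add: K_def)
    fix x h
    have lin: "linear (\<lambda>v. ?D v x)" for x using has_derivative_linear[OF Ck_has_derivative[OF C'], of x] by simp
    \<comment> \<open>The mean value inequality is applied to \<xi> minus its linear part at x,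
      whose derivative on the ball of radius |h| is of size |h|.\<close>
    have "norm ((\<xi> (x + h) - ?D (x + h) x) - (\<xi> x - ?D x x)) \<le> (L * DIM('a) * norm h * DIM('a)) * norm (x + h - x)"
    proof (rule differentiable_bound[where S = "cball x (norm h)"])
      fix y assume y: "y \<in> cball x (norm h)"
      show "((\<lambda>y. \<xi> y - ?D y x) has_derivative (\<lambda>v. ?D v y - ?D v x)) (at y within cball x (norm h))"
        by (rule has_derivative_diff[OF has_derivative_at_withinI[OF Ck_has_derivative[OF C']]
              linear_imp_has_derivative[OF lin]])
      have "norm (?D b y - ?D b x) \<le> L * DIM('a) * norm h" if "b \<in> Basis" for b
        using Lip[OF that, of y x] y L0 
        by (elim order_trans) (auto simp: dist_norm norm_minus_commute intro!: mult_left_mono)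
      then show "onorm (\<lambda>v. ?D v y - ?D v x) \<le> L * DIM('a) * norm h * DIM('a)"
        by (intro onorm_le_Basis(2) linear_compose_sub lin)
    qed (auto simp: dist_norm)
    also have "(\<xi> (x + h) - ?D (x + h) x) - (\<xi> x - ?D x x) = \<xi> (x + h) - \<xi> x - ?D h x"
      using linear_add[OF lin, of x x h] by simp
    finally show "\<bar>\<xi> (x + h) - \<xi> x - ?D h x\<bar> \<le> K * (norm h)\<^sup>2"
      by (simp add: K_def power2_eq_square mult_ac)
  qed
qed

text \<open>The derivative falls on the kernel: the uniform quadratic remainder of \<xi>, integrated
  against |f| over a fixed ball, is still quadratic in the increment.\<close>

lemma conv_has_derivative:
  fixes f :: "'a::euclidean_space \<Rightarrow> 'b::euclidean_space"
  assumes f: "loc_int f" and C: "Ck 2 \<xi>" and s: "\<And>x. norm x > R \<Longrightarrow> \<xi> x = 0"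
  shows "(conv f \<xi> has_derivative (\<lambda>v. conv f (\<lambda>x. frechet_derivative \<xi> (at x) v) x)) (at x)"
proof -
  have C': "Ck (Suc (Suc 0)) \<xi>" using C by (simp add: numeral_2_eq_2)
  let ?D = "\<lambda>v x. frechet_derivative \<xi> (at x) v"
  have cD: "continuous_on UNIV (?D v)" for v using Ck_continuous Ck_SucD[OF C'] by blast
  have c: "continuous_on UNIV \<xi>" using Ck_continuous C by blast
  have s1: "?D v x = 0" if "norm x > R" for v x using derivative_support[OF s that] .
  have iD: "integrable lborel (\<lambda>y. ?D v (x - y) *\<^sub>R f y)" for v x
    by (rule conv_integrable[OF f cD s1])
  have i: "integrable lborel (\<lambda>y. \<xi> (x - y) *\<^sub>R f y)" for x
    by (rule conv_integrable[OF f c s])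
  have lin: "linear (\<lambda>v. ?D v x)" for x using has_derivative_linear[OF Ck_has_derivative[OF C'], of x] by simp
  have "linear (\<lambda>v. conv f (?D v) x)"
  proof
    show "conv f (?D (a + b)) x = conv f (?D a) x + conv f (?D b) x" for a b
      unfolding conv_def linear_add[OF lin] scaleR_add_left using iD by simp
    show "conv f (?D (r *\<^sub>R b)) x = r *\<^sub>R conv f (?D b) x" for r b
      unfolding conv_def linear_cmul[OF lin] by (simp flip: scaleR_scaleR)
  qed
  then have bl: "bounded_linear (\<lambda>v. conv f (?D v) x)" by (simp add: linear_conv_bounded_linear)
  obtain K where K: "K \<ge> 0" "\<And>x h. \<bar>\<xi> (x + h) - \<xi> x - ?D h x\<bar> \<le> K * (norm h)\<^sup>2"
    using Ck2_uniform_first_order[OF C s] by blast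
  \<comment> \<open>For |y - x| < 1 the kernels centred at x and at y, and the derivative kernel at
    x, all vanish outside this ball.\<close>
  define I where "I = (\<integral>z. norm (indicator (cball 0 (\<bar>R\<bar> + norm x + 1)) z *\<^sub>R f z) \<partial>lborel)"
  have I0: "I \<ge> 0" by (simp add: I_def)
  have key: "norm (conv f \<xi> y - conv f \<xi> x - conv f (?D (y - x)) x) \<le> K * (norm (y - x))\<^sup>2 * I"
    if "norm (y - x) < 1" for y
  proof -
    have "conv f \<xi> y - conv f \<xi> x - conv f (?D (y - x)) x
        = (\<integral>z. (\<xi> (y - z) - \<xi> (x - z) - ?D (y - x) (x - z)) *\<^sub>R f z \<partial>lborel)"
      unfolding conv_def scaleR_diff_left using i iD by simp
    also have "norm \<dots> \<le> (\<integral>z. K * (norm (y - x))\<^sup>2 * norm (indicator (cball 0 (\<bar>R\<bar> + norm x + 1)) z *\<^sub>R f z) \<partial>lborel)"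
    proof (rule Bochner_Integration.integral_norm_bound_integral)
      show "integrable lborel (\<lambda>z. (\<xi> (y - z) - \<xi> (x - z) - ?D (y - x) (x - z)) *\<^sub>R f z)"
        unfolding scaleR_diff_left using i iD by simp
      show "integrable lborel (\<lambda>z. K * (norm (y - x))\<^sup>2 * norm (indicator (cball 0 (\<bar>R\<bar> + norm x + 1)) z *\<^sub>R f z))"
        by (intro integrable_mult_right integrable_norm loc_intD(2)[OF f])
      fix z
      show "norm ((\<xi> (y - z) - \<xi> (x - z) - ?D (y - x) (x - z)) *\<^sub>R f z)
          \<le> K * (norm (y - x))\<^sup>2 * norm (indicator (cball 0 (\<bar>R\<bar> + norm x + 1)) z *\<^sub>R f z)"
      proof (cases "z \<in> cball 0 (\<bar>R\<bar> + norm x + 1)")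
        case True
        have "\<bar>\<xi> (y - z) - \<xi> (x - z) - ?D (y - x) (x - z)\<bar> \<le> K * (norm (y - x))\<^sup>2"
          using K(2)[of "x - z" "y - x"] by simp
        then show ?thesis using True by (simp add: mult_right_mono)
      next
        case False
        then have z: "norm z > \<bar>R\<bar> + norm x + 1" by simp
        have "norm z \<le> norm (x - z) + norm x" "norm z \<le> norm (y - z) + norm (y - x) + norm x"
          using norm_triangle_ineq4[of x "x - z"] norm_triangle_ineq4[of y "y - z"] norm_triangle_ineq[of "y - x" x] by auto
        then have "norm (x - z) > R" "norm (y - z) > R" using z that by auto
        then show ?thesis using s s1 K(1) by simp
      qed
    qed
    also have "\<dots> = K * (norm (y - x))\<^sup>2 * I" unfolding I_def by simp
    finally show ?thesis .
  qed
  show ?thesis unfolding has_derivative_at_alt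
  proof (intro conjI bl allI impI)
    fix e :: real assume e: "e > 0"
    define d where "d = min 1 (e / (K * I + 1))"
    have KI: "K * I \<ge> 0" using K I0 by simp
    then have d: "d > 0" using e by (simp add: d_def)
    show "\<exists>d>0. \<forall>y. norm (y - x) < d \<longrightarrow> norm (conv f \<xi> y - conv f \<xi> x - conv f (?D (y - x)) x) \<le> e * norm (y - x)"
    proof (intro exI[of _ d] conjI d allI impI)
      fix y assume y: "norm (y - x) < d"
      then have y1: "norm (y - x) < 1" "norm (y - x) \<le> e / (K * I + 1)" by (auto simp: d_def)
      have "norm (conv f \<xi> y - conv f \<xi> x - conv f (?D (y - x)) x) \<le> (K * I) * norm (y - x) * norm (y - x)"
        using key[OF y1(1)] by (simp add: power2_eq_square mult_ac)
      also have "(K * I) * norm (y - x) \<le> (K * I + 1) * (e / (K * I + 1))"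
        using y1(2) KI by (intro mult_mono) auto
      also have "\<dots> = e" using KI by simp
      finally show "norm (conv f \<xi> y - conv f \<xi> x - conv f (?D (y - x)) x) \<le> e * norm (y - x)"
        by (simp add: mult_right_mono)
    qed
  qed
qed

lemma conv_smooth:
  assumes f: "loc_int f" and C: "smooth_fun \<xi>" and s: "\<And>x. norm x > R \<Longrightarrow> \<xi> x = 0"
  shows "smooth_fun (conv f \<xi>)"
proof -
  have "Ck k (conv f \<xi>)" for k
    using C s
  proof (induction k arbitrary: \<xi>)
    case 0
    then show ?case using conv_has_derivative[OF f smooth_funD[OF 0(1)] 0(2)]
      by (auto intro!: continuous_at_imp_continuous_on has_derivative_continuous)
  next
    case (Suc k)
    show ?case
      by (rule Ck_SucI[OF conv_has_derivative[OF f smooth_funD[OF Suc.prems(1)] Suc.prems(2)]], assumption)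
         (intro Suc.IH smooth_fun_derivative Suc.prems derivative_support[of R])
  qed
  then show ?thesis by (simp add: smooth_fun_def)
qed

definition mollifier :: "real \<Rightarrow> 'a::euclidean_space \<Rightarrow> real" where
  "mollifier \<delta> x = bump (x /\<^sub>R \<delta>) / \<delta> ^ DIM('a)"

lemma smooth_mollifier: "smooth_fun (mollifier \<delta> :: 'a::euclidean_space \<Rightarrow> real)"
proof -
  have "smooth_fun (\<lambda>x::'a. bump (x /\<^sub>R \<delta> + 0))"
    by (rule smooth_affine[OF bounded_linear_scaleR_right smooth_bump])
  moreover have "smooth_fun (\<lambda>x::'a. 1 / \<delta> ^ DIM('a))" by (simp add: smooth_fun_def Ck_const)
  ultimately have "smooth_fun (\<lambda>x::'a. bump (x /\<^sub>R \<delta> + 0) * (1 / \<delta> ^ DIM('a)))"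
    by (rule smooth_mult)
  then show ?thesis by (simp add: mollifier_def[abs_def])
qed

lemma mollifier_support: "\<delta> > 0 \<Longrightarrow> norm x \<ge> \<delta> \<Longrightarrow> mollifier \<delta> x = 0"
  unfolding mollifier_def by (subst bump_support) (auto simp: field_simps)

lemma mollifier_nonneg: "\<delta> > 0 \<Longrightarrow> mollifier \<delta> x \<ge> 0"
  by (simp add: mollifier_def bump_nonneg)

lemma mollifier_integral:
  assumes "\<delta> > 0" shows "(\<integral>x. mollifier \<delta> (x::'a::euclidean_space) \<partial>lborel) = 1"
proof -
  have "(\<integral>x. bump (0 + (inverse \<delta>) *\<^sub>R x) \<partial>(lborel :: 'a measure)) = 1 /\<^sub>R \<bar>inverse \<delta>\<bar> ^ DIM('a)"
    by (subst lborel_integral_affine) 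
       (use assms in \<open>auto simp: bump_integral intro!: borel_continuous smooth_continuous smooth_bump\<close>)
  then show ?thesis using assms by (simp add: mollifier_def power_inverse)
qed

subsection \<open>Integrating derivatives\<close>

text \<open>Difference quotients have integral zero by translation invariance, and they are bounded
  by \<open>B\<close> with support in a fixed ball, so dominated convergence gives the claim. Asking
  only for a bounded pointwise derivative lets it be applied to entire functions defined through
  mere differentiability.\<close>

lemma integral_dirderiv_zero:
  fixes G :: "'a::euclidean_space \<Rightarrow> 'b::euclidean_space"
  assumes D: "\<And>x. ((\<lambda>t. G (x + t *\<^sub>R v)) has_vector_derivative G' x) (at 0)"
    and B: "\<And>x. norm (G' x) \<le> B" and c: "continuous_on UNIV G" and s: "\<And>x. norm x > R \<Longrightarrow> G x = 0"
  shows "(\<integral>x. G' x \<partial>lborel) = 0" "integrable lborel G'"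
proof -
  have m[measurable]: "G \<in> borel_measurable borel" using c by (rule borel_continuous)
  define q where "q n x = (real (Suc n)) *\<^sub>R (G (x + (1 / real (Suc n)) *\<^sub>R v) - G x)" for n x
  have mq[measurable]: "q n \<in> borel_measurable borel" for n unfolding q_def by measurable
  have lim: "(\<lambda>n. q n x) \<longlonglongrightarrow> G' x" for x
  proof -
    have "((\<lambda>h. norm (G (x + h *\<^sub>R v) - G x - h *\<^sub>R G' x) / norm h) \<longlongrightarrow> 0) (at 0)"
      using D[of x] by (simp add: has_vector_derivative_def has_derivative_at)
    then have "((\<lambda>h. norm ((G (x + h *\<^sub>R v) - G x) /\<^sub>R h - G' x)) \<longlongrightarrow> 0) (at 0)"
    proof (rule Lim_transform_eventually)
      show "\<forall>\<^sub>F h in at 0. norm (G (x + h *\<^sub>R v) - G x - h *\<^sub>R G' x) / norm h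
          = norm ((G (x + h *\<^sub>R v) - G x) /\<^sub>R h - G' x)"
        unfolding eventually_at
      proof (intro exI[of _ 1] conjI ballI impI)
        fix h :: real assume h: "h \<noteq> 0 \<and> dist h 0 < 1"
        then have "(G (x + h *\<^sub>R v) - G x) /\<^sub>R h - G' x = (G (x + h *\<^sub>R v) - G x - h *\<^sub>R G' x) /\<^sub>R h"
          by (simp add: scaleR_diff_right)
        then show "norm (G (x + h *\<^sub>R v) - G x - h *\<^sub>R G' x) / norm h
          = norm ((G (x + h *\<^sub>R v) - G x) /\<^sub>R h - G' x)"
          by (simp only: norm_scaleR) (simp add: divide_inverse)
      qed simp
    qed
    then have "((\<lambda>h. (G (x + h *\<^sub>R v) - G x) /\<^sub>R h) \<longlongrightarrow> G' x) (at 0)"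
      by (rule LIM_zero_cancel[OF tendsto_norm_zero_cancel])
    moreover have "filterlim (\<lambda>n. 1 / real (Suc n)) (at 0) sequentially"
      by (intro filterlim_atI) (use LIMSEQ_inverse_real_of_nat in \<open>auto simp: inverse_eq_divide\<close>)
    ultimately have "(\<lambda>n. (G (x + (1 / real (Suc n)) *\<^sub>R v) - G x) /\<^sub>R (1 / real (Suc n))) \<longlonglongrightarrow> G' x"
      by (rule filterlim_compose)
    then show ?thesis by (simp add: q_def)
  qed
  have D': "((\<lambda>t. G (x + t *\<^sub>R v)) has_vector_derivative G' (x + t *\<^sub>R v)) (at t)" for x t
  proof -
    have "((\<lambda>s. s - t) has_vector_derivative 1) (at t)"
      by (auto intro!: derivative_eq_intros)
    from vector_diff_chain_at[OF this, of "\<lambda>s. G (x + t *\<^sub>R v + s *\<^sub>R v)" "G' (x + t *\<^sub>R v)"] D[of "x + t *\<^sub>R v"]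
    show ?thesis by (simp add: o_def algebra_simps)
  qed
  have B0: "B \<ge> 0" using B[of 0] norm_ge_zero[of "G' 0"] by linarith
  have qB: "norm (q n x) \<le> B" for n x
  proof -
    have "norm (G (x + (1 / real (Suc n)) *\<^sub>R v) - G (x + 0 *\<^sub>R v)) \<le> B * norm (1 / real (Suc n) - 0)"
    proof (rule differentiable_bound[where S = UNIV])
      show "((\<lambda>t. G (x + t *\<^sub>R v)) has_derivative (\<lambda>h. h *\<^sub>R G' (x + t *\<^sub>R v))) (at t within UNIV)" for t
        using D' by (simp add: has_vector_derivative_def)
      show "onorm (\<lambda>h. h *\<^sub>R G' (x + t *\<^sub>R v)) \<le> B" for t
        using mult_left_mono[OF B abs_ge_zero] by (intro onorm_le) (simp add: mult.commute[of B])
    qed auto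
    then show ?thesis unfolding q_def norm_scaleR by (simp add: field_simps del: of_nat_Suc)
  qed
  have qs: "q n x = 0" if "x \<notin> cball 0 (\<bar>R\<bar> + norm v)" for n x
  proof -
    have x: "norm x > \<bar>R\<bar> + norm v" using that by simp
    have "norm ((1 / real (Suc n)) *\<^sub>R v) \<le> norm v"
      by (simp add: divide_le_eq mult_le_cancel_left1)
    then have "norm (x + (1 / real (Suc n)) *\<^sub>R v) > R"
      using x norm_diff_ineq[of x "(1 / real (Suc n)) *\<^sub>R v"] by linarith
    moreover have "norm x > R" using x norm_ge_zero[of v] by linarith
    ultimately show ?thesis unfolding q_def by (simp add: s del: of_nat_Suc)
  qed
  have bnd: "norm (q n x) \<le> B * indicator (cball 0 (\<bar>R\<bar> + norm v)) x" for n x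
    using qB[of n x] qs[of x n] by (auto simp: indicator_def)
  have mG: "G' \<in> borel_measurable lborel"
    by (rule borel_measurable_LIMSEQ_metric[OF _ lim]) simp
  have iB: "integrable lborel (\<lambda>x::'a. B * indicator (cball 0 (\<bar>R\<bar> + norm v)) x)"
    using emeasure_lborel_cball_finite[of "0::'a"] by simp
  have dc: "integrable lborel G'" "(\<lambda>n. \<integral>x. q n x \<partial>lborel) \<longlonglongrightarrow> (\<integral>x. G' x \<partial>lborel)"
    by (rule integrable_dominated_convergence[OF mG _ iB AE_I2[OF lim] AE_I2[OF bnd]], simp)
       (rule integral_dominated_convergence[OF mG _ iB AE_I2[OF lim] AE_I2[OF bnd]], simp)
  have iG: "integrable lborel G" by (rule continuous_integrable_support[OF c s])
  have "(\<integral>x. q n x \<partial>lborel) = 0" for n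
  proof -
    define w where "w = (1 / real (Suc n)) *\<^sub>R v"
    have "continuous_on UNIV (\<lambda>x. G (w + x))"
      by (rule continuous_on_compose2[OF c]) (auto intro!: continuous_intros)
    moreover have "G (w + x) = 0" if "norm x > \<bar>R\<bar> + norm w" for x
      using norm_diff_ineq[of x w] that by (intro s) (simp add: add.commute)
    ultimately have "integrable lborel (\<lambda>x. G (w + x))" by (rule continuous_integrable_support)
    then have "(\<integral>x. G (w + x) - G x \<partial>lborel) = 0"
      using iG lborel_integral_translate[OF m, of w] by simp
    then show ?thesis unfolding q_def w_def[symmetric] by (simp add: add.commute)
  qed
  then show "(\<integral>x. G' x \<partial>lborel) = 0" using dc(2) by (simp add: LIMSEQ_const_iff)
  show "integrable lborel G'" by (rule dc)
qed

text \<open>Two applications of the mean value theorem write the second difference of f over the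
  parallelogram spanned by h v and h w as h^2 times a mixed derivative at a nearby point. The
  difference is symmetric in v and w, and continuity identifies the limits.\<close>

lemma mixed_partials_real:
  fixes f :: "'a::euclidean_space \<Rightarrow> real"
  assumes C: "Ck 2 f"
  shows "frechet_derivative (\<lambda>x. frechet_derivative f (at x) v) (at x) w
       = frechet_derivative (\<lambda>x. frechet_derivative f (at x) w) (at x) v"
proof -
  have C': "Ck (Suc (Suc 0)) f" using C by (simp add: numeral_2_eq_2)
  let ?D = "\<lambda>v x. frechet_derivative f (at x) v"
  let ?DD = "\<lambda>v w x. frechet_derivative (?D v) (at x) w"
  have cDD: "continuous_on UNIV (?DD v w)" for v w
    using Ck_SucD[OF Ck_SucD[OF C', of v], of w] by simp
  have d1: "((\<lambda>t. f (y + t *\<^sub>R u)) has_real_derivative ?D u (y + t *\<^sub>R u)) (at t)" for y u t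
    using dirderiv_has_vector_derivative[OF Ck_has_derivative[OF C']] 
    by (simp add: has_real_derivative_iff_has_vector_derivative)
  have d2: "((\<lambda>t. ?D v (y + t *\<^sub>R u)) has_real_derivative ?DD v u (y + t *\<^sub>R u)) (at t)" for y u v t
    using dirderiv_has_vector_derivative[OF Ck_has_derivative[OF Ck_SucD[OF C']]] 
    by (simp add: has_real_derivative_iff_has_vector_derivative)
  have quot: "\<exists>p. norm (p - x) \<le> h * (norm v + norm w) \<and>
      f (x + h *\<^sub>R v + h *\<^sub>R w) - f (x + h *\<^sub>R v) - f (x + h *\<^sub>R w) + f x = h\<^sup>2 * ?DD v w p"
    if h: "h > 0" for h v w
  proof -
    let ?g = "\<lambda>t. f ((x + h *\<^sub>R w) + t *\<^sub>R v) - f (x + t *\<^sub>R v)"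
    have "\<exists>t1. 0 < t1 \<and> t1 < h \<and> ?g h - ?g 0 = (h - 0) * (?D v ((x + h *\<^sub>R w) + t1 *\<^sub>R v) - ?D v (x + t1 *\<^sub>R v))"
      using h by (intro MVT2) (auto intro!: DERIV_diff d1)
    then obtain t1 where t1: "0 < t1" "t1 < h"
      "?g h - ?g 0 = h * (?D v ((x + h *\<^sub>R w) + t1 *\<^sub>R v) - ?D v (x + t1 *\<^sub>R v))" by auto
    have "\<exists>s1. 0 < s1 \<and> s1 < h \<and> ?D v ((x + t1 *\<^sub>R v) + h *\<^sub>R w) - ?D v ((x + t1 *\<^sub>R v) + 0 *\<^sub>R w)
        = (h - 0) * ?DD v w ((x + t1 *\<^sub>R v) + s1 *\<^sub>R w)"
      using h by (intro MVT2) (auto intro!: d2)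
    then obtain s1 where s1: "0 < s1" "s1 < h"
      "?D v ((x + t1 *\<^sub>R v) + h *\<^sub>R w) - ?D v (x + t1 *\<^sub>R v) = h * ?DD v w ((x + t1 *\<^sub>R v) + s1 *\<^sub>R w)" by auto
    have "norm (t1 *\<^sub>R v + s1 *\<^sub>R w) \<le> h * norm v + h * norm w"
      using t1 s1 by (intro order_trans[OF norm_triangle_ineq] add_mono) (auto intro!: mult_right_mono)
    then show ?thesis using t1 s1
      by (intro exI[of _ "x + t1 *\<^sub>R v + s1 *\<^sub>R w"]) (simp add: algebra_simps power2_eq_square)
  qed
  show ?thesis
  proof (rule ccontr)
    assume ne: "?DD v w x \<noteq> ?DD w v x"
    define e where "e = \<bar>?DD v w x - ?DD w v x\<bar> / 2"
    have e: "e > 0" using ne by (simp add: e_def)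
    obtain d1 where d1: "d1 > 0" "\<And>y. dist y x < d1 \<Longrightarrow> dist (?DD v w y) (?DD v w x) < e"
      using cDD[of v w] e unfolding continuous_on_iff by (metis UNIV_I)
    obtain d2 where d2: "d2 > 0" "\<And>y. dist y x < d2 \<Longrightarrow> dist (?DD w v y) (?DD w v x) < e"
      using cDD[of w v] e unfolding continuous_on_iff by (metis UNIV_I)
    define N where "N = norm v + norm w + 1"
    have N: "N > 0" by (simp add: N_def add_nonneg_pos)
    define h where "h = min d1 d2 / (2 * N)"
    have h: "h > 0" using d1(1) d2(1) N by (simp add: h_def)
    have m0: "min d1 d2 > 0" using d1(1) d2(1) by simp
    have hN: "h * (norm v + norm w) < min d1 d2"
    proof -
      have "h * (norm v + norm w) \<le> h * N" using h by (intro mult_left_mono) (auto simp: N_def)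
      also have "\<dots> = min d1 d2 / 2" using N by (simp add: h_def)
      also have "\<dots> < min d1 d2" using m0 by linarith
      finally show ?thesis .
    qed
    obtain p where p: "norm (p - x) \<le> h * (norm v + norm w)"
      "f (x + h *\<^sub>R v + h *\<^sub>R w) - f (x + h *\<^sub>R v) - f (x + h *\<^sub>R w) + f x = h\<^sup>2 * ?DD v w p" using quot[OF h] by blast
    obtain q where q: "norm (q - x) \<le> h * (norm w + norm v)"
      "f (x + h *\<^sub>R w + h *\<^sub>R v) - f (x + h *\<^sub>R w) - f (x + h *\<^sub>R v) + f x = h\<^sup>2 * ?DD w v q" using quot[OF h] by blast
    have sw: "x + h *\<^sub>R w + h *\<^sub>R v = x + h *\<^sub>R v + h *\<^sub>R w" by simp
    have "h\<^sup>2 * ?DD v w p = h\<^sup>2 * ?DD w v q" using p(2) q(2)[unfolded sw] by linarith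
    then have eq: "?DD v w p = ?DD w v q" using h by simp
    have "dist p x < d1" "dist q x < d2"
      using p(1) q(1) hN by (simp_all add: dist_norm add.commute)
    then have "\<bar>?DD v w p - ?DD v w x\<bar> < e" "\<bar>?DD w v q - ?DD w v x\<bar> < e"
      using d1(2) d2(2) by (simp_all add: dist_real_def)
    then have "\<bar>?DD v w x - ?DD w v x\<bar> < e + e" unfolding eq by linarith
    then show False by (simp only: e_def field_sum_of_halves less_irrefl)
  qed
qed

lemma mixed_partials:
  fixes f :: "'a::euclidean_space \<Rightarrow> 'b::euclidean_space"
  assumes C: "Ck 2 f"
  shows "frechet_derivative (\<lambda>x. frechet_derivative f (at x) v) (at x) w
       = frechet_derivative (\<lambda>x. frechet_derivative f (at x) w) (at x) v"
proof (rule euclidean_eqI)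
  fix b :: 'b assume "b \<in> Basis"
  have C': "Ck (Suc (Suc 0)) f" using C by (simp add: numeral_2_eq_2)
  have D: "frechet_derivative (\<lambda>x. g x \<bullet> b) (at x) u = frechet_derivative g (at x) u \<bullet> b"
    if "Ck (Suc k) g" for g :: "'a \<Rightarrow> 'b" and x u k
    using frechet_derivative_at[OF has_derivative_inner_left[OF Ck_has_derivative[OF that]], symmetric] by simp
  have "Ck 2 (\<lambda>x. f x \<bullet> b)" using C by (intro Ck_comp_linear[OF bounded_linear_inner_left])
  from mixed_partials_real[OF this, of v x w] 
  show "frechet_derivative (\<lambda>x. frechet_derivative f (at x) v) (at x) w \<bullet> b
      = frechet_derivative (\<lambda>x. frechet_derivative f (at x) w) (at x) v \<bullet> b"
    unfolding D[OF C'] D[OF Ck_SucD[OF C']] .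
qed

subsection \<open>Radial averages\<close>

lemma integral_C1_derivative:
  fixes H :: "'a::euclidean_space \<Rightarrow> 'b::euclidean_space"
  assumes C: "Ck 1 H" and s: "\<And>x. norm x > R \<Longrightarrow> H x = 0"
  shows "(\<integral>x. frechet_derivative H (at x) v \<partial>lborel) = 0"
    "integrable lborel (\<lambda>x. frechet_derivative H (at x) v)"
proof -
  have C': "Ck (Suc 0) H" using C by simp
  have c: "continuous_on UNIV (\<lambda>x. frechet_derivative H (at x) v)" using Ck_SucD[OF C'] by simp
  have s': "frechet_derivative H (at x) v = 0" if "norm x > R" for x
    using derivative_support[OF s that] .
  obtain B where B: "\<And>x. norm (frechet_derivative H (at x) v) \<le> B"
    using continuous_support_bounded[OF c s'] by metis
  have D: "((\<lambda>t. H (x + t *\<^sub>R v)) has_vector_derivative frechet_derivative H (at x) v) (at 0)" for x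
    using dirderiv_has_vector_derivative[OF Ck_has_derivative[OF C'], of x v 0] by simp
  note r = integral_dirderiv_zero[OF D B Ck_continuous[OF C] s]
  show "(\<integral>x. frechet_derivative H (at x) v \<partial>lborel) = 0"
    "integrable lborel (\<lambda>x. frechet_derivative H (at x) v)" by (simp_all add: r)
qed

text \<open>Bridge to the gauge integral over a box, for which the Leibniz rule is
  available.\<close>

lemma lborel_integral_unit_cbox:
  fixes g :: "'a::euclidean_space \<Rightarrow> 'b::euclidean_space"
  assumes c: "continuous_on UNIV g" and s: "\<And>x. norm x \<ge> 1 \<Longrightarrow> g x = 0"
  shows "(\<integral>x. g x \<partial>lborel) = integral (cbox (- One) One) g"
proof -
  have "g integrable_on cbox (- One) One"
    by (intro integrable_continuous continuous_on_subset[OF c]) simp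
  moreover have z: "g x = 0" if "x \<notin> cbox (- One) One" for x
  proof -
    obtain b where "b \<in> Basis" "\<bar>x \<bullet> b\<bar> > 1"
      using \<open>x \<notin> cbox (- One) One\<close> by (force simp: mem_box)
    then have "norm x \<ge> 1" using Basis_le_norm[of b x] by linarith
    then show ?thesis by (rule s)
  qed
  ultimately have "(g has_integral integral (cbox (- One) One) g) UNIV"
    by (intro has_integral_on_superset[OF integrable_integral]) auto
  moreover have "(g has_integral (\<integral>x. g x \<partial>lborel)) UNIV"
    using s by (intro has_integral_integral_lborel continuous_integrable_support[OF c, of 1]) auto
  ultimately show ?thesis using has_integral_unique by blast
qed

lemma bump_continuous: "continuous_on UNIV (bump :: 'a::euclidean_space \<Rightarrow> real)"
  by (rule smooth_continuous[OF smooth_bump])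

lemma radial_average_derivative:
  fixes F :: "'a::euclidean_space \<Rightarrow> 'b::euclidean_space"
  assumes C: "Ck 1 F"
  shows "((\<lambda>t. \<integral>y. bump y *\<^sub>R F (w + t *\<^sub>R y) \<partial>lborel) has_vector_derivative
     (\<integral>y. bump y *\<^sub>R frechet_derivative F (at (w + t *\<^sub>R y)) y \<partial>lborel)) (at t)"
proof -
  have C': "Ck (Suc 0) F" using C by simp
  let ?D = "\<lambda>v x. frechet_derivative F (at x) v"
  have cF: "continuous_on UNIV F" by (rule Ck_continuous[OF C])
  have cD: "continuous_on UNIV (?D v)" for v using Ck_SucD[OF C', of v] by simp
  have lin: "linear (\<lambda>v. ?D v x)" for x using has_derivative_linear[OF Ck_has_derivative[OF C']] .
  \<comment> \<open>The direction of differentiation is the integration variable itself; expanding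
    it in the basis reduces joint continuity in (t, y) to that of finitely many fixed partial
    derivatives.\<close>
  have rep: "?D y x = (\<Sum>b\<in>Basis. (y \<bullet> b) *\<^sub>R ?D b x)" for x y
  proof -
    have "?D y x = ?D (\<Sum>b\<in>Basis. (y \<bullet> b) *\<^sub>R b) x" by (simp add: euclidean_representation)
    then show ?thesis by (simp only: linear_sum[OF lin] linear_cmul[OF lin])
  qed
  have cb: "continuous_on UNIV (\<lambda>p::real \<times> 'a. bump (snd p))"
    by (rule continuous_on_compose2[OF bump_continuous continuous_on_snd[OF continuous_on_id]]) simp
  have cDb: "continuous_on UNIV (\<lambda>p::real \<times> 'a. ?D b (w + fst p *\<^sub>R snd p))" for b
    by (rule continuous_on_compose2[OF cD]) (auto intro!: continuous_on_add continuous_on_scaleR continuous_on_fst continuous_on_snd)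
  have c2: "continuous_on UNIV (\<lambda>p. bump (snd p) *\<^sub>R ?D (snd p) (w + fst p *\<^sub>R snd p))"
  proof (rule continuous_on_scaleR[OF cb])
    have "(\<lambda>p. ?D (snd p) (w + fst p *\<^sub>R snd p)) = (\<lambda>p. \<Sum>b\<in>Basis. (snd p \<bullet> b) *\<^sub>R ?D b (w + fst p *\<^sub>R snd p))"
      by (rule ext) (rule rep)
    then show "continuous_on UNIV (\<lambda>p. ?D (snd p) (w + fst p *\<^sub>R snd p))"
      by (simp only:) (rule continuous_on_sum, rule continuous_on_scaleR[OF _ cDb], rule continuous_on_inner[OF continuous_on_snd[OF continuous_on_id] continuous_on_const])
  qed
  have c1: "continuous_on UNIV (\<lambda>y. bump y *\<^sub>R F (w + t *\<^sub>R y))" for t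
    by (rule continuous_on_scaleR[OF bump_continuous], rule continuous_on_compose2[OF cF])
       (auto intro!: continuous_on_add continuous_on_scaleR)
  have c3: "continuous_on UNIV (\<lambda>y. bump y *\<^sub>R ?D y (w + t *\<^sub>R y))" for t
    using continuous_on_compose2[OF c2 continuous_on_Pair[OF continuous_on_const[of _ t] continuous_on_id]] by simp
  have "((\<lambda>t. integral (cbox (- One) One) (\<lambda>y. bump y *\<^sub>R F (w + t *\<^sub>R y))) has_vector_derivative
     integral (cbox (- One) One) (\<lambda>y. bump y *\<^sub>R ?D y (w + t *\<^sub>R y))) (at t within UNIV)"
  proof (rule leibniz_rule_vector_derivative)
    fix s y
    show "((\<lambda>s. bump y *\<^sub>R F (w + s *\<^sub>R y)) has_vector_derivative bump y *\<^sub>R ?D y (w + s *\<^sub>R y)) (at s within UNIV)"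
      using bounded_linear.has_vector_derivative[OF bounded_linear_scaleR_right
          dirderiv_has_vector_derivative[OF Ck_has_derivative[OF C'], of w y s]] by simp
    show "(\<lambda>y. bump y *\<^sub>R F (w + s *\<^sub>R y)) integrable_on cbox (- One) One"
      by (intro integrable_continuous continuous_on_subset[OF c1]) simp
    show "continuous_on (UNIV \<times> cbox (- One) One) (\<lambda>(s, y). bump y *\<^sub>R ?D y (w + s *\<^sub>R y))"
      using continuous_on_subset[OF c2, of "UNIV \<times> cbox (- One) One"] by (simp add: case_prod_beta)
  qed auto
  moreover have "(\<integral>y. bump y *\<^sub>R F (w + t *\<^sub>R y) \<partial>lborel) = integral (cbox (- One) One) (\<lambda>y. bump y *\<^sub>R F (w + t *\<^sub>R y))" for t
    by (rule lborel_integral_unit_cbox[OF c1]) (simp add: bump_support)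
  moreover have "(\<integral>y. bump y *\<^sub>R ?D y (w + t *\<^sub>R y) \<partial>lborel) = integral (cbox (- One) One) (\<lambda>y. bump y *\<^sub>R ?D y (w + t *\<^sub>R y))"
    by (rule lborel_integral_unit_cbox[OF c3]) (simp add: bump_support)
  ultimately show ?thesis by simp
qed

lemma radial_average_0: "(\<integral>y. bump y *\<^sub>R F (w + 0 *\<^sub>R y) \<partial>lborel) = F w"
  for F :: "'a::euclidean_space \<Rightarrow> 'b::euclidean_space"
  using bump_integral[where 'a='a] integral_scaleR_left[OF bump_integrable[where 'a='a], of "F w"] by simp

text \<open>The bump is radial, so \<open>bump y *\<^sub>R y\<close> is minus the gradient of \<open>bump_pot\<close>; integrating by parts turns
  the derivative of the radial average into an integral of the Laplacian.\<close>
lemma sub_mean_value: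
  fixes F :: "'a::euclidean_space \<Rightarrow> real"
  assumes C: "Ck 2 F" and r: "r > 0"
    and sub: "\<And>x. x \<in> ball w r \<Longrightarrow> 0 \<le> (\<Sum>b\<in>Basis. frechet_derivative (\<lambda>x. frechet_derivative F (at x) b) (at x) b)"
  shows "F w \<le> (\<integral>y. bump y * F (w + r *\<^sub>R y) \<partial>lborel)"
proof -
  have C': "Ck (Suc (Suc 0)) F" using C by (simp add: numeral_2_eq_2)
  have C1: "Ck 1 F" using Ck_pred[OF C'] by simp
  let ?D = "\<lambda>v x. frechet_derivative F (at x) v"
  let ?L = "\<lambda>x. \<Sum>b\<in>Basis. frechet_derivative (?D b) (at x) b"
  have CD: "Ck (Suc 0) (?D v)" for v using Ck_SucD[OF C'] .
  have lin: "linear (\<lambda>v. ?D v x)" for x using has_derivative_linear[OF Ck_has_derivative[OF C']] .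
  define m where "m t = (\<integral>y. bump y *\<^sub>R F (w + t *\<^sub>R y) \<partial>lborel)" for t
  have der: "(m has_real_derivative (\<integral>y. bump y *\<^sub>R ?D y (w + t *\<^sub>R y) \<partial>lborel)) (at t)" for t
    using radial_average_derivative[OF C1, of w t]
    unfolding m_def[abs_def] by (simp add: has_real_derivative_iff_has_vector_derivative)
  \<comment> \<open>Integration by parts for each basis vector b: the b-derivative of
    \<open>bump_pot\<close> times the b-th partial of F integrates to zero. One term contains
    \<open>bump y\<close> times the b-th coordinate of y, the other a factor t from the chain rule
    and a second derivative; summing over b produces the Laplacian.\<close>
  have eq: "(\<integral>y. bump y *\<^sub>R ?D y (w + t *\<^sub>R y) \<partial>lborel) = t * (\<integral>y. bump_pot y * ?L (w + t *\<^sub>R y) \<partial>lborel)" for t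
  proof -
    have cp: "Ck (Suc 0) (bump_pot :: 'a \<Rightarrow> real)" by (rule smooth_funD[OF smooth_bump_pot])
    have bl: "bounded_linear (\<lambda>y::'a. t *\<^sub>R y)" by (rule bounded_linear_scaleR_right)
    have CDt: "Ck (Suc 0) (\<lambda>y. ?D b (w + t *\<^sub>R y))" for b
      using Ck_affine[OF bl CD[of b], of w] by (simp add: add.commute)
    have dD: "((\<lambda>y. ?D b (w + t *\<^sub>R y)) has_derivative (\<lambda>v. t * frechet_derivative (?D b) (at (w + t *\<^sub>R y)) v)) (at y)" for b y
    proof -
      have "((\<lambda>y. w + t *\<^sub>R y) has_derivative (\<lambda>v. t *\<^sub>R v)) (at y)" 
        by (auto intro!: derivative_eq_intros)
      from has_derivative_compose[OF this Ck_has_derivative[OF CD]] 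
      have "((\<lambda>y. ?D b (w + t *\<^sub>R y)) has_derivative (\<lambda>v. frechet_derivative (?D b) (at (w + t *\<^sub>R y)) (t *\<^sub>R v))) (at y)" .
      moreover have "linear (frechet_derivative (?D b) (at (w + t *\<^sub>R y)))" 
        using has_derivative_linear[OF Ck_has_derivative[OF CD]] .
      ultimately show ?thesis by (simp add: linear_cmul)
    qed
    let ?H = "\<lambda>b y. bump_pot y * ?D b (w + t *\<^sub>R y)"
    have CH: "Ck 1 (?H b)" for b using Ck_mult[OF cp CDt] by simp
    have sH: "?H b y = 0" if "norm y > 1" for b y using that by (simp add: bump_pot_support)
    have dH: "frechet_derivative (?H b) (at y) b
        = bump_pot y * (t * frechet_derivative (?D b) (at (w + t *\<^sub>R y)) b) - (y \<bullet> b) * bump y * ?D b (w + t *\<^sub>R y)" for b y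
      using fun_cong[OF frechet_derivative_at[OF has_derivative_mult[OF Ck_has_derivative[OF cp] dD[of b y]]], of b]
      by (simp add: bump_pot_derivative)
    have z: "(\<integral>y. bump_pot y * (t * frechet_derivative (?D b) (at (w + t *\<^sub>R y)) b) - (y \<bullet> b) * bump y * ?D b (w + t *\<^sub>R y) \<partial>lborel) = 0" for b
      using integral_C1_derivative(1)[where H="?H b" and R=1 and v=b, OF CH sH] unfolding dH .
    have c1: "continuous_on UNIV (\<lambda>y. frechet_derivative (?D b) (at (w + t *\<^sub>R y)) b)" for b
    proof -
      have "continuous_on UNIV (\<lambda>x. frechet_derivative (?D b) (at x) b)" using Ck_SucD[OF CD[of b], of b] by simp
      then show ?thesis by (rule continuous_on_compose2) (auto intro!: continuous_on_add continuous_on_scaleR)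
    qed
    have i1: "integrable lborel (\<lambda>y. bump_pot y * (t * frechet_derivative (?D b) (at (w + t *\<^sub>R y)) b))" for b
      by (rule continuous_integrable_support[of _ 1]) 
         (auto intro!: continuous_intros c1 smooth_continuous[OF smooth_bump_pot] simp: bump_pot_support)
    have i2: "integrable lborel (\<lambda>y. (y \<bullet> b) * bump y * ?D b (w + t *\<^sub>R y))" for b
      by (rule continuous_integrable_support[of _ 1]) 
         (auto intro!: continuous_intros Ck_continuous[OF CDt] bump_continuous simp: bump_support)
    have e: "(\<integral>y. (y \<bullet> b) * bump y * ?D b (w + t *\<^sub>R y) \<partial>lborel)
        = (\<integral>y. bump_pot y * (t * frechet_derivative (?D b) (at (w + t *\<^sub>R y)) b) \<partial>lborel)" for b
      using z[of b] i1[of b] i2[of b] by simp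
    have rep: "?D y x = (\<Sum>b\<in>Basis. (y \<bullet> b) * ?D b x)" for x y
    proof -
      have "?D y x = ?D (\<Sum>b\<in>Basis. (y \<bullet> b) *\<^sub>R b) x" by (simp add: euclidean_representation)
      then show ?thesis by (simp only: linear_sum[OF lin] linear_cmul[OF lin] real_scaleR_def)
    qed
    have "(\<integral>y. bump y *\<^sub>R ?D y (w + t *\<^sub>R y) \<partial>lborel) = (\<integral>y. (\<Sum>b\<in>Basis. (y \<bullet> b) * bump y * ?D b (w + t *\<^sub>R y)) \<partial>lborel)"
    proof (rule Bochner_Integration.integral_cong[OF refl])
      fix y
      show "bump y *\<^sub>R ?D y (w + t *\<^sub>R y) = (\<Sum>b\<in>Basis. (y \<bullet> b) * bump y * ?D b (w + t *\<^sub>R y))"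
      proof -
        have "bump y * ?D y (w + t *\<^sub>R y) = bump y * (\<Sum>b\<in>Basis. (y \<bullet> b) * ?D b (w + t *\<^sub>R y))"
          by (rule arg_cong[OF rep])
        also have "\<dots> = (\<Sum>b\<in>Basis. (y \<bullet> b) * bump y * ?D b (w + t *\<^sub>R y))"
          by (simp only: sum_distrib_left mult_ac)
        finally show ?thesis by (simp only: real_scaleR_def)
      qed
    qed
    also have "\<dots> = (\<Sum>b\<in>Basis. (\<integral>y. (y \<bullet> b) * bump y * ?D b (w + t *\<^sub>R y) \<partial>lborel))"
      using i2 by (intro Bochner_Integration.integral_sum)
    also have "\<dots> = (\<integral>y. (\<Sum>b\<in>Basis. bump_pot y * (t * frechet_derivative (?D b) (at (w + t *\<^sub>R y)) b)) \<partial>lborel)"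
      unfolding e using i1 by (intro Bochner_Integration.integral_sum[symmetric])
    also have "\<dots> = (\<integral>y. t * (bump_pot y * ?L (w + t *\<^sub>R y)) \<partial>lborel)"
      by (simp add: sum_distrib_left mult_ac)
    finally show ?thesis by simp
  qed
  have "m 0 \<le> m r"
  proof (rule DERIV_nonneg_imp_nondecreasing[OF less_imp_le[OF r]])
    fix t assume t: "0 \<le> t" "t \<le> r"
    have "0 \<le> bump_pot y * ?L (w + t *\<^sub>R y)" for y
    proof (cases "norm y \<ge> 1")
      case False
      show ?thesis
      proof (cases "t = 0")
        case True
        then show ?thesis using r sub[of w] bump_pot_nonneg[of y] by simp
      next
        case t0: False
        have "t * norm y < t * 1" using False t t0 by (intro mult_strict_left_mono) auto
        moreover have "norm (t *\<^sub>R y) = t * norm y" using t by simp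
        ultimately have "norm (t *\<^sub>R y) < r" using t by linarith
        then show ?thesis using bump_pot_nonneg[of y] by (intro mult_nonneg_nonneg sub) (auto simp: dist_norm)
      qed
    qed (simp add: bump_pot_support)
    then have "0 \<le> t * (\<integral>y. bump_pot y * ?L (w + t *\<^sub>R y) \<partial>lborel)"
      using t by (intro mult_nonneg_nonneg integral_nonneg) auto
    then show "\<exists>y. (m has_real_derivative y) (at t) \<and> 0 \<le> y" using der[of t] unfolding eq by blast
  qed
  then show ?thesis using bump_integral[where 'a='a] by (simp add: m_def)
qed

subsection \<open>Complex derivatives\<close>

lemma sum_Basis_cvec:
  fixes g :: "complex^'n \<Rightarrow> 'b::comm_monoid_add"
  shows "(\<Sum>b\<in>Basis. g b) = (\<Sum>j\<in>UNIV. g (axis j 1) + g (axis j \<i>))"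
proof -
  have B: "(Basis :: (complex^'n) set) = (\<lambda>(i, u). axis i u) ` (UNIV \<times> {1, \<i>})"
    by (auto simp: Basis_vec_def Basis_complex_def)
  have inj: "inj_on (\<lambda>(i, u). axis i u :: complex^'n) (UNIV \<times> {1, \<i>})"
    by (auto simp: inj_on_def axis_eq_axis)
  have "(\<Sum>b\<in>Basis. g b) = (\<Sum>(i, u)\<in>UNIV \<times> {1, \<i>}. g (axis i u))"
    unfolding B sum.reindex[OF inj] by (rule sum.cong) auto
  also have "\<dots> = (\<Sum>i\<in>UNIV. \<Sum>u\<in>{1, \<i>}. g (axis i u))" by (rule sum.cartesian_product[symmetric])
  finally show ?thesis by simp
qed

lemma axis_complex_decomp: "axis j c = Re c *\<^sub>R axis j (1::complex) + Im c *\<^sub>R (axis j \<i> :: complex^'n)"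
  by (auto simp: vec_eq_iff axis_def complex_eq_iff)

lemma complex_linear_of_axes:
  fixes D :: "complex^'n \<Rightarrow> complex"
  assumes lin: "linear D" and ax: "\<And>j. D (axis j \<i>) = \<i> * D (axis j 1)"
  shows "D (c *s v) = c * D v"
proof -
  have a: "D (axis j c) = c * D (axis j 1)" for j c
  proof -
    have "D (axis j c) = Re c *\<^sub>R D (axis j 1) + Im c *\<^sub>R D (axis j \<i>)"
      by (subst axis_complex_decomp) (simp only: linear_add[OF lin] linear_cmul[OF lin])
    also have "\<dots> = (of_real (Re c) + \<i> * of_real (Im c)) * D (axis j 1)"
      by (simp add: ax scaleR_conv_of_real algebra_simps)
    finally show ?thesis by (simp add: complex_eq[symmetric])
  qed
  have b: "D v = (\<Sum>j\<in>UNIV. v $ j * D (axis j 1))" for v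
  proof -
    have "v = (\<Sum>j\<in>UNIV. axis j (v $ j))"
      by (simp add: vec_eq_iff axis_def)
    from arg_cong[OF this, of D] have "D v = (\<Sum>j\<in>UNIV. D (axis j (v $ j)))"
      by (simp only: linear_sum[OF lin])
    also have "\<dots> = (\<Sum>j\<in>UNIV. v $ j * D (axis j 1))" by (rule sum.cong[OF refl a])
    finally show ?thesis .
  qed
  show ?thesis unfolding b[of "c *s v"] b[of v] by (simp add: sum_distrib_left mult_ac)
qed

lemma complex_linear_of_wzbar:
  fixes F :: "complex^'n \<Rightarrow> complex"
  assumes d: "F differentiable (at x)" and w: "\<And>j. wzbar j F x = 0"
  shows "frechet_derivative F (at x) (c *s v) = c * frechet_derivative F (at x) v"
proof (rule complex_linear_of_axes)
  show "linear (frechet_derivative F (at x))"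
    using d frechet_derivative_works has_derivative_linear by blast
  fix j
  let ?D = "frechet_derivative F (at x)"
  have "?D (axis j 1) + \<i> * ?D (axis j \<i>) = 0" using w[of j] by (simp add: wzbar_def)
  then have "\<i> * (?D (axis j 1) + \<i> * ?D (axis j \<i>)) = 0" by simp
  then show "?D (axis j \<i>) = \<i> * ?D (axis j 1)" by (simp add: algebra_simps)
qed

text \<open>The vector field \<open>y \<mapsto> \<i> y\<close> is divergence free and tangential to spheres.\<close>
lemma integral_rotation_zero:
  fixes G :: "complex^'n \<Rightarrow> complex"
  assumes C: "Ck 1 G"
  shows "(\<integral>y. bump y *\<^sub>R frechet_derivative G (at y) (\<i> *s y) \<partial>lborel) = 0"
proof -
  have C': "Ck (Suc 0) G" using C by simp
  have cb: "Ck (Suc 0) (bump :: complex^'n \<Rightarrow> real)" by (rule smooth_funD[OF smooth_bump])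
  let ?D = "\<lambda>v x. frechet_derivative G (at x) v"
  let ?B = "\<lambda>v x. frechet_derivative (bump :: complex^'n \<Rightarrow> real) (at x) v"
  have linJ: "linear (\<lambda>y::complex^'n. \<i> *s y)"
    by (intro linearI) (auto simp: vec_eq_iff algebra_simps)
  have blJ: "bounded_linear (\<lambda>y::complex^'n. \<i> *s y)" using linJ by (simp add: linear_conv_bounded_linear)
  have orth: "y \<bullet> (\<i> *s y) = 0" for y :: "complex^'n"
    by (simp add: inner_vec_def inner_complex_def)
  have blb: "bounded_linear (\<lambda>y::complex^'n. (\<i> *s y) \<bullet> b)" for b
    by (rule bounded_linear_compose[OF bounded_linear_inner_left blJ])
  define c where "c b y = (\<i> *s y) \<bullet> b" for b y :: "complex^'n"
  have Cc: "Ck (Suc 0) (c b)" for b unfolding c_def[abs_def] by (rule Ck_linear[OF blb])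
  have dc: "(c b has_derivative c b) (at y)" for b y
    unfolding c_def[abs_def] by (rule bounded_linear_imp_has_derivative[OF blb])
  have cbb: "c b b = 0" for b :: "complex^'n" unfolding c_def using orth[of b] by (simp add: inner_commute)
  have db: "((\<lambda>y. c b y * bump y) has_derivative (\<lambda>v. c b y * ?B v y + c b v * bump y)) (at y)" for b y
    by (rule has_derivative_mult[OF dc Ck_has_derivative[OF cb]])
  let ?H = "\<lambda>b y. (c b y * bump y) *\<^sub>R G y"
  have dH: "frechet_derivative (?H b) (at y) b = (c b y * bump y) *\<^sub>R ?D b y + (c b y * ?B b y) *\<^sub>R G y" for b y
    using frechet_derivative_at[OF has_derivative_scaleR[OF db Ck_has_derivative[OF C']], of b y, symmetric]
    by (simp add: cbb)
  have CH: "Ck 1 (?H b)" for b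
    using Ck_bilinear[OF bounded_bilinear_scaleR Ck_mult[OF Cc cb] C'] by simp
  have sH: "?H b y = 0" if "norm y > 1" for b y using that by (simp add: bump_support)
  note z = integral_C1_derivative[OF CH sH]
  \<comment> \<open>This is the integral of the divergence of \<open>bump y\<close> G(y) times the
    rotation field. Derivatives of the coefficients \<open>c b\<close> drop out by
    \<open>cbb\<close>, and those of \<open>bump\<close> sum to its tangential derivative, which is
    zero; only the derivative of G along the field survives.\<close>
  have "0 = (\<Sum>b\<in>Basis. (\<integral>y. frechet_derivative (?H b) (at y) b \<partial>lborel))" using z(1) by simp
  also have "\<dots> = (\<integral>y. (\<Sum>b\<in>Basis. frechet_derivative (?H b) (at y) b) \<partial>lborel)"
    using z(2) by (intro Bochner_Integration.integral_sum[symmetric])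
  also have "(\<lambda>y. \<Sum>b\<in>Basis. frechet_derivative (?H b) (at y) b) = (\<lambda>y. bump y *\<^sub>R ?D (\<i> *s y) y)"
  proof
    fix y :: "complex^'n"
    have linD: "linear (\<lambda>v. ?D v y)" using has_derivative_linear[OF Ck_has_derivative[OF C']] .
    have linB: "linear (\<lambda>v. ?B v y)" using has_derivative_linear[OF Ck_has_derivative[OF cb]] .
    have r: "\<i> *s y = (\<Sum>b\<in>Basis. c b y *\<^sub>R b)" unfolding c_def by (simp add: euclidean_representation)
    have "(\<Sum>b\<in>Basis. c b y *\<^sub>R ?D b y) = ?D (\<i> *s y) y"
      by (subst r) (simp only: linear_sum[OF linD] linear_cmul[OF linD])
    moreover have "(\<Sum>b\<in>Basis. c b y * ?B b y) = ?B (\<i> *s y) y"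
      by (subst r) (simp only: linear_sum[OF linB] linear_cmul[OF linB] real_scaleR_def)
    moreover have "?B (\<i> *s y) y = 0" by (rule bump_tangential_derivative[OF orth])
    moreover have "(\<Sum>b\<in>Basis. (c b y * ?B b y) *\<^sub>R G y) = (\<Sum>b\<in>Basis. c b y * ?B b y) *\<^sub>R G y"
      by (simp only: scaleR_sum_left)
    moreover have "(\<Sum>b\<in>Basis. (c b y * bump y) *\<^sub>R ?D b y) = bump y *\<^sub>R (\<Sum>b\<in>Basis. c b y *\<^sub>R ?D b y)"
      by (simp add: scaleR_sum_right mult.commute)
    ultimately show "(\<Sum>b\<in>Basis. frechet_derivative (?H b) (at y) b) = bump y *\<^sub>R ?D (\<i> *s y) y"
      unfolding dH
      by (simp only: sum.distrib scaleR_zero_left add_0_right)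
  qed
  finally show ?thesis by simp
qed

text \<open>By complex linearity the radial derivative of F is, up to the factor i, its derivative
  along the rotation field, whose average against \<open>bump\<close> vanishes. Hence the radial
  averages are constant in t. No Cauchy formula in several variables is involved.\<close>

lemma holomorphic_mean_value:
  fixes F :: "complex^'n \<Rightarrow> complex"
  assumes C: "Ck 1 F" and h: "\<And>x j. x \<in> ball w r \<Longrightarrow> wzbar j F x = 0" and t: "0 \<le> t" "t \<le> r"
  shows "(\<integral>y. bump y *\<^sub>R F (w + t *\<^sub>R y) \<partial>lborel) = F w"
proof -
  have C': "Ck (Suc 0) F" using C by simp
  let ?D = "\<lambda>v x. frechet_derivative F (at x) v"
  define m where "m t = (\<integral>y. bump y *\<^sub>R F (w + t *\<^sub>R y) \<partial>lborel)" for t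
  have der: "(m has_vector_derivative (\<integral>y. bump y *\<^sub>R ?D y (w + s *\<^sub>R y) \<partial>lborel)) (at s)" for s
    using radial_average_derivative[OF C, of w s] unfolding m_def[abs_def] .
  have zero: "(\<integral>y. bump y *\<^sub>R ?D y (w + s *\<^sub>R y) \<partial>lborel) = 0" if s: "0 < s" "s \<le> r" for s
  proof -
    have lin: "linear (\<lambda>v. ?D v x)" for x using has_derivative_linear[OF Ck_has_derivative[OF C']] .
    have bl: "bounded_linear (\<lambda>y::complex^'n. s *\<^sub>R y)" by (rule bounded_linear_scaleR_right)
    have CG: "Ck 1 (\<lambda>y. F (w + s *\<^sub>R y))" using Ck_affine[OF bl C, of w] by (simp add: add.commute)
    have dG: "frechet_derivative (\<lambda>y. F (w + s *\<^sub>R y)) (at y) v = s *\<^sub>R ?D v (w + s *\<^sub>R y)" for y v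
    proof -
      have "((\<lambda>y. w + s *\<^sub>R y) has_derivative (\<lambda>v. s *\<^sub>R v)) (at y)" 
        by (auto intro!: derivative_eq_intros)
      from has_derivative_compose[OF this Ck_has_derivative[OF C']] 
      have "((\<lambda>y. F (w + s *\<^sub>R y)) has_derivative (\<lambda>v. ?D (s *\<^sub>R v) (w + s *\<^sub>R y))) (at y)" .
      from frechet_derivative_at[OF this, symmetric] show ?thesis by (simp add: linear_cmul[OF lin])
    qed
    have "bump y *\<^sub>R (s *\<^sub>R ?D (\<i> *s y) (w + s *\<^sub>R y)) = (of_real s * \<i>) * (bump y *\<^sub>R ?D y (w + s *\<^sub>R y))" for y
    proof (cases "norm y \<ge> 1")
      case False
      then have "s * norm y < s * 1" using s by (intro mult_strict_left_mono) auto
      moreover have "norm (s *\<^sub>R y) = s * norm y" using s by simp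
      ultimately have "norm (s *\<^sub>R y) < r" using s by linarith
      then have "w + s *\<^sub>R y \<in> ball w r" by (simp add: dist_norm)
      then have "?D (\<i> *s y) (w + s *\<^sub>R y) = \<i> * ?D y (w + s *\<^sub>R y)"
        using h C' by (intro complex_linear_of_wzbar) auto
      then show ?thesis by (simp add: scaleR_conv_of_real mult_ac)
    qed (simp add: bump_support)
    then have e: "(\<lambda>y. bump y *\<^sub>R (s *\<^sub>R ?D (\<i> *s y) (w + s *\<^sub>R y)))
        = (\<lambda>y. (of_real s * \<i>) * (bump y *\<^sub>R ?D y (w + s *\<^sub>R y)))" by (rule ext)
    have "(\<integral>y. (of_real s * \<i>) * (bump y *\<^sub>R ?D y (w + s *\<^sub>R y)) \<partial>lborel) = 0"
      using integral_rotation_zero[OF CG] unfolding dG e .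
    then have "(of_real s * \<i>) * (\<integral>y. bump y *\<^sub>R ?D y (w + s *\<^sub>R y) \<partial>lborel) = 0"
      by (simp only: integral_mult_right_zero)
    then show ?thesis using s by simp
  qed
  have "m t = m 0"
  proof (rule has_derivative_zero_unique_strong_convex[of "{0..t}" "{0}"])
    show "continuous_on {0..t} m"
      using der by (intro continuous_at_imp_continuous_on ballI has_vector_derivative_continuous)
    show "(m has_derivative (\<lambda>h. 0)) (at x within {0..t})" if "x \<in> {0..t} - {0}" for x
      using der[of x] zero[of x] that t 
      by (auto simp: has_vector_derivative_def intro: has_derivative_at_withinI)
  qed (use t in auto)
  then show ?thesis using radial_average_0[of F w] by (simp add: m_def)
qed

subsection \<open>Weighted sub-mean value inequality\<close>

text \<open>The Cauchy-Riemann equation is differentiated twice, with the mixed derivatives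
  interchanged in between; the two factors i multiply to -1, so f is harmonic in each complex
  coordinate.\<close>

lemma CR_second_derivatives:
  fixes f :: "complex^'n \<Rightarrow> complex"
  assumes C: "Ck 2 f" and S: "open S" "x \<in> S" and h: "\<And>y j. y \<in> S \<Longrightarrow> wzbar j f y = 0"
  shows "frechet_derivative f (at x) (axis j \<i>) = \<i> * frechet_derivative f (at x) (axis j 1)"
    "frechet_derivative (\<lambda>y. frechet_derivative f (at y) (axis j \<i>)) (at x) (axis j \<i>)
     = - frechet_derivative (\<lambda>y. frechet_derivative f (at y) (axis j 1)) (at x) (axis j 1)"
proof -
  have C': "Ck (Suc (Suc 0)) f" using C by (simp add: numeral_2_eq_2)
  let ?D = "\<lambda>v y. frechet_derivative f (at y) v"
  have cr: "?D (axis j \<i>) y = \<i> * ?D (axis j 1) y" if "y \<in> S" for y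
  proof -
    have "\<i> * (?D (axis j 1) y + \<i> * ?D (axis j \<i>) y) = 0" using h[OF that, of j] by (simp add: wzbar_def)
    then show ?thesis by (simp add: algebra_simps)
  qed
  show "?D (axis j \<i>) x = \<i> * ?D (axis j 1) x" using cr[OF S(2)] .
  have dd: "(?D u has_derivative (\<lambda>v. frechet_derivative (?D u) (at y) v)) (at y)" for u y
    using Ck_has_derivative[OF Ck_SucD[OF C']] .
  have cr2: "frechet_derivative (?D (axis j \<i>)) (at x) v = \<i> * frechet_derivative (?D (axis j 1)) (at x) v" for v
  proof -
    have "((\<lambda>y. \<i> * ?D (axis j 1) y) has_derivative (\<lambda>v. \<i> * frechet_derivative (?D (axis j 1)) (at x) v)) (at x)"
      by (rule has_derivative_mult_right[OF dd])
    then have "(?D (axis j \<i>) has_derivative (\<lambda>v. \<i> * frechet_derivative (?D (axis j 1)) (at x) v)) (at x)"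
      by (rule has_derivative_transform_within_open[OF _ S]) (simp add: cr)
    from fun_cong[OF frechet_derivative_at[OF this], of v] show ?thesis by simp
  qed
  have "frechet_derivative (?D (axis j \<i>)) (at x) (axis j \<i>) = \<i> * frechet_derivative (?D (axis j 1)) (at x) (axis j \<i>)"
    by (rule cr2)
  also have "frechet_derivative (?D (axis j 1)) (at x) (axis j \<i>) = frechet_derivative (?D (axis j \<i>)) (at x) (axis j 1)"
    by (rule mixed_partials[OF C])
  also have "\<dots> = \<i> * frechet_derivative (?D (axis j 1)) (at x) (axis j 1)" by (rule cr2)
  finally show "frechet_derivative (?D (axis j \<i>)) (at x) (axis j \<i>) = - frechet_derivative (?D (axis j 1)) (at x) (axis j 1)"
    by (simp flip: mult.assoc)
qed

lemma Ck2_second_derivative_weight: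
  fixes f :: "'a::euclidean_space \<Rightarrow> complex" and \<psi> :: "'a \<Rightarrow> real"
  assumes Cf: "Ck 2 f" and Cp: "Ck 2 \<psi>"
  defines "F \<equiv> \<lambda>x. (norm (f x))\<^sup>2 * exp (\<psi> x)"
  shows "Ck 2 F"
    "frechet_derivative (\<lambda>x. frechet_derivative F (at x) v) (at x) v =
      exp (\<psi> x) * (2 * (norm (frechet_derivative f (at x) v))\<^sup>2
       + 2 * Re (cnj (f x) * frechet_derivative (\<lambda>x. frechet_derivative f (at x) v) (at x) v)
       + 4 * Re (cnj (f x) * frechet_derivative f (at x) v) * frechet_derivative \<psi> (at x) v
       + (norm (f x))\<^sup>2 * ((frechet_derivative \<psi> (at x) v)\<^sup>2
       + frechet_derivative (\<lambda>x. frechet_derivative \<psi> (at x) v) (at x) v))"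
proof -
  have Cf': "Ck (Suc (Suc 0)) f" and Cp': "Ck (Suc (Suc 0)) \<psi>" using Cf Cp by (simp_all add: numeral_2_eq_2)
  have Cf1: "Ck (Suc 0) f" and Cp1: "Ck (Suc 0) \<psi>" by (rule Ck_pred[OF Cf'], rule Ck_pred[OF Cp'])
  let ?D = "\<lambda>v x. frechet_derivative f (at x) v"
  let ?P = "\<lambda>v x. frechet_derivative \<psi> (at x) v"
  have CD: "Ck (Suc 0) (?D v)" "Ck (Suc 0) (?P v)" for v
    by (rule Ck_SucD[OF Cf'], rule Ck_SucD[OF Cp'])
  have F_eq: "F = (\<lambda>x. Re (cnj (f x) * f x) * exp (\<psi> x))"
    by (simp add: F_def fun_eq_iff cmod_power2) (simp add: power2_eq_square)
  have dfc: "((\<lambda>x. Re (cnj (f x) * g x)) has_derivative (\<lambda>v. Re (cnj (f x) * g' v + cnj (?D v x) * g x))) (at x)"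
    if "(g has_derivative g') (at x)" for g g' x
    by (rule bounded_linear.has_derivative[OF bounded_linear_Re
          has_derivative_mult[OF bounded_linear.has_derivative[OF bounded_linear_cnj Ck_has_derivative[OF Cf']] that]])
  have de: "((\<lambda>x. exp (\<psi> x)) has_derivative (\<lambda>v. exp (\<psi> x) * ?P v x)) (at x)" for x
    using has_derivative_exp[OF Ck_has_derivative[OF Cp']] by (simp add: mult.commute)
  have CRe: "Ck k (\<lambda>x. Re (cnj (g x) * h x))" if "Ck k g" "Ck k h" for g h :: "'a \<Rightarrow> complex" and k
    by (intro Ck_comp_linear[OF bounded_linear_Re] Ck_mult Ck_comp_linear[OF bounded_linear_cnj] that)
  have Cexp: "Ck (Suc 0) (\<lambda>x. exp (\<psi> x))"
  proof (rule Ck_SucI[OF de])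
    show "Ck 0 (\<lambda>x. exp (\<psi> x) * ?P v x)" for v
      using Ck_continuous[OF Cp] Ck_continuous[OF CD(2)] by (auto intro!: continuous_intros)
  qed
  define F1 where "F1 v x = (2 * Re (cnj (f x) * ?D v x) + Re (cnj (f x) * f x) * ?P v x) * exp (\<psi> x)" for v x
  have dF: "(F has_derivative (\<lambda>v. F1 v x)) (at x)" for x
    unfolding F_eq
    by (rule has_derivative_eq_rhs[OF has_derivative_mult[OF dfc[OF Ck_has_derivative[OF Cf']] de]])
       (auto simp: F1_def fun_eq_iff algebra_simps)
  have F1': "frechet_derivative F (at x) v = F1 v x" for x v
    using fun_cong[OF frechet_derivative_at[OF dF], of v] by simp
  have CF1: "Ck (Suc 0) (F1 v)" for v
    unfolding F1_def[abs_def] by (intro Ck_mult Ck_add CRe Ck_const Cf1 CD Cexp)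
  have "Ck (Suc (Suc 0)) F" by (rule Ck_SucI[OF dF CF1])
  then show "Ck 2 F" by (simp add: numeral_2_eq_2)
  have dP: "(?P v has_derivative (\<lambda>u. frechet_derivative (?P v) (at x) u)) (at x)" for v x
    by (rule Ck_has_derivative[OF CD(2)])
  have "(F1 v has_derivative (\<lambda>u. 
      (2 * Re (cnj (f x) * ?D v x) + Re (cnj (f x) * f x) * ?P v x) * (exp (\<psi> x) * ?P u x)
      + (2 * Re (cnj (f x) * frechet_derivative (?D v) (at x) u + cnj (?D u x) * ?D v x)
         + (Re (cnj (f x) * f x) * frechet_derivative (?P v) (at x) u + Re (cnj (f x) * ?D u x + cnj (?D u x) * f x) * ?P v x)) * exp (\<psi> x))) (at x)"
    unfolding F1_def[abs_def]
    by (rule has_derivative_mult[OF has_derivative_add[OF has_derivative_mult_right[OF dfc[OF Ck_has_derivative[OF CD(1)]]]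
         has_derivative_mult[OF dfc[OF Ck_has_derivative[OF Cf']] dP]] de])
  from fun_cong[OF frechet_derivative_at[OF this], of v]
  show "frechet_derivative (\<lambda>x. frechet_derivative F (at x) v) (at x) v =
      exp (\<psi> x) * (2 * (norm (?D v x))\<^sup>2
       + 2 * Re (cnj (f x) * frechet_derivative (?D v) (at x) v)
       + 4 * Re (cnj (f x) * ?D v x) * ?P v x
       + (norm (f x))\<^sup>2 * ((?P v x)\<^sup>2 + frechet_derivative (?P v) (at x) v))"
    unfolding F1' cmod_power2 by (simp add: power2_eq_square algebra_simps)
qed

text \<open>In each complex coordinate the Laplacian of |f|^2 exp \<psi> equals exp \<psi> times
  |f|^2 times that of \<psi>, plus exp \<psi> times a square: the contributions of the second
  derivatives of f cancel by harmonicity.\<close>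

lemma weighted_laplacian_nonneg:
  fixes f :: "complex^'n \<Rightarrow> complex" and \<psi> :: "complex^'n \<Rightarrow> real"
  assumes Cf: "Ck 2 f" and Cp: "Ck 2 \<psi>" and S: "open S" "x \<in> S" and h: "\<And>y j. y \<in> S \<Longrightarrow> wzbar j f y = 0"
    and lp: "0 \<le> lap \<psi> x"
  defines "F \<equiv> \<lambda>x. (norm (f x))\<^sup>2 * exp (\<psi> x)"
  shows "0 \<le> (\<Sum>b\<in>Basis. frechet_derivative (\<lambda>x. frechet_derivative F (at x) b) (at x) b)"
proof -
  let ?P = "\<lambda>v. frechet_derivative \<psi> (at x) v"
  let ?PP = "\<lambda>v. frechet_derivative (\<lambda>x. frechet_derivative \<psi> (at x) v) (at x) v"
  let ?FF = "\<lambda>v. frechet_derivative (\<lambda>x. frechet_derivative F (at x) v) (at x) v"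
  \<comment> \<open>With a the complex derivative of f in one coordinate, z the value of f, and p, q
    the two real partials of \<psi>, the difference is |2 a + z (p - i q)|^2.\<close>
  have alg: "0 \<le> 2 * (norm a)\<^sup>2 + 2 * Re (cnj z * a2) + 4 * Re (cnj z * a) * p + (norm z)\<^sup>2 * (p\<^sup>2 + s)
     + (2 * (norm (\<i> * a))\<^sup>2 + 2 * Re (cnj z * (- a2)) + 4 * Re (cnj z * (\<i> * a)) * q + (norm z)\<^sup>2 * (q\<^sup>2 + t))
     - (norm z)\<^sup>2 * (s + t)" for a z a2 :: complex and p q s t :: real
  proof -
    have "2 * (norm a)\<^sup>2 + 2 * Re (cnj z * a2) + 4 * Re (cnj z * a) * p + (norm z)\<^sup>2 * (p\<^sup>2 + s)
     + (2 * (norm (\<i> * a))\<^sup>2 + 2 * Re (cnj z * (- a2)) + 4 * Re (cnj z * (\<i> * a)) * q + (norm z)\<^sup>2 * (q\<^sup>2 + t))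
     - (norm z)\<^sup>2 * (s + t)
     = (2 * Re a + Re z * p + Im z * q)\<^sup>2 + (2 * Im a + Im z * p - Re z * q)\<^sup>2"
      unfolding cmod_power2 by (simp add: power2_eq_square algebra_simps)
    then show ?thesis by simp
  qed
  have pair: "exp (\<psi> x) * ((norm (f x))\<^sup>2 * (?PP (axis j 1) + ?PP (axis j \<i>))) \<le> ?FF (axis j 1) + ?FF (axis j \<i>)" for j
  proof -
    have cr: "frechet_derivative f (at x) (axis j \<i>) = \<i> * frechet_derivative f (at x) (axis j 1)"
      "frechet_derivative (\<lambda>y. frechet_derivative f (at y) (axis j \<i>)) (at x) (axis j \<i>)
       = - frechet_derivative (\<lambda>y. frechet_derivative f (at y) (axis j 1)) (at x) (axis j 1)"
      by (rule CR_second_derivatives[OF Cf S], erule h)+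
    note ff = Ck2_second_derivative_weight(2)[OF Cf Cp, of _ x, folded F_def]
    have "(norm (f x))\<^sup>2 * (?PP (axis j 1) + ?PP (axis j \<i>)) \<le>
      2 * (norm (frechet_derivative f (at x) (axis j 1)))\<^sup>2
       + 2 * Re (cnj (f x) * frechet_derivative (\<lambda>x. frechet_derivative f (at x) (axis j 1)) (at x) (axis j 1))
       + 4 * Re (cnj (f x) * frechet_derivative f (at x) (axis j 1)) * ?P (axis j 1)
       + (norm (f x))\<^sup>2 * ((?P (axis j 1))\<^sup>2 + ?PP (axis j 1)) + 
     (2 * (norm (frechet_derivative f (at x) (axis j \<i>)))\<^sup>2
       + 2 * Re (cnj (f x) * frechet_derivative (\<lambda>x. frechet_derivative f (at x) (axis j \<i>)) (at x) (axis j \<i>))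
       + 4 * Re (cnj (f x) * frechet_derivative f (at x) (axis j \<i>)) * ?P (axis j \<i>)
       + (norm (f x))\<^sup>2 * ((?P (axis j \<i>))\<^sup>2 + ?PP (axis j \<i>)))"
      unfolding cr using alg[of "frechet_derivative f (at x) (axis j 1)" "f x"
        "frechet_derivative (\<lambda>x. frechet_derivative f (at x) (axis j 1)) (at x) (axis j 1)"
        "?P (axis j 1)" "?PP (axis j 1)" "?P (axis j \<i>)" "?PP (axis j \<i>)"] by linarith
    from mult_left_mono[OF this exp_ge_zero[of "\<psi> x"]] show ?thesis
      unfolding ff by (simp only: distrib_left)
  qed
  have "0 \<le> exp (\<psi> x) * ((norm (f x))\<^sup>2 * lap \<psi> x)" using lp by simp
  also have "\<dots> = (\<Sum>j\<in>UNIV. exp (\<psi> x) * ((norm (f x))\<^sup>2 * (?PP (axis j 1) + ?PP (axis j \<i>))))"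
    by (simp add: lap_def dd_def sum_distrib_left)
  also have "\<dots> \<le> (\<Sum>j\<in>UNIV. ?FF (axis j 1) + ?FF (axis j \<i>))"
    by (intro sum_mono pair)
  also have "\<dots> = (\<Sum>b\<in>Basis. ?FF b)" by (rule sum_Basis_cvec[symmetric])
  finally show ?thesis .
qed

text \<open>The real dimension is 2n, so the Laplacian of |x - w|^2 is 4n. The term compensates a
  positive Laplacian of \<phi> in the sub-mean value argument.\<close>

lemma lap_quadratic:
  fixes \<phi> :: "complex^'n \<Rightarrow> real"
  assumes C: "Ck 2 \<phi>"
  shows "Ck 2 (\<lambda>x. -2 * \<phi> x + c * ((x - w) \<bullet> (x - w)))"
    "lap (\<lambda>x. -2 * \<phi> x + c * ((x - w) \<bullet> (x - w))) x = -2 * lap \<phi> x + 4 * c * real CARD('n)"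
proof -
  have C': "Ck (Suc (Suc 0)) \<phi>" using C by (simp add: numeral_2_eq_2)
  let ?P = "\<lambda>x. -2 * \<phi> x + c * ((x - w) \<bullet> (x - w))"
  have d: "(?P has_derivative (\<lambda>v. -2 * frechet_derivative \<phi> (at x) v + c * (2 * ((x - w) \<bullet> v)))) (at x)" for x
  proof -
    have "((\<lambda>x. (x - w) \<bullet> (x - w)) has_derivative (\<lambda>v. 2 * ((x - w) \<bullet> v))) (at x)"
      by (auto intro!: derivative_eq_intros simp: inner_commute)
    then show ?thesis
      by (intro has_derivative_add has_derivative_mult_right Ck_has_derivative[OF C'])
  qed
  have d2: "((\<lambda>x. -2 * frechet_derivative \<phi> (at x) v + c * (2 * ((x - w) \<bullet> v))) has_derivative
     (\<lambda>u. -2 * frechet_derivative (\<lambda>x. frechet_derivative \<phi> (at x) v) (at x) u + c * (2 * (u \<bullet> v)))) (at x)" for v x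
  proof -
    have "((\<lambda>x. (x - w) \<bullet> v) has_derivative (\<lambda>u. u \<bullet> v)) (at x)"
      by (auto intro!: derivative_eq_intros)
    then show ?thesis
      by (intro has_derivative_add has_derivative_mult_right Ck_has_derivative[OF Ck_SucD[OF C']])
  qed
  have c0: "Ck 0 (\<lambda>x. -2 * frechet_derivative (\<lambda>x. frechet_derivative \<phi> (at x) v) (at x) u + c * (2 * (u \<bullet> v)))" for u v
    using Ck_SucD[OF Ck_SucD[OF C', of v], of u] by (auto intro!: continuous_intros)
  have "Ck (Suc (Suc 0)) ?P"
    by (rule Ck_SucI[OF d]) (rule Ck_SucI[OF d2 c0])
  then show "Ck 2 ?P" by (simp add: numeral_2_eq_2)
  have f1: "frechet_derivative ?P (at x) v = -2 * frechet_derivative \<phi> (at x) v + c * (2 * ((x - w) \<bullet> v))" for x v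
    using fun_cong[OF frechet_derivative_at[OF d[of x]], of v] by simp
  have f2: "dd ?P v x = -2 * dd \<phi> v x + 2 * c * (v \<bullet> v)" for v
    unfolding dd_def f1 using fun_cong[OF frechet_derivative_at[OF d2[of v x]], of v] by simp
  have n: "axis j (1::complex) \<bullet> axis j 1 = 1" "axis j \<i> \<bullet> axis j \<i> = 1" for j :: 'n
    by (simp_all add: inner_axis_axis inner_complex_def)
  show "lap ?P x = -2 * lap \<phi> x + 4 * c * real CARD('n)"
    unfolding lap_def f2 n by (simp add: sum.distrib sum_distrib_left algebra_simps sum_negf sum_subtractf)
qed

subsection \<open>Weyl's lemma for the Cauchy--Riemann operator\<close>

lemma mollifier_continuous: "continuous_on UNIV (mollifier \<delta> :: 'a::euclidean_space \<Rightarrow> real)"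
  by (rule smooth_continuous[OF smooth_mollifier])

lemma conv_mollifier_smooth: "loc_int f \<Longrightarrow> \<delta> > 0 \<Longrightarrow> smooth_fun (conv f (mollifier \<delta>))"
  by (rule conv_smooth[where R = \<delta>, OF _ smooth_mollifier]) (auto intro: mollifier_support)

lemma cbox_subset_cball:
  fixes a b :: "'a::euclidean_space"
  obtains R where "cbox a b \<subseteq> cball 0 R"
  using bounded_subset_ballD[OF bounded_cbox, of a b 0] ball_subset_cball by (metis order_trans)

text \<open>By evenness of the bump, mollification is the radial average for which the mean value
  results above are formulated.\<close>

lemma conv_mollifier_radial:
  fixes F :: "'a::euclidean_space \<Rightarrow> 'b::euclidean_space"
  assumes F: "continuous_on UNIV F" and t: "t > 0"
  shows "conv F (mollifier t) x = (\<integral>y. bump y *\<^sub>R F (x + t *\<^sub>R y) \<partial>lborel)"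
proof -
  have "continuous_on UNIV (\<lambda>y. mollifier t (x - y) *\<^sub>R F y)"
    by (rule continuous_on_scaleR[OF continuous_on_compose2[OF mollifier_continuous] F]) (auto intro!: continuous_intros)
  from lborel_integral_affine[OF borel_continuous[OF this], of t x] t
  have "(\<integral>y. mollifier t (x - (x + t *\<^sub>R y)) *\<^sub>R F (x + t *\<^sub>R y) \<partial>lborel) = conv F (mollifier t) x /\<^sub>R t ^ DIM('a)"
    by (simp add: conv_def)
  also have "(\<lambda>y. mollifier t (x - (x + t *\<^sub>R y)) *\<^sub>R F (x + t *\<^sub>R y)) = (\<lambda>y. (bump y *\<^sub>R F (x + t *\<^sub>R y)) /\<^sub>R t ^ DIM('a))"
    using t by (simp add: fun_eq_iff mollifier_def divide_inverse mult.commute)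
  finally have "(\<integral>y. bump y *\<^sub>R F (x + t *\<^sub>R y) \<partial>lborel) /\<^sub>R t ^ DIM('a) = conv F (mollifier t) x /\<^sub>R t ^ DIM('a)"
    by (simp only: integral_scaleR_right)
  then show ?thesis using t by simp
qed

text \<open>Moves the mollifier from f to \<beta>. Absolute integrability for Fubini comes from
  mollifying |f|, which is smooth and therefore bounded on the support of \<beta>.\<close>

lemma integral_mult_conv:
  fixes f :: "'a::euclidean_space \<Rightarrow> 'b::euclidean_space" and \<beta> :: "'a \<Rightarrow> real"
  assumes f: "loc_int f" and b: "\<beta> \<in> borel_measurable borel" "\<And>x. \<bar>\<beta> x\<bar> \<le> B" "\<And>x. norm x > R \<Longrightarrow> \<beta> x = 0"
    and \<delta>: "\<delta> > 0"
  shows "(\<integral>y. \<beta> y *\<^sub>R conv f (mollifier \<delta>) y \<partial>lborel)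
      = (\<integral>z. (\<integral>y. \<beta> y * mollifier \<delta> (y - z) \<partial>lborel) *\<^sub>R f z \<partial>lborel)"
proof -
  let ?a = "mollifier \<delta> :: 'a \<Rightarrow> real"
  have [measurable]: "?a \<in> borel_measurable borel" by (rule borel_continuous[OF mollifier_continuous])
  note [measurable] = b(1) loc_intD(1)[OF f]
  have s: "?a x = 0" if "norm x > \<delta>" for x by (rule mollifier_support[OF \<delta> less_imp_le[OF that]])
  have ab: "\<bar>?a x\<bar> = ?a x" for x using mollifier_nonneg[OF \<delta>, of x] by simp
  define h where "h y z = (\<beta> y * ?a (y - z)) *\<^sub>R f z" for y z
  have fn: "loc_int (\<lambda>z. norm (f z))"
    unfolding loc_int_def using loc_intD(2)[OF f, THEN integrable_norm] by (simp add: abs_mult)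
  have cn: "continuous_on UNIV (conv (\<lambda>z. norm (f z)) ?a)"
    by (rule smooth_continuous[OF conv_mollifier_smooth[OF fn \<delta>]])
  have int: "integrable (lborel \<Otimes>\<^sub>M lborel) (\<lambda>(y, z). h y z)"
  proof (rule lborel_pair.Fubini_integrable)
    show "(\<lambda>(y, z). h y z) \<in> borel_measurable (lborel \<Otimes>\<^sub>M lborel)" unfolding h_def by measurable
    have "(\<integral>z. norm (case (y, z) of (y, z) \<Rightarrow> h y z) \<partial>lborel) = \<bar>\<beta> y\<bar> *\<^sub>R conv (\<lambda>z. norm (f z)) ?a y" for y
      unfolding conv_def h_def by (simp add: abs_mult mult.assoc ab)
    moreover have "integrable lborel (\<lambda>y. \<bar>\<beta> y\<bar> *\<^sub>R conv (\<lambda>z. norm (f z)) ?a y)"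
      using b by (intro loc_int_mult_support[OF continuous_loc_int[OF cn], of _ B R]) auto
    ultimately show "integrable lborel (\<lambda>y. \<integral>z. norm (case (y, z) of (y, z) \<Rightarrow> h y z) \<partial>lborel)" by simp
    show "AE y in lborel. integrable lborel (\<lambda>z. case (y, z) of (y, z) \<Rightarrow> h y z)"
      using integrable_scaleR_right[OF conv_integrable[OF f mollifier_continuous s]]
      unfolding h_def by (intro AE_I2) (simp flip: scaleR_scaleR)
  qed
  have "(\<integral>y. \<beta> y *\<^sub>R conv f ?a y \<partial>lborel) = (\<integral>y. (\<integral>z. h y z \<partial>lborel) \<partial>lborel)"
    unfolding conv_def h_def by (simp flip: scaleR_scaleR)
  also have "\<dots> = (\<integral>z. (\<integral>y. h y z \<partial>lborel) \<partial>lborel)"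
    by (rule lborel_pair.Fubini_integral[OF int, symmetric])
  also have "\<dots> = (\<integral>z. (\<integral>y. \<beta> y * ?a (y - z) \<partial>lborel) *\<^sub>R f z \<partial>lborel)"
  proof -
    have "integrable lborel (\<lambda>y. \<beta> y *\<^sub>R ?a (y - z))" for z
      using b by (intro loc_int_mult_support[OF continuous_loc_int, of _ _ B R] continuous_on_compose2[OF mollifier_continuous])
        (auto intro!: continuous_intros)
    then show ?thesis unfolding h_def by (simp add: integral_scaleR_left)
  qed
  finally show ?thesis .
qed

text \<open>Both iterated mollifications have an integral kernel in z, and the substitution that
  sends y to x + z - y exchanges the two kernels.\<close>

lemma conv_mollifier_commute:
  fixes f :: "'a::euclidean_space \<Rightarrow> 'b::euclidean_space"
  assumes f: "loc_int f" and \<delta>: "\<delta> > 0" "\<delta>' > 0"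
  shows "conv (conv f (mollifier \<delta>)) (mollifier \<delta>') x = conv (conv f (mollifier \<delta>')) (mollifier \<delta>) x"
proof -
  have b: "(\<lambda>y. mollifier \<delta> (x - y)) \<in> borel_measurable borel" 
       "\<exists>B. \<forall>y. \<bar>mollifier \<delta> (x - y)\<bar> \<le> B" "\<And>y. norm y > norm x + \<delta> \<Longrightarrow> mollifier \<delta> (x - y) = 0"
    if "\<delta> > 0" for \<delta>
  proof -
    show "(\<lambda>y. mollifier \<delta> (x - y)) \<in> borel_measurable borel"
      by (intro borel_continuous continuous_on_compose2[OF mollifier_continuous]) (auto intro!: continuous_intros)
    have "\<And>x::'a. norm x > \<delta> \<Longrightarrow> mollifier \<delta> x = 0" by (rule mollifier_support[OF that less_imp_le])
    from continuous_support_bounded[OF mollifier_continuous this] 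
    obtain B where "\<And>y::'a. norm (mollifier \<delta> y) \<le> B" by metis
    then show "\<exists>B. \<forall>y. \<bar>mollifier \<delta> (x - y)\<bar> \<le> B" by (metis real_norm_def)
    show "mollifier \<delta> (x - y) = 0" if "norm y > norm x + \<delta>" for y
      using norm_triangle_ineq2[of y x] that \<open>\<delta> > 0\<close> by (intro mollifier_support) (auto simp: norm_minus_commute)
  qed
  have e: "conv (conv f (mollifier \<delta>)) (mollifier \<delta>') x
      = (\<integral>z. (\<integral>y. mollifier \<delta>' (x - y) * mollifier \<delta> (y - z) \<partial>lborel) *\<^sub>R f z \<partial>lborel)"
    if d: "\<delta> > 0" "\<delta>' > 0" for \<delta> \<delta>'
  proof -
    obtain B where B: "\<And>y. \<bar>mollifier \<delta>' (x - y)\<bar> \<le> B" using b(2)[OF d(2)] by blast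
    show ?thesis
      using integral_mult_conv[OF f b(1)[OF d(2)] B b(3)[OF d(2)] d(1)] by (simp add: conv_def)
  qed
  have i: "(\<integral>y. mollifier \<delta>' (x - y) * mollifier \<delta> (y - z) \<partial>lborel) = (\<integral>y. mollifier \<delta> (x - y) * mollifier \<delta>' (y - z) \<partial>lborel)" for z
  proof -
    have "(\<lambda>y. mollifier \<delta>' (x - y) * mollifier \<delta> (y - z)) \<in> borel_measurable borel"
      by (intro borel_continuous continuous_on_mult continuous_on_compose2[OF mollifier_continuous]) (auto intro!: continuous_intros)
    from lborel_integral_reflect[OF this, of "x + z"] show ?thesis by (simp add: algebra_simps)
  qed
  show ?thesis unfolding e[OF \<delta>] e[OF \<delta>(2) \<delta>(1)] i ..
qed

text \<open>A holomorphic function is unchanged by mollification. Hence each of the two mollified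
  functions equals the twice mollified one, and the order of the two mollifications is
  irrelevant.\<close>

lemma conv_mollifier_indep:
  fixes f :: "complex^'n \<Rightarrow> complex"
  assumes f: "loc_int f" 
    and hol: "\<And>\<delta> x j. 0 < \<delta> \<Longrightarrow> x \<in> ball w (R - \<delta>) \<Longrightarrow> wzbar j (conv f (mollifier \<delta>)) x = 0"
    and \<delta>: "0 < \<delta>" "0 < \<delta>'" and x: "x \<in> ball w (R - \<delta> - \<delta>')"
  shows "conv f (mollifier \<delta>) x = conv f (mollifier \<delta>') x"
proof -
  have m: "conv (conv f (mollifier \<delta>)) (mollifier \<delta>') x = conv f (mollifier \<delta>) x"
    if \<delta>: "0 < \<delta>" "0 < \<delta>'" and x: "x \<in> ball w (R - \<delta> - \<delta>')" for \<delta> \<delta>'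
  proof -
    note sm = conv_mollifier_smooth[OF f \<delta>(1)]
    have "y \<in> ball w (R - \<delta>)" if "y \<in> ball x \<delta>'" for y
      using that x dist_triangle[of w y x] by simp
    then show ?thesis
      unfolding conv_mollifier_radial[OF smooth_continuous[OF sm] \<delta>(2)]
      using \<delta> hol by (intro holomorphic_mean_value[OF smooth_funD[OF sm]]) auto
  qed
  have x': "x \<in> ball w (R - \<delta>' - \<delta>)" using x by (simp add: algebra_simps)
  show ?thesis
    using m[OF \<delta> x] m[OF \<delta>(2) \<delta>(1) x'] conv_mollifier_commute[OF f \<delta>, of x] by simp
qed

text \<open>Off the boundary of the box, the support of a fine enough mollifier about z lies wholly
  inside or wholly outside the box, so the sequence is eventually constant.\<close>

lemma mollified_cube_tendsto:
  fixes a b z :: "'a::euclidean_space"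
  assumes z: "z \<notin> cbox a b - box a b"
  shows "(\<lambda>n. \<integral>y. indicator (cbox a b) y * mollifier (1 / real (Suc n)) (y - z) \<partial>lborel) \<longlonglongrightarrow> indicator (cbox a b) z"
proof -
  have tr: "(\<integral>y. mollifier \<delta> (y - z) \<partial>lborel) = 1" if "\<delta> > 0" for \<delta>
    using lborel_integral_translate[OF borel_continuous[OF mollifier_continuous, of \<delta>], of "-z"] mollifier_integral[OF that, where 'a='a]
    by simp
  have "\<exists>e>0. ball z e \<subseteq> cbox a b \<or> ball z e \<inter> cbox a b = {}"
  proof (cases "z \<in> cbox a b")
    case True
    then have "z \<in> box a b" using z by simp
    then show ?thesis using open_box[of a b] box_subset_cbox[of a b] by (meson open_contains_ball order_trans)
  next
    case False
    then have "z \<in> - cbox a b" by simp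
    then obtain e where "e > 0" "ball z e \<subseteq> - cbox a b" 
      using open_contains_ball[of "- cbox a b"] closed_cbox[of a b] by (auto simp: open_Compl)
    then show ?thesis by blast
  qed
  then obtain e where e: "e > 0" "ball z e \<subseteq> cbox a b \<or> ball z e \<inter> cbox a b = {}" by blast
  obtain N :: nat where N: "1 / real (Suc N) < e" using e(1) by (metis nat_approx_posE)
  have "(\<integral>y. indicator (cbox a b) y * mollifier (1 / real (Suc n)) (y - z) \<partial>lborel) = indicator (cbox a b) z" if "n \<ge> N" for n
  proof -
    define d where "d = 1 / real (Suc n)"
    have d0: "d > 0" by (simp add: d_def)
    have "d \<le> 1 / real (Suc N)" using that by (simp add: d_def frac_le)
    then have d: "d < e" using N by simp
    have "indicator (cbox a b) y * mollifier d (y - z) = indicator (cbox a b) z * mollifier d (y - z)" for y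
    proof (cases "y \<in> ball z e")
      case True
      moreover have "z \<in> ball z e" using e(1) by simp
      ultimately have "y \<in> cbox a b \<longleftrightarrow> z \<in> cbox a b" using e(2) by blast
      then show ?thesis by (simp add: indicator_def)
    next
      case False
      then have "mollifier d (y - z) = 0"
        using d by (intro mollifier_support[OF d0]) (simp add: dist_norm norm_minus_commute)
      then show ?thesis by simp
    qed
    then have "(\<integral>y. indicator (cbox a b) y * mollifier d (y - z) \<partial>lborel)
        = (\<integral>y. indicator (cbox a b) z * mollifier d (y - z) \<partial>lborel)"
      by (intro Bochner_Integration.integral_cong refl)
    then show ?thesis unfolding d_def[symmetric] using tr[OF d0] by simp
  qed
  then show ?thesis by (intro tendsto_eventually eventually_sequentiallyI[of N]) auto
qed

lemma mollified_cube_bound: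
  fixes a b z :: "'a::euclidean_space"
  assumes "\<delta> > 0"
  shows "\<bar>\<integral>y. indicator (cbox a b) y * mollifier \<delta> (y - z) \<partial>lborel\<bar> \<le> 1"
proof -
  have tr: "(\<integral>y. mollifier \<delta> (y - z) \<partial>lborel) = 1"
    using lborel_integral_translate[OF borel_continuous[OF mollifier_continuous, of \<delta>], of "-z"] mollifier_integral[OF assms, where 'a='a]
    by simp
  then have i: "integrable lborel (\<lambda>y. mollifier \<delta> (y - z))"
    using not_integrable_integral_eq by force
  have "integrable lborel (\<lambda>y. indicator (cbox a b) y * mollifier \<delta> (y - z))"
    using integrable_mult_indicator[OF _ i, of "cbox a b"] by simp
  then have "\<bar>\<integral>y. indicator (cbox a b) y * mollifier \<delta> (y - z) \<partial>lborel\<bar> \<le> (\<integral>y. mollifier \<delta> (y - z) \<partial>lborel)"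
    using mollifier_nonneg[OF assms]
    by (intro integral_abs_bound_integral i) (auto simp: indicator_def)
  then show ?thesis using tr by simp
qed

lemma cube_integral_mollified_tendsto:
  fixes f :: "'a::euclidean_space \<Rightarrow> 'b::euclidean_space"
  assumes f: "loc_int f"
  shows "(\<lambda>n. \<integral>y. indicator (cbox a b) y *\<^sub>R conv f (mollifier (1 / real (Suc n))) y \<partial>lborel)
      \<longlonglongrightarrow> (\<integral>y. indicator (cbox a b) y *\<^sub>R f y \<partial>lborel)"
proof -
  note [measurable] = loc_intD(1)[OF f]
  obtain R where R: "cbox a b \<subseteq> cball 0 R"
    by (rule cbox_subset_cball)
  define c where "c n z = (\<integral>y. indicator (cbox a b) y * mollifier (1 / real (Suc n)) (y - z) \<partial>lborel)" for n z
  have eq: "(\<integral>y. indicator (cbox a b) y *\<^sub>R conv f (mollifier (1 / real (Suc n))) y \<partial>lborel) = (\<integral>z. c n z *\<^sub>R f z \<partial>lborel)" for n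
    unfolding c_def using R
    by (intro integral_mult_conv[OF f, of _ 1 R]) (auto simp: indicator_def)
  have cs: "c n z = 0" if "norm z > R + 1" for n z
  proof -
    have "indicator (cbox a b) y * mollifier (1 / real (Suc n)) (y - z) = 0" for y
    proof (cases "y \<in> cbox a b")
      case True
      then have "norm y \<le> R" using R by auto
      then have "norm (y - z) \<ge> 1" using that norm_triangle_ineq2[of z y] by (simp add: norm_minus_commute)
      moreover have "1 / real (Suc n) \<le> 1" by simp
      ultimately have "mollifier (1 / real (Suc n)) (y - z) = 0" by (intro mollifier_support) (simp, linarith)
      then show ?thesis by simp
    qed simp
    then have "(\<lambda>y. indicator (cbox a b) y * mollifier (1 / real (Suc n)) (y - z)) = (\<lambda>_. 0)" by (rule ext)
    then show ?thesis unfolding c_def by (simp only: integral_zero)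
  qed
  have cm[measurable]: "c n \<in> borel_measurable borel" for n
    unfolding c_def 
    using borel_continuous[OF mollifier_continuous, measurable] by measurable
  have cb: "\<bar>c n z\<bar> \<le> 1" for n z unfolding c_def by (rule mollified_cube_bound) simp
  have "(\<lambda>n. \<integral>z. c n z *\<^sub>R f z \<partial>lborel) \<longlonglongrightarrow> (\<integral>y. indicator (cbox a b) y *\<^sub>R f y \<partial>lborel)"
  proof (rule integral_dominated_convergence[where w = "\<lambda>z. norm (indicator (cball 0 (R + 1)) z *\<^sub>R f z)"])
    show "(\<lambda>y. indicator (cbox a b) y *\<^sub>R f y) \<in> borel_measurable lborel" by measurable
    show "(\<lambda>z. c n z *\<^sub>R f z) \<in> borel_measurable lborel" for n by measurable
    show "integrable lborel (\<lambda>z. norm (indicator (cball 0 (R + 1)) z *\<^sub>R f z))"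
      by (intro integrable_norm loc_intD(2)[OF f])
    have "cbox a b - box a b \<in> null_sets lborel"
      using negligible_frontier_interval[of a b] by (auto simp: negligible_iff_null_sets null_sets_completion_iff)
    then have "AE z in lborel. z \<notin> cbox a b - box a b" by (rule AE_not_in)
    then show "AE z in lborel. (\<lambda>n. c n z *\<^sub>R f z) \<longlonglongrightarrow> indicator (cbox a b) z *\<^sub>R f z"
    proof eventually_elim
      case (elim z)
      show ?case unfolding c_def by (intro tendsto_scaleR mollified_cube_tendsto[OF elim] tendsto_const)
    qed
    show "AE z in lborel. norm (c n z *\<^sub>R f z) \<le> norm (indicator (cball 0 (R + 1)) z *\<^sub>R f z)" for n
      using cb[of n] cs[of _ n] by (intro AE_I2) (auto simp: indicator_def mult_left_le_one_le)
  qed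
  then show ?thesis unfolding eq .
qed

text \<open>Lebesgue differentiation along the boxes that have x as a corner: almost every value of
  h is a limit of averages, all of which vanish once the box fits into S.\<close>

lemma AE_zero_of_cube_integrals:
  fixes h :: "'a::euclidean_space \<Rightarrow> 'b::euclidean_space"
  assumes h: "loc_int h" and S: "open S"
    and z: "\<And>a b. cbox a b \<subseteq> S \<Longrightarrow> (\<integral>y. indicator (cbox a b) y *\<^sub>R h y \<partial>lborel) = 0"
  shows "AE x in lebesgue. x \<in> S \<longrightarrow> h x = 0"
proof -
  have si: "set_integrable lborel (cbox a b) h" for a b
  proof -
    obtain R where R: "cbox a b \<subseteq> cball 0 R"
      by (rule cbox_subset_cball)
    have "integrable lborel (\<lambda>x. indicator (cbox a b) x *\<^sub>R (indicator (cball 0 R) x *\<^sub>R h x))"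
      by (intro integrable_mult_indicator loc_intD(2)[OF h]) auto
    also have "(\<lambda>x. indicator (cbox a b) x *\<^sub>R (indicator (cball 0 R) x *\<^sub>R h x)) = (\<lambda>x. indicator (cbox a b) x *\<^sub>R h x)"
      using R by (auto simp: indicator_def fun_eq_iff)
    finally show ?thesis by (simp add: set_integrable_def)
  qed
  have io: "h integrable_on cbox a b" for a b using set_borel_integral_eq_integral(1)[OF si] .
  have i0: "integral (cbox a b) h = 0" if "cbox a b \<subseteq> S" for a b
    using set_borel_integral_eq_integral(2)[OF si, of a b] z[OF that] by (simp add: set_lebesgue_integral_def)
  obtain N where N: "negligible N" "\<And>x e. x \<notin> N \<Longrightarrow> 0 < e \<Longrightarrow>
       \<exists>d>0. \<forall>k. 0 < k \<and> k < d \<longrightarrow> norm (integral (cbox x (x + k *\<^sub>R One)) h /\<^sub>R k ^ DIM('a) - h x) < e"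
    using integrable_ccontinuous_explicit[OF io] by blast
  have "AE x in lebesgue. x \<notin> N" using N(1) by (intro AE_not_in) (simp add: negligible_iff_null_sets)
  then show ?thesis
  proof eventually_elim
    case (elim x)
    show ?case
    proof (intro impI, rule ccontr)
      assume x: "x \<in> S" "h x \<noteq> 0"
      obtain d where d: "d > 0" "\<And>k. 0 < k \<Longrightarrow> k < d \<Longrightarrow> norm (integral (cbox x (x + k *\<^sub>R One)) h /\<^sub>R k ^ DIM('a) - h x) < norm (h x)"
        using N(2)[OF elim, of "norm (h x)"] x by auto
      obtain e where e: "e > 0" "ball x e \<subseteq> S" using S x by (meson openE)
      \<comment> \<open>The diameter of the box is bounded through the l1 norm, hence the dimension
        in the denominator; the 2 makes the inclusion in the open ball strict.\<close>
      define k where "k = min (d / 2) (e / (2 * real DIM('a)))"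
      have k: "0 < k" "k < d" "k * real DIM('a) < e"
      proof -
        show "0 < k" "k < d" using d(1) e(1) by (auto simp: k_def min_def)
        have "k * real DIM('a) \<le> e / (2 * real DIM('a)) * real DIM('a)" by (intro mult_right_mono) (auto simp: k_def)
        also have "\<dots> < e" using e(1) by simp
        finally show "k * real DIM('a) < e" .
      qed
      have "cbox x (x + k *\<^sub>R One) \<subseteq> ball x e"
      proof
        fix y assume y: "y \<in> cbox x (x + k *\<^sub>R One)"
        have "norm (y - x) \<le> (\<Sum>b\<in>Basis. \<bar>(y - x) \<bullet> b\<bar>)" by (rule norm_le_l1)
        also have "\<dots> \<le> (\<Sum>b\<in>(Basis::'a set). k)"
          using y by (intro sum_mono) (auto simp: mem_box inner_diff_left inner_add_left)
        finally show "y \<in> ball x e" using k(3) by (simp add: dist_norm norm_minus_commute mult.commute)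
      qed
      then have "integral (cbox x (x + k *\<^sub>R One)) h = 0" using e(2) by (intro i0) auto
      then show False using d(2)[OF k(1,2)] by simp
    qed
  qed
qed

text \<open>Integrals over a box of finer and finer mollifications are eventually those of the one
  at scale \<delta>, because inside the smaller ball the scale does not matter; they also converge
  to the integral of f. So f and its mollification have equal box integrals.\<close>

lemma Weyl_mollifier_AE:
  fixes f :: "complex^'n \<Rightarrow> complex"
  assumes f: "loc_int f" 
    and hol: "\<And>\<delta> x j. 0 < \<delta> \<Longrightarrow> x \<in> ball w (R - \<delta>) \<Longrightarrow> wzbar j (conv f (mollifier \<delta>)) x = 0"
    and \<delta>: "0 < \<delta>" "\<delta> < R / 4"
  shows "AE x in lebesgue. x \<in> ball w (R / 2) \<longrightarrow> f x = conv f (mollifier \<delta>) x"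
proof -
  let ?F = "conv f (mollifier \<delta>)"
  have lF: "loc_int ?F" by (intro continuous_loc_int smooth_continuous conv_mollifier_smooth f \<delta>)
  have lh: "loc_int (\<lambda>x. f x - ?F x)"
    using loc_intD[OF f] loc_intD[OF lF] by (auto simp: loc_int_def scaleR_diff_right)
  have "AE x in lebesgue. x \<in> ball w (R / 2) \<longrightarrow> f x - ?F x = 0"
  proof (rule AE_zero_of_cube_integrals[OF lh open_ball])
    fix a b assume Q: "cbox a b \<subseteq> ball w (R / 2)"
    have i: "integrable lborel (\<lambda>y. indicator (cbox a b) y *\<^sub>R g y)" if "loc_int g" for g :: "complex^'n \<Rightarrow> complex"
    proof -
      obtain r where r: "cbox a b \<subseteq> cball 0 r"
        by (rule cbox_subset_cball)
      show ?thesis using r by (intro loc_int_mult_support[OF that, of _ 1 r]) (auto simp: indicator_def)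
    qed
    obtain N :: nat where N: "1 / real (Suc N) < R / 4" using \<delta> by (metis nat_approx_posE order_less_trans)
    have "(\<integral>y. indicator (cbox a b) y *\<^sub>R conv f (mollifier (1 / real (Suc n))) y \<partial>lborel)
        = (\<integral>y. indicator (cbox a b) y *\<^sub>R ?F y \<partial>lborel)" if "n \<ge> N" for n
    proof (rule Bochner_Integration.integral_cong[OF refl])
      fix y :: "complex^'n"
      have d: "1 / real (Suc n) < R / 4" using N that frac_le[of 1 1 "real (Suc N)" "real (Suc n)"] by simp
      show "indicator (cbox a b) y *\<^sub>R conv f (mollifier (1 / real (Suc n))) y = indicator (cbox a b) y *\<^sub>R ?F y"
      proof (cases "y \<in> cbox a b")
        case True
        then have "dist w y < R / 2" using Q by auto
        then have "y \<in> ball w (R - 1 / real (Suc n) - \<delta>)" using d \<delta> by (simp del: of_nat_Suc)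
        then show ?thesis using conv_mollifier_indep[OF f hol _ \<delta>(1)] by simp
      qed simp
    qed
    then have "(\<lambda>n. \<integral>y. indicator (cbox a b) y *\<^sub>R conv f (mollifier (1 / real (Suc n))) y \<partial>lborel)
        \<longlonglongrightarrow> (\<integral>y. indicator (cbox a b) y *\<^sub>R ?F y \<partial>lborel)"
      by (intro tendsto_eventually eventually_sequentiallyI[of N]) auto
    from LIMSEQ_unique[OF this cube_integral_mollified_tendsto[OF f]]
    show "(\<integral>y. indicator (cbox a b) y *\<^sub>R (f y - ?F y) \<partial>lborel) = 0"
      unfolding scaleR_diff_right using i[OF f] i[OF lF] by simp
  qed
  then show ?thesis by eventually_elim simp
qed

lemma wzbar_of_real_reflected:
  assumes s: "smooth_fun \<xi>"
  shows "wzbar j (\<lambda>y. complex_of_real (\<xi> (x - y))) y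
     = - (of_real (frechet_derivative \<xi> (at (x - y)) (axis j 1)) + \<i> * of_real (frechet_derivative \<xi> (at (x - y)) (axis j \<i>))) / 2"
proof -
  have "((\<lambda>y. x - y) has_derivative (\<lambda>v. - v)) (at y)" by (auto intro!: derivative_eq_intros)
  from has_derivative_compose[OF this smooth_has_derivative[OF s]]
  have "((\<lambda>y. complex_of_real (\<xi> (x - y))) has_derivative (\<lambda>v. complex_of_real (frechet_derivative \<xi> (at (x - y)) (- v)))) (at y)"
    by (rule has_derivative_of_real)
  from frechet_derivative_at[OF this, symmetric]
  have d: "frechet_derivative (\<lambda>y. complex_of_real (\<xi> (x - y))) (at y) v = - of_real (frechet_derivative \<xi> (at (x - y)) v)" for v
    by (simp add: linear_neg[OF has_derivative_linear[OF smooth_has_derivative[OF s]]])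
  show ?thesis unfolding wzbar_def d by (simp add: field_simps)
qed

lemma test_fun_reflected_mollifier:
  assumes "\<delta> > 0"
  shows "test_fun (\<lambda>y. complex_of_real (mollifier \<delta> (x - y)))"
  unfolding test_fun_def
proof
  have "smooth_fun (\<lambda>y. mollifier \<delta> (- y + x))"
    by (rule smooth_affine[OF bounded_linear_minus[OF bounded_linear_ident] smooth_mollifier])
  from smooth_comp_linear[OF bounded_linear_of_real this]
  show "smooth_fun (\<lambda>y. complex_of_real (mollifier \<delta> (x - y)))" by simp
  have "{y. complex_of_real (mollifier \<delta> (x - y)) \<noteq> 0} \<subseteq> ball x \<delta>"
  proof
    fix y assume "y \<in> {y. complex_of_real (mollifier \<delta> (x - y)) \<noteq> 0}"
    then have "\<not> norm (x - y) \<ge> \<delta>" using mollifier_support[OF assms, of "x - y"] by auto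
    then show "y \<in> ball x \<delta>" by (simp add: dist_norm)
  qed
  then show "bounded {y. complex_of_real (mollifier \<delta> (x - y)) \<noteq> 0}" using bounded_ball bounded_subset by blast
qed

text \<open>The weak equation is tested against the mollifier centred at x. Reflecting the argument
  changes the sign of the derivative, which cancels the sign in the weak formulation.\<close>

lemma wzbar_mollify:
  fixes f g :: "complex^'n \<Rightarrow> complex"
  assumes f: "loc_int f" and \<delta>: "\<delta> > 0"
    and weak: "\<And>\<psi>. test_fun \<psi> \<Longrightarrow> (\<integral>z. f z * wzbar j \<psi> z \<partial>lborel) = - (\<integral>z. g z * \<psi> z \<partial>lborel)"
  shows "wzbar j (conv f (mollifier \<delta>)) x = conv g (mollifier \<delta>) x"
proof -
  let ?m = "mollifier \<delta> :: complex^'n \<Rightarrow> real"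
  let ?D = "\<lambda>v x. frechet_derivative ?m (at x) v"
  have s: "?m x = 0" if "norm x > \<delta>" for x by (rule mollifier_support[OF \<delta> less_imp_le[OF that]])
  have C: "Ck 2 ?m" by (rule smooth_funD[OF smooth_mollifier])
  have "(conv f ?m has_derivative (\<lambda>v. conv f (?D v) x)) (at x)"
    by (rule conv_has_derivative[where R = \<delta>, OF f C]) (rule s)
  then have d: "frechet_derivative (conv f ?m) (at x) v = conv f (?D v) x" for v
    using fun_cong[OF frechet_derivative_at] by metis
  have i: "integrable lborel (\<lambda>y. ?D v (x - y) *\<^sub>R f y)" for v
    by (rule conv_integrable[OF f smooth_continuous[OF smooth_fun_derivative[OF smooth_mollifier]] derivative_support[OF s]])
  have "wzbar j (conv f ?m) x = (\<integral>y. (?D (axis j 1) (x - y) *\<^sub>R f y + \<i> * (?D (axis j \<i>) (x - y) *\<^sub>R f y)) / 2 \<partial>lborel)"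
    unfolding wzbar_def d conv_def
    by (simp only: integral_divide_zero integral_mult_right_zero
        Bochner_Integration.integral_add[OF i integrable_mult_right[OF i]])
  also have "\<dots> = (\<integral>y. - (f y * wzbar j (\<lambda>y. complex_of_real (?m (x - y))) y) \<partial>lborel)"
    unfolding wzbar_of_real_reflected[OF smooth_mollifier]
    by (rule Bochner_Integration.integral_cong[OF refl]) (simp add: scaleR_conv_of_real field_simps)
  also have "\<dots> = (\<integral>y. g y * complex_of_real (?m (x - y)) \<partial>lborel)"
    using weak[OF test_fun_reflected_mollifier[OF \<delta>], of x] by simp
  also have "\<dots> = conv g ?m x" by (simp add: conv_def scaleR_conv_of_real mult.commute)
  finally show ?thesis .
qed

subsection \<open>The distance of a radius function\<close>

text \<open>At the break points \<open>vector_derivative\<close> has an unspecified value, and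
  outside the interval nothing is known. Cutting the velocity off to the good set gives a Borel
  function that agrees with it almost everywhere on the interval.\<close>

lemma piecewise_C1_speed_measurable:
  fixes \<gamma> :: "real \<Rightarrow> 'a::euclidean_space"
  assumes "\<gamma> piecewise_C1_differentiable_on {a..b}"
  obtains S where "finite S"
    "(\<lambda>t. indicator ({a..b} - S) t *\<^sub>R vector_derivative \<gamma> (at t)) \<in> borel_measurable lborel"
    "\<And>t. t \<in> {a..b} - S \<Longrightarrow> (\<gamma> has_vector_derivative vector_derivative \<gamma> (at t)) (at t)"
proof -
  obtain S where S: "finite S" "\<gamma> C1_differentiable_on ({a..b} - S)"
    using assms by (auto simp: piecewise_C1_differentiable_on_def)
  have "{a..b} - S \<in> sets borel" using finite_imp_closed[OF S(1)] by auto
  moreover have "continuous_on ({a..b} - S) (\<lambda>t. vector_derivative \<gamma> (at t))"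
    using S(2) by (simp add: C1_differentiable_on_eq)
  ultimately have "(\<lambda>t. indicator ({a..b} - S) t *\<^sub>R vector_derivative \<gamma> (at t)) \<in> borel_measurable borel"
    by (rule borel_measurable_continuous_on_indicator)
  moreover have "(\<gamma> has_vector_derivative vector_derivative \<gamma> (at t)) (at t)" if "t \<in> {a..b} - S" for t
    using S(2) that by (simp add: C1_differentiable_on_eq vector_derivative_works)
  ultimately show ?thesis using that[OF S(1)] by simp
qed

text \<open>Only finite speed integrals need an argument: then the velocity is integrable, and the
  fundamental theorem with finitely many exceptions identifies its integral with the
  displacement.\<close>

lemma displacement_le_speed_integral:
  fixes \<gamma> :: "real \<Rightarrow> 'a::euclidean_space"
  assumes g: "\<gamma> piecewise_C1_differentiable_on {a..b}" and ab: "a \<le> b"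
  shows "ennreal (norm (\<gamma> b - \<gamma> a)) \<le> (\<integral>\<^sup>+t\<in>{a..b}. ennreal (norm (vector_derivative \<gamma> (at t))) \<partial>lborel)"
proof -
  obtain S where S: "finite S"
    "(\<lambda>t. indicator ({a..b} - S) t *\<^sub>R vector_derivative \<gamma> (at t)) \<in> borel_measurable lborel"
    "\<And>t. t \<in> {a..b} - S \<Longrightarrow> (\<gamma> has_vector_derivative vector_derivative \<gamma> (at t)) (at t)"
    using piecewise_C1_speed_measurable[OF g] by metis
  define G where "G t = indicator ({a..b} - S) t *\<^sub>R vector_derivative \<gamma> (at t)" for t
  have Gm[measurable]: "G \<in> borel_measurable lborel" unfolding G_def[abs_def] by (rule S(2))
  have le: "(\<integral>\<^sup>+t. ennreal (norm (G t)) \<partial>lborel) \<le> (\<integral>\<^sup>+t\<in>{a..b}. ennreal (norm (vector_derivative \<gamma> (at t))) \<partial>lborel)"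
    by (intro nn_integral_mono) (auto simp: G_def indicator_def)
  show ?thesis
  proof (cases "(\<integral>\<^sup>+t. ennreal (norm (G t)) \<partial>lborel) = \<infinity>")
    case True
    then show ?thesis using le by (simp add: top_unique)
  next
    case False
    then have iG: "integrable lborel G" by (auto intro!: integrableI_bounded simp: less_top)
    have "((\<lambda>t. vector_derivative \<gamma> (at t)) has_integral (\<gamma> b - \<gamma> a)) {a..b}"
      using g S(3) ab
      by (intro fundamental_theorem_of_calculus_interior_strong[OF S(1)])
         (auto simp: piecewise_C1_differentiable_on_def)
    then have "(G has_integral (\<gamma> b - \<gamma> a)) {a..b}"
      by (rule has_integral_spike_finite[OF S(1), rotated]) (auto simp: G_def)
    then have "(G has_integral (\<gamma> b - \<gamma> a)) UNIV"
      by (rule has_integral_on_superset) (auto simp: G_def)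
    from has_integral_unique[OF this has_integral_integral_lborel[OF iG]]
    have "norm (\<gamma> b - \<gamma> a) \<le> (\<integral>t. norm (G t) \<partial>lborel)" by simp
    then have "ennreal (norm (\<gamma> b - \<gamma> a)) \<le> ennreal (\<integral>t. norm (G t) \<partial>lborel)" by (rule ennreal_leI)
    also have "\<dots> = (\<integral>\<^sup>+t. ennreal (norm (G t)) \<partial>lborel)"
      using iG by (intro nn_integral_eq_integral[symmetric]) auto
    finally show ?thesis using le by (rule order_trans)
  qed
qed

lemma curve_len_ge:
  fixes \<gamma> :: "real \<Rightarrow> 'a::euclidean_space"
  assumes g: "\<gamma> piecewise_C1_differentiable_on {a..b}" and ab: "a \<le> b"
    and K: "K > 0" "\<And>t. t \<in> {a..b} \<Longrightarrow> 0 < \<kappa> (\<gamma> t) \<and> \<kappa> (\<gamma> t) \<le> K"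
  shows "ennreal (norm (\<gamma> b - \<gamma> a) / K) \<le> curve_len \<kappa> \<gamma> a b"
proof -
  obtain S where S: "finite S"
    "(\<lambda>t. indicator ({a..b} - S) t *\<^sub>R vector_derivative \<gamma> (at t)) \<in> borel_measurable lborel"
    using piecewise_C1_speed_measurable[OF g] by metis
  define G where "G t = indicator ({a..b} - S) t *\<^sub>R vector_derivative \<gamma> (at t)" for t
  have Gm[measurable]: "G \<in> borel_measurable lborel" unfolding G_def[abs_def] by (rule S(2))
  have "AE t in lborel. t \<notin> S" using finite_imp_null_set_lborel[OF S(1)] by (rule AE_not_in)
  then have "(\<integral>\<^sup>+t\<in>{a..b}. ennreal (norm (vector_derivative \<gamma> (at t))) \<partial>lborel) = (\<integral>\<^sup>+t. ennreal (norm (G t)) \<partial>lborel)"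
    by (intro nn_integral_cong_AE, eventually_elim) (auto simp: G_def indicator_def)
  with displacement_le_speed_integral[OF g ab]
  have "ennreal (norm (\<gamma> b - \<gamma> a)) \<le> (\<integral>\<^sup>+t. ennreal (norm (G t)) \<partial>lborel)" by simp
  then have "ennreal (1 / K) * ennreal (norm (\<gamma> b - \<gamma> a)) \<le> ennreal (1 / K) * (\<integral>\<^sup>+t. ennreal (norm (G t)) \<partial>lborel)"
    by (rule mult_left_mono) simp
  also have "\<dots> = (\<integral>\<^sup>+t. ennreal (1 / K) * ennreal (norm (G t)) \<partial>lborel)"
    by (rule nn_integral_cmult[symmetric]) simp
  also have "\<dots> \<le> curve_len \<kappa> \<gamma> a b"
    unfolding curve_len_def
  proof (intro nn_integral_mono)
    fix t
    show "ennreal (1 / K) * ennreal (norm (G t)) \<le> ennreal (norm (vector_derivative \<gamma> (at t)) / \<kappa> (\<gamma> t)) * indicator {a..b} t"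
    proof (cases "t \<in> {a..b} - S")
      case True
      then have "norm (vector_derivative \<gamma> (at t)) / K \<le> norm (vector_derivative \<gamma> (at t)) / \<kappa> (\<gamma> t)"
        using K(2)[of t] by (intro divide_left_mono) auto
      then show ?thesis using True K(1) by (simp add: G_def ennreal_mult[symmetric] ennreal_leI)
    next
      case False
      then show ?thesis by (simp add: G_def)
    qed
  qed
  finally show ?thesis using K(1) by (simp add: ennreal_mult[symmetric])
qed

lemma curve_len_mono: "c \<le> b \<Longrightarrow> curve_len \<kappa> \<gamma> a c \<le> curve_len \<kappa> \<gamma> a b"
  unfolding curve_len_def by (intro nn_integral_mono) (auto simp: indicator_def)

text \<open>The curve is stopped at its first time at distance s from the start. Until then it stays
  where \<kappa> is at most K, and its displacement is already s.\<close>

lemma curve_len_exit: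
  fixes \<gamma> :: "real \<Rightarrow> 'a::euclidean_space"
  assumes g: "\<gamma> piecewise_C1_differentiable_on {a..b}" and ab: "a \<le> b"
    and s: "s > 0" "norm (\<gamma> b - \<gamma> a) \<ge> s"
    and K: "K > 0" "\<And>y. norm (y - \<gamma> a) \<le> s \<Longrightarrow> 0 < \<kappa> y \<and> \<kappa> y \<le> K"
  shows "ennreal (s / K) \<le> curve_len \<kappa> \<gamma> a b"
proof -
  have cg: "continuous_on {a..b} \<gamma>" using g by (simp add: piecewise_C1_differentiable_on_def)
  define f where "f t = norm (\<gamma> t - \<gamma> a)" for t
  have cf: "continuous_on {a..b} f" unfolding f_def[abs_def] by (intro continuous_intros cg)
  define T where "T = {t\<in>{a..b}. s \<le> f t}"
  have "closed T" unfolding T_def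
    by (intro continuous_on_closed_Collect_le continuous_intros cf closed_atLeastAtMost)
  moreover have bT: "b \<in> T" using ab s by (simp add: T_def f_def)
  moreover have bd: "bdd_below T" unfolding T_def by (auto intro!: bdd_belowI[of _ a])
  ultimately have t1: "Inf T \<in> T" by (intro closed_contains_Inf) auto
  define t1 where "t1 = Inf T"
  have t1T: "a \<le> t1" "t1 \<le> b" "s \<le> f t1" using t1 by (auto simp: T_def t1_def)
  \<comment> \<open>A time before \<open>t1\<close> with distance beyond s would, by the
    intermediate value theorem, be preceded by one at distance exactly s, contradicting that
    \<open>t1\<close> is the infimum.\<close>
  have min: "f t \<le> s" if at: "a \<le> t" "t \<le> t1" for t
  proof (rule ccontr)
    assume c: "\<not> f t \<le> s"
    have "continuous_on {a..t} f" using that t1T by (intro continuous_on_subset[OF cf]) auto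
    then obtain t0 where t0: "a \<le> t0" "t0 \<le> t" "f t0 = s"
      using IVT'[of f a s t] c s at by (auto simp: f_def)
    have "t0 \<noteq> t" using t0 c by auto
    then have "t0 < t1" using t0 that by simp
    moreover have "t0 \<in> T" using t0 that t1T by (simp add: T_def)
    ultimately show False using cInf_lower[OF _ bd, of t0] by (simp add: t1_def)
  qed
  have "ennreal (norm (\<gamma> t1 - \<gamma> a) / K) \<le> curve_len \<kappa> \<gamma> a t1"
    using t1T K min
    by (intro curve_len_ge piecewise_C1_differentiable_on_subset[OF g]) (auto simp: f_def)
  moreover have "s / K \<le> norm (\<gamma> t1 - \<gamma> a) / K" using t1T(3) K(1) by (simp add: f_def divide_right_mono)
  ultimately show ?thesis using curve_len_mono[OF t1T(2), of \<kappa> \<gamma> a] by (meson ennreal_leI order_trans)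
qed

text \<open>A triangle inequality for straight final pieces, which is all that local Lipschitz
  continuity of the distance needs. The segment is run through in unit time, so its speed is its
  length.\<close>

lemma curve_len_append_segment:
  fixes \<gamma> :: "real \<Rightarrow> 'a::euclidean_space"
  assumes \<kappa>: "\<kappa> \<in> borel_measurable borel" and g: "\<gamma> piecewise_C1_differentiable_on {a..b}" and ab: "a \<le> b"
    and k: "k > 0" "\<And>t. 0 \<le> t \<Longrightarrow> t \<le> 1 \<Longrightarrow> k \<le> \<kappa> (\<gamma> b + t *\<^sub>R (y - \<gamma> b))"
  shows "\<exists>\<gamma>'. \<gamma>' piecewise_C1_differentiable_on {a..b+1} \<and> \<gamma>' a = \<gamma> a \<and> \<gamma>' (b+1) = y \<and>
     curve_len \<kappa> \<gamma>' a (b+1) \<le> curve_len \<kappa> \<gamma> a b + ennreal (norm (y - \<gamma> b) / k)"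
proof -
  define l where "l t = \<gamma> b + (t - b) *\<^sub>R (y - \<gamma> b)" for t
  define \<gamma>' where "\<gamma>' t = (if t \<le> b then \<gamma> t else l t)" for t
  have l: "(l has_vector_derivative (y - \<gamma> b)) (at t)" for t
    unfolding l_def[abs_def] by (auto intro!: derivative_eq_intros)
  have lC: "l piecewise_C1_differentiable_on {b..b+1}"
    by (intro C1_differentiable_imp_piecewise) (auto simp: C1_differentiable_on_def intro!: exI[of _ "\<lambda>_. y - \<gamma> b"] l)
  have pw: "\<gamma>' piecewise_C1_differentiable_on {a..b+1}"
    unfolding \<gamma>'_def[abs_def] using ab by (intro piecewise_C1_differentiable_cases g lC) (auto simp: l_def)
  obtain S where S: "finite S"
    "(\<lambda>t. indicator ({a..b} - S) t *\<^sub>R vector_derivative \<gamma> (at t)) \<in> borel_measurable lborel"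
    using piecewise_C1_speed_measurable[OF g] by metis
  define G where "G t = indicator ({a..b} - S) t *\<^sub>R vector_derivative \<gamma> (at t)" for t
  have Gm[measurable]: "G \<in> borel_measurable lborel" unfolding G_def[abs_def] by (rule S(2))
  \<comment> \<open>Outside \<open>{a..b}\<close> the curve is arbitrary, so it is cut off before
    composing with \<kappa> in order to obtain a Borel integrand on the whole line.\<close>
  define P where "P t = indicator {a..b} t *\<^sub>R \<gamma> t" for t
  have Pm[measurable]: "P \<in> borel_measurable borel" unfolding P_def[abs_def]
    using g by (intro borel_measurable_continuous_on_indicator) (auto simp: piecewise_C1_differentiable_on_def)
  note \<kappa>[measurable]
  define F where "F t = ennreal (norm (G t) / \<kappa> (P t)) * indicator {a..b} t" for t
  have Fm[measurable]: "F \<in> borel_measurable lborel" unfolding F_def[abs_def] by measurable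
  have nS: "AE t in lborel. t \<notin> insert b S" 
    using S(1) by (intro AE_not_in finite_imp_null_set_lborel) simp
  have lenF: "curve_len \<kappa> \<gamma> a b = (\<integral>\<^sup>+t. F t \<partial>lborel)"
    unfolding curve_len_def using nS
    by (intro nn_integral_cong_AE, eventually_elim) (auto simp: F_def G_def P_def indicator_def)
  have "curve_len \<kappa> \<gamma>' a (b+1) \<le> (\<integral>\<^sup>+t. F t + ennreal (norm (y - \<gamma> b) / k) * indicator {b..b+1} t \<partial>lborel)"
    unfolding curve_len_def using nS
  proof (intro nn_integral_mono_AE, eventually_elim)
    case (elim t)
    consider "t < a" | "a \<le> t" "t < b" | "b < t" "t \<le> b + 1" | "b + 1 < t" using elim by force
    then show ?case
    proof cases
      case 2
      have "\<forall>\<^sub>F x in nhds t. \<gamma>' x = \<gamma> x"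
        using eventually_nhds_in_open[of "{..<b}" t] 2 by (auto elim!: eventually_mono simp: \<gamma>'_def)
      then have "vector_derivative \<gamma>' (at t) = vector_derivative \<gamma> (at t)"
        by (intro vector_derivative_cong_eq) auto
      then show ?thesis using 2 elim by (simp add: F_def G_def P_def \<gamma>'_def)
    next
      case 3
      have "(\<gamma>' has_vector_derivative (y - \<gamma> b)) (at t)"
        by (rule has_vector_derivative_transform_within_open[OF l open_greaterThan[of b]]) (use 3 in \<open>auto simp: \<gamma>'_def\<close>)
      then have v: "vector_derivative \<gamma>' (at t) = y - \<gamma> b" by (rule vector_derivative_at)
      have "k \<le> \<kappa> (\<gamma>' t)" using k(2)[of "t - b"] 3 by (simp add: \<gamma>'_def l_def)
      then have "norm (y - \<gamma> b) / \<kappa> (\<gamma>' t) \<le> norm (y - \<gamma> b) / k" using k(1) by (intro divide_left_mono) auto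
      then show ?thesis using 3 ab by (simp add: v F_def ennreal_leI)
    qed (use ab in \<open>auto simp: F_def\<close>)
  qed
  also have "\<dots> = curve_len \<kappa> \<gamma> a b + ennreal (norm (y - \<gamma> b) / k)"
    unfolding lenF by (subst nn_integral_add) (auto simp: nn_integral_cmult_indicator)
  finally show ?thesis using pw ab by (intro exI[of _ \<gamma>']) (auto simp: \<gamma>'_def l_def)
qed

locale radius_function =
  fixes \<kappa> :: "'a::euclidean_space \<Rightarrow> real" and C K :: real
  assumes meas: "\<kappa> \<in> borel_measurable borel" and pos: "\<And>x. 0 < \<kappa> x" and le_K: "\<And>x. \<kappa> x \<le> K"
    and C: "\<And>x y. dist y x < \<kappa> x \<Longrightarrow> \<kappa> x / C \<le> \<kappa> y \<and> \<kappa> y \<le> C * \<kappa> x"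
begin

lemma K_pos: "K > 0" using pos le_K order_less_le_trans by blast

lemma C_ge_1: "C \<ge> 1"
  using C[of undefined undefined] pos[of undefined] by simp

text \<open>A radius function may be discontinuous, but on the ball of radius \<kappa>(x) about x it
  is at least \<kappa>(x)/C; finitely many such balls cover a compact set.\<close>

lemma compact_lower_bound:
  assumes "compact S" obtains k where "k > 0" "\<And>x. x \<in> S \<Longrightarrow> k \<le> \<kappa> x"
proof -
  have "S \<subseteq> (\<Union>x\<in>S. ball x (\<kappa> x))" using pos by auto
  then obtain T where T: "T \<subseteq> S" "finite T" "S \<subseteq> (\<Union>x\<in>T. ball x (\<kappa> x))"
    using compactE_image[OF assms, of S "\<lambda>x. ball x (\<kappa> x)"] by auto
  \<comment> \<open>The inserted 1 keeps the minimum meaningful when the subcover is empty.\<close>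
  define k where "k = Min (insert 1 (\<kappa> ` T)) / C"
  have "k > 0" unfolding k_def using T(2) pos C_ge_1 by (subst Min_gr_iff[symmetric, THEN iffD1] | simp)+
  moreover have "k \<le> \<kappa> x" if xS: "x \<in> S" for x
  proof -
    obtain y where "y \<in> T" "x \<in> ball y (\<kappa> y)" using T(3) xS by blast
    then have y: "y \<in> T" "dist y x < \<kappa> y" by simp_all
    have "k \<le> \<kappa> y / C" unfolding k_def using T(2) y(1) C_ge_1 by (intro divide_right_mono Min_le) auto
    also have "\<dots> \<le> \<kappa> x" using C[of x y] y(2) by (simp add: dist_commute)
    finally show ?thesis .
  qed
  ultimately show ?thesis using that by blast
qed

abbreviation paths :: "'a \<Rightarrow> 'a \<Rightarrow> ((real \<Rightarrow> 'a) \<times> real \<times> real) set" where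
  "paths x y \<equiv> {(\<gamma>, a, b). a \<le> b \<and> \<gamma> piecewise_C1_differentiable_on {a..b} \<and> \<gamma> a = x \<and> \<gamma> b = y}"

abbreviation dinf :: "'a \<Rightarrow> 'a \<Rightarrow> ennreal" where
  "dinf x y \<equiv> (INF (\<gamma>, a, b) \<in> paths x y. curve_len \<kappa> \<gamma> a b)"

lemma dinf_le: "a \<le> b \<Longrightarrow> \<gamma> piecewise_C1_differentiable_on {a..b} \<Longrightarrow> dinf (\<gamma> a) (\<gamma> b) \<le> curve_len \<kappa> \<gamma> a b"
  by (rule INF_lower2[of "(\<gamma>, a, b)"]) auto

lemma dinf_append:
  assumes k: "k > 0" "\<And>t. 0 \<le> t \<Longrightarrow> t \<le> 1 \<Longrightarrow> k \<le> \<kappa> (y + t *\<^sub>R (y' - y))"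
  shows "dinf x y' \<le> dinf x y + ennreal (norm (y' - y) / k)"
proof -
  have "dinf x y' \<le> curve_len \<kappa> \<gamma> a b + ennreal (norm (y' - y) / k)"
    if p: "(\<gamma>, a, b) \<in> paths x y" for \<gamma> a b
  proof -
    have g: "\<gamma> piecewise_C1_differentiable_on {a..b}" "a \<le> b" "\<gamma> a = x" "\<gamma> b = y" using p by auto
    obtain \<gamma>' where g': "\<gamma>' piecewise_C1_differentiable_on {a..b+1}" "\<gamma>' a = \<gamma> a" "\<gamma>' (b+1) = y'"
      "curve_len \<kappa> \<gamma>' a (b+1) \<le> curve_len \<kappa> \<gamma> a b + ennreal (norm (y' - \<gamma> b) / k)"
      using curve_len_append_segment[OF meas g(1,2) k(1), of y'] k(2) g(4) by auto
    have "dinf (\<gamma>' a) (\<gamma>' (b+1)) \<le> curve_len \<kappa> \<gamma>' a (b+1)" using g'(1) g(2) by (intro dinf_le) auto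
    then show ?thesis using g' g by (auto intro: order_trans)
  qed
  then have "dinf x y' - ennreal (norm (y' - y) / k) \<le> dinf x y"
    by (intro INF_greatest) (auto simp: ennreal_minus_le_iff add.commute)
  then show ?thesis by (simp add: ennreal_minus_le_iff add.commute)
qed

lemma dinf_refl: "dinf x x = 0"
proof -
  have "curve_len \<kappa> (\<lambda>_. x) 0 0 = 0" unfolding curve_len_def
    by (subst nn_integral_0_iff_AE) auto
  then show ?thesis using dinf_le[of 0 0 "\<lambda>_. x", OF order_refl C1_differentiable_imp_piecewise[OF C1_differentiable_on_const]]
    by simp
qed

text \<open>Essential because \<open>enn2real\<close> in \<open>d_rho\<close> would turn an infinite
  infimum into 0. The straight segment is compact, so \<kappa> is bounded below along it.\<close>

lemma dinf_finite: "dinf x y < \<infinity>"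
proof -
  obtain k where k: "k > 0" "\<And>p. p \<in> cball x (norm (y - x)) \<Longrightarrow> k \<le> \<kappa> p"
    using compact_lower_bound[OF compact_cball] by blast
  have "dinf x y \<le> dinf x x + ennreal (norm (y - x) / k)"
    by (rule dinf_append[OF k(1) k(2)]) (auto simp: dist_norm mult_left_le_one_le)
  then show ?thesis unfolding dinf_refl by (auto intro: le_less_trans)
qed

lemma d_rho_eq: "ennreal (d_rho \<kappa> x y) = dinf x y"
  unfolding d_rho_def using dinf_finite[of x y] by (simp add: less_top)

lemma d_rho_nonneg: "0 \<le> d_rho \<kappa> x y"
  by (simp add: d_rho_def)

lemma d_rho_append:
  assumes "dist y' y < \<kappa> y"
  shows "d_rho \<kappa> x y' \<le> d_rho \<kappa> x y + C * dist y' y / \<kappa> y"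
proof -
  have "ennreal (d_rho \<kappa> x y') \<le> ennreal (d_rho \<kappa> x y) + ennreal (norm (y' - y) / (\<kappa> y / C))"
    unfolding d_rho_eq
  proof (rule dinf_append)
    show "\<kappa> y / C > 0" using pos C_ge_1 by simp
    fix t :: real assume t: "0 \<le> t" "t \<le> 1"
    have "dist (y + t *\<^sub>R (y' - y)) y \<le> dist y' y" using t by (simp add: dist_norm mult_left_le_one_le)
    then show "\<kappa> y / C \<le> \<kappa> (y + t *\<^sub>R (y' - y))" using C assms by (meson le_less_trans)
  qed
  also have "\<dots> = ennreal (d_rho \<kappa> x y + norm (y' - y) / (\<kappa> y / C))"
    using d_rho_nonneg pos[of y] C_ge_1 by (intro ennreal_plus[symmetric]) auto
  finally show ?thesis
    using d_rho_nonneg[of x y] pos[of y] C_ge_1 by (subst (asm) ennreal_le_iff) (auto simp: dist_norm mult.commute)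
qed

text \<open>The segment is appended once at each end, with x kept fixed. The radius \<kappa>(y)/C
  ensures that y also lies within \<kappa>(y') of y'; the second C comes from expressing the bound
  at y' through \<kappa>(y).\<close>

lemma d_rho_local_Lipschitz:
  assumes "dist y y' < \<kappa> y / C"
  shows "\<bar>d_rho \<kappa> x y - d_rho \<kappa> x y'\<bar> \<le> C\<^sup>2 * dist y y' / \<kappa> y"
proof -
  have "\<kappa> y / C \<le> \<kappa> y" using pos[of y] C_ge_1 by (simp add: divide_le_eq)
  then have d: "dist y' y < \<kappa> y" using assms by (simp add: dist_commute)
  have k: "\<kappa> y / C \<le> \<kappa> y'" using C d by simp
  then have "d_rho \<kappa> x y \<le> d_rho \<kappa> x y' + C * dist y y' / \<kappa> y'" using assms by (intro d_rho_append) simp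
  also have "C * dist y y' / \<kappa> y' \<le> C * dist y y' / (\<kappa> y / C)"
    using k pos C_ge_1 by (intro divide_left_mono) auto
  finally have 1: "d_rho \<kappa> x y \<le> d_rho \<kappa> x y' + C\<^sup>2 * dist y y' / \<kappa> y"
    by (simp add: power2_eq_square mult_ac)
  have "d_rho \<kappa> x y' \<le> d_rho \<kappa> x y + C * dist y' y / \<kappa> y" using d by (rule d_rho_append)
  also have "C * dist y' y / \<kappa> y \<le> C\<^sup>2 * dist y y' / \<kappa> y"
    using C_ge_1 pos[of y] by (intro divide_right_mono) (auto simp: dist_commute power2_eq_square mult_right_mono)
  finally show ?thesis using 1 by linarith
qed

lemma d_rho_continuous: "continuous_on UNIV (d_rho \<kappa> x)"
  unfolding continuous_on_iff
proof (intro ballI allI impI)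
  fix y :: 'a and e :: real assume e: "e > 0"
  define d where "d = min (\<kappa> y / C) (e * \<kappa> y / C\<^sup>2)"
  have d: "d > 0" using e pos[of y] C_ge_1 by (simp add: d_def)
  moreover have "dist (d_rho \<kappa> x y') (d_rho \<kappa> x y) < e" if "dist y' y < d" for y'
  proof -
    have "\<bar>d_rho \<kappa> x y - d_rho \<kappa> x y'\<bar> \<le> C\<^sup>2 * dist y y' / \<kappa> y"
      using that by (intro d_rho_local_Lipschitz) (simp add: d_def dist_commute)
    also have "\<dots> < e"
    proof -
      have "dist y y' < e * \<kappa> y / C\<^sup>2" using that by (simp add: d_def dist_commute)
      then show ?thesis using pos[of y] C_ge_1 by (simp add: field_simps)
    qed
    finally show ?thesis by (simp add: dist_real_def abs_minus_commute)
  qed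
  ultimately show "\<exists>d>0. \<forall>y'\<in>UNIV. dist y' y < d \<longrightarrow> dist (d_rho \<kappa> x y') (d_rho \<kappa> x y) < e" by blast
qed

text \<open>A curve leaving the ball of radius \<kappa>(x)/2 covers that distance where \<kappa> is
  at most C \<kappa>(x). Contrapositively, balls of radius 1/(2C) for the distance lie in Euclidean
  balls; this fixes the support radius of the final theorem.\<close>

lemma d_rho_ge_exit:
  assumes "norm (y - x) \<ge> \<kappa> x / 2"
  shows "d_rho \<kappa> x y \<ge> 1 / (2 * C)"
proof -
  have "ennreal ((\<kappa> x / 2) / (C * \<kappa> x)) \<le> dinf x y"
  proof (rule INF_greatest)
    fix q assume "q \<in> paths x y"
    then obtain \<gamma> a b where p: "q = (\<gamma>, a, b)" "a \<le> b" "\<gamma> piecewise_C1_differentiable_on {a..b}" "\<gamma> a = x" "\<gamma> b = y"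
      by auto
    have "\<kappa> p \<le> C * \<kappa> x" if "norm (p - x) \<le> \<kappa> x / 2" for p
    proof -
      have "dist p x < \<kappa> x" using that pos[of x] by (simp add: dist_norm)
      then show ?thesis using C by blast
    qed
    then have "ennreal ((\<kappa> x / 2) / (C * \<kappa> x)) \<le> curve_len \<kappa> \<gamma> a b"
      using assms pos C_ge_1 by (intro curve_len_exit[OF p(3,2)]) (auto simp: p(4,5))
    then show "ennreal ((\<kappa> x / 2) / (C * \<kappa> x)) \<le> (case q of (\<gamma>, a, b) \<Rightarrow> curve_len \<kappa> \<gamma> a b)"
      by (simp add: p(1))
  qed
  then have "(\<kappa> x / 2) / (C * \<kappa> x) \<le> d_rho \<kappa> x y"
    unfolding d_rho_eq[symmetric] using d_rho_nonneg by (subst (asm) ennreal_le_iff) auto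
  then show ?thesis using pos[of x] by (simp add: field_simps)
qed

lemma d_rho_ge_norm: "norm (y - x) / K \<le> d_rho \<kappa> x y"
proof -
  have "ennreal (norm (y - x) / K) \<le> dinf x y"
    by (intro INF_greatest) (auto intro!: curve_len_ge K_pos pos le_K)
  then show ?thesis
    unfolding d_rho_eq[symmetric] using d_rho_nonneg by (subst (asm) ennreal_le_iff) auto
qed

end

section \<open>Smooth exponential weights\<close>

lemma derivative_le_local_Lipschitz:
  fixes f :: "'a::real_normed_vector \<Rightarrow> 'b::real_normed_vector"
  assumes D: "(f has_derivative D) (at x)" and d: "d > 0"
    and L: "\<And>h. norm h < d \<Longrightarrow> norm (f (x + h) - f x) \<le> L * norm h"
  shows "norm (D v) \<le> L * norm v"
proof (cases "v = 0")
  case True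
  then show ?thesis using linear_0[OF has_derivative_linear[OF D]] by simp
next
  case False
  have lin: "linear D" by (rule has_derivative_linear[OF D])
  show ?thesis
  proof (rule field_le_epsilon)
    fix e :: real assume e: "e > 0"
    define e' where "e' = e / norm v"
    have e': "e' > 0" using e False by (simp add: e'_def)
    obtain d' where d': "d' > 0" "\<And>y. norm (y - x) < d' \<Longrightarrow> norm (f y - f x - D (y - x)) \<le> e' * norm (y - x)"
      using D e' unfolding has_derivative_at_alt by blast
    define t where "t = min d d' / (2 * norm v)"
    have t: "t > 0" using d d'(1) False by (simp add: t_def)
    have "norm (t *\<^sub>R v) = min d d' / 2" using False d d'(1) by (simp add: t_def)
    also have "\<dots> < min d d'"
    proof -
      have "min d d' > 0" using d d'(1) by simp
      then show ?thesis by linarith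
    qed
    finally have tv: "norm (t *\<^sub>R v) < d" "norm (t *\<^sub>R v) < d'" by auto
    have "norm (D (t *\<^sub>R v)) \<le> norm (f (x + t *\<^sub>R v) - f x) + norm (f (x + t *\<^sub>R v) - f x - D (t *\<^sub>R v))"
      using norm_triangle_ineq4[of "f (x + t *\<^sub>R v) - f x" "f (x + t *\<^sub>R v) - f x - D (t *\<^sub>R v)"] by simp
    also have "\<dots> \<le> L * norm (t *\<^sub>R v) + e' * norm (t *\<^sub>R v)"
      using L[OF tv(1)] d'(2)[of "x + t *\<^sub>R v"] tv(2) by (intro add_mono) auto
    finally have "t * norm (D v) \<le> t * (L * norm v + e' * norm v)"
      using t by (simp add: linear_cmul[OF lin] algebra_simps)
    then have "norm (D v) \<le> L * norm v + e' * norm v" using t by simp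
    then show "norm (D v) \<le> L * norm v + e" using False by (simp add: e'_def)
  qed
qed

text \<open>The mollifier has mass 1 and sees only the \<delta>-ball. The comparison function is a
  constant when values are estimated, and a translate of the same function when derivatives
  are.\<close>

lemma mollify_local_oscillation:
  fixes F :: "'a::euclidean_space \<Rightarrow> real"
  assumes F: "continuous_on UNIV F" and \<delta>: "\<delta> > 0"
    and osc: "\<And>y. dist y x < \<delta> \<Longrightarrow> \<bar>F y - G y\<bar> \<le> e" and G: "continuous_on UNIV G"
  shows "\<bar>conv F (mollifier \<delta>) x - conv G (mollifier \<delta>) x\<bar> \<le> e"
proof -
  have c: "continuous_on UNIV (\<lambda>y. bump y * H (x + \<delta> *\<^sub>R y))" if "continuous_on UNIV H" for H :: "'a \<Rightarrow> real"
    by (rule continuous_on_mult[OF bump_continuous continuous_on_compose2[OF that]]) (auto intro!: continuous_intros)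
  have i: "integrable lborel (\<lambda>y. bump y * H (x + \<delta> *\<^sub>R y))" if "continuous_on UNIV H" for H :: "'a \<Rightarrow> real"
    by (rule continuous_integrable_support[OF c[OF that], of 1]) (simp add: bump_support)
  have "\<bar>conv F (mollifier \<delta>) x - conv G (mollifier \<delta>) x\<bar>
     = \<bar>(\<integral>y. bump y * F (x + \<delta> *\<^sub>R y) - bump y * G (x + \<delta> *\<^sub>R y) \<partial>lborel)\<bar>"
    unfolding conv_mollifier_radial[OF F \<delta>] conv_mollifier_radial[OF G \<delta>] using i[OF F] i[OF G] by simp
  also have "\<dots> \<le> (\<integral>(y::'a). e * bump y \<partial>lborel)"
  proof (rule integral_abs_bound_integral)
    show "integrable lborel (\<lambda>y. bump y * F (x + \<delta> *\<^sub>R y) - bump y * G (x + \<delta> *\<^sub>R y))" using i[OF F] i[OF G] by simp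
    show "integrable lborel (\<lambda>y::'a. e * bump y)" by (rule integrable_mult_right[OF bump_integrable])
    fix y :: 'a
    show "\<bar>bump y * F (x + \<delta> *\<^sub>R y) - bump y * G (x + \<delta> *\<^sub>R y)\<bar> \<le> e * bump y"
    proof (cases "norm y < 1")
      case True
      then have "\<delta> * norm y < \<delta> * 1" using \<delta> by (intro mult_strict_left_mono) auto
      then have "\<bar>F (x + \<delta> *\<^sub>R y) - G (x + \<delta> *\<^sub>R y)\<bar> \<le> e" using \<delta> by (intro osc) (simp add: dist_norm)
      from mult_left_mono[OF this bump_nonneg[of y]] show ?thesis
        using bump_nonneg[of y] by (simp add: abs_mult right_diff_distrib[symmetric] mult.commute[of e])
    qed (simp add: bump_support)
  qed
  also have "\<dots> = e" by (simp add: bump_integral)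
  finally show ?thesis .
qed

lemma conv_mollifier_translate:
  fixes F :: "'a::euclidean_space \<Rightarrow> 'b::euclidean_space"
  assumes F: "continuous_on UNIV F" and \<delta>: "\<delta> > 0"
  shows "conv F (mollifier \<delta>) (x + h) = conv (\<lambda>y. F (y + h)) (mollifier \<delta>) x"
proof -
  have c: "continuous_on UNIV (\<lambda>y. F (y + h))"
    by (rule continuous_on_compose2[OF F]) (auto intro!: continuous_intros)
  show ?thesis unfolding conv_mollifier_radial[OF F \<delta>] conv_mollifier_radial[OF c \<delta>] by (simp add: add_ac)
qed

lemma conv_mollifier_const:
  assumes \<delta>: "\<delta> > 0"
  shows "conv (\<lambda>_. c) (mollifier \<delta>) (x::'a::euclidean_space) = (c::real)"
  using bump_integral[where 'a='a] unfolding conv_mollifier_radial[OF continuous_on_const \<delta>] by simp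

lemma exp_diff_le:
  fixes a b m :: real
  assumes "a \<le> m" "b \<le> m" "\<epsilon> \<ge> 0"
  shows "\<bar>exp (\<epsilon> * a) - exp (\<epsilon> * b)\<bar> \<le> \<epsilon> * exp (\<epsilon> * m) * \<bar>a - b\<bar>"
proof -
  have *: "exp (\<epsilon> * b) - exp (\<epsilon> * a) \<le> \<epsilon> * exp (\<epsilon> * m) * (b - a)" if "a \<le> b" "b \<le> m" for a b
  proof -
    have "1 + \<epsilon> * (a - b) \<le> exp (\<epsilon> * (a - b))" by (rule exp_ge_add_one_self)
    then have "exp (\<epsilon> * b) * (1 + \<epsilon> * (a - b)) \<le> exp (\<epsilon> * b) * exp (\<epsilon> * (a - b))" by simp
    also have "\<dots> = exp (\<epsilon> * a)" by (simp add: exp_add[symmetric] algebra_simps)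
    finally have "exp (\<epsilon> * b) - exp (\<epsilon> * a) \<le> exp (\<epsilon> * b) * (\<epsilon> * (b - a))" by (simp add: algebra_simps)
    also have "\<dots> \<le> exp (\<epsilon> * m) * (\<epsilon> * (b - a))"
      using that assms(3) by (intro mult_right_mono) (auto intro: mult_left_mono)
    finally show ?thesis by (simp add: mult_ac)
  qed
  show ?thesis
  proof (cases "a \<le> b")
    case True
    then have "exp (\<epsilon> * a) \<le> exp (\<epsilon> * b)" using assms(3) by (simp add: mult_left_mono)
    then show ?thesis using *[OF True assms(2)] True by simp
  next
    case False
    then have "exp (\<epsilon> * b) \<le> exp (\<epsilon> * a)" using assms(3) by (simp add: mult_left_mono)
    then show ?thesis using *[of b a] assms(1) False by simp
  qed
qed

context radius_function
begin

text \<open>Mollifying at a single scale suffices: the truncated distance is constant outside a bounded set, and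
  \<open>\<kappa>\<close> is bounded below on bounded sets.\<close>
lemma weight_function:
  fixes z :: 'a
  assumes \<epsilon>: "0 < \<epsilon>" "\<epsilon> \<le> 1/6" and M: "0 \<le> M"
  obtains \<eta> :: "'a \<Rightarrow> real" and B where "smooth_fun \<eta>" "\<And>x. \<bar>\<eta> x\<bar> \<le> B"
    "\<And>x v. \<bar>frechet_derivative \<eta> (at x) v\<bar> \<le> B * norm v"
    "\<And>x v. \<bar>frechet_derivative \<eta> (at x) v\<bar> \<le> 3 * \<epsilon> * C ^ 3 * (\<eta> x + exp (\<epsilon> * t1)) / \<kappa> x * norm v"
    "\<And>x. 0 \<le> \<eta> x" "\<And>x. d_rho \<kappa> z x \<le> t1 - 1 \<Longrightarrow> \<eta> x = 0"
    "\<And>x. exp (\<epsilon> * min (d_rho \<kappa> z x) M) / 2 - exp (\<epsilon> * t1) \<le> \<eta> x"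
proof -
  define s where "s x = min (d_rho \<kappa> z x) M" for x
  define c where "c = exp (\<epsilon> * t1)"
  define F where "F x = max 0 (exp (\<epsilon> * s x) - c)" for x
  have cF: "continuous_on UNIV F"
    unfolding F_def s_def by (intro continuous_intros d_rho_continuous)
  have s0: "0 \<le> s x" "s x \<le> M" for x using d_rho_nonneg[of z x] M by (auto simp: s_def)
  obtain k where k: "k > 0" "\<And>p. p \<in> cball z (K * M + 1) \<Longrightarrow> k \<le> \<kappa> p"
    using compact_lower_bound[OF compact_cball] by blast
  \<comment> \<open>The bound k / (8 C^3) ensures that points within 2 \<delta> of x satisfy the
    local Lipschitz hypothesis and that the distance varies by at most 1 among them; 1/2 keeps the
    mollification inside a unit collar.\<close>
  define \<delta> where "\<delta> = min (1/2) (k / (8 * C ^ 3))"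
  have C3: "C ^ 3 \<ge> 1" "C ^ 3 > 0" using one_le_power[OF C_ge_1, of 3] by linarith+
  have \<delta>: "\<delta> > 0" "2 * \<delta> \<le> 1" "8 * C ^ 3 * \<delta> \<le> k" using k(1) C3 by (auto simp: \<delta>_def min_def field_simps)
  \<comment> \<open>Two of the three factors C come from the local Lipschitz estimate at p, the
    third from comparing \<kappa>(p) with \<kappa>(x).\<close>
  have osc: "\<bar>s p - s q\<bar> \<le> C ^ 3 * dist p q / \<kappa> x \<and> \<bar>s p - s q\<bar> \<le> 1"
    if pq: "dist p x < 2 * \<delta>" "dist q x < 2 * \<delta>" and x: "x \<in> cball z (K * M + 1)" for p q x
  proof -
    have kx: "k \<le> \<kappa> x" by (rule k(2)[OF x])
    have "8 * C * \<delta> \<le> 8 * C ^ 3 * \<delta>" "8 * C ^ 2 * \<delta> \<le> 8 * C ^ 3 * \<delta>"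
      using power_increasing[of 1 3 C] power_increasing[of 2 3 C] C_ge_1 \<delta>(1) by (auto intro!: mult_right_mono)
    then have kd: "8 * C * \<delta> \<le> \<kappa> x" "8 * C ^ 2 * \<delta> \<le> \<kappa> x" "8 * C ^ 3 * \<delta> \<le> \<kappa> x" using \<delta>(3) kx by auto
    have "\<delta> \<le> C * \<delta>" using C_ge_1 \<delta>(1) by simp
    then have "dist p x < \<kappa> x" using pq(1) kd(1) \<delta>(1) by linarith
    then have kp: "\<kappa> x / C \<le> \<kappa> p" using C by blast
    have dpq: "dist p q < 4 * \<delta>" using pq dist_triangle2[of p q x] by linarith
    have "0 < C ^ 2 * \<delta>" using C_ge_1 \<delta>(1) by simp
    then have "4 * (C ^ 2 * \<delta>) < \<kappa> x" using kd(2) by (simp add: mult.assoc)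
    then have "4 * \<delta> < \<kappa> x / C / C" using C_ge_1 by (simp add: field_simps power2_eq_square)
    also have "\<dots> \<le> \<kappa> p / C" using C_ge_1 by (intro divide_right_mono kp) simp
    finally have "dist p q < \<kappa> p / C" using dpq by simp
    then have "\<bar>d_rho \<kappa> z p - d_rho \<kappa> z q\<bar> \<le> C\<^sup>2 * dist p q / \<kappa> p" by (rule d_rho_local_Lipschitz)
    also have "\<dots> \<le> C\<^sup>2 * dist p q / (\<kappa> x / C)" using kp pos C_ge_1 by (intro divide_left_mono) auto
    also have "\<dots> = C ^ 3 * dist p q / \<kappa> x" by (simp add: power2_eq_square power3_eq_cube)
    finally have d: "\<bar>d_rho \<kappa> z p - d_rho \<kappa> z q\<bar> \<le> C ^ 3 * dist p q / \<kappa> x" .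
    have "C ^ 3 * dist p q \<le> C ^ 3 * (4 * \<delta>)" using dpq C3 by (intro mult_left_mono) auto
    also have "\<dots> \<le> \<kappa> x" using kd(3) mult_pos_pos[OF C3(2) \<delta>(1)] by (simp add: mult.assoc)
    finally have "C ^ 3 * dist p q / \<kappa> x \<le> 1" using pos[of x] by simp
    moreover have "\<bar>s p - s q\<bar> \<le> \<bar>d_rho \<kappa> z p - d_rho \<kappa> z q\<bar>" unfolding s_def by linarith
    ultimately show ?thesis using d by linarith
  qed
  \<comment> \<open>The distance is at least the Euclidean one divided by K, so outside this ball,
    even after moving by 2 \<delta>, the truncation is active.\<close>
  have far: "s p = M" if "dist p x < 2 * \<delta>" "x \<notin> cball z (K * M + 1)" for p x
  proof -
    have "K * M \<le> norm (p - z)"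
      using that \<delta>(2) dist_triangle2[of z x p] by (simp add: dist_norm norm_minus_commute)
    then have "M \<le> norm (p - z) / K" using K_pos by (simp add: field_simps)
    then show ?thesis using d_rho_ge_norm[where x = z and y = p] by (simp add: s_def)
  qed
  have x2: "dist x x < 2 * \<delta>" for x :: 'a using \<delta>(1) by simp
  have osc1: "\<bar>s p - s x\<bar> \<le> 1" if "dist p x < 2 * \<delta>" for p x
    using osc[OF that x2] far[OF that] far[OF x2, of x] by (cases "x \<in> cball z (K * M + 1)") auto
  define \<eta> where "\<eta> = conv F (mollifier \<delta>)"
  have sm: "smooth_fun \<eta>" unfolding \<eta>_def by (intro conv_mollifier_smooth continuous_loc_int cF \<delta>)
  \<comment> \<open>A change of the truncated distance by at most 1 multiplies the exponential by at
    most 1 + 1/6 + 1/36, which is below 6/5.\<close>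
  have e2: "exp \<epsilon> \<le> 6/5"
  proof -
    have "exp \<epsilon> \<le> 1 + \<epsilon> + \<epsilon>\<^sup>2" using \<epsilon> by (intro exp_bound) auto
    moreover have "\<epsilon>\<^sup>2 \<le> (1/6)\<^sup>2" using \<epsilon> by (intro power_mono) auto
    ultimately show ?thesis using \<epsilon> by (simp add: power2_eq_square)
  qed
  have es: "exp (\<epsilon> * (s x + 1)) \<le> 6/5 * exp (\<epsilon> * s x)" for x
    using mult_left_mono[OF e2, of "exp (\<epsilon> * s x)"] by (simp add: distrib_left exp_add mult.commute)
  have FL: "\<bar>F p - F q\<bar> \<le> \<epsilon> * (6/5 * exp (\<epsilon> * s x)) * \<bar>s p - s q\<bar>" if pq: "dist p x < 2 * \<delta>" "dist q x < 2 * \<delta>" for p q x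
  proof -
    have "\<bar>F p - F q\<bar> \<le> \<bar>exp (\<epsilon> * s p) - exp (\<epsilon> * s q)\<bar>" unfolding F_def by linarith
    also have "\<dots> \<le> \<epsilon> * exp (\<epsilon> * (s x + 1)) * \<bar>s p - s q\<bar>"
      using osc1[OF pq(1)] osc1[OF pq(2)] \<epsilon>(1) by (intro exp_diff_le) auto
    also have "\<dots> \<le> \<epsilon> * (6/5 * exp (\<epsilon> * s x)) * \<bar>s p - s q\<bar>"
      using es[of x] \<epsilon>(1) by (intro mult_right_mono mult_left_mono) auto
    finally show ?thesis .
  qed
  have app: "\<bar>\<eta> x - F x\<bar> \<le> exp (\<epsilon> * s x) / 2" for x
  proof -
    have "\<bar>conv F (mollifier \<delta>) x - conv (\<lambda>_. F x) (mollifier \<delta>) x\<bar> \<le> exp (\<epsilon> * s x) / 2"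
    proof (rule mollify_local_oscillation[OF cF \<delta>(1) _ continuous_on_const])
      fix y assume "dist y x < \<delta>"
      then have y: "dist y x < 2 * \<delta>" using \<delta>(1) by simp
      have "\<bar>F y - F x\<bar> \<le> \<epsilon> * (6/5 * exp (\<epsilon> * s x)) * \<bar>s y - s x\<bar>" by (rule FL[OF y x2])
      also have "\<dots> \<le> (1/6) * (6/5 * exp (\<epsilon> * s x)) * 1" using osc1[OF y] \<epsilon> by (intro mult_mono) auto
      also have "\<dots> \<le> exp (\<epsilon> * s x) / 2" by simp
      finally show "\<bar>F y - F x\<bar> \<le> exp (\<epsilon> * s x) / 2" .
    qed
    then show ?thesis by (simp add: \<eta>_def conv_mollifier_const[OF \<delta>(1)])
  qed
  have F_ge: "exp (\<epsilon> * s x) - c \<le> F x" for x unfolding F_def by simp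
  \<comment> \<open>Turns the exponential into \<eta> + c at the cost of a factor 2. With the factor
    6/5 from above this gives 12/5, rounded up to the 3 in the gradient bound.\<close>
  have es_le: "exp (\<epsilon> * s x) \<le> 2 * (\<eta> x + c)" for x
  proof -
    have "- (\<eta> x - F x) \<le> exp (\<epsilon> * s x) / 2" by (rule abs_le_D2[OF app])
    then have "- 2 * \<eta> x + 2 * F x \<le> exp (\<epsilon> * s x)" by simp
    then show ?thesis using F_ge[of x] by simp
  qed
  have D: "\<bar>frechet_derivative \<eta> (at x) v\<bar> \<le> L * norm v"
    if L: "\<And>p q. dist p x < 2 * \<delta> \<Longrightarrow> dist q x < 2 * \<delta> \<Longrightarrow> \<bar>F p - F q\<bar> \<le> L * dist p q" for L x v
  proof -
    have "norm (\<eta> (x + h) - \<eta> x) \<le> L * norm h" if h: "norm h < \<delta>" for h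
    proof -
      have ch: "continuous_on UNIV (\<lambda>y. F (y + h))"
        by (rule continuous_on_compose2[OF cF]) (auto intro!: continuous_intros)
      have "\<bar>conv (\<lambda>y. F (y + h)) (mollifier \<delta>) x - conv F (mollifier \<delta>) x\<bar> \<le> L * norm h"
      proof (rule mollify_local_oscillation[OF ch \<delta>(1) _ cF])
        fix y assume y: "dist y x < \<delta>"
        have "dist (y + h) x < 2 * \<delta>" using y h norm_triangle_ineq[of "y - x" h] by (simp add: dist_norm algebra_simps)
        then show "\<bar>F (y + h) - F y\<bar> \<le> L * norm h" using L[of "y + h" y] y \<delta>(1) by (simp add: dist_norm)
      qed
      then show ?thesis unfolding \<eta>_def conv_mollifier_translate[OF cF \<delta>(1)] by simp
    qed
    from derivative_le_local_Lipschitz[OF smooth_has_derivative[OF sm] \<delta>(1) this] show ?thesis by simp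
  qed
  have Dfar: "\<bar>frechet_derivative \<eta> (at x) v\<bar> \<le> 0 * norm v" if "x \<notin> cball z (K * M + 1)" for x v
  proof (rule D)
    fix p q assume pq: "dist p x < 2 * \<delta>" "dist q x < 2 * \<delta>"
    show "\<bar>F p - F q\<bar> \<le> 0 * dist p q" using far[OF pq(1) that] far[OF pq(2) that] by (simp add: F_def)
  qed
  have Dnear: "\<bar>frechet_derivative \<eta> (at x) v\<bar> \<le> \<epsilon> * (6/5 * exp (\<epsilon> * s x)) * (C ^ 3 / \<kappa> x) * norm v"
    if x: "x \<in> cball z (K * M + 1)" for x v
  proof (rule D)
    fix p q assume pq: "dist p x < 2 * \<delta>" "dist q x < 2 * \<delta>"
    have "\<bar>F p - F q\<bar> \<le> \<epsilon> * (6/5 * exp (\<epsilon> * s x)) * \<bar>s p - s q\<bar>" by (rule FL[OF pq])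
    also have "\<dots> \<le> \<epsilon> * (6/5 * exp (\<epsilon> * s x)) * (C ^ 3 * dist p q / \<kappa> x)"
      using osc[OF pq x] \<epsilon>(1) by (intro mult_left_mono) auto
    finally show "\<bar>F p - F q\<bar> \<le> \<epsilon> * (6/5 * exp (\<epsilon> * s x)) * (C ^ 3 / \<kappa> x) * dist p q" by (simp add: mult_ac)
  qed
  have F0: "0 \<le> F x" for x by (simp add: F_def)
  have \<eta>0: "0 \<le> \<eta> x" for x
    unfolding \<eta>_def conv_mollifier_radial[OF cF \<delta>(1)] by (intro Bochner_Integration.integral_nonneg) (auto simp: F0 bump_nonneg)
  \<comment> \<open>This bound depends on M and k and serves only to make multiplication by \<eta>
    legitimate; the estimates use the bounds relative to \<eta> + c.\<close>
  define B where "B = max (2 * exp (\<epsilon> * M)) (\<epsilon> * (6/5 * exp (\<epsilon> * M)) * (C ^ 3 / k))"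
  have eM: "exp (\<epsilon> * s x) \<le> exp (\<epsilon> * M)" for x using s0[of x] \<epsilon>(1) by simp
  show ?thesis
  proof
    show "smooth_fun \<eta>" by (rule sm)
    show "\<bar>\<eta> x\<bar> \<le> B" for x
    proof -
      have "F x \<le> exp (\<epsilon> * M)" using eM[of x] exp_ge_zero[of "\<epsilon> * t1"] exp_ge_zero[of "\<epsilon> * M"] unfolding F_def c_def by linarith
      then have "\<bar>\<eta> x\<bar> \<le> 2 * exp (\<epsilon> * M)" using app[of x] eM[of x] F0[of x] by linarith
      then show ?thesis by (simp add: B_def)
    qed
    show "\<bar>frechet_derivative \<eta> (at x) v\<bar> \<le> B * norm v" for x v
    proof (cases "x \<in> cball z (K * M + 1)")
      case True
      have "\<epsilon> * (6/5 * exp (\<epsilon> * s x)) * (C ^ 3 / \<kappa> x) \<le> \<epsilon> * (6/5 * exp (\<epsilon> * M)) * (C ^ 3 / k)"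
        using eM[of x] \<epsilon>(1) k(1) k(2)[OF True] C3 pos[of x]
        by (intro mult_mono divide_left_mono) auto
      also have "\<dots> \<le> B" by (simp add: B_def)
      finally show ?thesis using Dnear[OF True, of v] mult_right_mono[OF _ norm_ge_zero[of v]] order_trans by blast
    next
      case False
      have "0 \<le> B * norm v" using order_trans[OF _ max.cobounded1[of "2 * exp (\<epsilon> * M)"]] by (simp add: B_def)
      then show ?thesis using Dfar[OF False, of v] by simp
    qed
    show "\<bar>frechet_derivative \<eta> (at x) v\<bar> \<le> 3 * \<epsilon> * C ^ 3 * (\<eta> x + exp (\<epsilon> * t1)) / \<kappa> x * norm v" for x v
    proof (cases "x \<in> cball z (K * M + 1)")
      case True
      have "\<epsilon> * (6/5 * exp (\<epsilon> * s x)) * (C ^ 3 / \<kappa> x) \<le> \<epsilon> * (3 * (\<eta> x + c)) * (C ^ 3 / \<kappa> x)"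
      proof (intro mult_right_mono mult_left_mono)
        have "0 < c" by (simp add: c_def)
        then show "6/5 * exp (\<epsilon> * s x) \<le> 3 * (\<eta> x + c)" using es_le[of x] \<eta>0[of x] by (simp add: algebra_simps)
      qed (use \<epsilon>(1) C3 pos[of x] in auto)
      also have "\<dots> = 3 * \<epsilon> * C ^ 3 * (\<eta> x + exp (\<epsilon> * t1)) / \<kappa> x" by (simp add: c_def)
      finally show ?thesis using Dnear[OF True, of v] mult_right_mono[OF _ norm_ge_zero[of v]] order_trans by blast
    next
      case False
      have "0 \<le> 3 * \<epsilon> * C ^ 3 * (\<eta> x + exp (\<epsilon> * t1)) / \<kappa> x * norm v"
        using \<eta>0[of x] \<epsilon>(1) C3 pos[of x] by simp
      then show ?thesis using Dfar[OF False, of v] by simp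
    qed
    show "0 \<le> \<eta> x" for x by (rule \<eta>0)
    \<comment> \<open>The unit gap between t1 - 1 and t1 absorbs the variation over the
      mollification ball: there the unmollified weight still vanishes.\<close>
    show "\<eta> x = 0" if "d_rho \<kappa> z x \<le> t1 - 1" for x
    proof -
      have "\<bar>conv F (mollifier \<delta>) x - conv (\<lambda>_. 0) (mollifier \<delta>) x\<bar> \<le> 0"
      proof (rule mollify_local_oscillation[OF cF \<delta>(1) _ continuous_on_const])
        fix y assume "dist y x < \<delta>"
        then have "s y \<le> s x + 1" using osc1[of y x] \<delta>(1) by simp
        also have "\<dots> \<le> t1" using that by (simp add: s_def)
        finally have "F y = 0" using \<epsilon>(1) by (simp add: F_def c_def)
        then show "\<bar>F y - 0\<bar> \<le> 0" by simp
      qed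
      then show ?thesis by (simp add: \<eta>_def conv_mollifier_const[OF \<delta>(1)])
    qed
    show "exp (\<epsilon> * min (d_rho \<kappa> z x) M) / 2 - exp (\<epsilon> * t1) \<le> \<eta> x" for x
      using app[of x] F_ge[of x] unfolding s_def[symmetric] c_def[symmetric] by linarith
  qed
qed

end

subsection \<open>Weighted spaces\<close>

lemma wz_test_bilinear:
  assumes f: "f differentiable (at z)" and g: "g differentiable (at z)"
  shows "wzbar j (\<lambda>x. f x * g x) z = f z * wzbar j g z + wzbar j f z * g z"
proof -
  have "frechet_derivative (\<lambda>x. f x * g x) (at z) v = f z * frechet_derivative g (at z) v + frechet_derivative f (at z) v * g z" for v
    using fun_cong[OF frechet_derivative_at[OF has_derivative_mult[OF f[unfolded frechet_derivative_works] g[unfolded frechet_derivative_works]]], of v]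
    by simp
  then show ?thesis unfolding wzbar_def by (simp add: field_simps)
qed

lemma smooth_differentiable: "smooth_fun f \<Longrightarrow> f differentiable (at x)"
  using smooth_has_derivative differentiable_def by blast

lemma smooth_wzbar: "smooth_fun f \<Longrightarrow> smooth_fun (\<lambda>z. wzbar j f z)"
proof -
  assume s: "smooth_fun f"
  have "smooth_fun (\<lambda>z. (frechet_derivative f (at z) (axis j 1) + \<i> * frechet_derivative f (at z) (axis j \<i>)) * (1/2))"
    by (intro smooth_mult smooth_add smooth_fun_derivative s) (simp_all add: smooth_fun_def Ck_const)
  then show ?thesis unfolding wzbar_def by simp
qed

lemma test_fun_support:
  assumes "test_fun \<psi>" obtains R where "\<And>z. norm z > R \<Longrightarrow> \<psi> z = 0"
  using assms unfolding test_fun_def bounded_iff by (metis (mono_tags, lifting) mem_Collect_eq not_le)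

lemma test_fun_smooth: "test_fun \<psi> \<Longrightarrow> smooth_fun \<psi>"
  by (simp add: test_fun_def)

lemma test_funI: "smooth_fun \<psi> \<Longrightarrow> (\<And>z. norm z > R \<Longrightarrow> \<psi> z = 0) \<Longrightarrow> test_fun \<psi>"
  unfolding test_fun_def bounded_iff by (auto intro!: exI[of _ R] simp: not_le[symmetric])

lemma test_fun_wzbar:
  assumes "test_fun \<psi>" shows "test_fun (\<lambda>z. wzbar j \<psi> z)"
proof -
  obtain R where R: "\<And>z. norm z > R \<Longrightarrow> \<psi> z = 0" using test_fun_support[OF assms] by metis
  have "wzbar j \<psi> z = 0" if "norm z > R" for z
    unfolding wzbar_def by (simp add: derivative_support[OF R that])
  then show ?thesis using test_funI[OF smooth_wzbar[OF test_fun_smooth[OF assms]]] by blast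
qed

lemma test_fun_mult:
  assumes "smooth_fun f" "test_fun \<psi>" shows "test_fun (\<lambda>z. f z * \<psi> z)"
proof -
  obtain R where R: "\<And>z. norm z > R \<Longrightarrow> \<psi> z = 0" using test_fun_support[OF assms(2)] by metis
  show ?thesis by (rule test_funI[OF smooth_mult[OF assms(1) test_fun_smooth[OF assms(2)]], of R]) (simp add: R)
qed

lemma wzbar_i: "smooth_fun \<psi> \<Longrightarrow> wzbar j (\<lambda>z. \<i> * \<psi> z) z = \<i> * wzbar j \<psi> z"
  using wz_test_bilinear[of "\<lambda>_. \<i>" z \<psi> j] by (simp add: smooth_differentiable wzbar_def)

lemma test_fun_i: "test_fun \<psi> \<Longrightarrow> test_fun (\<lambda>z. \<i> * \<psi> z)"
  by (rule test_fun_mult) (simp add: smooth_fun_def Ck_const)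

lemma wzbar_commute:
  assumes "smooth_fun \<psi>" shows "wzbar j (\<lambda>z. wzbar k \<psi> z) z = wzbar k (\<lambda>z. wzbar j \<psi> z) z"
proof -
  have d: "frechet_derivative (\<lambda>z. wzbar k \<psi> z) (at z) v
     = (frechet_derivative (\<lambda>z. frechet_derivative \<psi> (at z) (axis k 1)) (at z) v
        + \<i> * frechet_derivative (\<lambda>z. frechet_derivative \<psi> (at z) (axis k \<i>)) (at z) v) * (1/2)" for k v
  proof -
    have "((\<lambda>z. (frechet_derivative \<psi> (at z) (axis k 1) + \<i> * frechet_derivative \<psi> (at z) (axis k \<i>)) * (1/2)) has_derivative
      (\<lambda>v. (frechet_derivative (\<lambda>z. frechet_derivative \<psi> (at z) (axis k 1)) (at z) v
        + \<i> * frechet_derivative (\<lambda>z. frechet_derivative \<psi> (at z) (axis k \<i>)) (at z) v) * (1/2))) (at z)"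
      by (rule has_derivative_mult_left[OF has_derivative_add[OF _ has_derivative_mult_right]])
         (rule smooth_has_derivative[OF smooth_fun_derivative[OF assms]])+
    from fun_cong[OF frechet_derivative_at[OF this], of v] show ?thesis unfolding wzbar_def by simp
  qed
  note m = mixed_partials[OF smooth_funD[OF assms, of 2]]
  show ?thesis unfolding wzbar_def[of j "\<lambda>z. wzbar k \<psi> z"] wzbar_def[of k "\<lambda>z. wzbar j \<psi> z"] d
    by (simp add: m[of "axis k _" z "axis j _"] algebra_simps)
qed

lemma borel_imp_lebesgue: "f \<in> borel_measurable borel \<Longrightarrow> f \<in> borel_measurable lebesgue"
  by (simp add: measurable_completion)

text \<open>Orthogonal complements are closed, by Cauchy-Schwarz. Together with
  \<open>sq_int_complete\<close> this provides the completeness that \<open>Riesz_on\<close>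
  demands.\<close>

lemma orthogonality_limit:
  fixes F :: "nat \<Rightarrow> 'a \<Rightarrow> 'b::euclidean_space"
  assumes F: "\<And>n. sq_int M (F n)" "sq_int M L" "(\<lambda>n. \<integral>x. (norm (F n x - L x))\<^sup>2 \<partial>M) \<longlonglongrightarrow> 0"
    and G: "sq_int M G" "\<And>n. (\<integral>x. F n x \<bullet> G x \<partial>M) = 0"
  shows "(\<integral>x. L x \<bullet> G x \<partial>M) = 0"
proof -
  define b where "b = (\<integral>x. (norm (G x))\<^sup>2 \<partial>M)"
  have le: "(\<integral>x. L x \<bullet> G x \<partial>M)\<^sup>2 \<le> (\<integral>x. (norm (F n x - L x))\<^sup>2 \<partial>M) * b" for n
  proof -
    have d: "sq_int M (\<lambda>x. F n x - L x)" by (rule sq_int_diff[OF F(1,2)])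
    have "(\<integral>x. (F n x - L x) \<bullet> G x \<partial>M) = - (\<integral>x. L x \<bullet> G x \<partial>M)"
      unfolding inner_diff_left using sq_int_inner[OF F(1) G(1)] sq_int_inner[OF F(2) G(1)] G(2) by simp
    then have "\<bar>\<integral>x. L x \<bullet> G x \<partial>M\<bar> = \<bar>\<integral>x. (F n x - L x) \<bullet> G x \<partial>M\<bar>" by simp
    also have "\<dots> \<le> (\<integral>x. norm (F n x - L x) * norm (G x) \<partial>M)"
    proof -
      have "norm (\<integral>x. (F n x - L x) \<bullet> G x \<partial>M) \<le> (\<integral>x. norm ((F n x - L x) \<bullet> G x) \<partial>M)"
        by (rule integral_norm_bound)
      also have "\<dots> \<le> (\<integral>x. norm (F n x - L x) * norm (G x) \<partial>M)"
        by (intro integral_mono integrable_norm sq_int_inner[OF d G(1)] sq_int_norm_mult[OF d G(1)])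
           (simp add: Cauchy_Schwarz_ineq2)
      finally show ?thesis by simp
    qed
    finally have "(\<integral>x. L x \<bullet> G x \<partial>M)\<^sup>2 \<le> (\<integral>x. norm (F n x - L x) * norm (G x) \<partial>M)\<^sup>2"
      using abs_le_square_iff[of "\<integral>x. L x \<bullet> G x \<partial>M" "\<integral>x. norm (F n x - L x) * norm (G x) \<partial>M"] by simp
    also have "\<dots> \<le> (\<integral>x. (norm (F n x - L x))\<^sup>2 \<partial>M) * b"
      unfolding b_def by (rule sq_int_Cauchy_Schwarz[OF d G(1)])
    finally show ?thesis .
  qed
  have "(\<integral>x. L x \<bullet> G x \<partial>M)\<^sup>2 \<le> 0 * b"
    by (rule LIMSEQ_le_const[OF tendsto_mult_right[OF F(3), of b]]) (use le in blast)
  then show ?thesis by simp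
qed

locale weighted_space =
  fixes \<phi> :: "complex^'n \<Rightarrow> real"
  assumes cont: "continuous_on UNIV \<phi>"
begin

text \<open>Absorbing the weight into the measure turns weighted norms into plain ones, so the
  general facts on \<open>sq_int\<close> apply.\<close>

definition M :: "(complex^'n) measure" where
  "M = density lebesgue (\<lambda>z. ennreal (exp (-2 * \<phi> z)))"

lemma weight_measurable: "(\<lambda>z. exp (-2 * \<phi> z)) \<in> borel_measurable lebesgue"
  by (intro borel_imp_lebesgue borel_continuous continuous_intros cont)

lemma measurable_M: "f \<in> borel_measurable M \<longleftrightarrow> f \<in> borel_measurable lebesgue"
  by (simp add: M_def)

lemma integral_M:
  fixes f :: "complex^'n \<Rightarrow> 'b::{banach, second_countable_topology}"
  assumes "f \<in> borel_measurable lebesgue"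
  shows "(\<integral>z. f z \<partial>M) = (\<integral>z. exp (-2 * \<phi> z) *\<^sub>R f z \<partial>lebesgue)"
    "integrable M f \<longleftrightarrow> integrable lebesgue (\<lambda>z. exp (-2 * \<phi> z) *\<^sub>R f z)"
  unfolding M_def using assms weight_measurable by (simp_all add: integral_density integrable_density)

lemma nn_integral_M:
  assumes "f \<in> borel_measurable lebesgue"
  shows "(\<integral>\<^sup>+z. ennreal (f z) \<partial>M) = (\<integral>\<^sup>+z. ennreal (f z * exp (-2 * \<phi> z)) \<partial>lebesgue)"
proof -
  have [measurable]: "(\<lambda>z. ennreal (exp (-2 * \<phi> z))) \<in> borel_measurable lebesgue"
    using weight_measurable by measurable
  have "(\<integral>\<^sup>+z. ennreal (f z) \<partial>M) = (\<integral>\<^sup>+z. ennreal (exp (-2 * \<phi> z)) * ennreal (f z) \<partial>lebesgue)"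
    unfolding M_def using assms by (intro nn_integral_density) measurable
  also have "\<dots> = (\<integral>\<^sup>+z. ennreal (f z * exp (-2 * \<phi> z)) \<partial>lebesgue)"
    by (simp only: ennreal_mult''[OF exp_ge_zero] mult.commute)
  finally show ?thesis .
qed

lemma wnorm2_M: "f \<in> borel_measurable lebesgue \<Longrightarrow> wnorm2 \<phi> f = (\<integral>\<^sup>+z. ennreal ((norm (f z))\<^sup>2) \<partial>M)"
  unfolding wnorm2_def by (rule nn_integral_M[symmetric]) measurable

lemma wnorm2_eq: 
  fixes f :: "complex^'n \<Rightarrow> 'b::euclidean_space"
  shows "sq_int M f \<Longrightarrow> wnorm2 \<phi> f = ennreal (\<integral>z. (norm (f z))\<^sup>2 \<partial>M)"
  using sq_intD[of M f] by (subst wnorm2_M) (auto simp: measurable_M intro!: nn_integral_eq_integral)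

lemma L2w_iff: "L2w \<phi> f \<longleftrightarrow> sq_int M f"
proof
  assume "L2w \<phi> f"
  then have f: "f \<in> borel_measurable lebesgue" "(\<integral>\<^sup>+z. ennreal ((norm (f z))\<^sup>2) \<partial>M) < \<infinity>"
    using wnorm2_M[of f] by (auto simp: L2w_def)
  have [measurable]: "f \<in> borel_measurable M" using f(1) by (simp add: measurable_M)
  show "sq_int M f" unfolding sq_int_def using f(2) by (auto intro!: integrableI_nonneg)
next
  assume f: "sq_int M f"
  then show "L2w \<phi> f" using sq_intD(1)[OF f] wnorm2_eq[OF f] by (simp add: L2w_def measurable_M)
qed

lemma sq_int_continuous_image:
  fixes u :: "complex^'n \<Rightarrow> 'b::euclidean_space" and L :: "'b \<Rightarrow> 'c::euclidean_space"
  assumes u: "sq_int M u" and L: "linear L" and n: "\<And>x. norm (L x) \<le> norm x"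
  shows "sq_int M (\<lambda>z. L (u z))"
proof (rule sq_int_bound[OF u, of _ 1])
  have "L \<in> borel_measurable borel"
    using L by (intro borel_measurable_continuous_onI linear_continuous_on) (simp add: linear_conv_bounded_linear)
  then show "(\<lambda>z. L (u z)) \<in> borel_measurable M" by (rule measurable_compose[OF sq_intD(1)[OF u]])
qed (simp add: n)

lemma sq_int_nth: "sq_int M u \<Longrightarrow> sq_int M (\<lambda>z. (u z :: 'b::euclidean_space^'m) $ j)"
  by (rule sq_int_continuous_image[of u "\<lambda>x. x $ j"]) (auto intro!: linearI simp: Finite_Cartesian_Product.norm_nth_le)

lemma sq_int_axis: "sq_int M f \<Longrightarrow> sq_int M (\<lambda>z. axis j (f z :: 'b::euclidean_space) :: 'b^'m)"
proof (rule sq_int_continuous_image[of f "axis j"])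
  show "linear (axis j :: 'b \<Rightarrow> 'b^'m)" by (intro linearI) (auto simp: vec_eq_iff axis_def)
  show "norm (axis j x :: 'b^'m) \<le> norm x" for x by (simp add: norm_eq_sqrt_inner inner_axis_axis)
qed

lemma sq_int_sum: "finite I \<Longrightarrow> (\<And>i. i \<in> I \<Longrightarrow> sq_int M (f i)) \<Longrightarrow> sq_int M (\<lambda>z. \<Sum>i\<in>I. f i z)"
proof (induction I rule: finite_induct)
  case empty
  show ?case by (simp add: sq_int_def)
next
  case (insert i I)
  then show ?case by (simp add: sq_int_add)
qed

lemma vec_sum_axis: "(v :: 'b::euclidean_space^'m) = (\<Sum>j\<in>UNIV. axis j (v $ j))"
  by (simp add: vec_eq_iff axis_def)

lemma sq_int_vec:
  assumes "\<And>j. sq_int M (\<lambda>z. (u z :: 'b::euclidean_space^'m) $ j)" shows "sq_int M u"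
proof -
  have "sq_int M (\<lambda>z. \<Sum>j\<in>UNIV. axis j (u z $ j))" by (intro sq_int_sum sq_int_axis assms) simp
  then show ?thesis by (simp flip: vec_sum_axis)
qed

lemma L2form1_iff: "L2form1 \<phi> u \<longleftrightarrow> sq_int M u"
  unfolding L2form1_def L2w_iff using sq_int_nth sq_int_vec by blast

lemma form1_norm_eq: "sq_int M u \<Longrightarrow> (form1_norm \<phi> u)\<^sup>2 = (\<integral>z. (norm (u z))\<^sup>2 \<partial>M)"
  by (simp add: form1_norm_def wnorm2_eq)

lemma complex_inner_Re: "(a::complex) \<bullet> b = Re (a * cnj b)"
  by (simp add: inner_complex_def)

text \<open>The Hilbert space arguments are carried out over the reals. The complex pairing is
  recovered from the real one by pairing with g for the real part and with i g for the imaginary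
  part.\<close>

lemma winner_eq:
  assumes f: "sq_int M f" and g: "sq_int M g"
  shows "Re (winner \<phi> f g) = (\<integral>z. f z \<bullet> g z \<partial>M)" "Im (winner \<phi> f g) = (\<integral>z. f z \<bullet> (\<i> * g z) \<partial>M)"
    "winner \<phi> f g = (\<integral>z. f z * cnj (g z) \<partial>M)" "integrable M (\<lambda>z. f z * cnj (g z))"
proof -
  have m: "f \<in> borel_measurable lebesgue" "g \<in> borel_measurable lebesgue"
    using sq_intD(1)[OF f] sq_intD(1)[OF g] by (auto simp: measurable_M)
  note [measurable] = m sq_intD(1)[OF f] sq_intD(1)[OF g]
  have [measurable]: "cnj \<in> borel_measurable borel" by (intro borel_measurable_continuous_onI continuous_intros)
  show i: "integrable M (\<lambda>z. f z * cnj (g z))"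
    by (rule Bochner_Integration.integrable_bound[OF sq_int_norm_mult[OF f g]]) (auto simp: norm_mult)
  show w: "winner \<phi> f g = (\<integral>z. f z * cnj (g z) \<partial>M)"
    unfolding winner_def by (subst integral_M) (auto simp: scaleR_conv_of_real mult.commute)
  show "Re (winner \<phi> f g) = (\<integral>z. f z \<bullet> g z \<partial>M)"
    unfolding w using integral_Re[OF i] by (simp only: complex_inner_Re)
  show "Im (winner \<phi> f g) = (\<integral>z. f z \<bullet> (\<i> * g z) \<partial>M)"
    unfolding w integral_Im[OF i, symmetric] by (rule Bochner_Integration.integral_cong) (auto simp: inner_complex_def)
qed

lemma winner1_eq:
  assumes u: "sq_int M u" and v: "sq_int M v"
  shows "Re (winner1 \<phi> u v) = (\<integral>z. u z \<bullet> v z \<partial>M)"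
  unfolding winner1_def Re_sum winner_eq(1)[OF sq_int_nth[OF u] sq_int_nth[OF v]] inner_vec_def
  by (rule Bochner_Integration.integral_sum[symmetric]) (intro sq_int_inner sq_int_nth u v)

lemma sq_int_i: "sq_int M f \<Longrightarrow> sq_int M (\<lambda>z. \<i> * f z)"
  by (rule sq_int_bound[of _ f _ 1]) (auto simp: norm_mult dest: sq_intD(1))

lemma i_vec_measurable: "u \<in> borel_measurable N \<Longrightarrow> (\<lambda>z. \<i> *s (u z :: complex^'n)) \<in> borel_measurable N"
  by (rule measurable_compose[of u N borel "\<lambda>x. \<i> *s x"], assumption)
     (rule borel_measurable_continuous_onI, rule linear_continuous_on,
      auto simp: linear_conv_bounded_linear[symmetric] vec_eq_iff algebra_simps intro!: linearI)

lemma norm_cscale: "norm (c *s (v :: complex^'n)) = norm c * norm v"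
  by (simp add: norm_vec_def L2_set_def norm_mult power_mult_distrib sum_distrib_left[symmetric] real_sqrt_mult)

lemma sq_int_i_vec: "sq_int M u \<Longrightarrow> sq_int M (\<lambda>z. \<i> *s (u z :: complex^'n))"
  by (rule sq_int_bound[of _ u _ 1]) (auto simp: norm_cscale dest: sq_intD(1) intro: i_vec_measurable)

subsection \<open>Pairing with test functions\<close>

text \<open>The Riesz representative in the weighted space of the functional that integrates against
  \<psi>: the conjugate and the factor exp (2 \<phi>) undo those of the weighted inner
  product.\<close>

definition up :: "(complex^'n \<Rightarrow> complex) \<Rightarrow> complex^'n \<Rightarrow> complex" where
  "up \<psi> z = exp (2 * \<phi> z) *\<^sub>R cnj (\<psi> z)"

lemma sq_int_up:
  assumes "test_fun \<psi>" shows "sq_int M (up \<psi>)"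
  unfolding sq_int_def
proof
  have c: "continuous_on UNIV (up \<psi>)"
    unfolding up_def by (intro continuous_intros smooth_continuous[OF test_fun_smooth[OF assms]] cont)
  show m: "up \<psi> \<in> borel_measurable M" unfolding measurable_M by (intro borel_imp_lebesgue borel_continuous c)
  obtain R where R: "\<And>z. norm z > R \<Longrightarrow> \<psi> z = 0" using test_fun_support[OF assms] by metis
  have "integrable lborel (\<lambda>z. exp (-2 * \<phi> z) *\<^sub>R (norm (up \<psi> z))\<^sup>2)"
  proof (rule continuous_integrable_support[of _ R])
    show "continuous_on UNIV (\<lambda>z. exp (-2 * \<phi> z) *\<^sub>R (norm (up \<psi> z))\<^sup>2)" by (intro continuous_intros c cont)
  qed (simp add: up_def R)
  then have "integrable lebesgue (\<lambda>z. exp (-2 * \<phi> z) *\<^sub>R (norm (up \<psi> z))\<^sup>2)"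
    by (subst integrable_completion) auto
  then show "integrable M (\<lambda>z. (norm (up \<psi> z))\<^sup>2)"
    using m[unfolded measurable_M] by (subst integral_M) measurable
qed

lemma pairing:
  assumes f: "sq_int M f" and t: "test_fun \<psi>"
  shows "integrable lebesgue (\<lambda>z. f z * \<psi> z)" "Re (\<integral>z. f z * \<psi> z \<partial>lebesgue) = (\<integral>z. f z \<bullet> up \<psi> z \<partial>M)"
proof -
  have m: "f \<in> borel_measurable lebesgue" "up \<psi> \<in> borel_measurable lebesgue"
    using sq_intD(1)[OF f] sq_intD(1)[OF sq_int_up[OF t]] by (auto simp: measurable_M)
  have [measurable]: "cnj \<in> borel_measurable borel" by (intro borel_measurable_continuous_onI continuous_intros)
  note [measurable] = m
  have e: "exp (-2 * \<phi> z) *\<^sub>R (f z * cnj (up \<psi> z)) = f z * \<psi> z" for z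
    unfolding up_def by (simp add: scaleR_conv_of_real exp_minus flip: of_real_mult)
  have "integrable lebesgue (\<lambda>z. exp (-2 * \<phi> z) *\<^sub>R (f z * cnj (up \<psi> z)))"
    using winner_eq(4)[OF f sq_int_up[OF t]] m by (subst (asm) integral_M) measurable
  then show i: "integrable lebesgue (\<lambda>z. f z * \<psi> z)" unfolding e .
  have "(\<integral>z. f z * cnj (up \<psi> z) \<partial>M) = (\<integral>z. f z * \<psi> z \<partial>lebesgue)"
    using m by (subst integral_M) (simp_all only: e, measurable)
  then show "Re (\<integral>z. f z * \<psi> z \<partial>lebesgue) = (\<integral>z. f z \<bullet> up \<psi> z \<partial>M)"
    using winner_eq(1,3)[OF f sq_int_up[OF t]] by simp
qed

text \<open>Test functions may be multiplied by i, which recovers the imaginary part of the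
  identity.\<close>

lemma weak_dbar0_Re:
  assumes f: "sq_int M f" and g: "sq_int M g"
    and e: "\<And>\<psi>. test_fun \<psi> \<Longrightarrow> Re (\<integral>z. f z * wzbar j \<psi> z \<partial>lebesgue) = - Re (\<integral>z. g z * \<psi> z \<partial>lebesgue)"
  shows "weak_dbar0 j f g"
  unfolding weak_dbar0_def
proof (intro allI impI)
  fix \<psi> :: "complex^'n \<Rightarrow> complex" assume t: "test_fun \<psi>"
  have "(\<integral>z. f z * wzbar j (\<lambda>z. \<i> * \<psi> z) z \<partial>lebesgue) = \<i> * (\<integral>z. f z * wzbar j \<psi> z \<partial>lebesgue)"
    "(\<integral>z. g z * (\<i> * \<psi> z) \<partial>lebesgue) = \<i> * (\<integral>z. g z * \<psi> z \<partial>lebesgue)"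
    unfolding wzbar_i[OF test_fun_smooth[OF t]] by (simp_all flip: integral_mult_right_zero add: mult_ac)
  then show "(\<integral>z. f z * wzbar j \<psi> z \<partial>lebesgue) = - (\<integral>z. g z * \<psi> z \<partial>lebesgue)"
    using e[OF t] e[OF test_fun_i[OF t]] by (simp add: complex_eq_iff)
qed

text \<open>The representative of the functional sending u to the pairing of u_k with the j-th
  derivative of \<psi> minus that of u_j with the k-th, as in \<open>weak_dbar1\<close>. The weak
  equation becomes an orthogonality relation.\<close>

definition curl_test :: "'n \<Rightarrow> 'n \<Rightarrow> (complex^'n \<Rightarrow> complex) \<Rightarrow> complex^'n \<Rightarrow> complex^'n" where
  "curl_test j k \<psi> z = axis k (up (\<lambda>z. wzbar j \<psi> z) z) - axis j (up (\<lambda>z. wzbar k \<psi> z) z)"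

lemma sq_int_curl_test: "test_fun \<psi> \<Longrightarrow> sq_int M (curl_test j k \<psi>)"
  unfolding curl_test_def[abs_def] by (intro sq_int_diff sq_int_axis sq_int_up test_fun_wzbar)

lemma weak_dbar1_iff:
  assumes u: "sq_int M u" and g: "sq_int M g"
  shows "weak_dbar1 j k u g \<longleftrightarrow> (\<forall>\<psi>. test_fun \<psi> \<longrightarrow> (\<integral>z. u z \<bullet> curl_test j k \<psi> z \<partial>M) + (\<integral>z. g z \<bullet> up \<psi> z \<partial>M) = 0)"
proof -
  note p = pairing[OF sq_int_nth[OF u] test_fun_wzbar]
  have e: "Re (\<integral>z. u z $ k * wzbar j \<psi> z - u z $ j * wzbar k \<psi> z \<partial>lebesgue) = (\<integral>z. u z \<bullet> curl_test j k \<psi> z \<partial>M)"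
    if t: "test_fun \<psi>" for \<psi>
    unfolding curl_test_def inner_diff_right inner_axis
    using sq_int_inner[OF sq_int_nth[OF u] sq_int_up[OF test_fun_wzbar[OF t]]] p[OF t] by simp
  show ?thesis
  proof
    assume "weak_dbar1 j k u g"
    then have "Re (\<integral>z. u z $ k * wzbar j \<psi> z - u z $ j * wzbar k \<psi> z \<partial>lebesgue) = - Re (\<integral>z. g z * \<psi> z \<partial>lebesgue)"
      if "test_fun \<psi>" for \<psi>
      using that by (simp add: weak_dbar1_def)
    then show "\<forall>\<psi>. test_fun \<psi> \<longrightarrow> (\<integral>z. u z \<bullet> curl_test j k \<psi> z \<partial>M) + (\<integral>z. g z \<bullet> up \<psi> z \<partial>M) = 0"
      using e pairing(2)[OF g] by simp
  next
    assume r: "\<forall>\<psi>. test_fun \<psi> \<longrightarrow> (\<integral>z. u z \<bullet> curl_test j k \<psi> z \<partial>M) + (\<integral>z. g z \<bullet> up \<psi> z \<partial>M) = 0"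
    show "weak_dbar1 j k u g" unfolding weak_dbar1_def
    proof (intro allI impI)
      fix \<psi> :: "complex^'n \<Rightarrow> complex" assume t: "test_fun \<psi>"
      let ?I = "\<lambda>\<psi>. \<integral>z. u z $ k * wzbar j \<psi> z - u z $ j * wzbar k \<psi> z \<partial>lebesgue"
      let ?J = "\<lambda>\<psi>. \<integral>z. g z * \<psi> z \<partial>lebesgue"
      have re: "Re (?I \<psi>) + Re (?J \<psi>) = 0" if "test_fun \<psi>" for \<psi>
        using r that e[OF that] pairing(2)[OF g that] by simp
      have "?I (\<lambda>z. \<i> * \<psi> z) = \<i> * ?I \<psi>" "?J (\<lambda>z. \<i> * \<psi> z) = \<i> * ?J \<psi>"
        unfolding wzbar_i[OF test_fun_smooth[OF t]] by (simp_all flip: integral_mult_right_zero add: algebra_simps)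
      then show "?I \<psi> = - ?J \<psi>" using re[OF t] re[OF test_fun_i[OF t]] by (simp add: complex_eq_iff)
    qed
  qed
qed

definition dbar_graph :: "(complex^'n \<Rightarrow> complex) \<Rightarrow> (complex^'n \<Rightarrow> complex^'n) \<Rightarrow> bool" where
  "dbar_graph f v \<longleftrightarrow> sq_int M f \<and> sq_int M v \<and> has_dbar0 f v"

lemma dbar_graph_iff: "dom_dbar0 \<phi> f \<and> has_dbar0 f v \<and> L2form1 \<phi> v \<longleftrightarrow> dbar_graph f v"
  unfolding dbar_graph_def dom_dbar0_def L2form1_iff L2w_iff has_dbar0_def using sq_int_nth by blast

lemma dbar_graph_i: "dbar_graph f v \<Longrightarrow> dbar_graph (\<lambda>z. \<i> * f z) (\<lambda>z. \<i> *s v z)"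
  unfolding dbar_graph_def has_dbar0_def weak_dbar0_def
  by (auto simp: sq_int_i sq_int_i_vec mult.assoc)

text \<open>The graph of \<open>dbar\<close> is stable under multiplication by i, so equality of
  real parts for all graph elements yields the complex identity.\<close>

lemma adj_dbar_iff:
  assumes g: "sq_int M g" and h: "sq_int M h"
  shows "adj_dbar \<phi> g h \<longleftrightarrow> (\<forall>f v. dbar_graph f v \<longrightarrow> (\<integral>z. v z \<bullet> g z \<partial>M) = (\<integral>z. f z \<bullet> h z \<partial>M))"
proof
  assume "adj_dbar \<phi> g h"
  then have "winner1 \<phi> v g = winner \<phi> f h" if "dbar_graph f v" for f v
    using that unfolding adj_dbar_def dbar_graph_iff by blast
  then show "\<forall>f v. dbar_graph f v \<longrightarrow> (\<integral>z. v z \<bullet> g z \<partial>M) = (\<integral>z. f z \<bullet> h z \<partial>M)"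
    using winner1_eq[OF _ g] winner_eq(1)[OF _ h] unfolding dbar_graph_def by metis
next
  assume r: "\<forall>f v. dbar_graph f v \<longrightarrow> (\<integral>z. v z \<bullet> g z \<partial>M) = (\<integral>z. f z \<bullet> h z \<partial>M)"
  have "winner1 \<phi> v g = winner \<phi> f h" if fv: "dbar_graph f v" for f v
  proof -
    have Re: "Re (winner1 \<phi> v g) = Re (winner \<phi> f h)" if "dbar_graph f v" for f v
      using r that winner1_eq[OF _ g] winner_eq(1)[OF _ h] unfolding dbar_graph_def by metis
    have "winner1 \<phi> (\<lambda>z. \<i> *s v z) g = \<i> * winner1 \<phi> v g" "winner \<phi> (\<lambda>z. \<i> * f z) h = \<i> * winner \<phi> f h"
      unfolding winner1_def winner_def by (simp_all add: sum_distrib_left mult.assoc)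
    then show ?thesis using Re[OF fv] Re[OF dbar_graph_i[OF fv]] by (simp add: complex_eq_iff)
  qed
  then show "adj_dbar \<phi> g h" unfolding adj_dbar_def dbar_graph_iff unfolding L2form1_iff L2w_iff using g h by blast
qed

text \<open>The square of \<open>dbar\<close> vanishes weakly: both derivatives are moved onto the
  test function, where they commute.\<close>

lemma dbar_graph_closed:
  assumes "dbar_graph f v" shows "weak_dbar1 j k v (\<lambda>_. 0)"
  unfolding weak_dbar1_def
proof (intro allI impI)
  fix \<psi> :: "complex^'n \<Rightarrow> complex" assume t: "test_fun \<psi>"
  have f: "sq_int M f" "sq_int M v" and w: "\<And>j. weak_dbar0 j f (\<lambda>z. v z $ j)"
    using assms by (auto simp: dbar_graph_def has_dbar0_def)
  have w': "(\<integral>z. v z $ k * wzbar j \<psi> z \<partial>lebesgue) = - (\<integral>z. f z * wzbar k (\<lambda>z. wzbar j \<psi> z) z \<partial>lebesgue)" for j k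
    using w[of k] test_fun_wzbar[OF t, of j] unfolding weak_dbar0_def by simp
  show "(\<integral>z. v z $ k * wzbar j \<psi> z - v z $ j * wzbar k \<psi> z \<partial>lebesgue) = - (\<integral>z. 0 * \<psi> z \<partial>lebesgue)"
    using pairing(1)[OF sq_int_nth[OF f(2)] test_fun_wzbar[OF t]] 
    by (simp add: w' wzbar_commute[OF test_fun_smooth[OF t], of j k])
qed

subsection \<open>Multiplication by smooth functions\<close>

text \<open>The coefficients of the (0,1)-form \<open>dbar\<close> of \<eta>, not the real
  gradient.\<close>

definition grad :: "(complex^'n \<Rightarrow> real) \<Rightarrow> complex^'n \<Rightarrow> complex^'n" where
  "grad \<eta> z = (\<chi> j. wzbar j (\<lambda>x. complex_of_real (\<eta> x)) z)"

lemma grad_nth: "grad \<eta> z $ j = wzbar j (\<lambda>x. complex_of_real (\<eta> x)) z"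
  by (simp add: grad_def)

lemma smooth_of_real: "smooth_fun \<eta> \<Longrightarrow> smooth_fun (\<lambda>x. complex_of_real (\<eta> x))"
  by (rule smooth_comp_linear[OF bounded_linear_of_real])

lemma grad_bound:
  assumes s: "smooth_fun \<eta>" and l: "\<And>v. \<bar>frechet_derivative \<eta> (at z) v\<bar> \<le> l * norm v"
  shows "norm (grad \<eta> z $ j) \<le> l"
proof -
  have d: "frechet_derivative (\<lambda>x. complex_of_real (\<eta> x)) (at z) v = of_real (frechet_derivative \<eta> (at z) v)" for v
  proof -
    have "((\<lambda>x. complex_of_real (\<eta> x)) has_derivative (\<lambda>v. complex_of_real (frechet_derivative \<eta> (at z) v))) (at z)"
      by (rule has_derivative_of_real[OF smooth_has_derivative[OF s]])
    from fun_cong[OF frechet_derivative_at[OF this], of v] show ?thesis by simp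
  qed
  have n: "norm (axis j (1::complex)) = 1" "norm (axis j \<i>) = 1"
    by (simp_all add: norm_eq_sqrt_inner inner_axis_axis inner_complex_def)
  let ?a = "frechet_derivative \<eta> (at z) (axis j 1)" and ?b = "frechet_derivative \<eta> (at z) (axis j \<i>)"
  have "norm (complex_of_real ?a + \<i> * complex_of_real ?b) \<le> \<bar>?a\<bar> + \<bar>?b\<bar>"
    using norm_triangle_ineq[of "complex_of_real ?a" "\<i> * complex_of_real ?b"] by (simp add: norm_mult)
  also have "\<dots> \<le> 2 * l" using l[of "axis j 1"] l[of "axis j \<i>"] n by simp
  finally show ?thesis unfolding grad_nth wzbar_def d by (simp add: norm_divide)
qed

lemma grad_continuous: "smooth_fun \<eta> \<Longrightarrow> continuous_on UNIV (\<lambda>z. grad \<eta> z $ j)"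
  unfolding grad_nth by (intro smooth_continuous smooth_wzbar smooth_of_real)

lemma sq_int_bounded_scaleR:
  fixes \<eta> :: "complex^'n \<Rightarrow> real"
  assumes "sq_int M f" "continuous_on UNIV \<eta>" "\<And>z. \<bar>\<eta> z\<bar> \<le> B"
  shows "sq_int M (\<lambda>z. \<eta> z *\<^sub>R f z)"
proof (rule sq_int_bound[OF assms(1), of _ B])
  have [measurable]: "\<eta> \<in> borel_measurable M" "f \<in> borel_measurable M"
    using assms(2) sq_intD(1)[OF assms(1)] by (auto simp: measurable_M intro!: borel_imp_lebesgue borel_continuous)
  show "(\<lambda>z. \<eta> z *\<^sub>R f z) \<in> borel_measurable M" by measurable
qed (simp add: mult_right_mono assms(3))

lemma sq_int_bounded_mult:
  fixes a :: "complex^'n \<Rightarrow> complex"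
  assumes "sq_int M f" "continuous_on UNIV a" "\<And>z. norm (a z) \<le> B"
  shows "sq_int M (\<lambda>z. a z * f z)"
proof (rule sq_int_bound[OF assms(1), of _ B])
  have [measurable]: "a \<in> borel_measurable M" "f \<in> borel_measurable M"
    using assms(2) sq_intD(1)[OF assms(1)] by (auto simp: measurable_M intro!: borel_imp_lebesgue borel_continuous)
  show "(\<lambda>z. a z * f z) \<in> borel_measurable M" by measurable
qed (simp add: norm_mult mult_right_mono assms(3))

text \<open>Qualitative bounds that keep products with \<eta> and with its derivatives square
  integrable. They are never inserted into an estimate.\<close>

definition tame :: "(complex^'n \<Rightarrow> real) \<Rightarrow> bool" where
  "tame \<eta> \<longleftrightarrow> smooth_fun \<eta> \<and> (\<exists>B. \<forall>z. \<bar>\<eta> z\<bar> \<le> B) \<and> (\<exists>B. \<forall>z v. \<bar>frechet_derivative \<eta> (at z) v\<bar> \<le> B * norm v)"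

lemma tame_sq_int:
  assumes "tame \<eta>"
  shows "sq_int M f \<Longrightarrow> sq_int M (\<lambda>z. \<eta> z *\<^sub>R f z)" "sq_int M g \<Longrightarrow> sq_int M (\<lambda>z. grad \<eta> z $ j * g z)"
    "sq_int M g \<Longrightarrow> sq_int M (\<lambda>z. cnj (grad \<eta> z $ j) * g z)"
proof -
  obtain B B' where s: "smooth_fun \<eta>" and B: "\<And>z. \<bar>\<eta> z\<bar> \<le> B" "\<And>z v. \<bar>frechet_derivative \<eta> (at z) v\<bar> \<le> B' * norm v"
    using assms unfolding tame_def by metis
  show "sq_int M f \<Longrightarrow> sq_int M (\<lambda>z. \<eta> z *\<^sub>R f z)"
    by (rule sq_int_bounded_scaleR[OF _ smooth_continuous[OF s] B(1)])
  show "sq_int M g \<Longrightarrow> sq_int M (\<lambda>z. grad \<eta> z $ j * g z)"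
    by (rule sq_int_bounded_mult[OF _ grad_continuous[OF s] grad_bound[OF s B(2)]])
  show "sq_int M g \<Longrightarrow> sq_int M (\<lambda>z. cnj (grad \<eta> z $ j) * g z)"
    by (rule sq_int_bounded_mult[of _ _ B']) (auto intro!: continuous_intros grad_continuous[OF s] grad_bound[OF s B(2)])
qed

lemma wzbar_mult_test:
  assumes "smooth_fun \<eta>" "test_fun \<psi>"
  shows "wzbar j (\<lambda>x. complex_of_real (\<eta> x) * \<psi> x) z = complex_of_real (\<eta> z) * wzbar j \<psi> z + grad \<eta> z $ j * \<psi> z"
  unfolding grad_nth using assms by (intro wz_test_bilinear smooth_differentiable smooth_of_real test_fun_smooth)

lemma test_fun_grad_mult: "smooth_fun \<eta> \<Longrightarrow> test_fun \<psi> \<Longrightarrow> test_fun (\<lambda>z. grad \<eta> z $ j * \<psi> z)"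
  unfolding grad_nth by (intro test_fun_mult smooth_wzbar smooth_of_real)

lemma sq_int_smult_grad: "tame \<eta> \<Longrightarrow> sq_int M f \<Longrightarrow> sq_int M (\<lambda>z. f z *s grad \<eta> z)"
  by (rule sq_int_vec) (simp add: mult.commute[of "f _"] tame_sq_int(2))

text \<open>Leibniz rule for weak derivatives, obtained by testing the equation for f with \<eta>
  \<psi>.\<close>

lemma dbar_graph_mult:
  assumes t: "tame \<eta>" and g: "dbar_graph f v"
  shows "dbar_graph (\<lambda>z. \<eta> z *\<^sub>R f z) (\<lambda>z. \<eta> z *\<^sub>R v z + f z *s grad \<eta> z)"
proof -
  have s: "smooth_fun \<eta>" using t by (simp add: tame_def)
  have f: "sq_int M f" "sq_int M v" and w: "\<And>j. weak_dbar0 j f (\<lambda>z. v z $ j)"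
    using g by (auto simp: dbar_graph_def has_dbar0_def)
  have "weak_dbar0 j (\<lambda>z. \<eta> z *\<^sub>R f z) (\<lambda>z. (\<eta> z *\<^sub>R v z + f z *s grad \<eta> z) $ j)" for j
    unfolding weak_dbar0_def
  proof (intro allI impI)
    fix \<psi> :: "complex^'n \<Rightarrow> complex" assume p: "test_fun \<psi>"
    have p': "test_fun (\<lambda>x. complex_of_real (\<eta> x) * \<psi> x)" by (rule test_fun_mult[OF smooth_of_real[OF s] p])
    have i1: "integrable lebesgue (\<lambda>z. f z * wzbar j (\<lambda>x. complex_of_real (\<eta> x) * \<psi> x) z)"
      by (rule pairing(1)[OF f(1) test_fun_wzbar[OF p']])
    have i2: "integrable lebesgue (\<lambda>z. f z * (grad \<eta> z $ j * \<psi> z))"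
      by (rule pairing(1)[OF f(1) test_fun_grad_mult[OF s p]])
    have i3: "integrable lebesgue (\<lambda>z. v z $ j * (complex_of_real (\<eta> z) * \<psi> z))"
      by (rule pairing(1)[OF sq_int_nth[OF f(2)] p'])
    have "(\<integral>z. \<eta> z *\<^sub>R f z * wzbar j \<psi> z \<partial>lebesgue)
        = (\<integral>z. f z * wzbar j (\<lambda>x. complex_of_real (\<eta> x) * \<psi> x) z - f z * (grad \<eta> z $ j * \<psi> z) \<partial>lebesgue)"
      unfolding wzbar_mult_test[OF s p] by (simp add: scaleR_conv_of_real algebra_simps)
    also have "\<dots> = - (\<integral>z. v z $ j * (complex_of_real (\<eta> z) * \<psi> z) + f z * (grad \<eta> z $ j * \<psi> z) \<partial>lebesgue)"
      using i1 i2 i3 w[of j] p' unfolding weak_dbar0_def by simp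
    also have "\<dots> = - (\<integral>z. (\<eta> z *\<^sub>R v z + f z *s grad \<eta> z) $ j * \<psi> z \<partial>lebesgue)"
      unfolding vector_scaleR_component vector_add_component vector_smult_component by (simp add: scaleR_conv_of_real algebra_simps)
    finally show "(\<integral>z. \<eta> z *\<^sub>R f z * wzbar j \<psi> z \<partial>lebesgue) = - (\<integral>z. (\<eta> z *\<^sub>R v z + f z *s grad \<eta> z) $ j * \<psi> z \<partial>lebesgue)" .
  qed
  then show ?thesis unfolding dbar_graph_def has_dbar0_def
    by (intro conjI allI sq_int_add tame_sq_int(1)[OF t] sq_int_smult_grad[OF t] f)
qed

lemma weak_dbar1_mult:
  assumes t: "tame \<eta>" and u: "sq_int M u" and W: "sq_int M W" and w: "weak_dbar1 j k u W"
  shows "weak_dbar1 j k (\<lambda>z. \<eta> z *\<^sub>R u z) (\<lambda>z. \<eta> z *\<^sub>R W z + (grad \<eta> z $ j * u z $ k - grad \<eta> z $ k * u z $ j))"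
  unfolding weak_dbar1_def
proof (intro allI impI)
  have s: "smooth_fun \<eta>" using t by (simp add: tame_def)
  fix \<psi> :: "complex^'n \<Rightarrow> complex" assume p: "test_fun \<psi>"
  let ?p = "\<lambda>x. complex_of_real (\<eta> x) * \<psi> x"
  have p': "test_fun ?p" by (rule test_fun_mult[OF smooth_of_real[OF s] p])
  have i1: "integrable lebesgue (\<lambda>z. u z $ k * wzbar j ?p z)" for j k
    by (rule pairing(1)[OF sq_int_nth[OF u] test_fun_wzbar[OF p']])
  have i2: "integrable lebesgue (\<lambda>z. u z $ k * (grad \<eta> z $ j * \<psi> z))" for j k
    by (rule pairing(1)[OF sq_int_nth[OF u] test_fun_grad_mult[OF s p]])
  have i3: "integrable lebesgue (\<lambda>z. W z * ?p z)" by (rule pairing(1)[OF W p'])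
  have "(\<integral>z. (\<eta> z *\<^sub>R u z) $ k * wzbar j \<psi> z - (\<eta> z *\<^sub>R u z) $ j * wzbar k \<psi> z \<partial>lebesgue)
     = (\<integral>z. (u z $ k * wzbar j ?p z - u z $ j * wzbar k ?p z)
          - (u z $ k * (grad \<eta> z $ j * \<psi> z) - u z $ j * (grad \<eta> z $ k * \<psi> z)) \<partial>lebesgue)"
    unfolding wzbar_mult_test[OF s p] vector_scaleR_component by (simp add: scaleR_conv_of_real algebra_simps)
  also have "\<dots> = (\<integral>z. u z $ k * wzbar j ?p z - u z $ j * wzbar k ?p z \<partial>lebesgue)
      - (\<integral>z. u z $ k * (grad \<eta> z $ j * \<psi> z) - u z $ j * (grad \<eta> z $ k * \<psi> z) \<partial>lebesgue)"
    by (intro Bochner_Integration.integral_diff Bochner_Integration.integrable_diff i1 i2)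
  also have "(\<integral>z. u z $ k * wzbar j ?p z - u z $ j * wzbar k ?p z \<partial>lebesgue) = - (\<integral>z. W z * ?p z \<partial>lebesgue)"
    using w p' unfolding weak_dbar1_def by blast
  also have "- (\<integral>z. W z * ?p z \<partial>lebesgue) - (\<integral>z. u z $ k * (grad \<eta> z $ j * \<psi> z) - u z $ j * (grad \<eta> z $ k * \<psi> z) \<partial>lebesgue)
     = - (\<integral>z. W z * ?p z + (u z $ k * (grad \<eta> z $ j * \<psi> z) - u z $ j * (grad \<eta> z $ k * \<psi> z)) \<partial>lebesgue)"
    using i2 i3 by simp
  also have "\<dots> = - (\<integral>z. (\<eta> z *\<^sub>R W z + (grad \<eta> z $ j * u z $ k - grad \<eta> z $ k * u z $ j)) * \<psi> z \<partial>lebesgue)"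
    by (simp add: scaleR_conv_of_real algebra_simps)
  finally show "(\<integral>z. (\<eta> z *\<^sub>R u z) $ k * wzbar j \<psi> z - (\<eta> z *\<^sub>R u z) $ j * wzbar k \<psi> z \<partial>lebesgue)
     = - (\<integral>z. (\<eta> z *\<^sub>R W z + (grad \<eta> z $ j * u z $ k - grad \<eta> z $ k * u z $ j)) * \<psi> z \<partial>lebesgue)" .
qed

text \<open>The pointwise adjoint of multiplying a function by \<open>dbar\<close> of \<eta>. It is
  the commutator of \<eta> with the adjoint operator, as the wedge product with \<open>dbar\<close>
  of \<eta> is with \<open>dbar\<close> on (0,1)-forms.\<close>

definition contract :: "(complex^'n \<Rightarrow> real) \<Rightarrow> (complex^'n \<Rightarrow> complex^'n) \<Rightarrow> complex^'n \<Rightarrow> complex" where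
  "contract \<eta> u z = (\<Sum>j\<in>UNIV. cnj (grad \<eta> z $ j) * u z $ j)"

lemma sq_int_contract: "tame \<eta> \<Longrightarrow> sq_int M u \<Longrightarrow> sq_int M (contract \<eta> u)"
  unfolding contract_def[abs_def] by (intro sq_int_sum tame_sq_int(3) sq_int_nth) auto

lemma smult_grad_inner: "(c *s grad \<eta> z) \<bullet> u z = c \<bullet> contract \<eta> u z"
  unfolding contract_def inner_vec_def inner_sum_right by (rule sum.cong) (auto simp: inner_complex_def algebra_simps)

text \<open>Dual to \<open>dbar_graph_mult\<close>: the adjoint relation of g is applied to \<eta>
  f. Thus \<eta> g lies in the adjoint domain without any approximation by smooth forms.\<close>

lemma adj_dbar_mult:
  assumes t: "tame \<eta>" and g: "sq_int M g" and h: "sq_int M h" and a: "adj_dbar \<phi> g h"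
  shows "adj_dbar \<phi> (\<lambda>z. \<eta> z *\<^sub>R g z) (\<lambda>z. \<eta> z *\<^sub>R h z - contract \<eta> g z)"
proof -
  have r: "(\<integral>z. v z \<bullet> (\<eta> z *\<^sub>R g z) \<partial>M) = (\<integral>z. f z \<bullet> (\<eta> z *\<^sub>R h z - contract \<eta> g z) \<partial>M)" if fv: "dbar_graph f v" for f v
  proof -
    have f: "sq_int M f" "sq_int M v" using fv by (auto simp: dbar_graph_def)
    note m = dbar_graph_mult[OF t fv]
    have i: "integrable M (\<lambda>z. (\<eta> z *\<^sub>R v z + f z *s grad \<eta> z) \<bullet> g z)" "integrable M (\<lambda>z. (f z *s grad \<eta> z) \<bullet> g z)"
      "integrable M (\<lambda>z. (\<eta> z *\<^sub>R f z) \<bullet> h z)" "integrable M (\<lambda>z. f z \<bullet> contract \<eta> g z)"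
      by (intro sq_int_inner sq_int_add tame_sq_int(1)[OF t] sq_int_smult_grad[OF t] sq_int_contract[OF t] f g h)+
    have "(\<integral>z. v z \<bullet> (\<eta> z *\<^sub>R g z) \<partial>M) = (\<integral>z. (\<eta> z *\<^sub>R v z + f z *s grad \<eta> z) \<bullet> g z - (f z *s grad \<eta> z) \<bullet> g z \<partial>M)"
      by (simp add: inner_add_left)
    also have "\<dots> = (\<integral>z. (\<eta> z *\<^sub>R f z) \<bullet> h z \<partial>M) - (\<integral>z. f z \<bullet> contract \<eta> g z \<partial>M)"
      using i m a adj_dbar_iff[OF g h] unfolding smult_grad_inner[symmetric] by simp
    also have "\<dots> = (\<integral>z. f z \<bullet> (\<eta> z *\<^sub>R h z - contract \<eta> g z) \<partial>M)"
      using i by (simp add: inner_diff_right)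
    finally show ?thesis .
  qed
  show ?thesis
    using r by (subst adj_dbar_iff) (auto intro!: tame_sq_int(1)[OF t] sq_int_diff sq_int_contract[OF t] g h)
qed

end

subsection \<open>The form domain\<close>

locale coercive_weight = weighted_space \<phi> + radius_function \<kappa> C K
  for \<phi> :: "complex^'n \<Rightarrow> real" and \<kappa> :: "complex^'n \<Rightarrow> real" and C K +
  assumes coer: "coercive \<phi> (\<lambda>z. 1 / \<kappa> z)"
begin

text \<open>A form \<open>g\<close> in the domain of the quadratic form is stored with its images: \<open>F = (g, dbar g, dbar* g)\<close>.\<close>
definition V :: "(complex^'n \<Rightarrow> (complex^'n) \<times> (complex^'n^'n) \<times> complex) set" where
  "V = {F. sq_int M F \<and> (\<forall>j k. weak_dbar1 j k (\<lambda>z. fst (F z)) (\<lambda>z. fst (snd (F z)) $ j $ k))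
        \<and> adj_dbar \<phi> (\<lambda>z. fst (F z)) (\<lambda>z. snd (snd (F z)))}"

text \<open>Orthogonality to the first family says that the middle component is the weak
  \<open>dbar\<close> of the first; orthogonality to the second says that the last component is its
  image under the adjoint. So \<open>V\<close> is cut out of the square-integrable triples by linear
  conditions that survive limits.\<close>

definition tests :: "(complex^'n \<Rightarrow> (complex^'n) \<times> (complex^'n^'n) \<times> complex) set" where
  "tests = {\<lambda>z. (curl_test j k \<psi> z, axis j (axis k (up \<psi> z)), 0) | j k \<psi>. test_fun \<psi>}
     \<union> {\<lambda>z. (v z, 0, - f z) | f v. dbar_graph f v}"

lemma sq_int_Pair: "sq_int M a \<Longrightarrow> sq_int M b \<Longrightarrow> sq_int M (\<lambda>z. (a z, b z))"
proof -
  assume a: "sq_int M a" and b: "sq_int M b"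
  have "sq_int M (\<lambda>z. (a z, 0))"
    by (rule sq_int_continuous_image[OF a, of "\<lambda>x. (x, 0)"]) (auto intro!: linearI)
  moreover have "sq_int M (\<lambda>z. (0, b z))"
    by (rule sq_int_continuous_image[OF b, of "\<lambda>x. (0, x)"]) (auto intro!: linearI)
  ultimately show ?thesis using sq_int_add by fastforce
qed

lemma sq_int_fst: "sq_int M F \<Longrightarrow> sq_int M (\<lambda>z. fst (F z))"
  by (rule sq_int_continuous_image[of F fst]) (auto intro!: linearI simp: norm_fst_le)

lemma sq_int_snd: "sq_int M F \<Longrightarrow> sq_int M (\<lambda>z. snd (F z))"
  by (rule sq_int_continuous_image[of F snd]) (auto intro!: linearI simp: norm_snd_le)

lemma sq_int_zero: "sq_int M (\<lambda>_. 0)"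
  by (simp add: sq_int_def)

lemma sq_int_tests: "G \<in> tests \<Longrightarrow> sq_int M G"
  unfolding tests_def dbar_graph_def
  by (auto intro!: sq_int_Pair sq_int_curl_test sq_int_axis sq_int_up sq_int_zero 
      intro: sq_int_scaleR[of _ _ "-1", simplified])

lemma V_iff:
  assumes F: "sq_int M F" shows "F \<in> V \<longleftrightarrow> (\<forall>G\<in>tests. (\<integral>z. F z \<bullet> G z \<partial>M) = 0)"
proof -
  let ?g = "\<lambda>z. fst (F z)" and ?W = "\<lambda>j k z. fst (snd (F z)) $ j $ k" and ?h = "\<lambda>z. snd (snd (F z))"
  have g: "sq_int M ?g" and W: "\<And>j k. sq_int M (?W j k)" and h: "sq_int M ?h"
    by (intro sq_int_fst sq_int_snd sq_int_nth F)+
  have 1: "(\<integral>z. F z \<bullet> (curl_test j k \<psi> z, axis j (axis k (up \<psi> z)), 0) \<partial>M)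
      = (\<integral>z. ?g z \<bullet> curl_test j k \<psi> z \<partial>M) + (\<integral>z. ?W j k z \<bullet> up \<psi> z \<partial>M)" if "test_fun \<psi>" for j k \<psi>
    unfolding inner_prod_def
    using sq_int_inner[OF g sq_int_curl_test[OF that]] sq_int_inner[OF W sq_int_up[OF that]] by (simp add: inner_axis)
  have 2: "(\<integral>z. F z \<bullet> (v z, 0, - f z) \<partial>M) = (\<integral>z. v z \<bullet> ?g z \<partial>M) - (\<integral>z. f z \<bullet> ?h z \<partial>M)" if "dbar_graph f v" for f v
    unfolding inner_prod_def
    using sq_int_inner[OF g, of v] sq_int_inner[OF h, of f] that by (simp add: inner_commute dbar_graph_def)
  have "(\<forall>G\<in>tests. (\<integral>z. F z \<bullet> G z \<partial>M) = 0) \<longleftrightarrow>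
      (\<forall>j k \<psi>. test_fun \<psi> \<longrightarrow> (\<integral>z. ?g z \<bullet> curl_test j k \<psi> z \<partial>M) + (\<integral>z. ?W j k z \<bullet> up \<psi> z \<partial>M) = 0) \<and>
      (\<forall>f v. dbar_graph f v \<longrightarrow> (\<integral>z. v z \<bullet> ?g z \<partial>M) = (\<integral>z. f z \<bullet> ?h z \<partial>M))" (is "?L \<longleftrightarrow> ?R")
  proof
    assume L: ?L
    show ?R
    proof (intro conjI allI impI)
      fix j k and \<psi> :: "complex^'n \<Rightarrow> complex" assume t: "test_fun \<psi>"
      have "(\<lambda>z. (curl_test j k \<psi> z, axis j (axis k (up \<psi> z)), 0)) \<in> tests" unfolding tests_def using t by blast
      then show "(\<integral>z. ?g z \<bullet> curl_test j k \<psi> z \<partial>M) + (\<integral>z. ?W j k z \<bullet> up \<psi> z \<partial>M) = 0"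
        using L 1[OF t, of j k] by fastforce
    next
      fix f v assume t: "dbar_graph f v"
      have "(\<lambda>z. (v z, 0, - f z)) \<in> tests" unfolding tests_def using t by blast
      then show "(\<integral>z. v z \<bullet> ?g z \<partial>M) = (\<integral>z. f z \<bullet> ?h z \<partial>M)" using L 2[OF t] by fastforce
    qed
  next
    assume R: ?R
    show ?L unfolding tests_def using R 1 2 by auto
  qed
  then show ?thesis
    unfolding V_def using F weak_dbar1_iff[OF g W] adj_dbar_iff[OF g h] by auto
qed

lemma V_sq_int: "F \<in> V \<Longrightarrow> sq_int M F"
  by (simp add: V_def)

lemma V_lin:
  assumes "F \<in> V" "G \<in> V" shows "(\<lambda>z. a *\<^sub>R F z + b *\<^sub>R G z) \<in> V"
proof -
  note s = V_sq_int[OF assms(1)] V_sq_int[OF assms(2)]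
  have "(\<integral>z. (a *\<^sub>R F z + b *\<^sub>R G z) \<bullet> T z \<partial>M) = 0" if T: "T \<in> tests" for T
    using assms V_iff[OF s(1)] V_iff[OF s(2)] T sq_int_inner[OF s(1) sq_int_tests[OF T]] sq_int_inner[OF s(2) sq_int_tests[OF T]]
    by (simp add: inner_add_left)
  then show ?thesis using V_iff[OF sq_int_lin[OF s]] by blast
qed

text \<open>The polarised quadratic form. The factor 1/2 compensates for storing \<open>dbar\<close>
  of g as a full antisymmetric matrix, in which every pair j < k occurs twice. The first component
  enters only through coercivity.\<close>

definition form :: "(complex^'n \<Rightarrow> (complex^'n) \<times> (complex^'n^'n) \<times> complex) \<Rightarrow> (complex^'n \<Rightarrow> (complex^'n) \<times> (complex^'n^'n) \<times> complex) \<Rightarrow> real" where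
  "form F G = (\<integral>z. (1/2) * (fst (snd (F z)) \<bullet> fst (snd (G z))) + snd (snd (F z)) \<bullet> snd (snd (G z)) \<partial>M)"

lemma form_integrable:
  assumes "sq_int M F" "sq_int M G"
  shows "integrable M (\<lambda>z. fst (snd (F z)) \<bullet> fst (snd (G z)))" "integrable M (\<lambda>z. snd (snd (F z)) \<bullet> snd (snd (G z)))"
  by (intro sq_int_inner sq_int_fst sq_int_snd assms)+

lemma form_lin:
  assumes "sq_int M F" "sq_int M G" "sq_int M H"
  shows "form (\<lambda>z. a *\<^sub>R F z + b *\<^sub>R G z) H = a * form F H + b * form G H"
proof -
  note i = form_integrable[OF assms(1,3)] form_integrable[OF assms(2,3)]
  have "form (\<lambda>z. a *\<^sub>R F z + b *\<^sub>R G z) H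
    = (\<integral>z. a * ((1/2) * (fst (snd (F z)) \<bullet> fst (snd (H z))) + snd (snd (F z)) \<bullet> snd (snd (H z)))
        + b * ((1/2) * (fst (snd (G z)) \<bullet> fst (snd (H z))) + snd (snd (G z)) \<bullet> snd (snd (H z))) \<partial>M)"
    unfolding form_def by (rule Bochner_Integration.integral_cong) (auto simp: inner_add_left algebra_simps)
  then show ?thesis unfolding form_def using i by simp
qed

lemma form_commute: "form F G = form G F"
  unfolding form_def by (simp add: inner_commute)

lemma form_nonneg: "0 \<le> form F F"
  unfolding form_def by (intro Bochner_Integration.integral_nonneg) auto

lemma form_self:
  assumes "sq_int M F"
  shows "form F F = (\<integral>z. (norm (fst (snd (F z))))\<^sup>2 \<partial>M) / 2 + (\<integral>z. (norm (snd (snd (F z))))\<^sup>2 \<partial>M)"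
  unfolding form_def power2_norm_eq_inner using form_integrable[OF assms assms] by simp

lemma kappa_measurable: "\<kappa> \<in> borel_measurable M"
  using meas by (simp add: measurable_M borel_imp_lebesgue)

lemma norm_vec_sq: "(norm (x :: 'b::euclidean_space^'m))\<^sup>2 = (\<Sum>j\<in>UNIV. (norm (x $ j))\<^sup>2)"
  by (simp add: norm_vec_def L2_set_def sum_nonneg)

lemma coercivity:
  assumes F: "F \<in> V"
  shows "sq_int M (\<lambda>z. (1 / \<kappa> z) *\<^sub>R fst (F z))" "(\<integral>z. (norm ((1 / \<kappa> z) *\<^sub>R fst (F z)))\<^sup>2 \<partial>M) \<le> form F F"
proof -
  note s = V_sq_int[OF F]
  let ?W = "\<lambda>j k z. fst (snd (F z)) $ j $ k" and ?h = "\<lambda>z. snd (snd (F z))"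
  have W: "\<And>j k. sq_int M (?W j k)" and h: "sq_int M ?h" and g: "sq_int M (\<lambda>z. fst (F z))"
    by (intro sq_int_fst sq_int_snd sq_int_nth s)+
  have [measurable]: "(\<lambda>z. fst (F z)) \<in> borel_measurable M" "\<kappa> \<in> borel_measurable M"
    by (rule sq_intD(1)[OF g], rule kappa_measurable)
  have m: "(\<lambda>z. (1 / \<kappa> z) *\<^sub>R fst (F z)) \<in> borel_measurable M" by measurable
  then have m2: "(\<lambda>z. (norm ((1 / \<kappa> z) *\<^sub>R fst (F z)))\<^sup>2) \<in> borel_measurable lebesgue"
    unfolding measurable_M[symmetric] by measurable
  have "(\<integral>\<^sup>+z. ennreal ((norm ((1 / \<kappa> z) *\<^sub>R fst (F z)))\<^sup>2) \<partial>M)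
      = (\<integral>\<^sup>+z. ennreal ((1 / \<kappa> z)\<^sup>2 * (norm (fst (F z)))\<^sup>2 * exp (-2 * \<phi> z)) \<partial>lebesgue)"
    unfolding nn_integral_M[OF m2] by (simp add: power_mult_distrib power_divide)
  also have "\<dots> \<le> (\<Sum>j\<in>UNIV. \<Sum>k\<in>UNIV. wnorm2 \<phi> (?W j k)) / 2 + wnorm2 \<phi> ?h"
    using coer F unfolding coercive_def V_def L2form1_iff L2w_iff
    using g W by (elim allE[of _ "\<lambda>z. fst (F z)"] allE[of _ "\<lambda>j k z. fst (snd (F z)) $ j $ k"] allE[of _ ?h]) blast
  also have "\<dots> = ennreal (form F F)"
  proof -
    have "(\<Sum>j\<in>UNIV. \<Sum>k\<in>UNIV. wnorm2 \<phi> (?W j k)) = ennreal (\<Sum>j\<in>UNIV. \<Sum>k\<in>UNIV. \<integral>z. (norm (?W j k z))\<^sup>2 \<partial>M)"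
      unfolding wnorm2_eq[OF W] by (simp add: sum_nonneg)
    also have "(\<Sum>j\<in>UNIV. \<Sum>k\<in>UNIV. \<integral>z. (norm (?W j k z))\<^sup>2 \<partial>M) = (\<integral>z. (norm (fst (snd (F z))))\<^sup>2 \<partial>M)"
      unfolding norm_vec_sq using sq_intD(2)[OF W] by simp
    finally show ?thesis
      unfolding wnorm2_eq[OF h] form_self[OF s]
      by (simp add: ennreal_plus divide_ennreal flip: ennreal_numeral)
  qed
  finally have le: "(\<integral>\<^sup>+z. ennreal ((norm ((1 / \<kappa> z) *\<^sub>R fst (F z)))\<^sup>2) \<partial>M) \<le> ennreal (form F F)" .
  show sq: "sq_int M (\<lambda>z. (1 / \<kappa> z) *\<^sub>R fst (F z))"
    unfolding sq_int_def using m le by (auto intro!: integrableI_nonneg simp: le_less_trans)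
  show "(\<integral>z. (norm ((1 / \<kappa> z) *\<^sub>R fst (F z)))\<^sup>2 \<partial>M) \<le> form F F"
    using le nn_integral_eq_integral[OF sq_intD(2)[OF sq]] form_nonneg[of F] by simp
qed

text \<open>Since \<kappa> is at most K, coercivity controls the first component by K^2 times the
  form. The other two components cost 2 because of the factor 1/2 in \<open>form\<close>.\<close>

lemma form_controls_norm:
  assumes F: "F \<in> V" shows "(\<integral>z. (norm (F z))\<^sup>2 \<partial>M) \<le> (K\<^sup>2 + 2) * form F F"
proof -
  note s = V_sq_int[OF F] and c = coercivity[OF F]
  have i: "integrable M (\<lambda>z. (norm ((1 / \<kappa> z) *\<^sub>R fst (F z)))\<^sup>2)" "integrable M (\<lambda>z. (norm (fst (snd (F z))))\<^sup>2)"
    "integrable M (\<lambda>z. (norm (snd (snd (F z))))\<^sup>2)"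
    by (intro sq_intD(2) c(1) sq_int_fst sq_int_snd s)+
  have "(\<integral>z. (norm (F z))\<^sup>2 \<partial>M) \<le> (\<integral>z. K\<^sup>2 * (norm ((1 / \<kappa> z) *\<^sub>R fst (F z)))\<^sup>2 + ((norm (fst (snd (F z))))\<^sup>2 + (norm (snd (snd (F z))))\<^sup>2) \<partial>M)"
  proof (rule integral_mono)
    show "integrable M (\<lambda>z. (norm (F z))\<^sup>2)" by (rule sq_intD(2)[OF s])
    fix z
    have "(norm (fst (F z)))\<^sup>2 \<le> K\<^sup>2 * (norm ((1 / \<kappa> z) *\<^sub>R fst (F z)))\<^sup>2"
    proof -
      have "norm (fst (F z)) * \<kappa> z \<le> norm (fst (F z)) * K" using le_K[of z] by (rule mult_left_mono) simp
      then have "norm (fst (F z)) \<le> K * norm ((1 / \<kappa> z) *\<^sub>R fst (F z))"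
        using pos[of z] by (simp add: field_simps)
      from power_mono[OF this norm_ge_zero, of 2] show ?thesis by (simp add: power_mult_distrib power_divide)
    qed
    then show "(norm (F z))\<^sup>2 \<le> K\<^sup>2 * (norm ((1 / \<kappa> z) *\<^sub>R fst (F z)))\<^sup>2 + ((norm (fst (snd (F z))))\<^sup>2 + (norm (snd (snd (F z))))\<^sup>2)"
      by (simp add: norm_prod_def)
  qed (use i in simp)
  also have "\<dots> = K\<^sup>2 * (\<integral>z. (norm ((1 / \<kappa> z) *\<^sub>R fst (F z)))\<^sup>2 \<partial>M) + ((\<integral>z. (norm (fst (snd (F z))))\<^sup>2 \<partial>M) + (\<integral>z. (norm (snd (snd (F z))))\<^sup>2 \<partial>M))"
    using i by simp
  also have "\<dots> \<le> K\<^sup>2 * form F F + 2 * form F F"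
    using c(2) by (intro add_mono mult_left_mono) (auto simp: form_self[OF s])
  finally show ?thesis by (simp add: algebra_simps)
qed

text \<open>A sequence that is Cauchy for the form is, by \<open>form_controls_norm\<close>, Cauchy
  in the space of triples. Its limit stays orthogonal to \<open>tests\<close>, hence in
  \<open>V\<close>. The same estimate makes pairing with u a bounded functional.\<close>

lemma Riesz_V:
  assumes u: "sq_int M u"
  shows "\<exists>F\<in>V. \<forall>G\<in>V. form F G = (\<integral>z. u z \<bullet> fst (G z) \<partial>M)"
proof (rule Riesz_on[where K = "(\<integral>z. (norm (u z))\<^sup>2 \<partial>M) * (K\<^sup>2 + 2)"])
  have "(\<lambda>_. 0) \<in> V" by (subst V_iff) (auto simp: sq_int_zero)
  then show "V \<noteq> {}" by blast
  show "(\<lambda>x. a *\<^sub>R f x + b *\<^sub>R g x) \<in> V" if "f \<in> V" "g \<in> V" for f g a b using V_lin that by blast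
  show "form (\<lambda>x. a *\<^sub>R f x + b *\<^sub>R g x) h = a * form f h + b * form g h" if "f \<in> V" "g \<in> V" "h \<in> V" for f g h a b
    using form_lin that V_sq_int by blast
  show "form f g = form g f" for f g by (rule form_commute)
  show "0 \<le> form f f" for f by (rule form_nonneg)
  show "0 \<le> (\<integral>z. (norm (u z))\<^sup>2 \<partial>M) * (K\<^sup>2 + 2)" by simp
  show "(\<integral>z. u z \<bullet> fst (a *\<^sub>R f z + b *\<^sub>R g z) \<partial>M) = a * (\<integral>z. u z \<bullet> fst (f z) \<partial>M) + b * (\<integral>z. u z \<bullet> fst (g z) \<partial>M)"
    if "f \<in> V" "g \<in> V" for f g a b
    using sq_int_inner[OF u sq_int_fst[OF V_sq_int[OF that(1)]]] sq_int_inner[OF u sq_int_fst[OF V_sq_int[OF that(2)]]]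
    by (simp add: inner_add_right)
  show "(\<integral>z. u z \<bullet> fst (f z) \<partial>M)\<^sup>2 \<le> (\<integral>z. (norm (u z))\<^sup>2 \<partial>M) * (K\<^sup>2 + 2) * form f f" if f: "f \<in> V" for f
  proof -
    note s = V_sq_int[OF f]
    have "\<bar>\<integral>z. u z \<bullet> fst (f z) \<partial>M\<bar> \<le> (\<integral>z. norm (u z) * norm (f z) \<partial>M)"
    proof -
      have "norm (\<integral>z. u z \<bullet> fst (f z) \<partial>M) \<le> (\<integral>z. norm (u z \<bullet> fst (f z)) \<partial>M)" by (rule integral_norm_bound)
      also have "\<dots> \<le> (\<integral>z. norm (u z) * norm (f z) \<partial>M)"
      proof (intro integral_mono integrable_norm sq_int_inner sq_int_norm_mult u s sq_int_fst)
        fix z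
        have "norm (u z \<bullet> fst (f z)) \<le> norm (u z) * norm (fst (f z))" by (simp add: Cauchy_Schwarz_ineq2)
        also have "\<dots> \<le> norm (u z) * norm (f z)" using norm_fst_le[of "fst (f z)" "snd (f z)"] by (intro mult_left_mono) simp_all
        finally show "norm (u z \<bullet> fst (f z)) \<le> norm (u z) * norm (f z)" .
      qed
      finally show ?thesis by simp
    qed
    then have "(\<integral>z. u z \<bullet> fst (f z) \<partial>M)\<^sup>2 \<le> (\<integral>z. norm (u z) * norm (f z) \<partial>M)\<^sup>2"
      using abs_le_square_iff[of "\<integral>z. u z \<bullet> fst (f z) \<partial>M" "\<integral>z. norm (u z) * norm (f z) \<partial>M"] by simp
    also have "\<dots> \<le> (\<integral>z. (norm (u z))\<^sup>2 \<partial>M) * (\<integral>z. (norm (f z))\<^sup>2 \<partial>M)" by (rule sq_int_Cauchy_Schwarz[OF u s])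
    also have "\<dots> \<le> (\<integral>z. (norm (u z))\<^sup>2 \<partial>M) * ((K\<^sup>2 + 2) * form f f)"
      by (intro mult_left_mono form_controls_norm f) simp
    finally show ?thesis by (simp add: mult.assoc)
  qed
  show "\<exists>G\<in>V. (\<lambda>n. form (\<lambda>x. F n x - G x) (\<lambda>x. F n x - G x)) \<longlonglongrightarrow> 0"
    if F: "\<And>n::nat. F n \<in> V" and Cau: "\<And>e. e > 0 \<Longrightarrow> \<exists>N. \<forall>m\<ge>N. \<forall>n\<ge>N. form (\<lambda>x. F m x - F n x) (\<lambda>x. F m x - F n x) < e" for F
  proof -
    have dV: "(\<lambda>x. F m x - F n x) \<in> V" for m n using V_lin[OF F[of m] F[of n], of 1 "-1"] by simp
    have Cau': "\<exists>N. \<forall>m\<ge>N. \<forall>n\<ge>N. (\<integral>x. (norm (F m x - F n x))\<^sup>2 \<partial>M) < e" if e: "e > 0" for e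
    proof -
      have k: "K\<^sup>2 + 2 > 0" by (simp add: add_nonneg_pos)
      have "e / (K\<^sup>2 + 2) > 0" using e k by simp
      from Cau[OF this] obtain N where
        "\<forall>m\<ge>N. \<forall>n\<ge>N. form (\<lambda>x. F m x - F n x) (\<lambda>x. F m x - F n x) < e / (K\<^sup>2 + 2)" by (elim exE)
      then have N: "form (\<lambda>x. F m x - F n x) (\<lambda>x. F m x - F n x) < e / (K\<^sup>2 + 2)" if "m \<ge> N" "n \<ge> N" for m n
        using that by simp
      have "(\<integral>x. (norm (F m x - F n x))\<^sup>2 \<partial>M) < e" if "m \<ge> N" "n \<ge> N" for m n
        using form_controls_norm[OF dV, of m n] mult_strict_left_mono[OF N[OF that] k] k by simp
      then show ?thesis by blast
    qed
    obtain G where G: "sq_int M G" "(\<lambda>n. \<integral>x. (norm (F n x - G x))\<^sup>2 \<partial>M) \<longlonglongrightarrow> 0"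
      by (rule sq_int_complete[OF V_sq_int[OF F] Cau'])
    have "(\<integral>z. G z \<bullet> T z \<partial>M) = 0" if T: "T \<in> tests" for T
      using F V_iff[OF V_sq_int[OF F]] T by (intro orthogonality_limit[OF V_sq_int[OF F] G sq_int_tests[OF T]]) blast
    then have GV: "G \<in> V" using V_iff[OF G(1)] by blast
    have "(\<lambda>n. form (\<lambda>x. F n x - G x) (\<lambda>x. F n x - G x)) \<longlonglongrightarrow> 0"
    proof (rule tendsto_sandwich[OF _ _ tendsto_const G(2)])
      show "\<forall>\<^sub>F n in sequentially. form (\<lambda>x. F n x - G x) (\<lambda>x. F n x - G x) \<le> (\<integral>x. (norm (F n x - G x))\<^sup>2 \<partial>M)"
      proof (intro always_eventually allI)
        fix n
        have d: "sq_int M (\<lambda>x. F n x - G x)" by (rule sq_int_diff[OF V_sq_int[OF F] G(1)])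
        show "form (\<lambda>x. F n x - G x) (\<lambda>x. F n x - G x) \<le> (\<integral>x. (norm (F n x - G x))\<^sup>2 \<partial>M)"
          unfolding form_def
        proof (rule integral_mono)
          show "integrable M (\<lambda>z. 1/2 * (fst (snd (F n z - G z)) \<bullet> fst (snd (F n z - G z))) + snd (snd (F n z - G z)) \<bullet> snd (snd (F n z - G z)))"
            using form_integrable[OF d d] by simp
          show "integrable M (\<lambda>x. (norm (F n x - G x))\<^sup>2)" by (rule sq_intD(2)[OF d])
          show "1/2 * (fst (snd (F n z - G z)) \<bullet> fst (snd (F n z - G z))) + snd (snd (F n z - G z)) \<bullet> snd (snd (F n z - G z)) \<le> (norm (F n z - G z))\<^sup>2" for z
            unfolding power2_norm_eq_inner inner_prod_def[of "F n z - G z"] inner_prod_def[of "snd (F n z - G z)"]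
            using inner_ge_zero[of "fst (F n z - G z)"] inner_ge_zero[of "fst (snd (F n z - G z))"] by linarith
        qed
      qed
    qed (simp add: form_nonneg)
    then show ?thesis using GV by blast
  qed
qed

end

section \<open>Entire functions lie in the kernel of the weak Cauchy-Riemann operator\<close>

context weighted_space
begin

text \<open>Cauchy's estimate on the complex line through x in direction j. It gives the local
  boundedness of the derivatives that integration by parts needs, since \<open>holo_on\<close>
  asserts only differentiability.\<close>

lemma entire_partial_bound:
  fixes h :: "complex^'n \<Rightarrow> complex"
  assumes h: "holo_on UNIV h" and B: "\<And>y. norm y \<le> norm x + 1 \<Longrightarrow> norm (h y) \<le> B"
  shows "norm (frechet_derivative h (at x) (axis j 1)) \<le> B"
proof -
  define e :: "complex^'n" where "e = axis j 1"
  have ne: "norm e = 1" by (simp add: e_def norm_eq_sqrt_inner inner_axis_axis)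
  have lin: "linear (\<lambda>\<zeta>::complex. \<zeta> *s e)" by (intro linearI) (auto simp: vec_eq_iff algebra_simps)
  define p where "p \<zeta> = h (x + \<zeta> *s e)" for \<zeta>
  have dp: "(p has_field_derivative frechet_derivative h (at (x + \<zeta> *s e)) e) (at \<zeta>)" for \<zeta>
  proof -
    obtain L where L: "(h has_derivative L) (at (x + \<zeta> *s e))" "\<And>c v. L (c *s v) = c * L v"
      using h unfolding holo_on_def by blast
    have "((\<lambda>\<zeta>. x + \<zeta> *s e) has_derivative (\<lambda>\<zeta>. \<zeta> *s e)) (at \<zeta>)"
      using has_derivative_add[OF has_derivative_const[of x] linear_imp_has_derivative[OF lin]] by simp
    from has_derivative_compose[OF this L(1)]
    have "(p has_derivative (\<lambda>c. c * L e)) (at \<zeta>)" unfolding p_def[abs_def] L(2) .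
    then show ?thesis using frechet_derivative_at[OF L(1)] by (simp add: has_field_derivative_def mult_commute_abs)
  qed
  have hol: "p holomorphic_on UNIV" using dp by (subst holomorphic_on_open) auto
  have "norm ((deriv ^^ 1) p 0) \<le> fact 1 * B / 1 ^ 1"
  proof (rule Cauchy_inequality)
    show "p holomorphic_on ball 0 1" by (rule holomorphic_on_subset[OF hol]) simp
    show "continuous_on (cball 0 1) p" by (rule holomorphic_on_imp_continuous_on[OF holomorphic_on_subset[OF hol]]) simp
    show "norm (p \<zeta>) \<le> B" if "norm (0 - \<zeta>) = 1" for \<zeta>
      unfolding p_def using that norm_triangle_ineq[of x "\<zeta> *s e"] by (intro B) (simp add: norm_cscale ne)
  qed simp
  moreover have "deriv p 0 = frechet_derivative h (at x) e" using DERIV_imp_deriv[OF dp[of 0]] by simp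
  ultimately show ?thesis by (simp add: e_def)
qed

text \<open>The derivative of h \<psi> in each of the two real directions of the j-th coordinate
  integrates to zero; in the Cauchy-Riemann combination of the two, the terms that differentiate h
  cancel.\<close>

lemma holo_weak_dbar0:
  fixes h :: "complex^'n \<Rightarrow> complex"
  assumes h: "holo_on UNIV h"
  shows "weak_dbar0 j h (\<lambda>_. 0)"
  unfolding weak_dbar0_def
proof (intro allI impI)
  fix \<psi> :: "complex^'n \<Rightarrow> complex" assume t: "test_fun \<psi>"
  let ?Dh = "\<lambda>v x. frechet_derivative h (at x) v" and ?Dp = "\<lambda>v x. frechet_derivative \<psi> (at x) v"
  have hd: "(h has_derivative (\<lambda>v. ?Dh v x)) (at x)" and hl: "?Dh (c *s v) x = c * ?Dh v x" for x c v
  proof -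
    obtain L where L: "(h has_derivative L) (at x)" "\<And>c v. L (c *s v) = c * L v"
      using h unfolding holo_on_def by blast
    show "(h has_derivative (\<lambda>v. ?Dh v x)) (at x)" "?Dh (c *s v) x = c * ?Dh v x"
      using frechet_derivative_at[OF L(1)] L by auto
  qed
  have hc: "continuous_on UNIV h" using hd by (auto intro!: continuous_at_imp_continuous_on has_derivative_continuous)
  obtain R where R: "\<And>z. norm z > R \<Longrightarrow> \<psi> z = 0" using test_fun_support[OF t] by metis
  have sp: "smooth_fun \<psi>" by (rule test_fun_smooth[OF t])
  note cp = smooth_continuous[OF sp]
  have bounded_h: "\<exists>B. \<forall>y. norm y \<le> \<bar>R\<bar> + 1 \<longrightarrow> norm (h y) \<le> B"
  proof -
    have "bounded (h ` cball 0 (\<bar>R\<bar> + 1))"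
      by (intro compact_imp_bounded compact_continuous_image continuous_on_subset[OF hc]) auto
    then obtain a where "\<forall>x\<in>h ` cball 0 (\<bar>R\<bar> + 1). norm x \<le> a" unfolding bounded_iff by (elim exE)
    then show ?thesis by (intro exI[of _ a]) simp
  qed
  then obtain B where B: "\<And>y. norm y \<le> \<bar>R\<bar> + 1 \<Longrightarrow> norm (h y) \<le> B" by blast
  obtain P where P: "P \<ge> 0" "\<And>x. norm (\<psi> x) \<le> P" using continuous_support_bounded[OF cp R] by metis
  have i: "axis j \<i> = \<i> *s axis j (1::complex)" by (simp add: vec_eq_iff axis_def)
  have B0: "B \<ge> 0" by (rule order_trans[OF norm_ge_zero B[of 0]]) simp
  have main: "(\<integral>x. h x * ?Dp v x + ?Dh v x * \<psi> x \<partial>lborel) = 0 \<and> integrable lborel (\<lambda>x. h x * ?Dp v x + ?Dh v x * \<psi> x)"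
    if v: "v = axis j 1 \<or> v = axis j \<i>" for v
  proof -
    have D: "((\<lambda>t. h (x + t *\<^sub>R v) * \<psi> (x + t *\<^sub>R v)) has_vector_derivative h x * ?Dp v x + ?Dh v x * \<psi> x) (at 0)" for x
      using dirderiv_has_vector_derivative[OF has_derivative_mult[OF hd smooth_has_derivative[OF sp]], of x v 0] by simp
    have cq: "continuous_on UNIV (\<lambda>x. h x * ?Dp v x)"
      by (intro continuous_intros hc smooth_continuous smooth_fun_derivative sp)
    have sq: "h x * ?Dp v x = 0" if "norm x > R" for x using derivative_support[OF R that] by simp
    obtain Q where Q: "\<And>x. norm (h x * ?Dp v x) \<le> Q"
      using continuous_support_bounded[OF cq sq] by metis
    have "norm (h x * ?Dp v x + ?Dh v x * \<psi> x) \<le> Q + B * P" for x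
    proof (rule order_trans[OF norm_triangle_ineq], rule add_mono[OF Q])
      show "norm (?Dh v x * \<psi> x) \<le> B * P"
      proof (cases "norm x > R")
        case True
        then show ?thesis using R B0 P(1) by simp
      next
        case False
        have "norm (?Dh (axis j 1) x) \<le> B" using False by (intro entire_partial_bound[OF h] B) simp
        moreover have "norm (?Dh v x) = norm (?Dh (axis j 1) x)" using v hl[of x \<i> "axis j 1"] by (auto simp: i norm_mult)
        ultimately show ?thesis using P B0 by (simp add: norm_mult mult_mono)
      qed
    qed
    note r = integral_dirderiv_zero[OF D this continuous_on_mult[OF hc cp]]
    show ?thesis using r[of R] R by simp
  qed
  \<comment> \<open>The derivative of h along \<open>axis j \<i>\<close> is i times that along
    \<open>axis j 1\<close>, so its two contributions sum to (1 + i i) times the latter, that is, to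
    zero.\<close>
  have pt: "h x * wzbar j \<psi> x = ((h x * ?Dp (axis j 1) x + ?Dh (axis j 1) x * \<psi> x)
      + \<i> * (h x * ?Dp (axis j \<i>) x + ?Dh (axis j \<i>) x * \<psi> x)) / 2" for x
    unfolding wzbar_def i hl by (simp add: algebra_simps flip: mult.assoc)
  have "(\<integral>x. h x * wzbar j \<psi> x \<partial>lborel) = 0"
    unfolding pt using main[of "axis j 1"] main[of "axis j \<i>"] by simp
  moreover have "(\<lambda>x. h x * wzbar j \<psi> x) \<in> borel_measurable lborel"
    using borel_continuous[OF continuous_on_mult[OF hc smooth_continuous[OF smooth_wzbar[OF sp]]]] by simp
  ultimately show "(\<integral>z. h z * wzbar j \<psi> z \<partial>lebesgue) = - (\<integral>z. 0 * \<psi> z \<partial>lebesgue)"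
    by (simp add: integral_completion)
qed

lemma A2_dbar_graph: "A2 \<phi> h \<Longrightarrow> dbar_graph h (\<lambda>_. 0)"
  unfolding A2_def dbar_graph_def has_dbar0_def L2w_iff using holo_weak_dbar0 by (simp add: sq_int_def)

end

context coercive_weight
begin

subsection \<open>The canonical solution\<close>

definition Z :: "(complex^'n \<Rightarrow> complex^'n) set" where
  "Z = {v. sq_int M v \<and> (\<forall>j k. weak_dbar1 j k v (\<lambda>_. 0))}"

lemma Z_iff:
  assumes "sq_int M v" shows "v \<in> Z \<longleftrightarrow> (\<forall>j k \<psi>. test_fun \<psi> \<longrightarrow> (\<integral>z. v z \<bullet> curl_test j k \<psi> z \<partial>M) = 0)"
  unfolding Z_def using weak_dbar1_iff[OF assms sq_int_zero] assms by simp

lemma dbar_graph_Z: "dbar_graph f v \<Longrightarrow> v \<in> Z"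
  unfolding Z_def using dbar_graph_closed by (auto simp: dbar_graph_def)

text \<open>Orthogonal projection onto the closed forms, read off from \<open>Riesz_on\<close> with
  the inner product itself as form and pairing with w as functional.\<close>

lemma projection_Z:
  assumes w: "sq_int M w"
  shows "\<exists>v\<in>Z. \<forall>x\<in>Z. (\<integral>z. v z \<bullet> x z \<partial>M) = (\<integral>z. w z \<bullet> x z \<partial>M)"
proof (rule Riesz_on[where K = "\<integral>z. (norm (w z))\<^sup>2 \<partial>M"])
  have s: "sq_int M v" if "v \<in> Z" for v using that by (simp add: Z_def)
  have "(\<lambda>_. 0) \<in> Z" by (subst Z_iff) (auto simp: sq_int_zero)
  then show "Z \<noteq> {}" by blast
  show lin: "(\<lambda>x. a *\<^sub>R f x + b *\<^sub>R g x) \<in> Z" if f: "f \<in> Z" and g: "g \<in> Z" for f g a b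
  proof (subst Z_iff[OF sq_int_lin[OF s[OF f] s[OF g]]], intro allI impI)
    fix j k and \<psi> :: "complex^'n \<Rightarrow> complex" assume t: "test_fun \<psi>"
    show "(\<integral>z. (a *\<^sub>R f z + b *\<^sub>R g z) \<bullet> curl_test j k \<psi> z \<partial>M) = 0"
      using f g t Z_iff[OF s[OF f]] Z_iff[OF s[OF g]] sq_int_inner[OF s[OF f] sq_int_curl_test[OF t]] sq_int_inner[OF s[OF g] sq_int_curl_test[OF t]]
      by (simp add: inner_add_left)
  qed
  show "(\<integral>z. (a *\<^sub>R f z + b *\<^sub>R g z) \<bullet> h z \<partial>M) = a * (\<integral>z. f z \<bullet> h z \<partial>M) + b * (\<integral>z. g z \<bullet> h z \<partial>M)"
    if "f \<in> Z" "g \<in> Z" "h \<in> Z" for f g h a b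
    using sq_int_inner[OF s[OF that(1)] s[OF that(3)]] sq_int_inner[OF s[OF that(2)] s[OF that(3)]] by (simp add: inner_add_left)
  show "(\<integral>z. f z \<bullet> g z \<partial>M) = (\<integral>z. g z \<bullet> f z \<partial>M)" for f g :: "complex^'n \<Rightarrow> complex^'n" by (simp add: inner_commute)
  show "0 \<le> (\<integral>z. f z \<bullet> f z \<partial>M)" for f :: "complex^'n \<Rightarrow> complex^'n" by simp
  show "0 \<le> (\<integral>z. (norm (w z))\<^sup>2 \<partial>M)" by simp
  show "(\<integral>z. w z \<bullet> (a *\<^sub>R f z + b *\<^sub>R g z) \<partial>M) = a * (\<integral>z. w z \<bullet> f z \<partial>M) + b * (\<integral>z. w z \<bullet> g z \<partial>M)"
    if "f \<in> Z" "g \<in> Z" for f g a b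
    using sq_int_inner[OF w s[OF that(1)]] sq_int_inner[OF w s[OF that(2)]] by (simp add: inner_add_right)
  show "(\<integral>z. w z \<bullet> f z \<partial>M)\<^sup>2 \<le> (\<integral>z. (norm (w z))\<^sup>2 \<partial>M) * (\<integral>z. f z \<bullet> f z \<partial>M)" if "f \<in> Z" for f
  proof (rule discriminant_bound)
    fix t
    have "0 \<le> (\<integral>z. (w z + t *\<^sub>R f z) \<bullet> (w z + t *\<^sub>R f z) \<partial>M)" by simp
    also have "\<dots> = (\<integral>z. w z \<bullet> w z + 2 * t * (w z \<bullet> f z) + t\<^sup>2 * (f z \<bullet> f z) \<partial>M)"
      by (rule Bochner_Integration.integral_cong) (auto simp: inner_add_left inner_add_right inner_commute power2_eq_square algebra_simps)
    also have "\<dots> = (\<integral>z. (norm (w z))\<^sup>2 \<partial>M) + 2 * t * (\<integral>z. w z \<bullet> f z \<partial>M) + t\<^sup>2 * (\<integral>z. f z \<bullet> f z \<partial>M)"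
      using sq_int_inner[OF w s[OF that]] sq_int_inner[OF w w] sq_int_inner[OF s[OF that] s[OF that]] by (simp add: power2_norm_eq_inner)
    finally show "0 \<le> (\<integral>z. (norm (w z))\<^sup>2 \<partial>M) + 2 * t * (\<integral>z. w z \<bullet> f z \<partial>M) + t\<^sup>2 * (\<integral>z. f z \<bullet> f z \<partial>M)" .
  qed simp
  show "\<exists>G\<in>Z. (\<lambda>n. \<integral>z. (F n z - G z) \<bullet> (F n z - G z) \<partial>M) \<longlonglongrightarrow> 0"
    if F: "\<And>n::nat. F n \<in> Z" and Cau: "\<And>e. e > 0 \<Longrightarrow> \<exists>N. \<forall>m\<ge>N. \<forall>n\<ge>N. (\<integral>z. (F m z - F n z) \<bullet> (F m z - F n z) \<partial>M) < e" for F
  proof -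
    note sF = s[OF F]
    obtain G where G: "sq_int M G" "(\<lambda>n. \<integral>x. (norm (F n x - G x))\<^sup>2 \<partial>M) \<longlonglongrightarrow> 0"
      by (rule sq_int_complete[OF sF Cau[folded power2_norm_eq_inner]])
    have "G \<in> Z"
    proof (subst Z_iff[OF G(1)], intro allI impI)
      fix j k and \<psi> :: "complex^'n \<Rightarrow> complex" assume t: "test_fun \<psi>"
      show "(\<integral>z. G z \<bullet> curl_test j k \<psi> z \<partial>M) = 0"
        by (rule orthogonality_limit[OF sF G sq_int_curl_test[OF t]]) (use F Z_iff[OF sF] t in blast)
    qed
    then show ?thesis using G(2) unfolding power2_norm_eq_inner by blast
  qed
qed

definition solves :: "(complex^'n \<Rightarrow> complex^'n) \<Rightarrow> (complex^'n \<Rightarrow> (complex^'n) \<times> (complex^'n^'n) \<times> complex) \<Rightarrow> bool" where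
  "solves u F \<longleftrightarrow> F \<in> V \<and> (\<forall>G\<in>V. form F G = (\<integral>z. u z \<bullet> fst (G z) \<partial>M))"

lemma adj_dbar_test:
  assumes t: "test_fun \<psi>"
  shows "adj_dbar \<phi> (\<lambda>z. axis j (up \<psi> z)) (\<lambda>z. - up (\<lambda>z. wzbar j \<psi> z) z)"
proof (subst adj_dbar_iff)
  show "sq_int M (\<lambda>z. axis j (up \<psi> z))" by (intro sq_int_axis sq_int_up t)
  show "sq_int M (\<lambda>z. - up (\<lambda>z. wzbar j \<psi> z) z)"
    using sq_int_scaleR[OF sq_int_up[OF test_fun_wzbar[OF t]], of "-1"] by simp
  show "\<forall>f v. dbar_graph f v \<longrightarrow> (\<integral>z. v z \<bullet> axis j (up \<psi> z) \<partial>M) = (\<integral>z. f z \<bullet> - up (\<lambda>z. wzbar j \<psi> z) z \<partial>M)"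
  proof (intro allI impI)
    fix f v assume g: "dbar_graph f v"
    then have f: "sq_int M f" "sq_int M v" and w: "weak_dbar0 j f (\<lambda>z. v z $ j)" by (auto simp: dbar_graph_def has_dbar0_def)
    have "(\<integral>z. f z * wzbar j \<psi> z \<partial>lebesgue) = - (\<integral>z. v z $ j * \<psi> z \<partial>lebesgue)"
      using w t unfolding weak_dbar0_def by blast
    then show "(\<integral>z. v z \<bullet> axis j (up \<psi> z) \<partial>M) = (\<integral>z. f z \<bullet> - up (\<lambda>z. wzbar j \<psi> z) z \<partial>M)"
      using pairing(2)[OF sq_int_nth[OF f(2)] t, of j] pairing(2)[OF f(1) test_fun_wzbar[OF t], of j] by (simp add: inner_axis)
  qed
qed

text \<open>Test forms need not lie in the form domain. Replacing one by its projection onto the closed forms does not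
  change its image under the adjoint, since the difference is orthogonal to the range of the Cauchy--Riemann operator.\<close>
lemma solves_dbar:
  assumes F: "solves u F" and u: "u \<in> Z"
  shows "has_dbar0 (\<lambda>z. snd (snd (F z))) u"
  unfolding has_dbar0_def
proof
  fix j
  let ?h = "\<lambda>z. snd (snd (F z))"
  have FV: "F \<in> V" using F by (simp add: solves_def)
  have h: "sq_int M ?h" by (intro sq_int_snd V_sq_int FV)
  have su: "sq_int M u" using u by (simp add: Z_def)
  show "weak_dbar0 j ?h (\<lambda>z. u z $ j)"
  proof (rule weak_dbar0_Re[OF h sq_int_nth[OF su]])
    fix \<psi> :: "complex^'n \<Rightarrow> complex" assume t: "test_fun \<psi>"
    let ?v = "\<lambda>z. axis j (up \<psi> z) :: complex^'n" and ?t = "\<lambda>z. - up (\<lambda>z. wzbar j \<psi> z) z"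
    have v: "sq_int M ?v" by (intro sq_int_axis sq_int_up t)
    have st: "sq_int M ?t" using sq_int_scaleR[OF sq_int_up[OF test_fun_wzbar[OF t]], of "-1"] by simp
    obtain v1 where v1: "v1 \<in> Z" "\<And>x. x \<in> Z \<Longrightarrow> (\<integral>z. v1 z \<bullet> x z \<partial>M) = (\<integral>z. ?v z \<bullet> x z \<partial>M)"
      using projection_Z[OF v] by blast
    have s1: "sq_int M v1" using v1(1) by (simp add: Z_def)
    have "(\<integral>z. v' z \<bullet> v1 z \<partial>M) = (\<integral>z. f' z \<bullet> ?t z \<partial>M)" if g: "dbar_graph f' v'" for f' v'
      using v1(2)[OF dbar_graph_Z[OF g]] adj_dbar_test[OF t, of j] g adj_dbar_iff[OF v st] by (simp add: inner_commute)
    then have "adj_dbar \<phi> v1 ?t" using adj_dbar_iff[OF s1 st] by blast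
    \<comment> \<open>The projected form is closed, hence the 0 in the middle slot: the form of F
      against this element reduces to the pairing of the adjoint image of the solution with
      \<open>?t\<close>.\<close>
    then have G: "(\<lambda>z. (v1 z, 0, ?t z)) \<in> V"
      unfolding V_def using v1(1) by (auto simp: Z_def intro!: sq_int_Pair s1 st sq_int_zero)
    have "(\<integral>z. ?h z \<bullet> ?t z \<partial>M) = (\<integral>z. u z \<bullet> v1 z \<partial>M)"
      using F G unfolding solves_def form_def by fastforce
    \<comment> \<open>Closedness of u is used here: the projection may be dropped when pairing with
      a closed form.\<close>
    also have "\<dots> = (\<integral>z. u z \<bullet> ?v z \<partial>M)" using v1(2)[OF u] by (simp add: inner_commute)
    finally show "Re (\<integral>z. ?h z * wzbar j \<psi> z \<partial>lebesgue) = - Re (\<integral>z. u z $ j * \<psi> z \<partial>lebesgue)"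
      using pairing(2)[OF sq_int_nth[OF su] t, of j] pairing(2)[OF h test_fun_wzbar[OF t], of j] by (simp add: inner_axis)
  qed
qed

text \<open>A holomorphic h and i h belong to the graph of \<open>dbar\<close> with image 0; the
  adjoint relation then says that their pairings with the adjoint image vanish.\<close>

lemma solves_orthogonal:
  assumes F: "solves u F" and h: "A2 \<phi> h"
  shows "winner \<phi> (\<lambda>z. snd (snd (F z))) h = 0"
proof -
  have FV: "F \<in> V" using F by (simp add: solves_def)
  have f: "sq_int M (\<lambda>z. snd (snd (F z)))" "sq_int M (\<lambda>z. fst (F z))" by (intro sq_int_snd sq_int_fst V_sq_int FV)+
  have g: "dbar_graph h (\<lambda>_. 0)" "dbar_graph (\<lambda>z. \<i> * h z) (\<lambda>_. 0)"
    using A2_dbar_graph[OF h] dbar_graph_i[OF A2_dbar_graph[OF h]] by simp_all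
  have sh: "sq_int M h" using g by (simp add: dbar_graph_def)
  have "adj_dbar \<phi> (\<lambda>z. fst (F z)) (\<lambda>z. snd (snd (F z)))" using FV by (simp add: V_def)
  then have "\<And>k. dbar_graph k (\<lambda>_. 0) \<Longrightarrow> (\<integral>z. snd (snd (F z)) \<bullet> k z \<partial>M) = 0"
    using adj_dbar_iff[OF f(2,1)] by (fastforce simp: inner_commute)
  from this[OF g(1)] this[OF g(2)] show ?thesis
    using winner_eq(1,2)[OF f(1) sh] by (simp add: complex_eq_iff)
qed

subsection \<open>Exponential decay\<close>

definition wedge :: "(complex^'n \<Rightarrow> real) \<Rightarrow> (complex^'n \<Rightarrow> complex^'n) \<Rightarrow> complex^'n \<Rightarrow> complex^'n^'n" where
  "wedge \<eta> g z = (\<chi> j k. grad \<eta> z $ j * g z $ k - grad \<eta> z $ k * g z $ j)"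

text \<open>The triple belonging to the form \<eta> g, with the two commutator terms included; it is
  not the pointwise product of the triple with \<eta>.\<close>

definition mul :: "(complex^'n \<Rightarrow> real) \<Rightarrow> (complex^'n \<Rightarrow> (complex^'n) \<times> (complex^'n^'n) \<times> complex) \<Rightarrow> complex^'n \<Rightarrow> (complex^'n) \<times> (complex^'n^'n) \<times> complex" where
  "mul \<eta> F z = (\<eta> z *\<^sub>R fst (F z), \<eta> z *\<^sub>R fst (snd (F z)) + wedge \<eta> (\<lambda>z. fst (F z)) z,
     \<eta> z *\<^sub>R snd (snd (F z)) - contract \<eta> (\<lambda>z. fst (F z)) z)"

lemma sq_int_wedge: "tame \<eta> \<Longrightarrow> sq_int M g \<Longrightarrow> sq_int M (wedge \<eta> g)"
  by (intro sq_int_vec) (simp add: wedge_def, intro sq_int_diff tame_sq_int(2) sq_int_nth)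

lemma mul_V:
  assumes t: "tame \<eta>" and F: "F \<in> V" shows "mul \<eta> F \<in> V"
proof -
  note s = V_sq_int[OF F]
  have g: "sq_int M (\<lambda>z. fst (F z))" and W: "\<And>j k. sq_int M (\<lambda>z. fst (snd (F z)) $ j $ k)" and W': "sq_int M (\<lambda>z. fst (snd (F z)))"
    and h: "sq_int M (\<lambda>z. snd (snd (F z)))"
    by (intro sq_int_fst sq_int_snd sq_int_nth s)+
  have "sq_int M (mul \<eta> F)" unfolding mul_def[abs_def]
    by (intro sq_int_Pair sq_int_add sq_int_diff tame_sq_int(1)[OF t] sq_int_wedge[OF t] sq_int_contract[OF t] g W' h)
  moreover have "weak_dbar1 j k (\<lambda>z. fst (mul \<eta> F z)) (\<lambda>z. fst (snd (mul \<eta> F z)) $ j $ k)" for j k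
    using weak_dbar1_mult[OF t g W, of j k] F by (simp add: mul_def wedge_def V_def)
  moreover have "adj_dbar \<phi> (\<lambda>z. fst (mul \<eta> F z)) (\<lambda>z. snd (snd (mul \<eta> F z)))"
    using adj_dbar_mult[OF t g h] F by (simp add: mul_def V_def)
  ultimately show ?thesis by (simp add: V_def)
qed

lemma grad_square:
  assumes "smooth_fun \<eta>"
  shows "grad (\<lambda>z. (\<eta> z)\<^sup>2) z $ j = (2 * \<eta> z) *\<^sub>R (grad \<eta> z $ j)"
proof -
  have d: "(\<lambda>x. complex_of_real (\<eta> x)) differentiable (at z)"
    by (rule smooth_differentiable[OF smooth_of_real[OF assms]])
  have e: "(\<lambda>x. complex_of_real ((\<eta> x)\<^sup>2)) = (\<lambda>x. complex_of_real (\<eta> x) * complex_of_real (\<eta> x))"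
    by (rule ext) (simp only: power2_eq_square of_real_mult)
  have "wzbar j (\<lambda>x. complex_of_real ((\<eta> x)\<^sup>2)) z = complex_of_real (\<eta> z) * wzbar j (\<lambda>x. complex_of_real (\<eta> x)) z
      + wzbar j (\<lambda>x. complex_of_real (\<eta> x)) z * complex_of_real (\<eta> z)"
    unfolding e by (rule wz_test_bilinear[OF d d])
  then show ?thesis by (simp only: grad_nth scaleR_conv_of_real of_real_mult of_real_numeral) simp
qed

lemma tame_square:
  assumes "tame \<eta>" shows "tame (\<lambda>z. (\<eta> z)\<^sup>2)"
proof -
  obtain B B' where s: "smooth_fun \<eta>" and B: "\<And>z. \<bar>\<eta> z\<bar> \<le> B" "\<And>z v. \<bar>frechet_derivative \<eta> (at z) v\<bar> \<le> B' * norm v"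
    using assms unfolding tame_def by metis
  have B0: "0 \<le> B" using B(1)[of 0] by linarith
  have "smooth_fun (\<lambda>z. (\<eta> z)\<^sup>2)" unfolding power2_eq_square by (rule smooth_mult[OF s s])
  moreover have "\<bar>(\<eta> z)\<^sup>2\<bar> \<le> B\<^sup>2" for z using power_mono[OF B(1)[of z] abs_ge_zero, of 2] by simp
  moreover have "\<bar>frechet_derivative (\<lambda>z. (\<eta> z)\<^sup>2) (at z) v\<bar> \<le> (2 * B * B') * norm v" for z v
  proof -
    have "frechet_derivative (\<lambda>z. (\<eta> z)\<^sup>2) (at z) v = 2 * \<eta> z * frechet_derivative \<eta> (at z) v"
      unfolding power2_eq_square
      using fun_cong[OF frechet_derivative_at[OF has_derivative_mult[OF smooth_has_derivative[OF s, of z] smooth_has_derivative[OF s]]], of v] by simp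
    moreover have "\<bar>\<eta> z\<bar> * \<bar>frechet_derivative \<eta> (at z) v\<bar> \<le> B * (B' * norm v)"
      by (intro mult_mono B B0) simp
    ultimately show ?thesis by (simp add: abs_mult)
  qed
  ultimately show ?thesis unfolding tame_def by blast
qed

text \<open>With A the commutator, |\<eta> W + A|^2 is the pairing of W with \<eta>^2 W + 2 \<eta>
  A, plus |A|^2. The former is what multiplication by \<eta>^2 produces, because its gradient is 2
  \<eta> times that of \<eta>. The adjoint component behaves alike with a minus sign, so only
  squares of commutators remain.\<close>

lemma form_mul:
  assumes t: "tame \<eta>" and F: "F \<in> V"
  shows "form (mul \<eta> F) (mul \<eta> F) = form F (mul (\<lambda>z. (\<eta> z)\<^sup>2) F)
     + (\<integral>z. (1/2) * (norm (wedge \<eta> (\<lambda>z. fst (F z)) z))\<^sup>2 + (norm (contract \<eta> (\<lambda>z. fst (F z)) z))\<^sup>2 \<partial>M)"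
proof -
  have s: "smooth_fun \<eta>" using t by (simp add: tame_def)
  let ?g = "\<lambda>z. fst (F z)"
  have g: "sq_int M ?g" by (rule sq_int_fst[OF V_sq_int[OF F]])
  have w2: "wedge (\<lambda>z. (\<eta> z)\<^sup>2) ?g z = (2 * \<eta> z) *\<^sub>R wedge \<eta> ?g z" for z
    unfolding wedge_def by (simp add: vec_eq_iff grad_square[OF s] algebra_simps)
  have c2: "contract (\<lambda>z. (\<eta> z)\<^sup>2) ?g z = (2 * \<eta> z) *\<^sub>R contract \<eta> ?g z" for z
    unfolding contract_def by (simp add: grad_square[OF s] scaleR_sum_right)
  have m2: "mul (\<lambda>z. (\<eta> z)\<^sup>2) F z = ((\<eta> z)\<^sup>2 *\<^sub>R ?g z, (\<eta> z)\<^sup>2 *\<^sub>R fst (snd (F z)) + (2 * \<eta> z) *\<^sub>R wedge \<eta> ?g z,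
      (\<eta> z)\<^sup>2 *\<^sub>R snd (snd (F z)) - (2 * \<eta> z) *\<^sub>R contract \<eta> ?g z)" for z
    by (simp only: mul_def w2 c2)
  note sq = V_sq_int[OF F] V_sq_int[OF mul_V[OF tame_square[OF t] F]]
  have i: "integrable M (\<lambda>z. (norm (wedge \<eta> ?g z))\<^sup>2)" "integrable M (\<lambda>z. (norm (contract \<eta> ?g z))\<^sup>2)"
    by (rule sq_intD(2)[OF sq_int_wedge[OF t g]], rule sq_intD(2)[OF sq_int_contract[OF t g]])
  have "form (mul \<eta> F) (mul \<eta> F) = (\<integral>z. ((1/2) * (fst (snd (F z)) \<bullet> fst (snd (mul (\<lambda>z. (\<eta> z)\<^sup>2) F z)))
          + snd (snd (F z)) \<bullet> snd (snd (mul (\<lambda>z. (\<eta> z)\<^sup>2) F z)))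
      + ((1/2) * (norm (wedge \<eta> ?g z))\<^sup>2 + (norm (contract \<eta> ?g z))\<^sup>2) \<partial>M)"
    unfolding form_def
    by (rule Bochner_Integration.integral_cong)
       (simp_all only: m2 mul_def[of \<eta> F] fst_conv snd_conv power2_norm_eq_inner,
        simp add: inner_add_left inner_add_right inner_diff_left inner_diff_right inner_commute power2_eq_square algebra_simps)
  then show ?thesis unfolding form_def using form_integrable[OF sq] i by simp
qed

text \<open>An entrywise bound suffices: each of the n^2 entries of the wedge is at most 2 l |g|,
  and the contraction has n terms of size l |g|, giving 4/2 + 1 = 3 times n^2.\<close>

lemma wedge_contract_bound:
  assumes l: "0 \<le> l" "\<And>j. norm (grad \<eta> z $ j) \<le> l"
  shows "(1/2) * (norm (wedge \<eta> g z))\<^sup>2 + (norm (contract \<eta> g z))\<^sup>2 \<le> 3 * (real CARD('n))\<^sup>2 * (l * norm (g z))\<^sup>2"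
    "(norm (contract \<eta> g z))\<^sup>2 \<le> (real CARD('n))\<^sup>2 * (l * norm (g z))\<^sup>2"
proof -
  let ?n = "real CARD('n)"
  have p: "norm (grad \<eta> z $ j * g z $ k) \<le> l * norm (g z)" for j k
    unfolding norm_mult using l by (intro mult_mono Finite_Cartesian_Product.norm_nth_le) auto
  have "norm (wedge \<eta> g z $ j $ k) \<le> 2 * (l * norm (g z))" for j k
    unfolding wedge_def using norm_triangle_ineq4[of "grad \<eta> z $ j * g z $ k" "grad \<eta> z $ k * g z $ j"] p[of j k] p[of k j] by simp
  then have "(norm (wedge \<eta> g z $ j $ k))\<^sup>2 \<le> (2 * (l * norm (g z)))\<^sup>2" for j k
    by (intro power_mono) auto
  then have "(norm (wedge \<eta> g z))\<^sup>2 \<le> (\<Sum>j\<in>(UNIV::'n set). \<Sum>k\<in>(UNIV::'n set). (2 * (l * norm (g z)))\<^sup>2)"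
    unfolding norm_vec_sq by (intro sum_mono)
  then have w: "(norm (wedge \<eta> g z))\<^sup>2 \<le> 4 * ?n\<^sup>2 * (l * norm (g z))\<^sup>2" by (simp add: power2_eq_square)
  have "norm (contract \<eta> g z) \<le> (\<Sum>j\<in>UNIV. norm (cnj (grad \<eta> z $ j) * g z $ j))"
    unfolding contract_def by (rule norm_sum)
  also have "\<dots> \<le> (\<Sum>j\<in>(UNIV::'n set). l * norm (g z))" using p by (intro sum_mono) (simp add: norm_mult)
  finally have "norm (contract \<eta> g z) \<le> ?n * (l * norm (g z))" by simp
  from power_mono[OF this norm_ge_zero, of 2]
  show c: "(norm (contract \<eta> g z))\<^sup>2 \<le> ?n\<^sup>2 * (l * norm (g z))\<^sup>2" by (simp add: power_mult_distrib)
  show "(1/2) * (norm (wedge \<eta> g z))\<^sup>2 + (norm (contract \<eta> g z))\<^sup>2 \<le> 3 * ?n\<^sup>2 * (l * norm (g z))\<^sup>2"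
    using w c by linarith
qed

lemma sq_int_kappa:
  fixes u :: "complex^'n \<Rightarrow> complex^'n"
  assumes u: "sq_int M u"
  shows "sq_int M (\<lambda>z. \<kappa> z *\<^sub>R u z)"
proof (rule sq_int_bound[OF u])
  show "(\<lambda>z. \<kappa> z *\<^sub>R u z) \<in> borel_measurable M"
    by (rule borel_measurable_scaleR[OF kappa_measurable sq_intD(1)[OF u]])
  show "norm (\<kappa> z *\<^sub>R u z) \<le> K * norm (u z)" for z
    using mult_right_mono[OF le_K[of z] norm_ge_zero[of "u z"]] pos[of z] by simp
qed

text \<open>The equation is tested with the solution itself. Writing the right-hand side as the
  pairing of \<kappa> u with g/\<kappa> and splitting it by the arithmetic-geometric mean inequality
  lets coercivity absorb half of it.\<close>

lemma solves_weighted_bound: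
  assumes F: "solves u F" and u: "sq_int M u"
  shows "(\<integral>z. (norm ((1 / \<kappa> z) *\<^sub>R fst (F z)))\<^sup>2 \<partial>M) \<le> (\<integral>z. (norm (\<kappa> z *\<^sub>R u z))\<^sup>2 \<partial>M)"
proof -
  have FV: "F \<in> V" using F by (simp add: solves_def)
  note c = coercivity[OF FV]
  let ?a = "\<lambda>z. \<kappa> z *\<^sub>R u z" and ?b = "\<lambda>z. (1 / \<kappa> z) *\<^sub>R fst (F z)"
  have half: "x \<le> (a + b) / 2" if "2 * x \<le> a + b" for x a b :: real using that by simp
  have "form F F = (\<integral>z. ?a z \<bullet> ?b z \<partial>M)"
    using F FV pos unfolding solves_def by (simp add: less_imp_neq[OF pos, symmetric])
  also have "\<dots> \<le> (\<integral>z. ((norm (?a z))\<^sup>2 + (norm (?b z))\<^sup>2) / 2 \<partial>M)"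
  proof (rule integral_mono)
    show "integrable M (\<lambda>z. ?a z \<bullet> ?b z)" by (intro sq_int_inner sq_int_kappa u c)
    show "integrable M (\<lambda>z. ((norm (?a z))\<^sup>2 + (norm (?b z))\<^sup>2) / 2)"
      using sq_intD(2)[OF sq_int_kappa[OF u]] sq_intD(2)[OF c(1)] by simp
    fix z
    have "0 \<le> (?a z - ?b z) \<bullet> (?a z - ?b z)" by simp
    then have "2 * (?a z \<bullet> ?b z) \<le> ?a z \<bullet> ?a z + ?b z \<bullet> ?b z"
      by (simp only: inner_diff_left inner_diff_right inner_commute[of "?b z" "?a z"])
    then show "?a z \<bullet> ?b z \<le> ((norm (?a z))\<^sup>2 + (norm (?b z))\<^sup>2) / 2" unfolding power2_norm_eq_inner by (rule half)
  qed
  also have "\<dots> = ((\<integral>z. (norm (?a z))\<^sup>2 \<partial>M) + (\<integral>z. (norm (?b z))\<^sup>2 \<partial>M)) / 2"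
    using sq_intD(2)[OF sq_int_kappa[OF u]] sq_intD(2)[OF c(1)] by simp
  finally have "2 * form F F \<le> (\<integral>z. (norm (?a z))\<^sup>2 \<partial>M) + (\<integral>z. (norm (?b z))\<^sup>2 \<partial>M)" by simp
  then show ?thesis using c(2) by simp
qed

text \<open>Agmon's method: testing with \<open>\<eta>\<^sup>2\<close> times the solution leaves only commutator terms, which coercivity absorbs.\<close>
lemma agmon_estimate:
  assumes F: "solves u F" and u: "sq_int M u" and t: "tame \<eta>" and \<eta>: "\<And>z. 0 \<le> \<eta> z" "\<And>z. \<eta> z *\<^sub>R u z = 0"
    and p: "0 \<le> p" "0 \<le> c" "6 * (real CARD('n))\<^sup>2 * p\<^sup>2 \<le> 1/2"
    and D: "\<And>z v. \<bar>frechet_derivative \<eta> (at z) v\<bar> \<le> p * (\<eta> z + c) / \<kappa> z * norm v"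
  shows "(\<integral>z. (norm (\<eta> z *\<^sub>R snd (snd (F z))))\<^sup>2 \<partial>M) \<le> 4 * c\<^sup>2 * (\<integral>z. (norm (\<kappa> z *\<^sub>R u z))\<^sup>2 \<partial>M)"
proof -
  have FV: "F \<in> V" using F by (simp add: solves_def)
  have s: "smooth_fun \<eta>" using t by (simp add: tame_def)
  let ?n = "real CARD('n)" and ?g = "\<lambda>z. fst (F z)"
  let ?A = "\<lambda>z. wedge \<eta> ?g z" and ?b = "\<lambda>z. contract \<eta> ?g z"
  have sg: "sq_int M ?g" by (rule sq_int_fst[OF V_sq_int[OF FV]])
  note mV = mul_V[OF t FV] and c1 = coercivity[OF FV] and c2 = coercivity[OF mul_V[OF t FV]]
  define Y where "Y = (\<integral>z. (norm ((1 / \<kappa> z) *\<^sub>R ?g z))\<^sup>2 \<partial>M)"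
  define X where "X = (\<integral>z. (norm ((1 / \<kappa> z) *\<^sub>R (\<eta> z *\<^sub>R ?g z)))\<^sup>2 \<partial>M)"
  have iY: "integrable M (\<lambda>z. (norm ((1 / \<kappa> z) *\<^sub>R ?g z))\<^sup>2)" by (rule sq_intD(2)[OF c1(1)])
  have iX: "integrable M (\<lambda>z. (norm ((1 / \<kappa> z) *\<^sub>R (\<eta> z *\<^sub>R ?g z)))\<^sup>2)"
    using sq_intD(2)[OF c2(1)] by (simp add: mul_def)
  have iA: "integrable M (\<lambda>z. (norm (?A z))\<^sup>2)" "integrable M (\<lambda>z. (norm (?b z))\<^sup>2)"
    by (rule sq_intD(2)[OF sq_int_wedge[OF t sg]], rule sq_intD(2)[OF sq_int_contract[OF t sg]])
  define E where "E = (\<integral>z. (1/2) * (norm (?A z))\<^sup>2 + (norm (?b z))\<^sup>2 \<partial>M)"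
  \<comment> \<open>The gradient bound and (\<eta> + c)^2 \<le> 2 \<eta>^2 + 2 c^2 turn the factor 3
    of \<open>wedge_contract_bound\<close> into 6; the smallness assumption on p makes the total at
    most 1/2.\<close>
  have pt: "(1/2) * (norm (?A z))\<^sup>2 + (norm (?b z))\<^sup>2
      \<le> (1/2) * ((norm ((1 / \<kappa> z) *\<^sub>R (\<eta> z *\<^sub>R ?g z)))\<^sup>2 + c\<^sup>2 * (norm ((1 / \<kappa> z) *\<^sub>R ?g z))\<^sup>2)" for z
  proof -
    define l where "l = p * (\<eta> z + c) / \<kappa> z"
    have l0: "0 \<le> l" using p \<eta>(1)[of z] pos[of z] by (simp add: l_def)
    have "norm (grad \<eta> z $ j) \<le> l" for j by (rule grad_bound[OF s]) (use D in \<open>simp add: l_def\<close>)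
    from wedge_contract_bound(1)[OF l0 this]
    have "(1/2) * (norm (?A z))\<^sup>2 + (norm (?b z))\<^sup>2 \<le> 3 * ?n\<^sup>2 * (l * norm (?g z))\<^sup>2" .
    also have "(l * norm (?g z))\<^sup>2 = p\<^sup>2 * ((\<eta> z + c)\<^sup>2 * (norm ((1 / \<kappa> z) *\<^sub>R ?g z))\<^sup>2)"
      by (simp add: l_def power_mult_distrib power_divide)
    also have "3 * ?n\<^sup>2 * (p\<^sup>2 * ((\<eta> z + c)\<^sup>2 * (norm ((1 / \<kappa> z) *\<^sub>R ?g z))\<^sup>2))
       \<le> 3 * ?n\<^sup>2 * (p\<^sup>2 * ((2 * (\<eta> z)\<^sup>2 + 2 * c\<^sup>2) * (norm ((1 / \<kappa> z) *\<^sub>R ?g z))\<^sup>2))"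
      using sum_squares_bound[of "\<eta> z" c] by (intro mult_left_mono mult_right_mono) (auto simp: power2_sum)
    also have "\<dots> = (6 * ?n\<^sup>2 * p\<^sup>2) * (((\<eta> z)\<^sup>2 + c\<^sup>2) * (norm ((1 / \<kappa> z) *\<^sub>R ?g z))\<^sup>2)" by (simp add: algebra_simps)
    also have "\<dots> \<le> (1/2) * (((\<eta> z)\<^sup>2 + c\<^sup>2) * (norm ((1 / \<kappa> z) *\<^sub>R ?g z))\<^sup>2)"
      by (intro mult_right_mono p) simp
    finally show ?thesis by (simp add: power_mult_distrib power_divide algebra_simps add_divide_distrib)
  qed
  have E: "E \<le> (1/2) * (X + c\<^sup>2 * Y)"
  proof -
    have "E \<le> (\<integral>z. (1/2) * ((norm ((1 / \<kappa> z) *\<^sub>R (\<eta> z *\<^sub>R ?g z)))\<^sup>2 + c\<^sup>2 * (norm ((1 / \<kappa> z) *\<^sub>R ?g z))\<^sup>2) \<partial>M)"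
      unfolding E_def
    proof (rule integral_mono)
      show "integrable M (\<lambda>z. (1/2) * (norm (?A z))\<^sup>2 + (norm (?b z))\<^sup>2)" using iA by simp
      show "integrable M (\<lambda>z. (1/2) * ((norm ((1 / \<kappa> z) *\<^sub>R (\<eta> z *\<^sub>R ?g z)))\<^sup>2 + c\<^sup>2 * (norm ((1 / \<kappa> z) *\<^sub>R ?g z))\<^sup>2))"
        by (intro integrable_mult_right Bochner_Integration.integrable_add iX iY)
    qed (rule pt)
    also have "\<dots> = (1/2) * (X + c\<^sup>2 * Y)"
      unfolding X_def Y_def
      by (simp only: integral_mult_right_zero Bochner_Integration.integral_add[OF iX integrable_mult_right[OF iY]])
    finally show ?thesis .
  qed
  \<comment> \<open>The weight vanishes wherever u does not, so testing with \<eta>^2 g gives zero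
    and the form of \<eta> g consists of commutators alone.\<close>
  have "form F (mul (\<lambda>z. (\<eta> z)\<^sup>2) F) = (\<integral>z. u z \<bullet> ((\<eta> z)\<^sup>2 *\<^sub>R ?g z) \<partial>M)"
    using F mul_V[OF tame_square[OF t] FV] by (simp add: solves_def mul_def)
  also have "\<dots> = 0"
  proof -
    have "u z \<bullet> ((\<eta> z)\<^sup>2 *\<^sub>R ?g z) = 0" for z
      using \<eta>(2)[of z] by (auto simp: power2_eq_square)
    then have "(\<lambda>z. u z \<bullet> ((\<eta> z)\<^sup>2 *\<^sub>R ?g z)) = (\<lambda>_. 0)" by (rule ext)
    then show ?thesis by (simp only: integral_zero)
  qed
  finally have fm: "form (mul \<eta> F) (mul \<eta> F) = E" using form_mul[OF t FV] by (simp add: E_def)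
  \<comment> \<open>Coercivity for \<eta> g bounds X by E, and E is at most half of X + c^2 Y; the X
    on the right is absorbed, leaving c^2 Y as a bound for both.\<close>
  have "X \<le> E" using c2(2) unfolding fm by (simp add: X_def mul_def)
  moreover have "2 * E \<le> X + c\<^sup>2 * Y" using E by simp
  ultimately have XY: "X \<le> c\<^sup>2 * Y" "E \<le> c\<^sup>2 * Y" by simp_all
  have bE: "(\<integral>z. (norm (?b z))\<^sup>2 \<partial>M) \<le> E"
    unfolding E_def by (rule integral_mono) (use iA in auto)
  have sh: "sq_int M (\<lambda>z. snd (snd (mul \<eta> F z)))" by (intro sq_int_snd V_sq_int mV)
  have hE: "(\<integral>z. (norm (snd (snd (mul \<eta> F z))))\<^sup>2 \<partial>M) \<le> E"
    using form_self[OF V_sq_int[OF mV]] fm by simp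
  \<comment> \<open>\<eta> times the adjoint image of g differs from the adjoint image of \<eta> g
    by the contraction. Both have squared norm at most E, which yields 2 + 2 = 4.\<close>
  have "(\<integral>z. (norm (\<eta> z *\<^sub>R snd (snd (F z))))\<^sup>2 \<partial>M) \<le> (\<integral>z. 2 * (norm (snd (snd (mul \<eta> F z))))\<^sup>2 + 2 * (norm (?b z))\<^sup>2 \<partial>M)"
  proof (rule integral_mono)
    show "integrable M (\<lambda>z. (norm (\<eta> z *\<^sub>R snd (snd (F z))))\<^sup>2)"
      by (intro sq_intD(2) tame_sq_int(1)[OF t] sq_int_snd V_sq_int FV)
    show "integrable M (\<lambda>z. 2 * (norm (snd (snd (mul \<eta> F z))))\<^sup>2 + 2 * (norm (?b z))\<^sup>2)"
      using sq_intD(2)[OF sh] iA by simp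
    fix z
    have e: "\<eta> z *\<^sub>R snd (snd (F z)) = snd (snd (mul \<eta> F z)) + ?b z" by (simp add: mul_def)
    have "(norm (\<eta> z *\<^sub>R snd (snd (F z))))\<^sup>2 \<le> (norm (snd (snd (mul \<eta> F z))) + norm (?b z))\<^sup>2"
      unfolding e by (intro power_mono norm_triangle_ineq) simp
    also have "\<dots> \<le> 2 * (norm (snd (snd (mul \<eta> F z))))\<^sup>2 + 2 * (norm (?b z))\<^sup>2"
      using sum_squares_bound[of "norm (snd (snd (mul \<eta> F z)))" "norm (?b z)"] by (simp add: power2_sum)
    finally show "(norm (\<eta> z *\<^sub>R snd (snd (F z))))\<^sup>2 \<le> 2 * (norm (snd (snd (mul \<eta> F z))))\<^sup>2 + 2 * (norm (?b z))\<^sup>2" .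
  qed
  also have "\<dots> = 2 * (\<integral>z. (norm (snd (snd (mul \<eta> F z))))\<^sup>2 \<partial>M) + 2 * (\<integral>z. (norm (?b z))\<^sup>2 \<partial>M)"
    using sq_intD(2)[OF sh] iA by simp
  also have "\<dots> \<le> 4 * (c\<^sup>2 * Y)" using hE bE XY(2) by linarith
  also have "\<dots> \<le> 4 * (c\<^sup>2 * (\<integral>z. (norm (\<kappa> z *\<^sub>R u z))\<^sup>2 \<partial>M))"
    using solves_weighted_bound[OF F u] unfolding Y_def by (intro mult_left_mono) auto
  finally show ?thesis by (simp add: mult.assoc)
qed

end

subsection \<open>Interior regularity and pointwise bounds\<close>

lemma borel_representative:
  fixes f :: "'a::euclidean_space \<Rightarrow> complex"
  assumes "f \<in> borel_measurable lebesgue"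
  obtains f' where "f' \<in> borel_measurable borel" "AE x in lebesgue. f x = f' x"
proof -
  have "(\<lambda>x. Re (f x)) \<in> borel_measurable lebesgue" "(\<lambda>x. Im (f x)) \<in> borel_measurable lebesgue"
    using assms by simp_all
  then obtain a b where a: "a \<in> borel_measurable lborel" "AE x in lborel. Re (f x) = a x"
    and b: "b \<in> borel_measurable lborel" "AE x in lborel. Im (f x) = b x"
    using completion_ex_borel_measurable_real by metis
  have "(\<lambda>x. complex_of_real (a x) + \<i> * complex_of_real (b x)) \<in> borel_measurable borel"
    using a(1) b(1) by simp
  moreover have "AE x in lborel. f x = complex_of_real (a x) + \<i> * complex_of_real (b x)"
    using a(2) b(2) by eventually_elim (simp add: complex_eq_iff)
  ultimately show ?thesis using that AE_completion by blast
qed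

text \<open>A single function defined everywhere must be chosen to make pointwise bounds meaningful.
  At x it is a mollification at a scale adapted to a ball about x inside the open set; independence
  of the scale makes these values fit together. By Lindelof, countably many balls give almost
  everywhere equality with the original.\<close>

lemma holomorphic_representative:
  fixes f0 :: "complex^'n \<Rightarrow> complex"
  assumes l: "loc_int f0" and O: "open \<Omega>"
    and hol: "\<And>\<delta> w R x j. 0 < \<delta> \<Longrightarrow> ball w R \<subseteq> \<Omega> \<Longrightarrow> x \<in> ball w (R - \<delta>) \<Longrightarrow> wzbar j (conv f0 (mollifier \<delta>)) x = 0"
  obtains f where "AE x in lebesgue. f x = f0 x"
    "\<And>w R. 0 < R \<Longrightarrow> ball w R \<subseteq> \<Omega> \<Longrightarrow> \<exists>g. smooth_fun g \<and> (\<forall>x\<in>ball w (R/2). f x = g x \<and> (\<forall>j. wzbar j g x = 0))"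
proof -
  have "\<forall>x. \<exists>s. x \<in> \<Omega> \<longrightarrow> s > 0 \<and> ball x s \<subseteq> \<Omega>"
    using O unfolding open_contains_ball by blast
  then obtain s where s: "\<And>x. x \<in> \<Omega> \<Longrightarrow> s x > 0" "\<And>x. x \<in> \<Omega> \<Longrightarrow> ball x (s x) \<subseteq> \<Omega>" by metis
  define f where "f x = (if x \<in> \<Omega> then conv f0 (mollifier (s x / 4)) x else f0 x)" for x
  have eq: "conv f0 (mollifier \<delta>) x = conv f0 (mollifier \<delta>') x"
    if "ball x R \<subseteq> \<Omega>" "0 < \<delta>" "0 < \<delta>'" "\<delta> + \<delta>' < R" for x R \<delta> \<delta>'
  proof (rule conv_mollifier_indep[OF l])
    show "wzbar j (conv f0 (mollifier d)) y = 0" if "0 < d" "y \<in> ball x (R - d)" for d y j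
      by (rule hol[OF that(1) \<open>ball x R \<subseteq> \<Omega>\<close> that(2)])
    show "x \<in> ball x (R - \<delta> - \<delta>')" using that by simp
  qed (use that in auto)
  have loc: "f x = conv f0 (mollifier (R/8)) x" if R: "0 < R" "ball w R \<subseteq> \<Omega>" "x \<in> ball w (R/2)" for w R x
  proof -
    have "ball x (R/2) \<subseteq> ball w R"
    proof
      fix y assume "y \<in> ball x (R/2)"
      then show "y \<in> ball w R" using R(3) dist_triangle[of w y x] by simp
    qed
    then have b: "ball x (R/2) \<subseteq> \<Omega>" using R(2) by blast
    have x: "x \<in> \<Omega>" using R by auto
    \<comment> \<open>The two scales live on different balls about x, so they are compared through a
      third one, small enough for both.\<close>
    define d where "d = min (R/8) (s x / 4)"
    have d: "0 < d" "d \<le> R/8" "d \<le> s x / 4" using R(1) s(1)[OF x] by (auto simp: d_def)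
    have "conv f0 (mollifier (s x / 4)) x = conv f0 (mollifier d) x"
      by (rule eq[OF s(2)[OF x]]) (use d s(1)[OF x] in auto)
    moreover have "conv f0 (mollifier (R/8)) x = conv f0 (mollifier d) x"
      by (rule eq[OF b]) (use d R(1) in auto)
    ultimately show ?thesis using x by (simp add: f_def)
  qed
  have "AE x in lebesgue. f x = f0 x"
  proof -
    let ?U = "(\<lambda>w. ball w (s w / 2)) ` \<Omega>"
    obtain U where U: "U \<subseteq> ?U" "countable U" "\<Union>U = \<Union>?U"
      using Lindelof[of ?U] by blast
    have "AE x in lebesgue. x \<in> B \<longrightarrow> f x = f0 x" if B: "B \<in> U" for B
    proof -
      obtain w where w: "w \<in> \<Omega>" "B = ball w (s w / 2)" using B U(1) by blast
      have "AE x in lebesgue. x \<in> ball w (s w / 2) \<longrightarrow> f0 x = conv f0 (mollifier (s w / 8)) x"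
        by (rule Weyl_mollifier_AE[OF l]) (use hol[OF _ s(2)[OF w(1)]] s(1)[OF w(1)] in auto)
      then show ?thesis
      proof eventually_elim
        fix x assume "x \<in> ball w (s w / 2) \<longrightarrow> f0 x = conv f0 (mollifier (s w / 8)) x"
        then show "x \<in> B \<longrightarrow> f x = f0 x" using loc[OF s(1)[OF w(1)] s(2)[OF w(1)], of x] w(2) by simp
      qed
    qed
    then have "AE x in lebesgue. \<forall>B\<in>U. x \<in> B \<longrightarrow> f x = f0 x" unfolding AE_ball_countable[OF U(2)] by blast
    then show ?thesis
    proof eventually_elim
      fix x assume a: "\<forall>B\<in>U. x \<in> B \<longrightarrow> f x = f0 x"
      show "f x = f0 x"
      proof (cases "x \<in> \<Omega>")
        case True
        then have "x \<in> ball x (s x / 2)" using s(1) by simp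
        then have "x \<in> \<Union>U" unfolding U(3) using True by blast
        then show ?thesis using a by blast
      qed (simp add: f_def)
    qed
  qed
  moreover have "\<exists>g. smooth_fun g \<and> (\<forall>x\<in>ball w (R/2). f x = g x \<and> (\<forall>j. wzbar j g x = 0))"
    if R: "0 < R" "ball w R \<subseteq> \<Omega>" for w R
  proof (intro exI conjI ballI allI)
    show "smooth_fun (conv f0 (mollifier (R/8)))" by (rule conv_mollifier_smooth[OF l]) (use R in simp)
    fix x j assume x: "x \<in> ball w (R/2)"
    show "f x = conv f0 (mollifier (R/8)) x" by (rule loc[OF R x])
    show "wzbar j (conv f0 (mollifier (R/8))) x = 0" by (rule hol[OF _ R(2)]) (use R x in auto)
  qed
  ultimately show ?thesis using that by blast
qed

lemma bump_bounded: 
  obtains B where "0 \<le> B" "\<And>x::'a::euclidean_space. bump x \<le> B"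
proof -
  have "bump x = 0" if "norm x > 1" for x :: 'a by (rule bump_support) (use that in simp)
  then obtain B where "0 \<le> B" "\<And>x::'a. norm (bump x) \<le> B"
    using continuous_support_bounded[of bump 1, OF smooth_continuous[OF smooth_bump]] by metis
  then show ?thesis using that[of B] by (metis abs_le_D1 real_norm_def)
qed

lemma weighted_sub_mean_value:
  fixes g :: "complex^'n \<Rightarrow> complex" and \<phi> :: "complex^'n \<Rightarrow> real"
  assumes g: "smooth_fun g" and \<phi>: "Ck 2 \<phi>" and r: "0 < r" and h: "\<And>x j. x \<in> ball w r \<Longrightarrow> wzbar j g x = 0"
    and lp: "\<And>x. x \<in> ball w r \<Longrightarrow> lap \<phi> x \<le> 1 / r\<^sup>2" and B: "0 \<le> B" "\<And>x. bump (x::complex^'n) \<le> B"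
  shows "(norm (g w))\<^sup>2 * exp (-2 * \<phi> w) \<le>
    B * exp 1 / r ^ (2 * CARD('n)) * (\<integral>x. indicator (ball w r) x * ((norm (g x))\<^sup>2 * exp (-2 * \<phi> x)) \<partial>lborel)"
proof -
  \<comment> \<open>Chosen so that the Laplacian 4 c n of the quadratic term is exactly 2/r^2, which
    offsets -2 times that of \<phi>. On the ball the term is at most 1/(2n), hence the factor
    \<open>exp 1\<close>.\<close>
  define c where "c = 1 / (2 * real CARD('n) * r\<^sup>2)"
  have n1: "1 \<le> real CARD('n)" by (simp add: Suc_leI)
  have c0: "0 \<le> c" using n1 by (simp add: c_def)
  have cn: "4 * c * real CARD('n) = 2 * (1 / r\<^sup>2)" using n1 r by (simp add: c_def field_simps)
  define \<psi> where "\<psi> x = -2 * \<phi> x + c * ((x - w) \<bullet> (x - w))" for x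
  define F where "F x = (norm (g x))\<^sup>2 * exp (\<psi> x)" for x
  define G where "G x = (norm (g x))\<^sup>2 * exp (-2 * \<phi> x)" for x
  have C\<psi>: "Ck 2 \<psi>" unfolding \<psi>_def[abs_def] by (rule lap_quadratic(1)[OF \<phi>])
  have cg: "continuous_on UNIV g" by (rule smooth_continuous[OF g])
  have Cg: "Ck 2 g" using g by (simp add: smooth_fun_def)
  have c\<phi>: "continuous_on UNIV \<phi>" by (rule Ck_continuous[OF \<phi>])
  have CF: "Ck 2 F" unfolding F_def[abs_def] by (rule Ck2_second_derivative_weight(1)[OF Cg C\<psi>])
  have cF: "continuous_on UNIV F" by (rule Ck_continuous[OF CF])
  have cG: "continuous_on UNIV G" unfolding G_def by (intro continuous_intros cg c\<phi>)
  have "F w \<le> (\<integral>y. bump y * F (w + r *\<^sub>R y) \<partial>lborel)"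
  proof (rule sub_mean_value[OF CF r])
    fix x assume x: "x \<in> ball w r"
    show "0 \<le> (\<Sum>b\<in>Basis. frechet_derivative (\<lambda>x. frechet_derivative F (at x) b) (at x) b)"
      unfolding F_def[abs_def]
    proof (rule weighted_laplacian_nonneg[OF Cg C\<psi> open_ball x h])
      show "0 \<le> lap \<psi> x" unfolding \<psi>_def[abs_def] lap_quadratic(2)[OF \<phi>] cn using lp[OF x] by linarith
    qed
  qed
  also have "\<dots> \<le> (\<integral>y. B * exp 1 * (indicator (ball w r) (w + r *\<^sub>R y) * G (w + r *\<^sub>R y)) \<partial>lborel)"
  proof (rule integral_mono)
    have cFa: "continuous_on UNIV (\<lambda>y. bump y * F (w + r *\<^sub>R y))"
      by (intro continuous_on_mult smooth_continuous[OF smooth_bump] continuous_on_compose2[OF cF]) (auto intro!: continuous_intros)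
    show "integrable lborel (\<lambda>y. bump y * F (w + r *\<^sub>R y))"
      by (rule continuous_integrable_support[OF cFa, of 1]) (simp add: bump_support)
    have cGa: "continuous_on UNIV (\<lambda>y. G (w + r *\<^sub>R y))"
      by (intro continuous_on_compose2[OF cG]) (auto intro!: continuous_intros)
    have e: "indicator (ball w r) (w + r *\<^sub>R y) = (indicator (ball 0 1) y :: real)" for y
      using r by (simp add: indicator_def dist_norm)
    have "integrable lborel (\<lambda>y. indicator (cball 0 1) y *\<^sub>R G (w + r *\<^sub>R y))"
      using continuous_loc_int[OF cGa] by (simp add: loc_int_def)
    then have "integrable lborel (\<lambda>y. indicator (ball 0 1) y * G (w + r *\<^sub>R y))"
    proof (rule Bochner_Integration.integrable_bound)
      show "(\<lambda>y. indicator (ball 0 1) y * G (w + r *\<^sub>R y)) \<in> borel_measurable lborel"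
        by (intro borel_measurable_times borel_measurable_indicator) (use borel_continuous[OF cGa] in simp_all)
    qed (auto simp: indicator_def)
    then show "integrable lborel (\<lambda>y. B * exp 1 * (indicator (ball w r) (w + r *\<^sub>R y) * G (w + r *\<^sub>R y)))"
      unfolding e by simp
    fix y :: "complex^'n"
    show "bump y * F (w + r *\<^sub>R y) \<le> B * exp 1 * (indicator (ball w r) (w + r *\<^sub>R y) * G (w + r *\<^sub>R y))"
    proof (cases "norm y < 1")
      case True
      have "c * ((r *\<^sub>R y) \<bullet> (r *\<^sub>R y)) = (norm y)\<^sup>2 / (2 * real CARD('n))"
        unfolding power2_norm_eq_inner using r by (simp add: c_def power2_eq_square)
      also have "\<dots> \<le> 1"
      proof -
        have "(norm y)\<^sup>2 \<le> 1" using power_mono[of "norm y" 1 2] True by simp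
        then have "(norm y)\<^sup>2 \<le> 2 * real CARD('n)" using n1 by linarith
        then show ?thesis by simp
      qed
      finally have le1: "c * ((r *\<^sub>R y) \<bullet> (r *\<^sub>R y)) \<le> 1" .
      have "\<psi> (w + r *\<^sub>R y) \<le> 1 + -2 * \<phi> (w + r *\<^sub>R y)"
        unfolding \<psi>_def add_diff_cancel_left' using le1 by linarith
      then have "exp (\<psi> (w + r *\<^sub>R y)) \<le> exp (1 + -2 * \<phi> (w + r *\<^sub>R y))" by (simp only: exp_le_cancel_iff)
      then have "F (w + r *\<^sub>R y) \<le> (norm (g (w + r *\<^sub>R y)))\<^sup>2 * exp (1 + -2 * \<phi> (w + r *\<^sub>R y))"
        unfolding F_def by (intro mult_left_mono) simp_all
      also have "\<dots> = exp 1 * G (w + r *\<^sub>R y)" unfolding G_def by (simp only: exp_add mult_ac)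
      finally have "bump y * F (w + r *\<^sub>R y) \<le> B * (exp 1 * G (w + r *\<^sub>R y))"
        by (rule mult_mono[OF B(2) _ B(1)]) (simp_all only: F_def mult_nonneg_nonneg zero_le_power2 exp_ge_zero)
      moreover have "indicator (ball 0 1) y = (1::real)" using True by simp
      ultimately show ?thesis by (simp only: e mult_1 mult.assoc)
    next
      case False
      then show ?thesis unfolding e using bump_support[of y] by simp
    qed
  qed
  also have "\<dots> = B * exp 1 * (\<integral>y. indicator (ball w r) (w + r *\<^sub>R y) * G (w + r *\<^sub>R y) \<partial>lborel)"
    by (rule Bochner_Integration.integral_mult_right_zero)
  also have "(\<integral>y. indicator (ball w r) (w + r *\<^sub>R y) * G (w + r *\<^sub>R y) \<partial>lborel)
      = (\<integral>x. indicator (ball w r) x * G x \<partial>lborel) /\<^sub>R \<bar>r\<bar> ^ DIM(complex^'n)"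
  proof (rule lborel_integral_affine[where f = "\<lambda>x. indicator (ball w r) x * G x" and t = w and c = r])
    show "(\<lambda>x. indicator (ball w r) x * G x) \<in> borel_measurable borel"
      by (rule borel_measurable_times[OF borel_measurable_indicator borel_continuous[OF cG]]) simp
  qed (use r in simp)
  finally have "F w \<le> B * exp 1 * ((\<integral>x. indicator (ball w r) x * G x \<partial>lborel) /\<^sub>R r ^ (2 * CARD('n)))"
    using r by (simp add: mult.commute[of "CARD('n)" 2])
  moreover have "F w = (norm (g w))\<^sup>2 * exp (-2 * \<phi> w)" by (simp add: F_def \<psi>_def)
  ultimately show ?thesis unfolding G_def by (simp add: divide_inverse mult_ac)
qed

context weighted_space
begin

lemma sq_int_loc_int:
  assumes f: "sq_int M f" "f \<in> borel_measurable borel"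
  shows "loc_int f"
  unfolding loc_int_def
proof (intro conjI allI f(2))
  fix R :: real
  \<comment> \<open>The weight exp (-2 \<phi>) of the inner product cancels the exponential in G, so
    Cauchy-Schwarz for |f| and G bounds the plain integral of |f| over the ball.\<close>
  define G where "G z = indicator (cball 0 R) z * exp (2 * \<phi> z)" for z
  have c: "continuous_on UNIV (\<lambda>z. exp (2 * \<phi> z))" by (intro continuous_intros cont)
  have mG: "G \<in> borel_measurable borel" unfolding G_def
    by (intro borel_measurable_times borel_measurable_indicator borel_continuous[OF c]) simp
  have "integrable lborel (\<lambda>z. indicator (cball 0 R) z *\<^sub>R exp (2 * \<phi> z))"
    using continuous_loc_int[OF c] by (simp add: loc_int_def)
  moreover have "indicator (cball 0 R) z *\<^sub>R exp (2 * \<phi> z) = exp (-2 * \<phi> z) *\<^sub>R (norm (G z))\<^sup>2" for z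
    unfolding G_def by (simp add: indicator_def power2_eq_square flip: exp_add)
  ultimately have "integrable lborel (\<lambda>z. exp (-2 * \<phi> z) *\<^sub>R (norm (G z))\<^sup>2)" by simp
  then have "integrable lebesgue (\<lambda>z. exp (-2 * \<phi> z) *\<^sub>R (norm (G z))\<^sup>2)"
    by (subst integrable_completion) auto
  then have "integrable M (\<lambda>z. (norm (G z))\<^sup>2)"
    by (subst integral_M) (use borel_imp_lebesgue[OF mG] in measurable)
  then have sG: "sq_int M G" unfolding sq_int_def using borel_imp_lebesgue[OF mG] by (simp add: measurable_M)
  have mf: "f \<in> borel_measurable lebesgue" by (rule borel_imp_lebesgue[OF f(2)])
  have "integrable lebesgue (\<lambda>z. exp (-2 * \<phi> z) *\<^sub>R (norm (f z) * norm (G z)))"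
    using sq_int_norm_mult[OF f(1) sG]
    by (subst integral_M(2)[symmetric]) (use borel_imp_lebesgue[OF mG] mf in measurable)
  moreover have "(\<lambda>z. exp (-2 * \<phi> z) *\<^sub>R (norm (f z) * norm (G z))) = (\<lambda>z. norm (indicator (cball 0 R) z *\<^sub>R f z))"
    unfolding G_def by (rule ext) (simp add: indicator_def flip: exp_add)
  ultimately have "integrable lebesgue (\<lambda>z. norm (indicator (cball 0 R) z *\<^sub>R f z))" by (simp only:)
  moreover have m: "(\<lambda>z. indicator (cball 0 R) z *\<^sub>R f z) \<in> borel_measurable borel"
    by (intro borel_measurable_scaleR borel_measurable_indicator f(2)) simp
  ultimately have "integrable lebesgue (\<lambda>z. indicator (cball 0 R) z *\<^sub>R f z)"
    by (rule integrable_norm_cancel[OF _ borel_imp_lebesgue])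
  then show "integrable lborel (\<lambda>z. indicator (cball 0 R) z *\<^sub>R f z)"
    using m by (subst (asm) integrable_completion) auto
qed

lemma AE_M: "AE z in lebesgue. P z \<Longrightarrow> AE z in M. P z"
proof -
  assume "AE z in lebesgue. P z"
  moreover have "(\<lambda>z. ennreal (exp (-2 * \<phi> z))) \<in> borel_measurable lebesgue" using weight_measurable by simp
  ultimately show ?thesis unfolding M_def by (subst AE_density) (auto elim: eventually_mono)
qed

lemma sq_int_AE:
  fixes f g :: "complex^'n \<Rightarrow> 'b::euclidean_space"
  assumes f: "sq_int M f" and ae: "AE z in lebesgue. f z = g z"
  shows "sq_int M g"
proof -
  have g: "g \<in> borel_measurable M" using borel_measurable_AE[OF _ ae] sq_intD(1)[OF f] by (simp add: measurable_M)
  have "integrable M (\<lambda>x. (norm (g x))\<^sup>2)"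
    by (rule integrable_cong_AE_imp[OF sq_intD(2)[OF f]]) (use g AE_M[OF ae] in \<open>auto elim: eventually_mono\<close>)
  then show ?thesis using g by (simp add: sq_int_def)
qed

lemma canonical_solution_AE:
  assumes f: "canonical_solution \<phi> u f" and ae: "AE z in lebesgue. f z = g z"
  shows "canonical_solution \<phi> u g"
proof -
  have sf: "sq_int M f" using f by (simp add: canonical_solution_def dom_dbar0_def L2w_iff)
  have sg: "sq_int M g" by (rule sq_int_AE[OF sf ae])
  have mf: "f \<in> borel_measurable lebesgue" "g \<in> borel_measurable lebesgue"
    using sq_intD(1)[OF sf] sq_intD(1)[OF sg] by (simp_all add: measurable_M)
  have e: "(\<integral>z. f z * wzbar j \<psi> z \<partial>lebesgue) = (\<integral>z. g z * wzbar j \<psi> z \<partial>lebesgue)" if t: "test_fun \<psi>" for j \<psi>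
    by (rule integral_cong_AE)
       (use mf ae borel_imp_lebesgue[OF borel_continuous[OF smooth_continuous[OF smooth_wzbar[OF test_fun_smooth[OF t]]]]]
        in \<open>auto elim: eventually_mono\<close>)
  have w: "weak_dbar0 j f v \<Longrightarrow> weak_dbar0 j g v" for j v
    unfolding weak_dbar0_def by (simp add: e)
  have "winner \<phi> g h = 0" if h: "A2 \<phi> h" for h
  proof -
    have sh: "sq_int M h" using h by (simp add: A2_def L2w_iff)
    have "winner \<phi> f h = (\<integral>z. f z * cnj (h z) \<partial>M)" "winner \<phi> g h = (\<integral>z. g z * cnj (h z) \<partial>M)"
      by (rule winner_eq(3)[OF sf sh], rule winner_eq(3)[OF sg sh])
    moreover have "(\<integral>z. f z * cnj (h z) \<partial>M) = (\<integral>z. g z * cnj (h z) \<partial>M)"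
      by (rule integral_cong_AE) (use winner_eq(4)[OF sf sh] winner_eq(4)[OF sg sh] AE_M[OF ae] in \<open>auto elim: eventually_mono\<close>)
    ultimately show ?thesis using f h by (simp add: canonical_solution_def)
  qed
  then show ?thesis using f sg w unfolding canonical_solution_def dom_dbar0_def L2w_iff has_dbar0_def by blast
qed

lemma dbar_solution_representative:
  assumes g: "dbar_graph f0 u" and O: "open \<Omega>" "\<And>z. z \<in> \<Omega> \<Longrightarrow> u z = 0"
  obtains f where "AE x in lebesgue. f0 x = f x"
    "\<And>w R. 0 < R \<Longrightarrow> ball w R \<subseteq> \<Omega> \<Longrightarrow> \<exists>g. smooth_fun g \<and> (\<forall>x\<in>ball w (R/2). f x = g x \<and> (\<forall>j. wzbar j g x = 0))"
proof -
  have s: "sq_int M f0" and su: "sq_int M u" and d: "has_dbar0 f0 u" using g by (simp_all add: dbar_graph_def)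
  have m: "f0 \<in> borel_measurable lebesgue" using sq_intD(1)[OF s] by (simp add: measurable_M)
  obtain f1 where f1: "f1 \<in> borel_measurable borel" "AE x in lebesgue. f0 x = f1 x"
    using borel_representative[OF m] by metis
  have l: "loc_int f1" by (rule sq_int_loc_int[OF sq_int_AE[OF s f1(2)] f1(1)])
  have hol: "wzbar j (conv f1 (mollifier \<delta>)) x = 0"
    if \<delta>: "0 < \<delta>" and b: "ball w R \<subseteq> \<Omega>" and x: "x \<in> ball w (R - \<delta>)" for \<delta> w R x j
  proof -
    have mu: "(\<lambda>z. u z $ j) \<in> borel_measurable lebesgue" using sq_intD(1)[OF sq_int_nth[OF su, of j]] by (simp add: measurable_M)
    obtain v where v: "v \<in> borel_measurable borel" "AE x in lebesgue. u x $ j = v x"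
      using borel_representative[OF mu] by metis
    \<comment> \<open>The Borel representative of u_j is reset to 0 on the whole open set, so that
      its mollification vanishes there by pointwise cancellation of the integrand.\<close>
    define v' where "v' x = indicator (- \<Omega>) x *\<^sub>R v x" for x
    have mv: "v' \<in> borel_measurable borel" unfolding v'_def using v(1) O(1) by simp
    have av: "AE x in lebesgue. u x $ j = v' x"
      using v(2)
    proof eventually_elim
      fix x assume "u x $ j = v x"
      then show "u x $ j = v' x" using O(2)[of x] by (cases "x \<in> \<Omega>") (simp_all add: v'_def)
    qed
    have "(\<integral>z. f1 z * wzbar j \<psi> z \<partial>lborel) = - (\<integral>z. v' z * \<psi> z \<partial>lborel)" if t: "test_fun \<psi>" for \<psi>
    proof -
      have b1: "wzbar j \<psi> \<in> borel_measurable borel" "\<psi> \<in> borel_measurable borel"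
        by (intro borel_continuous smooth_continuous smooth_wzbar test_fun_smooth t)+
      have "(\<integral>z. f1 z * wzbar j \<psi> z \<partial>lborel) = (\<integral>z. f1 z * wzbar j \<psi> z \<partial>lebesgue)"
        by (rule integral_completion[symmetric]) (use f1(1) b1 in measurable)
      also have "\<dots> = (\<integral>z. f0 z * wzbar j \<psi> z \<partial>lebesgue)"
        by (rule integral_cong_AE) (use m f1(2) borel_imp_lebesgue[OF f1(1)] borel_imp_lebesgue[OF b1(1)] in \<open>auto elim: eventually_mono\<close>)
      also have "\<dots> = - (\<integral>z. u z $ j * \<psi> z \<partial>lebesgue)"
        using d t by (simp add: has_dbar0_def weak_dbar0_def)
      also have "(\<integral>z. u z $ j * \<psi> z \<partial>lebesgue) = (\<integral>z. v' z * \<psi> z \<partial>lebesgue)"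
        by (rule integral_cong_AE) (use mu av borel_imp_lebesgue[OF mv] borel_imp_lebesgue[OF b1(2)] in \<open>auto elim: eventually_mono\<close>)
      also have "\<dots> = (\<integral>z. v' z * \<psi> z \<partial>lborel)"
        by (rule integral_completion) (use mv b1 in measurable)
      finally show ?thesis .
    qed
    from wzbar_mollify[OF l \<delta> this] have "wzbar j (conv f1 (mollifier \<delta>)) x = conv v' (mollifier \<delta>) x" .
    also have "\<dots> = (\<integral>(y::complex^'n). 0 \<partial>lborel)" unfolding conv_def
    proof (rule Bochner_Integration.integral_cong[OF refl])
      fix y :: "complex^'n"
      show "mollifier \<delta> (x - y) *\<^sub>R v' y = 0"
      proof (cases "norm (x - y) < \<delta>")
        case True
        then have "y \<in> ball w R" using x dist_triangle[of w y x] by (simp add: dist_norm)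
        then show ?thesis using b by (auto simp: v'_def)
      next
        case False
        then have "mollifier \<delta> (x - y) = 0" by (intro mollifier_support[OF \<delta>]) simp
        then show ?thesis by simp
      qed
    qed
    finally show ?thesis by simp
  qed
  obtain f where f: "AE x in lebesgue. f x = f1 x"
    "\<And>w R. 0 < R \<Longrightarrow> ball w R \<subseteq> \<Omega> \<Longrightarrow> \<exists>g. smooth_fun g \<and> (\<forall>x\<in>ball w (R/2). f x = g x \<and> (\<forall>j. wzbar j g x = 0))"
    by (rule holomorphic_representative[OF l O(1) hol]) blast+
  have "AE x in lebesgue. f0 x = f x" using f1(2) f(1) by eventually_elim simp
  then show ?thesis using that f(2) by blast
qed

end

section \<open>Admissible weights and the maximal eigenvalue radius\<close>

lemma Ck2_second_derivative:
  assumes "Ck 2 f"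
  shows "f differentiable (at x)" "(\<lambda>x. frechet_derivative f (at x) v) differentiable (at x)"
    "continuous_on UNIV (\<lambda>x. frechet_derivative (\<lambda>x. frechet_derivative f (at x) v) (at x) w)"
  using assms unfolding numeral_2_eq_2 by simp_all

lemma lap_continuous: "Ck 2 \<phi> \<Longrightarrow> continuous_on UNIV (lap \<phi>)"
  unfolding lap_def[abs_def] dd_def by (intro continuous_intros Ck2_second_derivative(3))

lemma Re_cHess_diagonal:
  fixes \<phi> :: "complex^'n \<Rightarrow> real"
  assumes c: "Ck 2 \<phi>"
  shows "Re (cHess \<phi> z j j) = (dd \<phi> (axis j 1) z + dd \<phi> (axis j \<i>) z) / 4"
proof -
  let ?P = "\<lambda>v x. frechet_derivative \<phi> (at x) v"
  have of_real: "frechet_derivative (\<lambda>x. complex_of_real (f x)) (at x) v = complex_of_real (frechet_derivative f (at x) v)"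
    if "f differentiable (at x)" for f :: "complex^'n \<Rightarrow> real" and x v
  proof -
    have "((\<lambda>x. complex_of_real (f x)) has_derivative (\<lambda>v. complex_of_real (frechet_derivative f (at x) v))) (at x)"
      by (rule has_derivative_of_real[OF that[unfolded frechet_derivative_works]])
    from fun_cong[OF frechet_derivative_at[OF this], of v] show ?thesis by simp
  qed
  have w: "wzbar j (\<lambda>x. complex_of_real (\<phi> x)) = (\<lambda>x. (complex_of_real (?P (axis j 1) x) + \<i> * complex_of_real (?P (axis j \<i>) x)) * (1/2))"
    unfolding wzbar_def[abs_def] of_real[OF Ck2_second_derivative(1)[OF c]] by simp
  have Pd: "((\<lambda>x. complex_of_real (?P a x)) has_derivative (\<lambda>v. complex_of_real (frechet_derivative (?P a) (at z) v))) (at z)" for a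
    by (rule has_derivative_of_real) (rule Ck2_second_derivative(2)[OF c, unfolded frechet_derivative_works])
  have dP: "frechet_derivative (\<lambda>x. (complex_of_real (?P (axis j 1) x) + \<i> * complex_of_real (?P (axis j \<i>) x)) * (1/2)) (at z) v
     = (complex_of_real (frechet_derivative (?P (axis j 1)) (at z) v) + \<i> * complex_of_real (frechet_derivative (?P (axis j \<i>)) (at z) v)) * (1/2)" for v
  proof -
    have "((\<lambda>x. (complex_of_real (?P (axis j 1) x) + \<i> * complex_of_real (?P (axis j \<i>) x)) * (1/2)) has_derivative
      (\<lambda>v. (complex_of_real (frechet_derivative (?P (axis j 1)) (at z) v) + \<i> * complex_of_real (frechet_derivative (?P (axis j \<i>)) (at z) v)) * (1/2))) (at z)"
      by (rule has_derivative_mult_left[OF has_derivative_add[OF _ has_derivative_mult_right]]) (rule Pd)+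
    from fun_cong[OF frechet_derivative_at[OF this], of v] show ?thesis by simp
  qed
  show ?thesis unfolding cHess_def w wz_def dd_def dP by simp
qed

text \<open>The Laplacian is four times the trace of the complex Hessian, and the diagonal entries
  are values of its quadratic form at unit vectors.\<close>

lemma admissible_lap_nonneg:
  fixes \<phi> :: "complex^'n \<Rightarrow> real"
  assumes "admissible \<phi>" shows "0 \<le> lap \<phi> z"
proof -
  have c: "Ck 2 \<phi>" and psd: "\<And>\<xi>. 0 \<le> Re (\<Sum>j\<in>UNIV. \<Sum>k\<in>UNIV. cnj (\<xi> $ j) * cHess \<phi> z j k * \<xi> $ k)"
    using assms unfolding admissible_def by blast+
  have "0 \<le> Re (cHess \<phi> z j j)" for j
  proof -
    have i: "cnj (axis j 1 $ a) * cHess \<phi> z a b * axis j 1 $ b = (if b = j then (if a = j then cHess \<phi> z j j else 0) else 0)" for a b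
      by (simp add: axis_def)
    have s: "(\<Sum>a\<in>UNIV. \<Sum>b\<in>UNIV. cnj (axis j 1 $ a) * cHess \<phi> z a b * axis j 1 $ b) = cHess \<phi> z j j"
      unfolding i by (simp add: sum.delta)
    show ?thesis using psd[of "axis j 1"] unfolding s .
  qed
  then have "0 \<le> dd \<phi> (axis j 1) z + dd \<phi> (axis j \<i>) z" for j
    unfolding Re_cHess_diagonal[OF c] by simp
  then show ?thesis unfolding lap_def by (intro sum_nonneg) blast
qed

text \<open>The supremum defining the radius need not be attained, so a radius beyond half of it is
  used. For real suprema, nonemptiness and boundedness must be secured first: the former by
  continuity of the Laplacian, the latter by the uniform lower bound in admissibility.\<close>

lemma max_eig_radius_witness:
  fixes \<phi> :: "complex^'n \<Rightarrow> real"
  assumes adm: "admissible \<phi>"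
  shows "0 < max_eig_radius \<phi> z"
    "\<exists>r>0. max_eig_radius \<phi> z / 2 < r \<and> r \<le> max_eig_radius \<phi> z \<and> (\<forall>x\<in>ball z r. lap \<phi> x \<le> 1 / r\<^sup>2)"
proof -
  have c: "Ck 2 \<phi>" using adm by (simp add: admissible_def)
  have bd: "bdd_above (lap \<phi> ` ball z r)" for z r
  proof -
    have "bounded (lap \<phi> ` cball z r)"
      by (intro compact_imp_bounded compact_continuous_image continuous_on_subset[OF lap_continuous[OF c]]) simp_all
    then show ?thesis using bounded_imp_bdd_above bdd_above_mono[of "lap \<phi> ` cball z r"] ball_subset_cball image_mono by metis
  qed
  have up: "lap \<phi> x \<le> Sup (lap \<phi> ` ball z r)" if "x \<in> ball z r" for x z r
    by (rule cSup_upper[OF imageI[OF that] bd])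
  define S where "S = {r. 0 < r \<and> Sup (lap \<phi> ` ball z r) \<le> 1 / r\<^sup>2}"
  have e: "max_eig_radius \<phi> z = Sup S" by (simp add: max_eig_radius_def S_def)
  have "\<exists>r. r \<in> S"
  proof -
    \<comment> \<open>Since L is at least 1, the ball of radius 1/L lies in the unit ball, where the
      Laplacian is at most L, and L \<le> L^2; so 1/L is an admissible radius.\<close>
    define L where "L = max 1 (Sup (lap \<phi> ` ball z 1))"
    have L: "1 \<le> L" "Sup (lap \<phi> ` ball z 1) \<le> L" by (simp_all add: L_def)
    have sub: "ball z (1/L) \<subseteq> ball z 1" using L(1) by (intro subset_ball) simp
    have "Sup (lap \<phi> ` ball z (1/L)) \<le> L"
    proof (rule cSup_least)
      show "lap \<phi> ` ball z (1/L) \<noteq> {}" using L(1) by simp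
      fix y assume "y \<in> lap \<phi> ` ball z (1/L)"
      then obtain x where "x \<in> ball z 1" "y = lap \<phi> x" using sub by blast
      then show "y \<le> L" using up[of x z 1] L(2) by linarith
    qed
    also have "L \<le> 1 / (1/L)\<^sup>2" using L(1) by (simp add: power2_eq_square)
    finally have "1/L \<in> S" using L(1) by (simp add: S_def)
    then show ?thesis by blast
  qed
  then have ne: "S \<noteq> {}" by blast
  obtain c0 where c0: "c0 > 0" "Inf (range (\<lambda>z. Sup (lap \<phi> ` ball z c0))) > 0"
    using adm unfolding admissible_def by blast
  define m where "m = Inf (range (\<lambda>z. Sup (lap \<phi> ` ball z c0)))"
  have m: "m > 0" "m \<le> Sup (lap \<phi> ` ball z c0)"
  proof -
    show "m > 0" using c0(2) by (simp add: m_def)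
    have "bdd_below (range (\<lambda>z. Sup (lap \<phi> ` ball z c0)))"
    proof (rule bdd_belowI2)
      fix z :: "complex^'n"
      have "lap \<phi> z \<le> Sup (lap \<phi> ` ball z c0)" by (rule up) (use c0(1) in simp)
      then show "0 \<le> Sup (lap \<phi> ` ball z c0)" using admissible_lap_nonneg[OF adm, of z] by linarith
    qed
    then show "m \<le> Sup (lap \<phi> ` ball z c0)" unfolding m_def by (rule cINF_lower) simp
  qed
  \<comment> \<open>A radius beyond \<open>c0\<close> sees a Laplacian of at least m, which forces
    r^2 \<le> 1/m; then r \<le> 1 + r^2 avoids a square root.\<close>
  have "r \<le> c0 + (1 + 1/m)" if r: "r \<in> S" for r
  proof (cases "r \<le> c0")
    case True
    have "0 < 1/m" using m(1) by simp
    then show ?thesis using True by linarith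
  next
    case False
    have r0: "0 < r" "Sup (lap \<phi> ` ball z r) \<le> 1 / r\<^sup>2" using r by (simp_all add: S_def)
    have "Sup (lap \<phi> ` ball z c0) \<le> Sup (lap \<phi> ` ball z r)"
      by (rule cSup_subset_mono[OF _ bd]) (use c0(1) False in auto)
    then have "m \<le> 1 / r\<^sup>2" using m(2) r0(2) by linarith
    then have "r\<^sup>2 \<le> 1/m" using r0(1) m(1) by (simp add: field_simps)
    moreover have "r \<le> 1 + r\<^sup>2"
    proof -
      have "2 * r \<le> 1 + r\<^sup>2" using zero_le_power2[of "r - 1"] by (simp add: power2_eq_square algebra_simps)
      then show ?thesis using r0(1) by linarith
    qed
    ultimately show ?thesis using c0(1) by linarith
  qed
  then have bS: "bdd_above S" by (rule bdd_aboveI)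
  obtain r1 where r1: "r1 \<in> S" using ne by blast
  have "0 < r1" using r1 by (simp add: S_def)
  then show pos: "0 < max_eig_radius \<phi> z" unfolding e using cSup_upper[OF r1 bS] by linarith
  then have "Sup S / 2 < Sup S" unfolding e by simp
  then obtain r where r: "r \<in> S" "Sup S / 2 < r" using less_cSupE[OF _ ne] by metis
  have "lap \<phi> x \<le> 1 / r\<^sup>2" if "x \<in> ball z r" for x using up[OF that] r(1) unfolding S_def by simp
  moreover have "r \<le> Sup S" by (rule cSup_upper[OF r(1) bS])
  ultimately show "\<exists>r>0. max_eig_radius \<phi> z / 2 < r \<and> r \<le> max_eig_radius \<phi> z \<and> (\<forall>x\<in>ball z r. lap \<phi> x \<le> 1 / r\<^sup>2)"
    unfolding e using r(2) r(1)[unfolded S_def] by blast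
qed

section \<open>Choice of constants and the pointwise estimate\<close>

context coercive_weight
begin

text \<open>By \<open>d_rho_ge_exit\<close> the support lies within \<kappa>(z)/2 of z, where
  \<kappa> is comparable to \<kappa>(z). This is the source of the factor \<kappa>(z) in the
  theorem.\<close>

lemma kappa_form_bound:
  assumes u: "sq_int M u" and supp: "\<And>x. 1 / (2 * C) \<le> d_rho \<kappa> z x \<Longrightarrow> u x = 0"
  shows "(\<integral>x. (norm (\<kappa> x *\<^sub>R u x))\<^sup>2 \<partial>M) \<le> (C * \<kappa> z * form1_norm \<phi> u)\<^sup>2"
proof -
  have "(norm (\<kappa> x *\<^sub>R u x))\<^sup>2 \<le> (C * \<kappa> z)\<^sup>2 * (norm (u x))\<^sup>2" for x
  proof (cases "u x = 0")
    case False
    then have "\<not> norm (x - z) \<ge> \<kappa> z / 2" using supp d_rho_ge_exit by blast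
    then have "dist x z < \<kappa> z" using pos[of z] by (simp add: dist_norm)
    then have "\<kappa> x \<le> C * \<kappa> z" using C by blast
    then have "(\<kappa> x * norm (u x))\<^sup>2 \<le> (C * \<kappa> z * norm (u x))\<^sup>2"
      using pos[of x] by (intro power_mono mult_right_mono mult_nonneg_nonneg) simp_all
    then show ?thesis using pos[of x] by (simp add: power_mult_distrib)
  qed simp
  then have "(\<integral>x. (norm (\<kappa> x *\<^sub>R u x))\<^sup>2 \<partial>M) \<le> (\<integral>x. (C * \<kappa> z)\<^sup>2 * (norm (u x))\<^sup>2 \<partial>M)"
    by (intro integral_mono integrable_mult_right sq_intD(2)[OF sq_int_kappa[OF u]] sq_intD(2)[OF u])
  also have "\<dots> = (C * \<kappa> z)\<^sup>2 * (form1_norm \<phi> u)\<^sup>2"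
    unfolding form1_norm_eq[OF u] by (rule Bochner_Integration.integral_mult_right_zero)
  finally show ?thesis by (simp add: power_mult_distrib)
qed

lemma d_rho_ball:
  assumes "x \<in> ball w (\<kappa> w / C)"
  shows "\<bar>d_rho \<kappa> z w - d_rho \<kappa> z x\<bar> \<le> C"
proof -
  have d: "dist w x < \<kappa> w / C" using assms by simp
  have "C\<^sup>2 * dist w x \<le> C\<^sup>2 * (\<kappa> w / C)" using d by (intro mult_left_mono) simp_all
  also have "\<dots> = C * \<kappa> w" using C_ge_1 by (simp add: power2_eq_square)
  finally have "C\<^sup>2 * dist w x / \<kappa> w \<le> C" using pos[of w] by (simp add: divide_le_eq)
  then show ?thesis using d_rho_local_Lipschitz[OF d, of z] by linarith
qed

text \<open>Applies the Agmon estimate with the weight truncated at the distance of w itself: the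
  set B then sees the full exponential up to a factor depending on \<epsilon> and C, and the bound
  does not feel the truncation.\<close>

lemma local_weighted_bound:
  assumes F: "solves u F" and u: "sq_int M u" and supp: "\<And>x. 1 / (2 * C) \<le> d_rho \<kappa> z x \<Longrightarrow> u x = 0"
    and \<epsilon>: "\<epsilon> = 1 / (11 * real CARD('n) * C ^ 3)" and t1: "t1 = 1 / (2 * C) + 1"
    and w: "C + t1 + 3 / \<epsilon> \<le> d_rho \<kappa> z w" and B: "B \<subseteq> ball w (\<kappa> w / C)" "B \<in> sets borel"
  shows "(\<integral>x. indicator B x * (norm (snd (snd (F x))))\<^sup>2 \<partial>M)
     \<le> (8 * exp (\<epsilon> * (C + t1)) * exp (- \<epsilon> * d_rho \<kappa> z w) * (C * \<kappa> z * form1_norm \<phi> u))\<^sup>2"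
proof -
  let ?d = "d_rho \<kappa> z w"
  have n1: "1 \<le> real CARD('n)" by (simp add: Suc_leI)
  have C3: "1 \<le> C ^ 3" using C_ge_1 by simp
  have nC: "1 \<le> real CARD('n) * C ^ 3" using mult_mono[OF n1 C3] by simp
  have \<epsilon>0: "0 < \<epsilon>" "\<epsilon> \<le> 1/6" using nC unfolding \<epsilon> by (simp_all add: divide_le_eq mult.assoc)
  have p: "3 * \<epsilon> * C ^ 3 = 3 / (11 * real CARD('n))" using C_ge_1 unfolding \<epsilon> by simp
  have d0: "0 \<le> ?d" by (rule d_rho_nonneg)
  obtain \<eta> B' where \<eta>: "smooth_fun \<eta>" "\<And>x. \<bar>\<eta> x\<bar> \<le> B'" "\<And>x v. \<bar>frechet_derivative \<eta> (at x) v\<bar> \<le> B' * norm v"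
    "\<And>x v. \<bar>frechet_derivative \<eta> (at x) v\<bar> \<le> 3 * \<epsilon> * C ^ 3 * (\<eta> x + exp (\<epsilon> * t1)) / \<kappa> x * norm v"
    "\<And>x. 0 \<le> \<eta> x" "\<And>x. d_rho \<kappa> z x \<le> t1 - 1 \<Longrightarrow> \<eta> x = 0"
    "\<And>x. exp (\<epsilon> * min (d_rho \<kappa> z x) ?d) / 2 - exp (\<epsilon> * t1) \<le> \<eta> x"
    by (rule weight_function[where \<epsilon> = \<epsilon> and M = ?d and z = z and ?t1.0 = t1, OF \<epsilon>0 d0]) (rule that, assumption+)
  have tame: "tame \<eta>" unfolding tame_def using \<eta>(1-3) by blast
  have \<eta>u: "\<eta> x *\<^sub>R u x = 0" for x
  proof (cases "1 / (2 * C) \<le> d_rho \<kappa> z x")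
    case False
    then show ?thesis using \<eta>(6)[of x] t1 by simp
  qed (simp add: supp)
  have p2: "6 * (real CARD('n))\<^sup>2 * (3 * \<epsilon> * C ^ 3)\<^sup>2 \<le> 1/2"
    unfolding p using n1 by (simp add: power_divide power_mult_distrib)
  have p0: "0 \<le> 3 * \<epsilon> * C ^ 3" unfolding p by simp
  note ag = agmon_estimate[OF F u tame \<eta>(5) \<eta>u p0 exp_ge_zero p2 \<eta>(4)]
  \<comment> \<open>On B the truncated distance is at least d - C, so X bounds the exponential from
    below there. The summand 3/\<epsilon> in the lower bound for d gives exp 3 \<ge> 4, so the
    subtracted constant is at most X/4 and \<eta> \<ge> X/2 - X/4 on B.\<close>
  define X where "X = exp (\<epsilon> * (?d - C))"
  have X: "0 < X" "4 * exp (\<epsilon> * t1) \<le> X"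
  proof -
    show "0 < X" by (simp add: X_def)
    have "\<epsilon> * (t1 + 3/\<epsilon>) \<le> \<epsilon> * (?d - C)" using w \<epsilon>0 by (intro mult_left_mono) simp_all
    then have "\<epsilon> * t1 + 3 \<le> \<epsilon> * (?d - C)" using \<epsilon>0 by (simp add: distrib_left)
    then have "exp (\<epsilon> * t1 + 3) \<le> X" by (simp add: X_def)
    moreover have "4 * exp (\<epsilon> * t1) \<le> exp (\<epsilon> * t1 + 3)"
      unfolding exp_add using exp_ge_add_one_self[of "3::real"] by simp
    ultimately show "4 * exp (\<epsilon> * t1) \<le> X" by linarith
  qed
  have sf: "sq_int M (\<lambda>x. snd (snd (F x)))"
    using F by (intro sq_int_snd V_sq_int) (simp add: solves_def)
  note s\<eta> = sq_intD[OF tame_sq_int(1)[OF tame sf]]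
  have "(\<integral>x. indicator B x * (norm (snd (snd (F x))))\<^sup>2 \<partial>M) \<le> (\<integral>x. (4 / X)\<^sup>2 * (norm (\<eta> x *\<^sub>R snd (snd (F x))))\<^sup>2 \<partial>M)"
  proof (rule integral_mono)
    show "integrable M (\<lambda>x. (4 / X)\<^sup>2 * (norm (\<eta> x *\<^sub>R snd (snd (F x))))\<^sup>2)" using s\<eta>(2) by simp
    show "integrable M (\<lambda>x. indicator B x * (norm (snd (snd (F x))))\<^sup>2)"
    proof (rule Bochner_Integration.integrable_bound[OF sq_intD(2)[OF sf]])
      have "indicator B \<in> borel_measurable M"
        unfolding measurable_M by (intro borel_imp_lebesgue borel_measurable_indicator B(2))
      then show "(\<lambda>x. indicator B x * (norm (snd (snd (F x))))\<^sup>2) \<in> borel_measurable M"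
        using sq_intD(1)[OF sf] by measurable
    qed (auto simp: indicator_def)
    fix x
    show "indicator B x * (norm (snd (snd (F x))))\<^sup>2 \<le> (4 / X)\<^sup>2 * (norm (\<eta> x *\<^sub>R snd (snd (F x))))\<^sup>2"
    proof (cases "x \<in> B")
      case True
      then have "?d - C \<le> min (d_rho \<kappa> z x) ?d" using d_rho_ball[of x w z] B(1) C_ge_1 by auto
      then have "X \<le> exp (\<epsilon> * min (d_rho \<kappa> z x) ?d)" unfolding X_def using \<epsilon>0 by simp
      then have "X / 4 \<le> \<eta> x" using \<eta>(7)[of x] X(2) by (simp add: field_simps)
      then have "1 \<le> (4 / X) * \<eta> x" using X(1) by (simp add: field_simps)
      then have "1 * norm (snd (snd (F x))) \<le> (4 / X) * \<eta> x * norm (snd (snd (F x)))" by (rule mult_right_mono) simp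
      then have "(norm (snd (snd (F x))))\<^sup>2 \<le> ((4 / X) * \<eta> x * norm (snd (snd (F x))))\<^sup>2" by (intro power_mono) simp_all
      then show ?thesis using True by (simp add: power_mult_distrib power_divide)
    qed simp
  qed
  also have "\<dots> = (4 / X)\<^sup>2 * (\<integral>x. (norm (\<eta> x *\<^sub>R snd (snd (F x))))\<^sup>2 \<partial>M)" by (rule Bochner_Integration.integral_mult_right_zero)
  also have "\<dots> \<le> (4 / X)\<^sup>2 * (4 * (exp (\<epsilon> * t1))\<^sup>2 * (C * \<kappa> z * form1_norm \<phi> u)\<^sup>2)"
  proof (rule mult_left_mono)
    have "4 * (exp (\<epsilon> * t1))\<^sup>2 * (\<integral>x. (norm (\<kappa> x *\<^sub>R u x))\<^sup>2 \<partial>M) \<le> 4 * (exp (\<epsilon> * t1))\<^sup>2 * (C * \<kappa> z * form1_norm \<phi> u)\<^sup>2"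
      by (rule mult_left_mono[OF kappa_form_bound[OF u supp]]) simp_all
    then show "(\<integral>x. (norm (\<eta> x *\<^sub>R snd (snd (F x))))\<^sup>2 \<partial>M) \<le> 4 * (exp (\<epsilon> * t1))\<^sup>2 * (C * \<kappa> z * form1_norm \<phi> u)\<^sup>2"
      using ag by (rule order_trans[rotated])
  qed simp
  also have "\<dots> = (8 * (exp (\<epsilon> * t1) / X) * (C * \<kappa> z * form1_norm \<phi> u))\<^sup>2"
    by (simp add: power_mult_distrib power_divide)
  also have "exp (\<epsilon> * t1) / X = exp (\<epsilon> * (C + t1)) * exp (- \<epsilon> * ?d)"
    unfolding X_def by (simp add: algebra_simps flip: exp_add exp_diff)
  finally show ?thesis by (simp add: mult.assoc)
qed

text \<open>The quantified C of the conclusion shadows the locale constant; its witness is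
  \<open>C0\<close>, and r0 is 1/(2C) with the locale's C.\<close>

theorem canonical_solution_decay:
  assumes adm: "admissible \<phi>" and ge: "\<forall>z. max_eig_radius \<phi> z \<le> \<kappa> z"
  shows "\<exists>\<epsilon> r0 R0 C. 0 < \<epsilon> \<and> 0 < r0 \<and> 0 < R0 \<and>
    (\<forall>z u. dom_dbar1 \<phi> u \<and> (\<forall>j k. weak_dbar1 j k u (\<lambda>_. 0)) \<and>
           (\<forall>w. w \<notin> ball_rho \<kappa> z r0 \<longrightarrow> u w = 0) \<longrightarrow>
      (\<exists>f. canonical_solution \<phi> u f \<and>
        (\<forall>w. d_rho \<kappa> z w \<ge> R0 \<longrightarrow>
           (\<exists>U. open U \<and> w \<in> U \<and> holo_on U f) \<and>
           norm (f w) \<le> C * exp (\<phi> w) * \<kappa> z * exp (- \<epsilon> * d_rho \<kappa> z w)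
                          * max_eig_radius \<phi> w powr (- real CARD('n)) * form1_norm \<phi> u)))"
proof -
  have c2: "Ck 2 \<phi>" using adm by (simp add: admissible_def)
  define n where "n = CARD('n)"
  define \<epsilon> where "\<epsilon> = 1 / (11 * real CARD('n) * C ^ 3)"
  define t1 where "t1 = 1 / (2 * C) + 1"
  define R0 where "R0 = C + t1 + 3 / \<epsilon>"
  obtain B where B: "0 \<le> B" "\<And>x::complex^'n. bump x \<le> B" using bump_bounded by metis
  \<comment> \<open>Three sources: the square root comes from the mean value inequality, the middle
    factor from \<open>local_weighted_bound\<close>, and (4C)^n from replacing the radius of the
    ball by the maximal eigenvalue radius.\<close>
  define C0 where "C0 = sqrt (B * exp 1) * (8 * exp (\<epsilon> * (C + t1)) * C) * (4 * C) ^ n"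
  have C0: "0 < C" using C_ge_1 by simp
  have \<epsilon>0: "0 < \<epsilon>" using C0 by (simp add: \<epsilon>_def)
  have R0: "1 / (2 * C) + C < R0" "0 < R0" using C0 \<epsilon>0 unfolding R0_def t1_def by (simp_all add: add_pos_pos)
  have main: "\<exists>f. canonical_solution \<phi> u f \<and>
        (\<forall>w. d_rho \<kappa> z w \<ge> R0 \<longrightarrow>
           (\<exists>U. open U \<and> w \<in> U \<and> holo_on U f) \<and>
           norm (f w) \<le> C0 * exp (\<phi> w) * \<kappa> z * exp (- \<epsilon> * d_rho \<kappa> z w)
                          * max_eig_radius \<phi> w powr (- real CARD('n)) * form1_norm \<phi> u)"
    if d1: "dom_dbar1 \<phi> u" and closed: "\<forall>j k. weak_dbar1 j k u (\<lambda>_. 0)"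
      and supp: "\<forall>w. w \<notin> ball_rho \<kappa> z (1 / (2 * C)) \<longrightarrow> u w = 0" for z u
  proof -
    have su: "sq_int M u" using d1 by (simp add: dom_dbar1_def L2form1_iff)
    have uZ: "u \<in> Z" using su closed by (simp add: Z_def)
    have u0: "u x = 0" if "1 / (2 * C) \<le> d_rho \<kappa> z x" for x using supp that by (simp add: ball_rho_def)
    obtain F where F: "solves u F" using Riesz_V[OF su] unfolding solves_def by blast
    let ?f0 = "\<lambda>x. snd (snd (F x))"
    have sf: "sq_int M ?f0" using F by (intro sq_int_snd V_sq_int) (simp add: solves_def)
    have g: "dbar_graph ?f0 u" unfolding dbar_graph_def using sf su solves_dbar[OF F uZ] by blast
    have can: "canonical_solution \<phi> u ?f0"
      unfolding canonical_solution_def using dbar_graph_iff[of ?f0 u] g solves_orthogonal[OF F] by blast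
    define \<Omega> where "\<Omega> = {x. 1 / (2 * C) < d_rho \<kappa> z x}"
    have O: "open \<Omega>" unfolding \<Omega>_def by (intro open_Collect_less continuous_on_const d_rho_continuous)
    have uO: "u x = 0" if "x \<in> \<Omega>" for x using that u0 by (simp add: \<Omega>_def)
    obtain f where ae: "AE x in lebesgue. ?f0 x = f x"
      and reg: "\<And>w R. 0 < R \<Longrightarrow> ball w R \<subseteq> \<Omega> \<Longrightarrow> \<exists>g. smooth_fun g \<and> (\<forall>x\<in>ball w (R/2). f x = g x \<and> (\<forall>j. wzbar j g x = 0))"
      by (rule dbar_solution_representative[OF g O uO]) (assumption, rule that, assumption+)
    have "(\<exists>U. open U \<and> w \<in> U \<and> holo_on U f) \<and>
           norm (f w) \<le> C0 * exp (\<phi> w) * \<kappa> z * exp (- \<epsilon> * d_rho \<kappa> z w)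
                          * max_eig_radius \<phi> w powr (- real CARD('n)) * form1_norm \<phi> u"
      if w: "R0 \<le> d_rho \<kappa> z w" for w
    proof -
      note \<rho> = max_eig_radius_witness[OF adm, of w]
      obtain r where r: "0 < r" "max_eig_radius \<phi> w / 2 < r" "r \<le> max_eig_radius \<phi> w" "\<And>x. x \<in> ball w r \<Longrightarrow> lap \<phi> x \<le> 1 / r\<^sup>2"
        using \<rho>(2) by blast
      \<comment> \<open>The double ball has radius r/C \<le> \<kappa>(w)/C, on which the distance
        varies by at most C, so it avoids the support of u. The factor 2 is lost because the
        representative is described only on half-balls.\<close>
      define q where "q = r / (2 * C)"
      have q: "0 < q" using r(1) C0 by (simp add: q_def)
      have "r / C \<le> r" using r(1) C_ge_1 by (simp add: divide_le_eq)
      then have qr: "q \<le> r" "2 * q \<le> r" "2 * q = r / C" using q by (simp_all add: q_def)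
      have "2 * q \<le> \<kappa> w / C" using qr(3) r(3) ge C0 by (simp add: divide_right_mono order_trans)
      then have sub: "ball w (2 * q) \<subseteq> ball w (\<kappa> w / C)" by (rule subset_ball)
      have "ball w (2 * q) \<subseteq> \<Omega>"
      proof
        fix x assume "x \<in> ball w (2 * q)"
        then have "\<bar>d_rho \<kappa> z w - d_rho \<kappa> z x\<bar> \<le> C" using sub d_rho_ball by blast
        then show "x \<in> \<Omega>" using w R0(1) by (simp add: \<Omega>_def)
      qed
      then obtain g where g: "smooth_fun g" "\<And>x. x \<in> ball w q \<Longrightarrow> f x = g x" "\<And>x j. x \<in> ball w q \<Longrightarrow> wzbar j g x = 0"
        using reg[of "2 * q" w] q by auto
      have "holo_on (ball w q) f"
        unfolding holo_on_def
      proof (intro ballI exI conjI allI)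
        fix x assume x: "x \<in> ball w q"
        show "(f has_derivative frechet_derivative g (at x)) (at x)"
          by (rule has_derivative_transform_within_open[OF smooth_has_derivative[OF g(1)] open_ball x]) (simp add: g(2))
        show "frechet_derivative g (at x) (c *s v) = c * frechet_derivative g (at x) v" for c v
          by (rule complex_linear_of_wzbar[OF smooth_differentiable[OF g(1)] g(3)[OF x]])
      qed
      then have hol: "\<exists>U. open U \<and> w \<in> U \<and> holo_on U f" using q by (intro exI[of _ "ball w q"]) simp
      have lp: "lap \<phi> x \<le> 1 / q\<^sup>2" if x: "x \<in> ball w q" for x
      proof -
        have "lap \<phi> x \<le> 1 / r\<^sup>2" by (rule r(4)) (use x qr(1) in simp)
        also have "\<dots> \<le> 1 / q\<^sup>2" using q qr(1) by (intro divide_left_mono power_mono mult_pos_pos) simp_all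
        finally show ?thesis .
      qed
      let ?I = "indicator (ball w q) :: _ \<Rightarrow> real"
      let ?N = "C * \<kappa> z * form1_norm \<phi> u" and ?E = "exp (- \<epsilon> * d_rho \<kappa> z w)"
      have cg: "continuous_on UNIV (\<lambda>x. (norm (g x))\<^sup>2 * exp (-2 * \<phi> x))"
        by (intro continuous_intros smooth_continuous[OF g(1)] cont)
      have "(\<lambda>x. ?I x * ((norm (g x))\<^sup>2 * exp (-2 * \<phi> x))) \<in> borel_measurable borel"
        by (rule borel_measurable_times[OF borel_measurable_indicator borel_continuous[OF cg]]) simp
      note mg = this borel_imp_lebesgue[OF this]
      have mi: "(\<lambda>x. ?I x * (norm (?f0 x))\<^sup>2) \<in> borel_measurable lebesgue"
      proof -
        have "?f0 \<in> borel_measurable lebesgue" using sq_intD(1)[OF sf] by (simp add: measurable_M)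
        moreover have "?I \<in> borel_measurable lebesgue" by (intro borel_imp_lebesgue borel_measurable_indicator) simp
        ultimately show ?thesis by measurable
      qed
      have "(\<integral>x. ?I x * ((norm (g x))\<^sup>2 * exp (-2 * \<phi> x)) \<partial>lborel) = (\<integral>x. ?I x * ((norm (g x))\<^sup>2 * exp (-2 * \<phi> x)) \<partial>lebesgue)"
        by (rule integral_completion[symmetric]) (use mg(1) in simp)
      also have "\<dots> = (\<integral>x. exp (-2 * \<phi> x) *\<^sub>R (?I x * (norm (?f0 x))\<^sup>2) \<partial>lebesgue)"
      proof (rule integral_cong_AE[OF mg(2)])
        show "(\<lambda>x. exp (-2 * \<phi> x) *\<^sub>R (?I x * (norm (?f0 x))\<^sup>2)) \<in> borel_measurable lebesgue"
          by (rule borel_measurable_scaleR[OF weight_measurable mi])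
        show "AE x in lebesgue. ?I x * ((norm (g x))\<^sup>2 * exp (-2 * \<phi> x)) = exp (-2 * \<phi> x) *\<^sub>R (?I x * (norm (?f0 x))\<^sup>2)"
          using ae
        proof eventually_elim
          fix x assume e: "?f0 x = f x"
          show "?I x * ((norm (g x))\<^sup>2 * exp (-2 * \<phi> x)) = exp (-2 * \<phi> x) *\<^sub>R (?I x * (norm (?f0 x))\<^sup>2)"
            unfolding e using g(2)[of x] by (cases "x \<in> ball w q") (simp_all add: mult.commute)
        qed
      qed
      also have "\<dots> = (\<integral>x. ?I x * (norm (?f0 x))\<^sup>2 \<partial>M)" by (rule integral_M(1)[OF mi, symmetric])
      also have "\<dots> \<le> (8 * exp (\<epsilon> * (C + t1)) * ?E * ?N)\<^sup>2"
      proof (rule local_weighted_bound[OF F su u0 \<epsilon>_def t1_def])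
        show "C + t1 + 3 / \<epsilon> \<le> d_rho \<kappa> z w" using w by (simp add: R0_def)
        have "ball w q \<subseteq> ball w (2 * q)" using q by (intro subset_ball) simp
        then show "ball w q \<subseteq> ball w (\<kappa> w / C)" using sub by blast
      qed simp_all
      finally have I: "(\<integral>x. ?I x * ((norm (g x))\<^sup>2 * exp (-2 * \<phi> x)) \<partial>lborel) \<le> (8 * exp (\<epsilon> * (C + t1)) * ?E * ?N)\<^sup>2" .
      \<comment> \<open>r exceeds half of the maximal eigenvalue radius \<rho>, so q = r/(2C) is at
        least \<rho>/(4C). The exponent 2n is the real dimension, and taking the square root later
        leaves the power -n.\<close>
      have qn: "1 / q ^ (2 * n) \<le> ((4 * C) ^ n * max_eig_radius \<phi> w powr (- real n))\<^sup>2"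
      proof -
        have "max_eig_radius \<phi> w / (4 * C) \<le> q" unfolding q_def using r(2) C0 by (simp add: field_simps)
        then have "1 / q \<le> 1 / (max_eig_radius \<phi> w / (4 * C))" using \<rho>(1) C0 q by (intro divide_left_mono mult_pos_pos) simp_all
        then have "1 / q \<le> 4 * C / max_eig_radius \<phi> w" by simp
        then have "(1 / q) ^ (2 * n) \<le> (4 * C / max_eig_radius \<phi> w) ^ (2 * n)" using q by (intro power_mono) simp_all
        also have "\<dots> = ((4 * C / max_eig_radius \<phi> w) ^ n)\<^sup>2" by (simp add: power_mult mult.commute[of 2])
        also have "(4 * C / max_eig_radius \<phi> w) ^ n = (4 * C) ^ n * max_eig_radius \<phi> w powr (- real n)"
          using \<rho>(1) by (simp add: power_divide power_mult_distrib power_inverse powr_minus powr_realpow divide_inverse)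
        finally show ?thesis by (simp add: power_one_over)
      qed
      define T where "T = C0 * \<kappa> z * ?E * max_eig_radius \<phi> w powr (- real n) * form1_norm \<phi> u"
      have N0: "0 \<le> form1_norm \<phi> u" by (simp add: form1_norm_def)
      have T0: "0 \<le> T" unfolding T_def C0_def using B(1) C0 pos[of z] N0 by simp
      have "(norm (f w) * exp (- \<phi> w))\<^sup>2 = (norm (g w))\<^sup>2 * exp (-2 * \<phi> w)"
        using g(2)[of w] q by (simp add: power_mult_distrib flip: exp_double)
      also have "\<dots> \<le> B * exp 1 / q ^ (2 * n) * (\<integral>x. ?I x * ((norm (g x))\<^sup>2 * exp (-2 * \<phi> x)) \<partial>lborel)"
        unfolding n_def by (rule weighted_sub_mean_value[OF g(1) c2 q g(3) lp B])
      also have "\<dots> \<le> B * exp 1 / q ^ (2 * n) * (8 * exp (\<epsilon> * (C + t1)) * ?E * ?N)\<^sup>2"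
        using B(1) q by (intro mult_left_mono I) simp_all
      also have "\<dots> = B * exp 1 * (8 * exp (\<epsilon> * (C + t1)) * ?E * ?N)\<^sup>2 * (1 / q ^ (2 * n))" by simp
      also have "\<dots> \<le> B * exp 1 * (8 * exp (\<epsilon> * (C + t1)) * ?E * ?N)\<^sup>2 * ((4 * C) ^ n * max_eig_radius \<phi> w powr (- real n))\<^sup>2"
        using B(1) by (intro mult_left_mono qn) simp_all
      also have "B * exp 1 = (sqrt (B * exp 1))\<^sup>2" using B(1) by simp
      also have "(sqrt (B * exp 1))\<^sup>2 * (8 * exp (\<epsilon> * (C + t1)) * ?E * ?N)\<^sup>2 * ((4 * C) ^ n * max_eig_radius \<phi> w powr (- real n))\<^sup>2 = T\<^sup>2"
        unfolding T_def C0_def power_mult_distrib by (simp only: mult_ac)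
      finally have "norm (f w) * exp (- \<phi> w) \<le> T" by (rule power2_le_imp_le) (rule T0)
      then have "norm (f w) \<le> T * exp (\<phi> w)" by (simp add: exp_minus field_simps)
      then show ?thesis using hol by (simp add: T_def n_def mult_ac)
    qed
    then show ?thesis using canonical_solution_AE[OF can ae] by blast
  qed
  have "0 < 1 / (2 * C)" using C0 by simp
  then show ?thesis using \<epsilon>0 R0(2) main by blast
qed

end

theorem mainTheorem2:
  fixes \<phi> :: "complex^'n \<Rightarrow> real" and \<kappa> :: "complex^'n \<Rightarrow> real"
  assumes adm: "admissible \<phi>"
    and rad: "radius_fun \<kappa>" and bdd: "bounded (range \<kappa>)"
    and ge: "\<forall>z. \<kappa> z \<ge> max_eig_radius \<phi> z"
    and coer: "coercive \<phi> (\<lambda>z. 1 / \<kappa> z)"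
  shows "\<exists>\<epsilon> r0 R0 C. 0 < \<epsilon> \<and> 0 < r0 \<and> 0 < R0 \<and>
    (\<forall>z u. dom_dbar1 \<phi> u \<and> (\<forall>j k. weak_dbar1 j k u (\<lambda>_. 0)) \<and>
           (\<forall>w. w \<notin> ball_rho \<kappa> z r0 \<longrightarrow> u w = 0) \<longrightarrow>
      (\<exists>f. canonical_solution \<phi> u f \<and>
        (\<forall>w. d_rho \<kappa> z w \<ge> R0 \<longrightarrow>
           (\<exists>U. open U \<and> w \<in> U \<and> holo_on U f) \<and>
           norm (f w) \<le> C * exp (\<phi> w) * \<kappa> z * exp (- \<epsilon> * d_rho \<kappa> z w)
                          * max_eig_radius \<phi> w powr (- real CARD('n)) * form1_norm \<phi> u)))"
proof -
  obtain C where C: "\<And>x y. dist y x < \<kappa> x \<Longrightarrow> \<kappa> x / C \<le> \<kappa> y \<and> \<kappa> y \<le> C * \<kappa> x"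
    using rad unfolding radius_fun_def by blast
  obtain K where K: "\<And>x. \<kappa> x \<le> K" using bdd unfolding bounded_iff by (metis abs_le_D1 rangeI real_norm_def)
  have "continuous_on UNIV \<phi>" using adm Ck_continuous unfolding admissible_def by blast
  then interpret coercive_weight \<phi> \<kappa> C K
    using rad C K coer by unfold_locales (auto simp: radius_fun_def)
  show ?thesis by (rule canonical_solution_decay[OF adm]) (use ge in blast)
qed

end
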